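(* Let $(\mathcal{M}^{n},g,f)$ be a complete steady gradient Ricci soliton, that is, $(\mathcal{M}^n,g)$ is a complete $n$-dimensional Riemannian manifold and $f:\mathcal{M}\to\mathbb{R}$ is a smooth function with $$R_{ij}=-\nabla_{i}\nabla_{j}f ,$$ and suppose that $$R+\left\vert \nabla f\right\vert ^{2}=1 \quad\text{on } \mathcal{M}.$$ If $\lim_{x\rightarrow\infty}f(x)=-\infty$ and $f\leq 0$ on $\mathcal{M}$, then $$R\geq\frac{1}{\sqrt{\frac{n}{2}}+2}\,e^{f}\quad\text{on } \mathcal{M}.$$
   Context: $R_{ij}$ denotes the Ricci tensor of $g$, $R$ denotes the scalar curvature of $g$ (the trace of the Ricci tensor with respect to $g$), $\nabla$ denotes the Levi-Civita connection of $g$, so that $\nabla_i\nabla_j f$ is the Hessian of $f$, and $|\nabla f|$ is the $g$-norm of the gradient of $f$. The condition $\lim_{x\to\infty} f(x)=-\infty$ means that for every $A\in\mathbb{R}$ there is a compact set $K\subset\mathcal{M}$ such that $f(x)<A$ for all $x\in\mathcal{M}\setminus K$. *)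

theory Defs
  imports "HOL-Analysis.Analysis"
begin

section \<open>Smooth functions on open subsets of Euclidean space\<close>

definition partial_d :: "'n::finite \<Rightarrow> (real^'n \<Rightarrow> real) \<Rightarrow> real^'n \<Rightarrow> real" where
  "partial_d i u x = frechet_derivative u (at x) (axis i 1)"

text \<open>Only used for open sets; membership then depends only on the values of the function on the set.\<close>

primrec C_k_on :: "nat \<Rightarrow> (real^'n::finite) set \<Rightarrow> (real^'n \<Rightarrow> real) \<Rightarrow> bool" where
  "C_k_on 0 S u \<longleftrightarrow> continuous_on S u"
| "C_k_on (Suc k) S u \<longleftrightarrow> (\<forall>x\<in>S. u differentiable (at x)) \<and> (\<forall>i. C_k_on k S (partial_d i u))"

definition C_infinity_on :: "(real^'n::finite) set \<Rightarrow> (real^'n \<Rightarrow> real) \<Rightarrow> bool" where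
  "C_infinity_on S u \<longleftrightarrow> (\<forall>k. C_k_on k S u)"


section \<open>Levi-Civita connection and curvature in local coordinates\<close>

text \<open>Here \<open>G x\<close> is the matrix of metric components \<open>g\<^sub>i\<^sub>j\<close> at the coordinate point \<open>x\<close>.
  \<open>christoffel G k i j\<close> is \<open>\<Gamma>\<^sup>k\<^sub>i\<^sub>j\<close>, so that \<open>\<nabla>\<^sub>i \<partial>\<^sub>j = \<Gamma>\<^sup>k\<^sub>i\<^sub>j \<partial>\<^sub>k\<close>.\<close>

definition christoffel ::
  "(real^'n::finite \<Rightarrow> real^'n^'n) \<Rightarrow> 'n \<Rightarrow> 'n \<Rightarrow> 'n \<Rightarrow> real^'n \<Rightarrow> real" where
  "christoffel G k i j x =
     1/2 * (\<Sum>l\<in>UNIV. matrix_inv (G x) $ k $ l *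
       (partial_d i (\<lambda>y. G y $ j $ l) x + partial_d j (\<lambda>y. G y $ i $ l) x
        - partial_d l (\<lambda>y. G y $ i $ j) x))"

text \<open>The \<open>\<partial>\<^sub>l\<close>-component of \<open>R(\<partial>\<^sub>i, \<partial>\<^sub>j) \<partial>\<^sub>k\<close> for
  \<open>R(X, Y) Z = \<nabla>\<^sub>X \<nabla>\<^sub>Y Z - \<nabla>\<^sub>Y \<nabla>\<^sub>X Z - \<nabla>\<^sub>[\<^sub>X\<^sub>,\<^sub>Y\<^sub>] Z\<close>.\<close>

definition riemann_coord ::
  "(real^'n::finite \<Rightarrow> real^'n^'n) \<Rightarrow> 'n \<Rightarrow> 'n \<Rightarrow> 'n \<Rightarrow> 'n \<Rightarrow> real^'n \<Rightarrow> real" where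
  "riemann_coord G l i j k x =
     partial_d i (christoffel G l j k) x - partial_d j (christoffel G l i k) x
     + (\<Sum>m\<in>UNIV. christoffel G l i m x * christoffel G m j k x
                 - christoffel G l j m x * christoffel G m i k x)"

text \<open>The trace of \<open>X \<mapsto> R(X, \<partial>\<^sub>j) \<partial>\<^sub>k\<close>; round spheres have positive Ricci tensor.\<close>

definition ricci_coord ::
  "(real^'n::finite \<Rightarrow> real^'n^'n) \<Rightarrow> 'n \<Rightarrow> 'n \<Rightarrow> real^'n \<Rightarrow> real" where
  "ricci_coord G j k x = (\<Sum>i\<in>UNIV. riemann_coord G i i j k x)"

definition scalar_coord :: "(real^'n::finite \<Rightarrow> real^'n^'n) \<Rightarrow> real^'n \<Rightarrow> real" where
  "scalar_coord G x = (\<Sum>j\<in>UNIV. \<Sum>k\<in>UNIV. matrix_inv (G x) $ j $ k * ricci_coord G j k x)"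

definition hessian_coord ::
  "(real^'n::finite \<Rightarrow> real^'n^'n) \<Rightarrow> (real^'n \<Rightarrow> real) \<Rightarrow> 'n \<Rightarrow> 'n \<Rightarrow> real^'n \<Rightarrow> real" where
  "hessian_coord G u i j x =
     partial_d i (partial_d j u) x - (\<Sum>k\<in>UNIV. christoffel G k i j x * partial_d k u x)"

text \<open>The coefficients above are those of the unique torsion-free metric connection.\<close>

lemma christoffel_levi_civita:
  fixes G :: "real^'n::finite \<Rightarrow> real^'n^'n" and \<Gamma> :: "'n \<Rightarrow> 'n \<Rightarrow> 'n \<Rightarrow> real"
  assumes S: "open S" "x \<in> S" and sym: "\<And>y i j. y \<in> S \<Longrightarrow> G y $ i $ j = G y $ j $ i"
    and inv: "invertible (G x)"
  shows "(\<forall>i j k. \<Gamma> k i j = \<Gamma> k j i) \<and>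
     (\<forall>i j k. partial_d k (\<lambda>y. G y $ i $ j) x =
        (\<Sum>l\<in>UNIV. \<Gamma> l k i * G x $ l $ j + \<Gamma> l k j * G x $ i $ l))
     \<longleftrightarrow> (\<forall>i j k. \<Gamma> k i j = christoffel G k i j x)"
    (is "?L \<longleftrightarrow> ?R")
proof -
  define d where "d k i j = partial_d k (\<lambda>y. G y $ i $ j) x" for k i j
  define H where "H = matrix_inv (G x)"
  have "((\<lambda>y. G y $ i $ j) has_derivative D) (at x) \<longleftrightarrow> ((\<lambda>y. G y $ j $ i) has_derivative D) (at x)" for i j D
    using has_derivative_transform_within_open[OF _ S] sym by (smt (verit, best))
  then have dsym: "d k i j = d k j i" for k i j
    by (simp add: d_def partial_d_def frechet_derivative_def)
  have symx: "G x $ i $ j = G x $ j $ i" for i j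
    using sym S(2) by blast
  have "G x ** H = mat 1 \<and> H ** G x = mat 1"
    unfolding H_def matrix_inv_def by (rule someI_ex) (use inv in \<open>auto simp: invertible_def\<close>)
  then have GH: "(\<Sum>k\<in>UNIV. G x $ i $ k * H $ k $ j) = (if i = j then 1 else 0)"
    and HG: "(\<Sum>k\<in>UNIV. H $ i $ k * G x $ k $ j) = (if i = j then 1 else 0)" for i j
    by (auto simp: matrix_matrix_mult_def mat_def vec_eq_iff)
  have chr: "christoffel G k i j x = 1/2 * (\<Sum>l\<in>UNIV. H $ k $ l * (d i j l + d j i l - d l i j))"
    for k i j by (simp add: christoffel_def d_def H_def)
  have low: "(\<Sum>k\<in>UNIV. G x $ m $ k * christoffel G k i j x) = 1/2 * (d i j m + d j i m - d m i j)"
    for m i j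
  proof -
    have "(\<Sum>k\<in>UNIV. G x $ m $ k * christoffel G k i j x)
        = (\<Sum>k\<in>UNIV. \<Sum>l\<in>UNIV. 1/2 * (G x $ m $ k * H $ k $ l) * (d i j l + d j i l - d l i j))"
      by (simp add: chr sum_distrib_left mult_ac)
    also have "\<dots> = (\<Sum>l\<in>UNIV. 1/2 * (\<Sum>k\<in>UNIV. G x $ m $ k * H $ k $ l) * (d i j l + d j i l - d l i j))"
      by (subst sum.swap) (simp add: sum_distrib_left sum_distrib_right)
    also have "\<dots> = (\<Sum>l\<in>UNIV. if m = l then 1/2 * (d i j l + d j i l - d l i j) else 0)"
      by (intro sum.cong) (auto simp: GH)
    finally show ?thesis by simp
  qed
  show ?thesis
  proof
    assume L: ?L
    define b where "b m i j = (\<Sum>k\<in>UNIV. G x $ m $ k * \<Gamma> k i j)" for m i j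
    have bs: "b m i j = b m j i" for m i j
      unfolding b_def using L by metis
    have db: "d k i j = b j k i + b i k j" for k i j
    proof -
      have "d k i j = (\<Sum>l\<in>UNIV. \<Gamma> l k i * G x $ l $ j + \<Gamma> l k j * G x $ i $ l)"
        using L by (simp add: d_def)
      also have "\<dots> = b j k i + b i k j"
        by (simp add: b_def sum.distrib symx[of _ j] mult.commute)
      finally show ?thesis .
    qed
    show ?R
    proof (intro allI)
      fix i j k
      have b: "2 * b l i j = d i j l + d j i l - d l i j" for l
        unfolding db using bs[of l i j] bs[of i j l] bs[of j i l] by (simp add: bs)
      have "christoffel G k i j x = (\<Sum>l\<in>UNIV. H $ k $ l * b l i j)"
        unfolding chr b[symmetric] by (simp add: sum_distrib_left)
      also have "\<dots> = (\<Sum>m\<in>UNIV. (\<Sum>l\<in>UNIV. H $ k $ l * G x $ l $ m) * \<Gamma> m i j)"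
        unfolding b_def sum_distrib_left sum_distrib_right
        by (subst sum.swap) (simp add: mult.assoc)
      also have "\<dots> = (\<Sum>m\<in>UNIV. if k = m then \<Gamma> m i j else 0)"
        by (intro sum.cong) (auto simp: HG)
      finally show "\<Gamma> k i j = christoffel G k i j x" by simp
    qed
  next
    assume R: ?R
    have "\<Gamma> k i j = \<Gamma> k j i" for i j k
    proof -
      have "d i j l + d j i l - d l i j = d j i l + d i j l - d l j i" for l
        using dsym[of l i j] by simp
      then show ?thesis by (simp only: R[rule_format] chr)
    qed
    moreover have "d k i j = (\<Sum>l\<in>UNIV. \<Gamma> l k i * G x $ l $ j + \<Gamma> l k j * G x $ i $ l)" for i j k
    proof -
      have "(\<Sum>l\<in>UNIV. \<Gamma> l k i * G x $ l $ j + \<Gamma> l k j * G x $ i $ l)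
         = (\<Sum>l\<in>UNIV. G x $ j $ l * christoffel G l k i x) + (\<Sum>l\<in>UNIV. G x $ i $ l * christoffel G l k j x)"
        by (simp add: R sum.distrib symx[of _ j] mult.commute)
      also have "\<dots> = d k i j"
        unfolding low using dsym[of k j i] by (simp add: field_simps)
      finally show ?thesis by simp
    qed
    ultimately show ?L by (simp add: d_def)
  qed
qed


section \<open>Smooth manifolds\<close>

text \<open>The manifold is the whole type \<open>'m\<close>, its dimension is \<open>CARD('n)\<close>.  A chart is a domain together
  with a coordinate map; the map is arbitrary outside the domain.  Atlases need not be maximal, and
  manifolds need not be connected.\<close>

type_synonym ('m, 'n) chart = "'m set \<times> ('m \<Rightarrow> real^'n)"

definition coord_range :: "('m, 'n::finite) chart \<Rightarrow> (real^'n) set" where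
  "coord_range c = snd c ` fst c"

definition chart_inv :: "('m, 'n::finite) chart \<Rightarrow> real^'n \<Rightarrow> 'm" where
  "chart_inv c = inv_into (fst c) (snd c)"

definition smooth_atlas ::
  "('m::{t2_space,second_countable_topology}, 'n::finite) chart set \<Rightarrow> bool" where
  "smooth_atlas \<A> \<longleftrightarrow>
     (\<Union>c\<in>\<A>. fst c) = UNIV \<and>
     (\<forall>c\<in>\<A>. open (fst c) \<and> open (coord_range c) \<and>
        homeomorphism (fst c) (coord_range c) (snd c) (chart_inv c)) \<and>
     (\<forall>c\<in>\<A>. \<forall>c'\<in>\<A>. \<forall>i.
        C_infinity_on (snd c ` (fst c \<inter> fst c')) (\<lambda>x. snd c' (chart_inv c x) $ i))"

definition smooth_fun_on ::
  "('m::topological_space, 'n::finite) chart set \<Rightarrow> 'm set \<Rightarrow> ('m \<Rightarrow> real) \<Rightarrow> bool" where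
  "smooth_fun_on \<A> S u \<longleftrightarrow>
     (\<forall>c\<in>\<A>. C_infinity_on (snd c ` (fst c \<inter> S)) (\<lambda>x. u (chart_inv c x)))"

definition smooth_near ::
  "('m::topological_space, 'n::finite) chart set \<Rightarrow> 'm \<Rightarrow> ('m \<Rightarrow> real) set" where
  "smooth_near \<A> p = {u. \<exists>S. open S \<and> p \<in> S \<and> smooth_fun_on \<A> S u}"


section \<open>Tangent vectors\<close>

text \<open>Tangent vectors at \<open>p\<close> are the derivations at \<open>p\<close> of the functions that are smooth near \<open>p\<close>.
  They are set to \<open>0\<close> on all other functions, so that equality of derivations is equality of functions.
  The Leibniz rule (applied to indicator functions of neighbourhoods of \<open>p\<close>) forces the value on a
  function to depend on its germ only.\<close>

type_synonym 'm tangent = "('m \<Rightarrow> real) \<Rightarrow> real"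

definition tangent_space ::
  "('m::topological_space, 'n::finite) chart set \<Rightarrow> 'm \<Rightarrow> 'm tangent set" where
  "tangent_space \<A> p = {X.
     (\<forall>u. u \<notin> smooth_near \<A> p \<longrightarrow> X u = 0) \<and>
     (\<forall>u\<in>smooth_near \<A> p. \<forall>v\<in>smooth_near \<A> p. \<forall>a b.
        X (\<lambda>q. a * u q + b * v q) = a * X u + b * X v) \<and>
     (\<forall>u\<in>smooth_near \<A> p. \<forall>v\<in>smooth_near \<A> p.
        X (\<lambda>q. u q * v q) = u p * X v + v p * X u)}"

definition coord_vector ::
  "('m::topological_space, 'n::finite) chart set \<Rightarrow> ('m, 'n) chart \<Rightarrow> 'm \<Rightarrow> 'n \<Rightarrow> 'm tangent" where
  "coord_vector \<A> c p i = (\<lambda>u. if u \<in> smooth_near \<A> p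
     then partial_d i (\<lambda>x. u (chart_inv c x)) (snd c p) else 0)"

definition velocity ::
  "('m::topological_space, 'n::finite) chart set \<Rightarrow> (real \<Rightarrow> 'm) \<Rightarrow> real \<Rightarrow> 'm tangent" where
  "velocity \<A> \<gamma> t = (\<lambda>u. if u \<in> smooth_near \<A> (\<gamma> t)
     then vector_derivative (\<lambda>s. u (\<gamma> s)) (at t) else 0)"


section \<open>Riemannian manifolds\<close>

type_synonym 'm metric = "'m \<Rightarrow> 'm tangent \<Rightarrow> 'm tangent \<Rightarrow> real"

definition metric_coord ::
  "('m::topological_space, 'n::finite) chart set \<Rightarrow> 'm metric \<Rightarrow> ('m, 'n) chart
     \<Rightarrow> real^'n \<Rightarrow> real^'n^'n" where
  "metric_coord \<A> g c x = (\<chi> i j. g (chart_inv c x)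
     (coord_vector \<A> c (chart_inv c x) i) (coord_vector \<A> c (chart_inv c x) j))"

definition riemannian_metric ::
  "('m::topological_space, 'n::finite) chart set \<Rightarrow> 'm metric \<Rightarrow> bool" where
  "riemannian_metric \<A> g \<longleftrightarrow>
     (\<forall>p. \<forall>X\<in>tangent_space \<A> p. \<forall>Y\<in>tangent_space \<A> p.
        g p X Y = g p Y X \<and>
        (X \<noteq> (\<lambda>u. 0) \<longrightarrow> g p X X > 0) \<and>
        (\<forall>Z\<in>tangent_space \<A> p. \<forall>a b.
           g p (\<lambda>u. a * X u + b * Y u) Z = a * g p X Z + b * g p Y Z)) \<and>
     (\<forall>c\<in>\<A>. \<forall>i j. C_infinity_on (coord_range c) (\<lambda>x. metric_coord \<A> g c x $ i $ j))"

definition piecewise_C1_curve ::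
  "('m::topological_space, 'n::finite) chart set \<Rightarrow> (real \<Rightarrow> 'm) \<Rightarrow> bool" where
  "piecewise_C1_curve \<A> \<gamma> \<longleftrightarrow> continuous_on {0..1} \<gamma> \<and>
     (\<exists>T. finite T \<and>
        (\<forall>c\<in>\<A>. (\<lambda>t. snd c (\<gamma> t)) C1_differentiable_on {t\<in>{0<..<1} - T. \<gamma> t \<in> fst c}))"

definition curve_length ::
  "('m::topological_space, 'n::finite) chart set \<Rightarrow> 'm metric \<Rightarrow> (real \<Rightarrow> 'm) \<Rightarrow> ennreal" where
  "curve_length \<A> g \<gamma> =
     (\<integral>\<^sup>+t\<in>{0..1}. ennreal (sqrt (g (\<gamma> t) (velocity \<A> \<gamma> t) (velocity \<A> \<gamma> t))) \<partial>lborel)"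

text \<open>The distance is \<open>\<infinity>\<close> between different connected components.\<close>

definition riemannian_dist ::
  "('m::topological_space, 'n::finite) chart set \<Rightarrow> 'm metric \<Rightarrow> 'm \<Rightarrow> 'm \<Rightarrow> ennreal" where
  "riemannian_dist \<A> g p q =
     (INF \<gamma>\<in>{\<gamma>. piecewise_C1_curve \<A> \<gamma> \<and> \<gamma> 0 = p \<and> \<gamma> 1 = q}. curve_length \<A> g \<gamma>)"

definition complete_riemannian_manifold ::
  "('m::{t2_space,second_countable_topology}, 'n::finite) chart set \<Rightarrow> 'm metric \<Rightarrow> bool" where
  "complete_riemannian_manifold \<A> g \<longleftrightarrow>
     smooth_atlas \<A> \<and> riemannian_metric \<A> g \<and>
     (\<forall>\<sigma>::nat \<Rightarrow> 'm.
        (\<forall>e>0. \<exists>N. \<forall>m\<ge>N. \<forall>k\<ge>N. riemannian_dist \<A> g (\<sigma> m) (\<sigma> k) < e) \<longrightarrow>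
        (\<exists>p. (\<lambda>k. riemannian_dist \<A> g (\<sigma> k) p) \<longlonglongrightarrow> 0))"


section \<open>Curvature, gradient and solitons\<close>

definition ricci ::
  "('m::topological_space, 'n::finite) chart set \<Rightarrow> 'm metric \<Rightarrow> ('m, 'n) chart
     \<Rightarrow> 'm \<Rightarrow> 'n \<Rightarrow> 'n \<Rightarrow> real" where
  "ricci \<A> g c p i j = ricci_coord (metric_coord \<A> g c) i j (snd c p)"

definition hessian ::
  "('m::topological_space, 'n::finite) chart set \<Rightarrow> 'm metric \<Rightarrow> ('m, 'n) chart
     \<Rightarrow> ('m \<Rightarrow> real) \<Rightarrow> 'm \<Rightarrow> 'n \<Rightarrow> 'n \<Rightarrow> real" where
  "hessian \<A> g c u p i j =
     hessian_coord (metric_coord \<A> g c) (\<lambda>x. u (chart_inv c x)) i j (snd c p)"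

text \<open>Scalar curvature and gradient do not depend on the chart used to compute them.\<close>

definition chart_at :: "('m, 'n::finite) chart set \<Rightarrow> 'm \<Rightarrow> ('m, 'n) chart" where
  "chart_at \<A> p = (SOME c. c \<in> \<A> \<and> p \<in> fst c)"

definition scalar_curvature ::
  "('m::topological_space, 'n::finite) chart set \<Rightarrow> 'm metric \<Rightarrow> 'm \<Rightarrow> real" where
  "scalar_curvature \<A> g p =
     (let c = chart_at \<A> p in scalar_coord (metric_coord \<A> g c) (snd c p))"

definition gradient ::
  "('m::topological_space, 'n::finite) chart set \<Rightarrow> 'm metric \<Rightarrow> ('m \<Rightarrow> real) \<Rightarrow> 'm \<Rightarrow> 'm tangent" where
  "gradient \<A> g u p =
     (let c = chart_at \<A> p in
      (\<lambda>v. \<Sum>i\<in>UNIV. \<Sum>j\<in>UNIV. matrix_inv (metric_coord \<A> g c (snd c p)) $ i $ j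
              * coord_vector \<A> c p j u * coord_vector \<A> c p i v))"

definition tangent_norm :: "'m metric \<Rightarrow> 'm \<Rightarrow> 'm tangent \<Rightarrow> real" where
  "tangent_norm g p X = sqrt (g p X X)"

definition complete_steady_gradient_soliton ::
  "('m::{t2_space,second_countable_topology}, 'n::finite) chart set \<Rightarrow> 'm metric
     \<Rightarrow> ('m \<Rightarrow> real) \<Rightarrow> bool" where
  "complete_steady_gradient_soliton \<A> g f \<longleftrightarrow>
     complete_riemannian_manifold \<A> g \<and> smooth_fun_on \<A> UNIV f \<and>
     (\<forall>c\<in>\<A>. \<forall>p\<in>fst c. \<forall>i j. ricci \<A> g c p i j = - hessian \<A> g c f p i j)"

definition tends_to_minus_infinity_at_infinity :: "('m::topological_space \<Rightarrow> real) \<Rightarrow> bool" where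
  "tends_to_minus_infinity_at_infinity f \<longleftrightarrow> (\<forall>a. \<exists>K. compact K \<and> (\<forall>x\<in>- K. f x < a))"

end

theory Submission
  imports Defs "HOL-Library.Diagonal_Subsequence"
begin

text \<open>Write \<open>u = -f \<ge> 0\<close> and \<open>w = |\<nabla>u|\<^sup>2 = 1 - R\<close>, and let \<open>L = \<Delta> + \<nabla>u \<bullet> \<nabla>\<close> be the drift Laplacian. The soliton equation says
\<open>Ric = \<nabla>\<nabla>u\<close>, its trace says \<open>L u = 1\<close>, and the Bochner formula turns into \<open>L w = 2 |Ric|\<^sup>2 \<ge> 2 (1 - w)\<^sup>2 / n\<close>
(\<open>drift_laplacian_energy\<close>). The estimate follows in two steps.

The first step is \<open>R \<ge> 0\<close>, that is \<open>w \<le> 1\<close> (\<open>scalar_curvature_nonneg\<close>). If \<open>w p > 1\<close> then the bounded function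
\<open>F = 1 / sqrt (1 + w)\<close> satisfies \<open>F L F \<le> - k + 3 |\<nabla>F|\<^sup>2\<close> with a constant \<open>k > 0\<close> wherever \<open>F \<le> F p\<close>, so that a point in this
region where \<open>\<nabla>F\<close> is almost zero and \<open>L F\<close> is almost nonnegative would be contradictory. On a complete manifold such points are usually
produced with the Laplacian comparison theorem, whose ingredients are minimal geodesics and the second variation formula.
Here minimal geodesics are replaced by long chains \<open>x\<^sub>0, ..., x\<^sub>N\<close> that minimise
\<open>F x\<^sub>N + \<mu> u x\<^sub>0 + \<theta> N (\<Sum>i. S (x\<^sub>i, x\<^sub>i\<^sub>+\<^sub>1))\<close>, where \<open>S (x, y) = g\<^sub>i\<^sub>j(x) (y - x)\<^sup>i (y - x)\<^sup>j\<close> in one of finitely many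
charts. The point \<open>x\<^sub>0\<close> is held back by the proper function \<open>u\<close>, and since \<open>L u = 1\<close> it contributes only \<open>\<mu>\<close>. What makes this work
is that the operator \<open>L\<close> on a steady soliton couples with itself: if both end points of a short step move along parallel
orthonormal frames and with the drift \<open>\<nabla>u\<close>, the second-order change of \<open>S\<close> is \<open>-2 Ric + 2 \<nabla>\<nabla>u = 0\<close> up to \<open>o(S)\<close>
(\<open>coupling_identity\<close>, \<open>pair_estimate\<close>). Adding this up along the chain gives \<open>0 \<le> L F + \<mu> + e\<close> at \<open>x\<^sub>N\<close>, and moving \<open>x\<^sub>i\<close> with
speed proportional to \<open>i\<close> shows that \<open>\<nabla>F\<close> is small there (\<open>chain_variation\<close>). The chains are minimised in a large compact
set, and by completeness chains of bounded length with small steps do not reach its boundary (\<open>chains_bounded\<close>, the substitute for the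
Hopf-Rinow theorem).

The second step is a maximum principle on a compact sublevel set of \<open>u\<close> (\<open>scalar_lower_bound\<close>). With \<open>c = 1 / (sqrt (n / 2) + 2)\<close> consider
\<open>\<phi> = R - c e\<^sup>f - t c e\<^sup>2\<^sup>f\<close>; by \<open>R \<ge> 0\<close> a negative infimum would be attained. The identities \<open>L e\<^sup>f = - R e\<^sup>f\<close> and
\<open>L e\<^sup>2\<^sup>f = (2 - 4 R) e\<^sup>2\<^sup>f\<close> together with \<open>L R \<le> - 2 R\<^sup>2 / n\<close> give a quadratic inequality for \<open>R e\<^sup>-\<^sup>f\<close> at the minimum, which
is impossible for \<open>t = 21/50\<close> in every dimension (\<open>quadratic_negative\<close>). Since \<open>\<phi> \<ge> 0\<close> is slightly stronger than the claim, the claim follows.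

Everything infinitesimal is expressed through second-order jets of real functions \<open>\<epsilon> \<mapsto> \<phi> (\<kappa> \<epsilon>)\<close> along paths without covariant
acceleration; the second derivative of such a jet is the Hessian, in every chart.\<close>

section \<open>Calculus of functions that are k times continuously differentiable\<close>

lemma partial_d_eqI: "(u has_derivative D) (at x) \<Longrightarrow> partial_d i u x = D (axis i 1)"
  unfolding partial_d_def by (metis frechet_derivative_at)

lemma has_derivative_partial:
  fixes u :: "real^'n::finite \<Rightarrow> real"
  assumes "u differentiable (at x)"
  shows "(u has_derivative (\<lambda>h. \<Sum>i\<in>UNIV. h $ i * partial_d i u x)) (at x)"
proof -
  have D: "(u has_derivative frechet_derivative u (at x)) (at x)"
    using assms frechet_derivative_works by blast
  have lin: "linear (frechet_derivative u (at x))"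
    using D has_derivative_linear by blast
  have "frechet_derivative u (at x) h = (\<Sum>i\<in>UNIV. h $ i * partial_d i u x)" for h
  proof -
    have "frechet_derivative u (at x) h = frechet_derivative u (at x) (\<Sum>i\<in>UNIV. h $ i *s axis i 1)"
      by (simp add: basis_expansion)
    also have "\<dots> = (\<Sum>i\<in>UNIV. h $ i * partial_d i u x)"
      by (simp add: linear_sum[OF lin] linear_cmul[OF lin] scalar_mult_eq_scaleR partial_d_def)
    finally show ?thesis .
  qed
  then have "frechet_derivative u (at x) = (\<lambda>h. \<Sum>i\<in>UNIV. h $ i * partial_d i u x)" by blast
  then show ?thesis using D by simp
qed

lemma has_derivative_cong_on_open:
  fixes u :: "real^'n::finite \<Rightarrow> real"
  assumes "open S" "x \<in> S" "\<And>y. y \<in> S \<Longrightarrow> u y = v y"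
  shows "(u has_derivative D) (at x) \<longleftrightarrow> (v has_derivative D) (at x)"
  using has_derivative_transform_within_open[OF _ assms(1,2)] assms(3) by (smt (verit, best))

lemma partial_d_cong:
  fixes u :: "real^'n::finite \<Rightarrow> real"
  assumes "open S" "x \<in> S" "\<And>y. y \<in> S \<Longrightarrow> u y = v y"
  shows "partial_d i u x = partial_d i v x"
  using has_derivative_cong_on_open[OF assms] by (simp add: partial_d_def frechet_derivative_def)

lemma differentiable_cong_on_open:
  fixes u :: "real^'n::finite \<Rightarrow> real"
  assumes "open S" "x \<in> S" "\<And>y. y \<in> S \<Longrightarrow> u y = v y"
  shows "u differentiable (at x) \<longleftrightarrow> v differentiable (at x)"
  using has_derivative_cong_on_open[OF assms] by (simp add: differentiable_def)

lemma C_k_on_cong: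
  assumes "open S" "\<And>y. y \<in> S \<Longrightarrow> u y = v y"
  shows "C_k_on k S u \<longleftrightarrow> C_k_on k S v"
  using assms(2)
proof (induction k arbitrary: u v)
  case 0
  then show ?case unfolding C_k_on.simps by (rule continuous_on_cong[OF refl])
next
  case (Suc k)
  have "C_k_on k S (partial_d i u) \<longleftrightarrow> C_k_on k S (partial_d i v)" for i
  proof (rule Suc.IH)
    show "partial_d i u y = partial_d i v y" if "y \<in> S" for y
      by (rule partial_d_cong[OF assms(1) that Suc.prems])
  qed
  moreover have "(\<forall>x\<in>S. u differentiable (at x)) \<longleftrightarrow> (\<forall>x\<in>S. v differentiable (at x))"
    by (intro ball_cong refl differentiable_cong_on_open[OF assms(1)] Suc.prems)
  ultimately show ?case unfolding C_k_on.simps by blast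
qed

lemma C_k_on_congI:
  assumes "open S" "C_k_on k S v" "\<And>y. y \<in> S \<Longrightarrow> u y = v y"
  shows "C_k_on k S u"
  using C_k_on_cong[of S u v k] assms by blast

lemma C_k_on_subset: "C_k_on k S u \<Longrightarrow> T \<subseteq> S \<Longrightarrow> C_k_on k T u"
  by (induction k arbitrary: u) (auto intro: continuous_on_subset)

lemma C_k_on_SucD: "C_k_on (Suc k) S u \<Longrightarrow> C_k_on k S u"
proof (induction k arbitrary: u)
  case 0
  then show ?case
    by (auto intro!: continuous_at_imp_continuous_on differentiable_imp_continuous_within)
qed auto

lemma C_k_on_le: "C_k_on k S u \<Longrightarrow> j \<le> k \<Longrightarrow> C_k_on j S u"
proof (induction k)
  case (Suc k)
  then show ?case using C_k_on_SucD le_Suc_eq by blast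
qed simp

lemma C_k_on_partial: "C_k_on (Suc k) S u \<Longrightarrow> C_k_on k S (partial_d i u)"
  by simp

lemma C_k_on_differentiable: "C_k_on (Suc k) S u \<Longrightarrow> x \<in> S \<Longrightarrow> u differentiable (at x)"
  by simp

lemma C_k_on_continuous_on: "C_k_on k S u \<Longrightarrow> continuous_on S u"
  using C_k_on_le[of k S u 0] by simp

lemma partial_d_const [simp]: "partial_d i (\<lambda>x. c) x = 0"
  by (rule partial_d_eqI) (auto intro!: derivative_eq_intros)

lemma C_k_on_const [simp]: "C_k_on k S (\<lambda>x. c)"
proof (induction k arbitrary: c)
  case (Suc k)
  have "partial_d i (\<lambda>x. c) = (\<lambda>x. 0)" for i :: 'a by (rule ext) simp
  then show ?case by (simp add: Suc)
qed simp

lemma partial_d_coord [simp]: "partial_d i (\<lambda>x. x $ j) x = (if i = j then 1 else 0)"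
proof -
  have "((\<lambda>x::real^'a. x $ j) has_derivative (\<lambda>h. h $ j)) (at x)"
    by (simp add: bounded_linear_imp_has_derivative bounded_linear_vec_nth)
  from partial_d_eqI[OF this] show ?thesis by (simp add: axis_def)
qed

lemma vec_nth_differentiable [simp]: "(\<lambda>x::real^'n::finite. x $ j) differentiable (at x)"
  by (rule bounded_linear_imp_differentiable) (rule bounded_linear_vec_nth)

lemma C_k_on_coord [simp]: "C_k_on k S (\<lambda>x. x $ j)"
proof (cases k)
  case (Suc k')
  have "partial_d i (\<lambda>x. x $ j) = (\<lambda>x. (if i = j then 1 else 0))" for i by (rule ext) simp
  then show ?thesis using Suc by simp
qed (auto intro!: continuous_intros)

lemma partial_d_add:
  assumes "u differentiable (at x)" "v differentiable (at x)"
  shows "partial_d i (\<lambda>x. u x + v x) x = partial_d i u x + partial_d i v x"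
proof -
  have D: "(u has_derivative frechet_derivative u (at x)) (at x)"
     "(v has_derivative frechet_derivative v (at x)) (at x)"
    using assms frechet_derivative_works by blast+
  from partial_d_eqI[OF has_derivative_add[OF D]] show ?thesis by (simp add: partial_d_def)
qed

lemma partial_d_mult:
  assumes "u differentiable (at x)" "v differentiable (at x)"
  shows "partial_d i (\<lambda>x. u x * v x) x = u x * partial_d i v x + partial_d i u x * v x"
proof -
  have D: "(u has_derivative frechet_derivative u (at x)) (at x)"
     "(v has_derivative frechet_derivative v (at x)) (at x)"
    using assms frechet_derivative_works by blast+
  from partial_d_eqI[OF has_derivative_mult[OF D]] show ?thesis by (simp add: partial_d_def)
qed

lemma partial_d_cmult:
  assumes "v differentiable (at x)"
  shows "partial_d i (\<lambda>x. c * v x) x = c * partial_d i v x"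
  using partial_d_mult[OF _ assms, of "\<lambda>x. c" i] by simp

lemma partial_d_minus:
  assumes "v differentiable (at x)"
  shows "partial_d i (\<lambda>x. - v x) x = - partial_d i v x"
  using partial_d_cmult[OF assms, of i "-1"] by simp

lemma partial_d_sum:
  assumes "\<And>a. a \<in> A \<Longrightarrow> u a differentiable (at x)"
  shows "partial_d i (\<lambda>x. \<Sum>a\<in>A. u a x) x = (\<Sum>a\<in>A. partial_d i (u a) x)"
proof (cases "finite A")
  case True
  then show ?thesis using assms
    by (induction A) (auto simp: partial_d_add differentiable_sum)
qed simp

lemma C_k_on_add:
  assumes "open S" "C_k_on k S u" "C_k_on k S v"
  shows "C_k_on k S (\<lambda>x. u x + v x)"
  using assms(2,3)
proof (induction k arbitrary: u v)
  case (Suc k)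
  have "C_k_on k S (partial_d i (\<lambda>x. u x + v x))" for i
    by (rule C_k_on_congI[OF assms(1) Suc.IH[OF C_k_on_partial[OF Suc.prems(1)] C_k_on_partial[OF Suc.prems(2)]]])
      (use Suc.prems in \<open>simp add: partial_d_add\<close>)
  then show ?case using Suc.prems by simp
qed (auto intro: continuous_on_add)

lemma C_k_on_mult:
  assumes "open S" "C_k_on k S u" "C_k_on k S v"
  shows "C_k_on k S (\<lambda>x. u x * v x)"
  using assms(2,3)
proof (induction k arbitrary: u v)
  case (Suc k)
  have "C_k_on k S (partial_d i (\<lambda>x. u x * v x))" for i
  proof -
    have "C_k_on k S (\<lambda>x. u x * partial_d i v x + partial_d i u x * v x)"
      using Suc.prems C_k_on_SucD by (intro C_k_on_add assms(1) Suc.IH) auto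
    from assms(1) this show ?thesis
      by (rule C_k_on_congI) (use Suc.prems in \<open>simp add: partial_d_mult\<close>)
  qed
  then show ?case using Suc.prems by simp
qed (auto intro: continuous_on_mult)

lemma C_k_on_cmult: "open S \<Longrightarrow> C_k_on k S u \<Longrightarrow> C_k_on k S (\<lambda>x. c * u x)"
  using C_k_on_mult[of S k "\<lambda>x. c" u] by simp

lemma C_k_on_minus: "open S \<Longrightarrow> C_k_on k S u \<Longrightarrow> C_k_on k S (\<lambda>x. - u x)"
  using C_k_on_cmult[of S k u "-1"] by simp

lemma C_k_on_diff: "open S \<Longrightarrow> C_k_on k S u \<Longrightarrow> C_k_on k S v \<Longrightarrow> C_k_on k S (\<lambda>x. u x - v x)"
  using C_k_on_add[of S k u "\<lambda>x. - v x"] C_k_on_minus[of S k v] by simp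

lemma C_k_on_sum:
  assumes "open S" "\<And>a. a \<in> A \<Longrightarrow> C_k_on k S (u a)"
  shows "C_k_on k S (\<lambda>x. \<Sum>a\<in>A. u a x)"
proof (cases "finite A")
  case True
  then show ?thesis using assms(2) by induction (auto intro: C_k_on_add[OF assms(1)])
qed simp

lemma C_k_on_prod:
  assumes "open S" "\<And>a. a \<in> A \<Longrightarrow> C_k_on k S (u a)"
  shows "C_k_on k S (\<lambda>x. \<Prod>a\<in>A. u a x)"
proof (cases "finite A")
  case True
  then show ?thesis using assms(2) by induction (auto intro: C_k_on_mult[OF assms(1)])
qed simp

lemma partial_d_chain_real:
  assumes "u differentiable (at x)" "(h has_real_derivative d) (at (u x))"
  shows "partial_d i (\<lambda>x. h (u x)) x = d * partial_d i u x"
proof -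
  have D: "(u has_derivative frechet_derivative u (at x)) (at x)"
    using assms frechet_derivative_works by blast
  have "((h \<circ> u) has_derivative ((*) d \<circ> frechet_derivative u (at x))) (at x)"
    using diff_chain_at[OF D, of h "(*) d"] assms(2) by (simp add: has_field_derivative_def)
  from partial_d_eqI[OF this] show ?thesis by (simp add: o_def partial_d_def)
qed

lemma differentiable_chain_real:
  assumes "u differentiable (at x)" "(h has_real_derivative d) (at (u x))"
  shows "(\<lambda>x. h (u x)) differentiable (at x)"
proof -
  have "h differentiable (at (u x))"
    using assms(2) by (auto simp: differentiable_def has_field_derivative_def)
  then show ?thesis using differentiable_chain_at[OF assms(1)] by (simp add: o_def)
qed

lemma C_k_on_inverse:
  assumes "open S" "C_k_on k S u" "\<And>x. x \<in> S \<Longrightarrow> u x \<noteq> 0"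
  shows "C_k_on k S (\<lambda>x. inverse (u x))"
  using assms(2)
proof (induction k)
  case 0
  then show ?case using assms(3) by (auto intro!: continuous_intros)
next
  case (Suc k)
  have d: "(inverse has_real_derivative - (inverse (u x) * inverse (u x))) (at (u x))" if "x \<in> S" for x
    using assms(3)[OF that] by (auto intro!: derivative_eq_intros)
  have "C_k_on k S (\<lambda>x. - (inverse (u x) * inverse (u x)) * partial_d i u x)" for i
    using Suc C_k_on_SucD by (intro C_k_on_mult C_k_on_minus assms(1)) auto
  then have "C_k_on k S (partial_d i (\<lambda>x. inverse (u x)))" for i
    by (rule C_k_on_congI[OF assms(1) _ partial_d_chain_real]) (use Suc.prems in \<open>auto intro!: d\<close>)
  moreover have "(\<lambda>x. inverse (u x)) differentiable (at x)" if "x \<in> S" for x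
    by (rule differentiable_chain_real[where u = u, OF _ d[OF that]]) (use Suc.prems that in auto)
  ultimately show ?case by simp
qed

lemma C_k_on_divide:
  assumes "open S" "C_k_on k S u" "C_k_on k S v" "\<And>x. x \<in> S \<Longrightarrow> v x \<noteq> 0"
  shows "C_k_on k S (\<lambda>x. u x / v x)"
  unfolding divide_inverse by (intro C_k_on_mult C_k_on_inverse assms)

lemma C_k_on_sqrt:
  assumes "open S" "C_k_on k S u" "\<And>x. x \<in> S \<Longrightarrow> u x > 0"
  shows "C_k_on k S (\<lambda>x. sqrt (u x))"
  using assms(2)
proof (induction k)
  case 0
  then show ?case by (auto intro!: continuous_intros)
next
  case (Suc k)
  have d: "(sqrt has_real_derivative (inverse (sqrt (u x)) / 2)) (at (u x))" if "x \<in> S" for x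
    using assms(3)[OF that] by (auto intro!: derivative_eq_intros)
  have pos: "sqrt (u x) \<noteq> 0" if "x \<in> S" for x using assms(3)[OF that] by auto
  have "C_k_on k S (\<lambda>x. (inverse (sqrt (u x)) / 2) * partial_d i u x)" for i
    using Suc C_k_on_SucD pos by (intro C_k_on_mult C_k_on_divide C_k_on_inverse assms(1)) auto
  then have "C_k_on k S (partial_d i (\<lambda>x. sqrt (u x)))" for i
    by (rule C_k_on_congI[OF assms(1) _ partial_d_chain_real]) (use Suc.prems in \<open>auto intro!: d\<close>)
  moreover have "(\<lambda>x. sqrt (u x)) differentiable (at x)" if "x \<in> S" for x
    by (rule differentiable_chain_real[where u = u, OF _ d[OF that]]) (use Suc.prems that in auto)
  ultimately show ?case by simp
qed

lemma has_real_derivative_pos_part_power: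
  "((\<lambda>t. (max t 0) ^ (m + 2)) has_real_derivative (real m + 2) * (max t 0) ^ (m + 1)) (at t)"
proof (cases "t = 0")
  case False
  show ?thesis
  proof (cases "t > 0")
    case True
    have "((\<lambda>t. t ^ (m + 2)) has_real_derivative (real m + 2) * t ^ (m + 1)) (at t)"
      by (rule DERIV_cong[OF DERIV_pow]) simp
    then have "((\<lambda>t. max t 0 ^ (m + 2)) has_real_derivative (real m + 2) * t ^ (m + 1)) (at t)"
      by (rule has_field_derivative_transform_within_open[of _ _ _ "{0<..}"]) (use True in auto)
    then show ?thesis using True by simp
  next
    case f: False
    have "((\<lambda>t::real. 0) has_real_derivative 0) (at t)" by simp
    then have "((\<lambda>t. max t 0 ^ (m + 2)) has_real_derivative 0) (at t)"
      by (rule has_field_derivative_transform_within_open[of _ _ _ "{..<0}"]) (use False f in auto)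
    then show ?thesis using f by simp
  qed
next
  case True
  have "((\<lambda>h. (max h 0 ^ (m + 2)) / h) \<longlongrightarrow> 0) (at (0::real))"
  proof (rule Lim_null_comparison)
    have "norm ((max h 0 ^ (m + 2)) / h) \<le> \<bar>h\<bar> ^ (m + 1)" for h :: real
    proof (cases "h > 0")
      case False
      then have "norm ((max h 0 ^ (m + 2)) / h) = 0" by simp
      then show ?thesis using zero_le_power[of "\<bar>h\<bar>" "m + 1"] by linarith
    qed (simp add: max_def)
    then show "\<forall>\<^sub>F h in at (0::real). norm ((max h 0 ^ (m + 2)) / h) \<le> \<bar>h\<bar> ^ (m + 1)"
      by (intro always_eventually) blast
    show "((\<lambda>h::real. \<bar>h\<bar> ^ (m + 1)) \<longlongrightarrow> 0) (at 0)"
      by (auto intro!: tendsto_eq_intros)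
  qed
  then show ?thesis using True by (simp add: DERIV_def)
qed

text \<open>Cutoff functions are built from powers of a positive part: one derivative is lost for each exponent, so these are
flat but not smooth, and no bump functions are needed.\<close>

lemma C_k_on_pos_part_power:
  assumes "open S" "C_k_on k S u"
  shows "C_k_on k S (\<lambda>x. (max (u x) 0) ^ (k + 1))"
  using assms(2)
proof (induction k)
  case 0
  then show ?case by (auto intro!: continuous_intros)
next
  case (Suc k)
  note d = has_real_derivative_pos_part_power[of k]
  have "C_k_on k S (\<lambda>x. ((real k + 2) * (max (u x) 0) ^ (k + 1)) * partial_d i u x)" for i
    using Suc C_k_on_SucD by (intro C_k_on_mult C_k_on_cmult assms(1)) auto
  then have "C_k_on k S (partial_d i (\<lambda>x. max (u x) 0 ^ (k + 2)))" for i
    by (rule C_k_on_congI[OF assms(1) _ partial_d_chain_real[OF _ d]]) (use Suc.prems in auto)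
  moreover have "(\<lambda>x. max (u x) 0 ^ (k + 2)) differentiable (at x)" if "x \<in> S" for x
    by (rule differentiable_chain_real[OF _ d]) (use Suc.prems that in auto)
  ultimately show ?case by simp
qed

lemma has_derivative_vec_iff:
  fixes \<tau> :: "'a::real_normed_vector \<Rightarrow> real^'m::finite"
  shows "(\<tau> has_derivative D) (at x) \<longleftrightarrow> (\<forall>i. ((\<lambda>y. \<tau> y $ i) has_derivative (\<lambda>h. D h $ i)) (at x))"
  by (subst has_derivative_componentwise_within) (auto simp: Basis_vec_def inner_axis)

lemma differentiable_vec:
  fixes \<tau> :: "real^'n::finite \<Rightarrow> real^'m::finite"
  assumes "\<And>i. (\<lambda>x. \<tau> x $ i) differentiable (at x)"
  shows "(\<tau> has_derivative (\<lambda>h. \<chi> i. \<Sum>j\<in>UNIV. h $ j * partial_d j (\<lambda>x. \<tau> x $ i) x)) (at x)"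
  using has_derivative_partial[OF assms] by (simp add: has_derivative_vec_iff)

lemma partial_d_compose:
  fixes \<tau> :: "real^'n::finite \<Rightarrow> real^'m::finite"
  assumes "\<And>i. (\<lambda>x. \<tau> x $ i) differentiable (at x)" "u differentiable (at (\<tau> x))"
  shows "partial_d j (\<lambda>x. u (\<tau> x)) x = (\<Sum>m\<in>UNIV. partial_d m u (\<tau> x) * partial_d j (\<lambda>x. \<tau> x $ m) x)"
    and "(\<lambda>x. u (\<tau> x)) differentiable (at x)"
proof -
  have D: "((u \<circ> \<tau>) has_derivative
     ((\<lambda>h. \<Sum>i\<in>UNIV. h $ i * partial_d i u (\<tau> x)) \<circ> (\<lambda>h. \<chi> i. \<Sum>j\<in>UNIV. h $ j * partial_d j (\<lambda>x. \<tau> x $ i) x))) (at x)"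
    by (rule diff_chain_at[OF differentiable_vec[OF assms(1)] has_derivative_partial[OF assms(2)]])
  have *: "(\<Sum>j'\<in>UNIV. axis j (1::real) $ j' * f j') = f j" for f
    by (simp add: axis_def if_distrib[of "\<lambda>x. x * _"] cong: if_cong)
  from partial_d_eqI[OF D, of j, unfolded o_def, simplified, unfolded *]
  show "partial_d j (\<lambda>x. u (\<tau> x)) x = (\<Sum>m\<in>UNIV. partial_d m u (\<tau> x) * partial_d j (\<lambda>x. \<tau> x $ m) x)"
    by (simp add: mult.commute)
  show "(\<lambda>x. u (\<tau> x)) differentiable (at x)"
    using D by (auto simp: differentiable_def o_def)
qed

lemma C_k_on_compose:
  fixes \<tau> :: "real^'n::finite \<Rightarrow> real^'m::finite"
  assumes "open S" "\<And>i. C_k_on k S (\<lambda>x. \<tau> x $ i)" "\<tau> ` S \<subseteq> T" "C_k_on k T u"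
  shows "C_k_on k S (\<lambda>x. u (\<tau> x))"
  using assms(2,4)
proof (induction k arbitrary: u)
  case 0
  have "continuous_on S (\<lambda>x. \<chi> i. \<tau> x $ i)" using 0 by (intro continuous_on_vec_lambda) auto
  then have "continuous_on S \<tau>" by simp
  then show ?case using 0 assms(3) by (auto intro: continuous_on_compose2)
next
  case (Suc k)
  have *: "C_k_on k S (\<lambda>x. \<Sum>m\<in>UNIV. partial_d m u (\<tau> x) * partial_d j (\<lambda>x. \<tau> x $ m) x)" for j
  proof (intro C_k_on_sum C_k_on_mult assms(1))
    show "C_k_on k S (\<lambda>x. partial_d m u (\<tau> x))" for m
      by (rule Suc.IH[OF C_k_on_SucD[OF Suc.prems(1)] C_k_on_partial[OF Suc.prems(2)]])
    show "C_k_on k S (partial_d j (\<lambda>x. \<tau> x $ m))" for m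
      using Suc.prems(1)[of m] by simp
  qed
  have d: "(\<lambda>x. \<tau> x $ i) differentiable (at x)" if "x \<in> S" for i x
    using Suc.prems(1)[of i] that by simp
  have d2: "u differentiable (at (\<tau> x))" if "x \<in> S" for x
    using Suc.prems(2) that assms(3) by auto
  have "C_k_on k S (partial_d j (\<lambda>x. u (\<tau> x)))" for j
    by (rule C_k_on_congI[OF assms(1) *[of j]]) (rule partial_d_compose(1)[OF d d2])
  then show ?case unfolding C_k_on.simps using partial_d_compose(2)[OF d d2] by blast
qed

section \<open>Strict differentiability and symmetry of second derivatives\<close>

text \<open>The estimate is uniform in both arguments near \<open>z\<close>, as is needed for functions of two nearby points. It holds because all
partial derivatives are close to their values at \<open>z\<close> and \<open>y - x\<close> is traversed inside a ball.\<close>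

lemma strict_differentiability:
  fixes u :: "real^'n::finite \<Rightarrow> real"
  assumes S: "open S" "z \<in> S" and u: "C_k_on 1 S u" and e: "e > 0"
  obtains d where "d > 0" "ball z d \<subseteq> S"
    "\<And>x y. x \<in> ball z d \<Longrightarrow> y \<in> ball z d \<Longrightarrow>
       \<bar>u y - u x - (\<Sum>i\<in>UNIV. (y - x) $ i * partial_d i u z)\<bar> \<le> e * norm (y - x)"
proof -
  define e' where "e' = e / (real CARD('n))"
  have e': "e' > 0" using e by (simp add: e'_def)
  have "\<exists>d>0. \<forall>x\<in>ball z d. \<bar>partial_d i u x - partial_d i u z\<bar> < e'" for i
  proof -
    have "continuous_on S (partial_d i u)" using u by simp
    then have "isCont (partial_d i u) z" using S continuous_on_eq_continuous_at by blast
    then show ?thesis using e' unfolding continuous_at_eps_delta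
      by (metis dist_commute dist_real_def mem_ball)
  qed
  then obtain d where d: "d i > 0" "x \<in> ball z (d i) \<Longrightarrow> \<bar>partial_d i u x - partial_d i u z\<bar> < e'" for i x
    by metis
  obtain r where r: "r > 0" "ball z r \<subseteq> S" using S open_contains_ball by blast
  define \<delta> where "\<delta> = min r (Min (range d))"
  have pos: "\<delta> > 0" using d(1) r by (simp add: \<delta>_def)
  have le: "\<delta> \<le> d i" for i by (simp add: \<delta>_def min.coboundedI2)
  have sub: "ball z \<delta> \<subseteq> S" using r by (auto simp: \<delta>_def)
  have "\<bar>u y - u x - (\<Sum>i\<in>UNIV. (y - x) $ i * partial_d i u z)\<bar> \<le> e * norm (y - x)"
    if xy: "x \<in> ball z \<delta>" "y \<in> ball z \<delta>" for x y
  proof -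
    define v where "v = (\<lambda>x. u x - (\<Sum>i\<in>UNIV. x $ i * partial_d i u z))"
    have der: "(v has_derivative (\<lambda>h. \<Sum>i\<in>UNIV. h $ i * (partial_d i u x - partial_d i u z))) (at x within ball z \<delta>)"
      if "x \<in> ball z \<delta>" for x
    proof -
      have "(u has_derivative (\<lambda>h. \<Sum>i\<in>UNIV. h $ i * partial_d i u x)) (at x)"
        by (rule has_derivative_partial) (use that sub u in auto)
      moreover have "((\<lambda>x. \<Sum>i\<in>UNIV. x $ i * partial_d i u z) has_derivative (\<lambda>h. \<Sum>i\<in>UNIV. h $ i * partial_d i u z)) (at x)"
        by (intro has_derivative_sum has_derivative_mult_left bounded_linear_imp_has_derivative bounded_linear_vec_nth)
      ultimately have "(v has_derivative (\<lambda>h. (\<Sum>i\<in>UNIV. h $ i * partial_d i u x) - (\<Sum>i\<in>UNIV. h $ i * partial_d i u z))) (at x)"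
        unfolding v_def by (rule has_derivative_diff)
      then show ?thesis
        by (auto simp: sum_subtractf[symmetric] right_diff_distrib intro: has_derivative_at_withinI)
    qed
    have "norm (v y - v x) \<le> e * norm (y - x)"
    proof (rule differentiable_bound[OF convex_ball der _ xy(2) xy(1)])
      fix x assume x: "x \<in> ball z \<delta>"
      show "onorm (\<lambda>h. \<Sum>i\<in>UNIV. h $ i * (partial_d i u x - partial_d i u z)) \<le> e"
      proof (rule onorm_bound)
        fix h :: "real^'n"
        have "norm (\<Sum>i\<in>UNIV. h $ i * (partial_d i u x - partial_d i u z)) \<le> (\<Sum>i\<in>(UNIV::'n set). norm h * e')"
        proof (rule sum_norm_le)
          fix i
          have "x \<in> ball z (d i)" using x le[of i] by auto
          from d(2)[OF this] have "\<bar>partial_d i u x - partial_d i u z\<bar> \<le> e'" by simp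
          then show "norm (h $ i * (partial_d i u x - partial_d i u z)) \<le> norm h * e'"
            unfolding real_norm_def abs_mult by (intro mult_mono) (auto simp: component_le_norm_cart)
        qed
        also have "\<dots> = e * norm h" by (simp add: e'_def)
        finally show "norm (\<Sum>i\<in>UNIV. h $ i * (partial_d i u x - partial_d i u z)) \<le> e * norm h" .
      qed (use e in simp)
    qed
    moreover have "v y - v x = u y - u x - (\<Sum>i\<in>UNIV. (y - x) $ i * partial_d i u z)"
      by (simp add: v_def sum_subtractf left_diff_distrib)
    ultimately show ?thesis by simp
  qed
  then show ?thesis using that pos sub by blast
qed

lemma has_real_derivative_line:
  fixes u :: "real^'n::finite \<Rightarrow> real"
  assumes "u differentiable (at (x + t *\<^sub>R axis i 1))"
  shows "((\<lambda>s. u (x + s *\<^sub>R axis i 1)) has_real_derivative partial_d i u (x + t *\<^sub>R axis i 1)) (at t)"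
proof -
  have "(u has_derivative frechet_derivative u (at (x + t *\<^sub>R axis i 1))) (at (x + t *\<^sub>R axis i 1))"
    using assms frechet_derivative_works by blast
  moreover have "((\<lambda>s. x + s *\<^sub>R axis i 1) has_derivative (\<lambda>s. s *\<^sub>R axis i 1)) (at t)"
    by (auto intro!: derivative_eq_intros)
  ultimately have "((u \<circ> (\<lambda>s. x + s *\<^sub>R axis i 1)) has_derivative
      (frechet_derivative u (at (x + t *\<^sub>R axis i 1)) \<circ> (\<lambda>s. s *\<^sub>R axis i 1))) (at t)"
    by (intro diff_chain_at)
  moreover have "linear (frechet_derivative u (at (x + t *\<^sub>R axis i 1)))"
    using assms frechet_derivative_works has_derivative_linear by blast
  ultimately show ?thesis
    by (simp add: has_field_derivative_def o_def linear_cmul partial_d_def mult_commute_abs)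
qed

text \<open>One half of Schwarz's theorem: the second difference is symmetric in the two directions, the iterated mean value is not.\<close>

lemma second_difference_mean_value:
  fixes u :: "real^'n::finite \<Rightarrow> real"
  assumes u: "C_k_on 2 (ball z r) u" and r: "r > 0" and s: "0 < s" "2 * s < r"
  shows "\<exists>y. norm (y - z) \<le> 2 * s \<and>
    u (z + s *\<^sub>R axis i 1 + s *\<^sub>R axis j 1) - u (z + s *\<^sub>R axis i 1) - u (z + s *\<^sub>R axis j 1) + u z
      = s * s * partial_d j (partial_d i u) y"
proof -
  have near: "z + a *\<^sub>R axis i 1 + b *\<^sub>R axis j 1 \<in> ball z r"
       "norm (a *\<^sub>R axis i 1 + b *\<^sub>R axis j (1::real)) \<le> 2 * s"
    if "0 \<le> a" "a \<le> s" "0 \<le> b" "b \<le> s" for a b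
  proof -
    have "norm (a *\<^sub>R axis i 1 + b *\<^sub>R axis j (1::real)) \<le> a + b"
      by (rule norm_triangle_le) (use that in simp)
    then show "norm (a *\<^sub>R axis i 1 + b *\<^sub>R axis j (1::real)) \<le> 2 * s" using that by linarith
    then show "z + a *\<^sub>R axis i 1 + b *\<^sub>R axis j 1 \<in> ball z r"
      using s by (simp add: dist_norm norm_minus_commute algebra_simps)
  qed
  have near0: "z + a *\<^sub>R axis i 1 \<in> ball z r" if "0 \<le> a" "a \<le> s" for a
    using near(1)[of a 0] that s by simp
  have d1: "u differentiable (at y)" "partial_d i u differentiable (at y)" if "y \<in> ball z r" for y i
    using u that by (auto simp: numeral_2_eq_2)
  define h where "h = (\<lambda>a. u (z + s *\<^sub>R axis j 1 + a *\<^sub>R axis i 1) - u (z + a *\<^sub>R axis i 1))"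
  have "\<exists>a. 0 < a \<and> a < s \<and> h s - h 0 = (s - 0) * (partial_d i u (z + s *\<^sub>R axis j 1 + a *\<^sub>R axis i 1) - partial_d i u (z + a *\<^sub>R axis i 1))"
  proof (rule MVT2)
    fix a assume a: "0 \<le> a" "a \<le> s"
    have "z + s *\<^sub>R axis j 1 + a *\<^sub>R axis i 1 \<in> ball z r"
      using near(1)[of a s] a s by (simp add: algebra_simps)
    then show "(h has_real_derivative partial_d i u (z + s *\<^sub>R axis j 1 + a *\<^sub>R axis i 1) - partial_d i u (z + a *\<^sub>R axis i 1)) (at a)"
      unfolding h_def by (intro DERIV_diff has_real_derivative_line d1 near0[OF a])
  qed (use s in auto)
  then obtain a where a: "0 < a" "a < s" and ha: "h s - h 0 = s * (partial_d i u (z + s *\<^sub>R axis j 1 + a *\<^sub>R axis i 1) - partial_d i u (z + a *\<^sub>R axis i 1))"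
    by auto
  have "\<exists>b. 0 < b \<and> b < s \<and> partial_d i u (z + a *\<^sub>R axis i 1 + s *\<^sub>R axis j 1) - partial_d i u (z + a *\<^sub>R axis i 1 + 0 *\<^sub>R axis j 1)
      = (s - 0) * partial_d j (partial_d i u) (z + a *\<^sub>R axis i 1 + b *\<^sub>R axis j 1)"
    using near(1)[of a] a s by (intro MVT2 has_real_derivative_line d1) auto
  then obtain b where b: "0 < b" "b < s" and hb: "partial_d i u (z + a *\<^sub>R axis i 1 + s *\<^sub>R axis j 1) - partial_d i u (z + a *\<^sub>R axis i 1)
      = s * partial_d j (partial_d i u) (z + a *\<^sub>R axis i 1 + b *\<^sub>R axis j 1)"
    by auto
  have "h s - h 0 = s * s * partial_d j (partial_d i u) (z + a *\<^sub>R axis i 1 + b *\<^sub>R axis j 1)"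
    using ha hb by (simp add: algebra_simps)
  moreover have "h s - h 0 = u (z + s *\<^sub>R axis i 1 + s *\<^sub>R axis j 1) - u (z + s *\<^sub>R axis i 1) - u (z + s *\<^sub>R axis j 1) + u z"
    by (simp add: h_def algebra_simps)
  moreover have "norm ((z + a *\<^sub>R axis i 1 + b *\<^sub>R axis j 1) - z) \<le> 2 * s"
    using near(2)[of a b] a b by (simp add: algebra_simps)
  ultimately show ?thesis by metis
qed

lemma partial_d_commute:
  fixes u :: "real^'n::finite \<Rightarrow> real"
  assumes S: "open S" "z \<in> S" and u: "C_k_on 2 S u"
  shows "partial_d i (partial_d j u) z = partial_d j (partial_d i u) z"
proof (rule ccontr)
  assume ne: "\<not> ?thesis"
  define e where "e = \<bar>partial_d i (partial_d j u) z - partial_d j (partial_d i u) z\<bar> / 2"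
  have e: "e > 0" using ne by (simp add: e_def)
  have "\<exists>d>0. \<forall>y. norm (y - z) < d \<longrightarrow> \<bar>partial_d i (partial_d j u) y - partial_d i (partial_d j u) z\<bar> < e" for i j
  proof -
    have "continuous_on S (partial_d i (partial_d j u))" using u by (simp add: numeral_2_eq_2)
    then have "isCont (partial_d i (partial_d j u)) z" using S continuous_on_eq_continuous_at by blast
    then show ?thesis using e unfolding continuous_at_eps_delta by (simp add: dist_norm)
  qed
  then obtain d1 d2 where d: "d1 > 0" "d2 > 0"
     "\<And>y. norm (y - z) < d1 \<Longrightarrow> \<bar>partial_d i (partial_d j u) y - partial_d i (partial_d j u) z\<bar> < e"
     "\<And>y. norm (y - z) < d2 \<Longrightarrow> \<bar>partial_d j (partial_d i u) y - partial_d j (partial_d i u) z\<bar> < e"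
    by metis
  obtain r where r: "r > 0" "ball z r \<subseteq> S" using S open_contains_ball by blast
  have ub: "C_k_on 2 (ball z r) u" using u r C_k_on_subset by blast
  define s where "s = min r (min d1 d2) / 3"
  have s: "0 < s" "2 * s < r" "2 * s < d1" "2 * s < d2" using r d by (auto simp: s_def)
  obtain y1 where y1: "norm (y1 - z) \<le> 2 * s" "u (z + s *\<^sub>R axis i 1 + s *\<^sub>R axis j 1) - u (z + s *\<^sub>R axis i 1) - u (z + s *\<^sub>R axis j 1) + u z
      = s * s * partial_d j (partial_d i u) y1"
    using second_difference_mean_value[OF ub r(1) s(1,2)] by blast
  obtain y2 where y2: "norm (y2 - z) \<le> 2 * s" "u (z + s *\<^sub>R axis j 1 + s *\<^sub>R axis i 1) - u (z + s *\<^sub>R axis j 1) - u (z + s *\<^sub>R axis i 1) + u z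
      = s * s * partial_d i (partial_d j u) y2"
    using second_difference_mean_value[OF ub r(1) s(1,2)] by blast
  have "s * s * partial_d j (partial_d i u) y1 = s * s * partial_d i (partial_d j u) y2"
    unfolding y1(2)[symmetric] y2(2)[symmetric] by (simp add: algebra_simps)
  then have "partial_d j (partial_d i u) y1 = partial_d i (partial_d j u) y2" using s(1) by simp
  moreover have "\<bar>partial_d i (partial_d j u) y2 - partial_d i (partial_d j u) z\<bar> < e" using d(3) y2(1) s by force
  moreover have "\<bar>partial_d j (partial_d i u) y1 - partial_d j (partial_d i u) z\<bar> < e" using d(4) y1(1) s by force
  ultimately have "\<bar>partial_d i (partial_d j u) z - partial_d j (partial_d i u) z\<bar> < 2 * e" by linarith
  then show False by (simp add: e_def)
qed

section \<open>Second-order jets of real functions\<close>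

text \<open>First and second derivative at \<open>0\<close> in one relation. The first derivative must exist near \<open>0\<close>, so that a local minimum
has a nonnegative second derivative.\<close>

definition jet2 :: "(real \<Rightarrow> real) \<Rightarrow> real \<Rightarrow> real \<Rightarrow> bool" where
  "jet2 h a b \<longleftrightarrow> (\<exists>h'. (\<forall>\<^sub>F \<epsilon> in nhds 0. (h has_real_derivative h' \<epsilon>) (at \<epsilon>)) \<and> h' 0 = a \<and>
      (h' has_real_derivative b) (at 0))"

lemma jet2_const [simp]: "jet2 (\<lambda>\<epsilon>. c) 0 0"
  unfolding jet2_def by (rule exI[of _ "\<lambda>\<epsilon>. 0"]) auto

lemma jet2_first: "jet2 h a b \<Longrightarrow> (h has_real_derivative a) (at 0)"
  unfolding jet2_def by (auto dest: eventually_nhds_x_imp_x)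

lemma jet2_isCont: "jet2 h a b \<Longrightarrow> isCont h 0"
  using jet2_first DERIV_isCont by blast

lemma jet2_add:
  assumes "jet2 h a b" "jet2 k c d" shows "jet2 (\<lambda>\<epsilon>. h \<epsilon> + k \<epsilon>) (a + c) (b + d)"
proof -
  obtain h' k' where h: "\<forall>\<^sub>F \<epsilon> in nhds 0. (h has_real_derivative h' \<epsilon>) (at \<epsilon>)" "h' 0 = a" "(h' has_real_derivative b) (at 0)"
    and k: "\<forall>\<^sub>F \<epsilon> in nhds 0. (k has_real_derivative k' \<epsilon>) (at \<epsilon>)" "k' 0 = c" "(k' has_real_derivative d) (at 0)"
    using assms unfolding jet2_def by blast
  have "\<forall>\<^sub>F \<epsilon> in nhds 0. ((\<lambda>\<epsilon>. h \<epsilon> + k \<epsilon>) has_real_derivative h' \<epsilon> + k' \<epsilon>) (at \<epsilon>)"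
    using h(1) k(1) by eventually_elim (rule DERIV_add)
  then show ?thesis unfolding jet2_def
    by (intro exI[of _ "\<lambda>\<epsilon>. h' \<epsilon> + k' \<epsilon>"]) (use h k in \<open>auto intro: DERIV_add\<close>)
qed

lemma jet2_mult:
  assumes "jet2 h a b" "jet2 k c d"
  shows "jet2 (\<lambda>\<epsilon>. h \<epsilon> * k \<epsilon>) (a * k 0 + h 0 * c) (b * k 0 + 2 * a * c + h 0 * d)"
proof -
  obtain h' k' where h: "\<forall>\<^sub>F \<epsilon> in nhds 0. (h has_real_derivative h' \<epsilon>) (at \<epsilon>)" "h' 0 = a" "(h' has_real_derivative b) (at 0)"
    and k: "\<forall>\<^sub>F \<epsilon> in nhds 0. (k has_real_derivative k' \<epsilon>) (at \<epsilon>)" "k' 0 = c" "(k' has_real_derivative d) (at 0)"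
    using assms unfolding jet2_def by blast
  have "\<forall>\<^sub>F \<epsilon> in nhds 0. ((\<lambda>\<epsilon>. h \<epsilon> * k \<epsilon>) has_real_derivative h' \<epsilon> * k \<epsilon> + k' \<epsilon> * h \<epsilon>) (at \<epsilon>)"
    using h(1) k(1) by eventually_elim (rule DERIV_mult)
  moreover have "((\<lambda>\<epsilon>. h' \<epsilon> * k \<epsilon> + k' \<epsilon> * h \<epsilon>) has_real_derivative (b * k 0 + c * h' 0) + (d * h 0 + a * k' 0)) (at 0)"
    using jet2_first[OF assms(1)] jet2_first[OF assms(2)] h(3) k(3) by (intro DERIV_add DERIV_mult)
  ultimately show ?thesis unfolding jet2_def
    by (intro exI[of _ "\<lambda>\<epsilon>. h' \<epsilon> * k \<epsilon> + k' \<epsilon> * h \<epsilon>"]) (use h(2) k(2) in \<open>auto simp: algebra_simps\<close>)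
qed

lemma jet2_cmult: "jet2 h a b \<Longrightarrow> jet2 (\<lambda>\<epsilon>. c * h \<epsilon>) (c * a) (c * b)"
  using jet2_mult[OF jet2_const, of h a b c] by simp

lemma jet2_diff: "jet2 h a b \<Longrightarrow> jet2 k c d \<Longrightarrow> jet2 (\<lambda>\<epsilon>. h \<epsilon> - k \<epsilon>) (a - c) (b - d)"
  using jet2_add[of h a b "\<lambda>\<epsilon>. - k \<epsilon>" "- c" "- d"] jet2_cmult[of k c d "-1"] by simp

lemma jet2_sum:
  "(\<And>i. i \<in> A \<Longrightarrow> jet2 (h i) (a i) (b i)) \<Longrightarrow> jet2 (\<lambda>\<epsilon>. \<Sum>i\<in>A. h i \<epsilon>) (\<Sum>i\<in>A. a i) (\<Sum>i\<in>A. b i)"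
  by (induction A rule: infinite_finite_induct) (auto intro: jet2_add)

lemma jet2_cong:
  assumes "jet2 h a b" "\<forall>\<^sub>F \<epsilon> in nhds 0. k \<epsilon> = h \<epsilon>"
  shows "jet2 k a b"
proof -
  obtain h' where h: "\<forall>\<^sub>F \<epsilon> in nhds 0. (h has_real_derivative h' \<epsilon>) (at \<epsilon>)" "h' 0 = a" "(h' has_real_derivative b) (at 0)"
    using assms unfolding jet2_def by blast
  have "\<forall>\<^sub>F \<epsilon> in nhds 0. \<forall>\<^sub>F \<epsilon>' in nhds \<epsilon>. k \<epsilon>' = h \<epsilon>'"
    using assms(2) by (simp add: eventually_eventually)
  then have "\<forall>\<^sub>F \<epsilon> in nhds 0. (k has_real_derivative h' \<epsilon>) (at \<epsilon>)"
    using h(1) by eventually_elim (simp add: DERIV_cong_ev[OF refl _ refl])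
  then show ?thesis using h unfolding jet2_def by blast
qed

lemma jet2_unique:
  assumes "jet2 h a b" "jet2 h c d"
  shows "a = c" "b = d"
proof -
  obtain h' k' where h: "\<forall>\<^sub>F \<epsilon> in nhds 0. (h has_real_derivative h' \<epsilon>) (at \<epsilon>)" "h' 0 = a" "(h' has_real_derivative b) (at 0)"
    and k: "\<forall>\<^sub>F \<epsilon> in nhds 0. (h has_real_derivative k' \<epsilon>) (at \<epsilon>)" "k' 0 = c" "(k' has_real_derivative d) (at 0)"
    using assms unfolding jet2_def by blast
  have ev: "\<forall>\<^sub>F \<epsilon> in nhds 0. h' \<epsilon> = k' \<epsilon>"
    using h(1) k(1) by eventually_elim (rule DERIV_unique)
  then show "a = c" using h(2) k(2) eventually_nhds_x_imp_x by blast
  have "(k' has_real_derivative b) (at 0)" using h(3) DERIV_cong_ev[OF refl ev refl] by blast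
  then show "b = d" using k(3) DERIV_unique by blast
qed

text \<open>If the second derivative were negative then the first would be negative to the right of \<open>0\<close>.\<close>

lemma jet2_local_min:
  assumes h: "jet2 h a b" and min: "\<forall>\<^sub>F \<epsilon> in nhds 0. h 0 \<le> h \<epsilon>"
  shows "a = 0" "b \<ge> 0"
proof -
  obtain h' where h': "\<forall>\<^sub>F \<epsilon> in nhds 0. (h has_real_derivative h' \<epsilon>) (at \<epsilon>)" "h' 0 = a" "(h' has_real_derivative b) (at 0)"
    using h unfolding jet2_def by blast
  obtain d where d: "d > 0" "\<And>\<epsilon>. \<bar>\<epsilon>\<bar> < d \<Longrightarrow> h 0 \<le> h \<epsilon> \<and> (h has_real_derivative h' \<epsilon>) (at \<epsilon>)"
    using eventually_conj[OF min h'(1)] unfolding eventually_nhds_metric by (auto simp: dist_norm)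
  show a: "a = 0" by (rule DERIV_local_min[OF jet2_first[OF h] d(1)]) (use d(2) in auto)
  show "b \<ge> 0"
  proof (rule ccontr)
    assume "\<not> b \<ge> 0"
    then have "b < 0" by simp
    from DERIV_neg_dec_right[OF h'(3) this] obtain d2 where d2: "d2 > 0" "\<And>t. 0 < t \<Longrightarrow> t < d2 \<Longrightarrow> h' t < 0"
      using h'(2) a by auto
    define t where "t = min d d2 / 2"
    have t: "0 < t" "t < d" "t < d2" using d d2 by (auto simp: t_def)
    have "\<exists>\<xi>. 0 < \<xi> \<and> \<xi> < t \<and> h t - h 0 = (t - 0) * h' \<xi>"
      by (rule MVT2) (use t d(2) in auto)
    then obtain \<xi> where xi: "0 < \<xi>" "\<xi> < t" "h t - h 0 = t * h' \<xi>" by auto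
    have "h' \<xi> < 0" using d2(2) xi t by auto
    then have "h t - h 0 < 0" using xi t by (simp add: mult_pos_neg)
    moreover have "h 0 \<le> h t" using d(2)[of t] t by auto
    ultimately show False by simp
  qed
qed

lemma jet2_compose_real:
  assumes h: "jet2 h a b" and F: "open T" "h 0 \<in> T" "\<And>t. t \<in> T \<Longrightarrow> (F has_real_derivative F' t) (at t)"
    and F2: "(F' has_real_derivative F'') (at (h 0))"
  shows "jet2 (\<lambda>\<epsilon>. F (h \<epsilon>)) (F' (h 0) * a) (F'' * a\<^sup>2 + F' (h 0) * b)"
proof -
  obtain h' where h': "\<forall>\<^sub>F \<epsilon> in nhds 0. (h has_real_derivative h' \<epsilon>) (at \<epsilon>)" "h' 0 = a" "(h' has_real_derivative b) (at 0)"
    using h unfolding jet2_def by blast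
  have "(h \<longlongrightarrow> h 0) (at 0)" using jet2_isCont[OF h] by (simp add: isCont_def)
  then have "(h \<longlongrightarrow> h 0) (nhds 0)" by (simp add: tendsto_at_iff_tendsto_nhds)
  then have "\<forall>\<^sub>F \<epsilon> in nhds 0. h \<epsilon> \<in> T" using F(1,2) topological_tendstoD by blast
  then have "\<forall>\<^sub>F \<epsilon> in nhds 0. ((\<lambda>\<epsilon>. F (h \<epsilon>)) has_real_derivative F' (h \<epsilon>) * h' \<epsilon>) (at \<epsilon>)"
    using h'(1) by eventually_elim (rule DERIV_chain2[OF F(3)])
  moreover have "((\<lambda>\<epsilon>. F' (h \<epsilon>) * h' \<epsilon>) has_real_derivative (F'' * a) * h' 0 + b * F' (h 0)) (at 0)"
    by (intro DERIV_mult h'(3) DERIV_chain2[OF F2 jet2_first[OF h]])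
  ultimately show ?thesis unfolding jet2_def
    by (intro exI[of _ "\<lambda>\<epsilon>. F' (h \<epsilon>) * h' \<epsilon>"]) (use h' in \<open>auto simp: power2_eq_square algebra_simps\<close>)
qed

lemma has_real_derivative_along:
  fixes \<zeta> :: "real \<Rightarrow> real^'n::finite"
  assumes "\<And>i. ((\<lambda>\<epsilon>. \<zeta> \<epsilon> $ i) has_real_derivative d i) (at t)" "u differentiable (at (\<zeta> t))"
  shows "((\<lambda>\<epsilon>. u (\<zeta> \<epsilon>)) has_real_derivative (\<Sum>i\<in>UNIV. partial_d i u (\<zeta> t) * d i)) (at t)"
proof -
  have "(\<zeta> has_derivative (\<lambda>h. \<chi> i. d i * h)) (at t)"
    using assms(1) by (simp add: has_derivative_vec_iff has_field_derivative_def)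
  from diff_chain_at[OF this has_derivative_partial[OF assms(2)]]
  have "((u \<circ> \<zeta>) has_derivative ((\<lambda>h. \<Sum>i\<in>UNIV. h $ i * partial_d i u (\<zeta> t)) \<circ> (\<lambda>h. \<chi> i. d i * h))) (at t)" .
  moreover have "(\<lambda>h. \<Sum>i\<in>UNIV. h $ i * partial_d i u (\<zeta> t)) \<circ> (\<lambda>h. \<chi> i. d i * h) = (*) (\<Sum>i\<in>UNIV. partial_d i u (\<zeta> t) * d i)"
    by (rule ext) (simp add: sum_distrib_left mult_ac)
  ultimately show ?thesis by (simp add: has_field_derivative_def o_def)
qed

lemma jet2_along:
  fixes \<zeta> :: "real \<Rightarrow> real^'n::finite"
  assumes j: "\<And>i. jet2 (\<lambda>\<epsilon>. \<zeta> \<epsilon> $ i) (V i) (A i)" and S: "open S" "\<zeta> 0 \<in> S" and u: "C_k_on 2 S u"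
  shows "jet2 (\<lambda>\<epsilon>. u (\<zeta> \<epsilon>)) (\<Sum>i\<in>UNIV. partial_d i u (\<zeta> 0) * V i)
     ((\<Sum>i\<in>UNIV. \<Sum>j\<in>UNIV. partial_d i (partial_d j u) (\<zeta> 0) * V i * V j) + (\<Sum>i\<in>UNIV. partial_d i u (\<zeta> 0) * A i))"
proof -
  have "\<exists>h'. (\<forall>\<^sub>F \<epsilon> in nhds 0. ((\<lambda>\<epsilon>. \<zeta> \<epsilon> $ i) has_real_derivative h' \<epsilon>) (at \<epsilon>)) \<and> h' 0 = V i \<and>
      (h' has_real_derivative A i) (at 0)" for i
    using j[of i] unfolding jet2_def .
  then obtain d where d: "\<And>i. \<forall>\<^sub>F \<epsilon> in nhds 0. ((\<lambda>\<epsilon>. \<zeta> \<epsilon> $ i) has_real_derivative d i \<epsilon>) (at \<epsilon>)"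
      "\<And>i. d i 0 = V i" "\<And>i. (d i has_real_derivative A i) (at 0)"
    by metis
  have d0: "((\<lambda>\<epsilon>. \<zeta> \<epsilon> $ i) has_real_derivative V i) (at 0)" for i by (rule jet2_first[OF j])
  have "(\<zeta> \<longlongrightarrow> \<zeta> 0) (at 0)"
    by (rule vec_tendstoI) (use d0 DERIV_isCont isCont_def in blast)
  then have "(\<zeta> \<longlongrightarrow> \<zeta> 0) (nhds 0)" by (simp add: tendsto_at_iff_tendsto_nhds)
  then have inS: "\<forall>\<^sub>F \<epsilon> in nhds 0. \<zeta> \<epsilon> \<in> S" using S topological_tendstoD by blast
  have u1: "u differentiable (at y)" "partial_d i u differentiable (at y)" if "y \<in> S" for y i
    using u that by (auto simp: numeral_2_eq_2)
  have "\<forall>\<^sub>F \<epsilon> in nhds 0. \<forall>i\<in>UNIV. ((\<lambda>\<epsilon>. \<zeta> \<epsilon> $ i) has_real_derivative d i \<epsilon>) (at \<epsilon>)"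
    using d(1) by (intro eventually_ball_finite) auto
  with inS have "\<forall>\<^sub>F \<epsilon> in nhds 0. ((\<lambda>\<epsilon>. u (\<zeta> \<epsilon>)) has_real_derivative (\<Sum>i\<in>UNIV. partial_d i u (\<zeta> \<epsilon>) * d i \<epsilon>)) (at \<epsilon>)"
    by eventually_elim (intro has_real_derivative_along u1, auto)
  moreover have "((\<lambda>\<epsilon>. \<Sum>i\<in>UNIV. partial_d i u (\<zeta> \<epsilon>) * d i \<epsilon>) has_real_derivative
     (\<Sum>i\<in>UNIV. (\<Sum>j\<in>UNIV. partial_d j (partial_d i u) (\<zeta> 0) * V j) * d i 0 + A i * partial_d i u (\<zeta> 0))) (at 0)"
    by (intro DERIV_sum DERIV_mult d has_real_derivative_along d0 u1 S)
  moreover have "(\<Sum>i\<in>UNIV. (\<Sum>j\<in>UNIV. partial_d j (partial_d i u) (\<zeta> 0) * V j) * d i 0 + A i * partial_d i u (\<zeta> 0))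
    = ((\<Sum>i\<in>UNIV. \<Sum>j\<in>UNIV. partial_d i (partial_d j u) (\<zeta> 0) * V i * V j) + (\<Sum>i\<in>UNIV. partial_d i u (\<zeta> 0) * A i))"
    by (subst sum.swap) (simp add: d(2) sum.distrib sum_distrib_left mult_ac)
  ultimately show ?thesis unfolding jet2_def
    by (intro exI[of _ "\<lambda>\<epsilon>. \<Sum>i\<in>UNIV. partial_d i u (\<zeta> \<epsilon>) * d i \<epsilon>"]) (simp add: d(2))
qed

section \<open>Directional derivatives\<close>

definition dir :: "real^'n::finite \<Rightarrow> (real^'n \<Rightarrow> real) \<Rightarrow> real^'n \<Rightarrow> real" where
  "dir e u x = (\<Sum>m\<in>UNIV. e $ m * partial_d m u x)"

definition vdir :: "real^'n::finite \<Rightarrow> (real^'n \<Rightarrow> real^'m::finite) \<Rightarrow> real^'n \<Rightarrow> real^'m" where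
  "vdir e X x = (\<chi> k. dir e (\<lambda>y. X y $ k) x)"

lemma sum_axis [simp]: fixes f :: "'n::finite \<Rightarrow> real" shows "(\<Sum>m\<in>UNIV. axis i 1 $ m * f m) = f i"
  by (simp add: axis_def if_distrib[of "\<lambda>x. x * _"] cong: if_cong)

lemma dir_axis [simp]: "dir (axis i 1) u x = partial_d i u x"
  by (simp add: dir_def)

lemma dir_vec_add [simp]: "dir (a + b) u x = dir a u x + dir b u x"
  by (simp add: dir_def sum.distrib algebra_simps)

lemma dir_vec_scale [simp]: "dir (c *\<^sub>R a) u x = c * dir a u x"
  by (simp add: dir_def sum_distrib_left mult_ac)

lemma dir_vec_minus [simp]: "dir (- a) u x = - dir a u x"
  using dir_vec_scale[of "-1" a u x] by simp

lemma dir_vec_diff [simp]: "dir (a - b) u x = dir a u x - dir b u x"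
  using dir_vec_add[of a "- b" u x] by simp

lemma dir_const [simp]: "dir e (\<lambda>y. c) x = 0"
  by (simp add: dir_def)

lemma dir_add: "u differentiable (at x) \<Longrightarrow> v differentiable (at x) \<Longrightarrow>
   dir e (\<lambda>y. u y + v y) x = dir e u x + dir e v x"
  by (simp add: dir_def partial_d_add sum.distrib algebra_simps)

lemma dir_mult: "u differentiable (at x) \<Longrightarrow> v differentiable (at x) \<Longrightarrow>
   dir e (\<lambda>y. u y * v y) x = dir e u x * v x + u x * dir e v x"
  by (simp add: dir_def partial_d_mult sum.distrib sum_distrib_left sum_distrib_right algebra_simps)

lemma dir_cmult: "v differentiable (at x) \<Longrightarrow> dir e (\<lambda>y. c * v y) x = c * dir e v x"
  using dir_mult[of "\<lambda>y. c" x v e] by simp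

lemma dir_minus: "v differentiable (at x) \<Longrightarrow> dir e (\<lambda>y. - v y) x = - dir e v x"
  using dir_cmult[of v x e "-1"] by simp

lemma dir_diff: "u differentiable (at x) \<Longrightarrow> v differentiable (at x) \<Longrightarrow>
   dir e (\<lambda>y. u y - v y) x = dir e u x - dir e v x"
  using dir_add[of u x "\<lambda>y. - v y" e] dir_minus[of v x e] by simp

lemma dir_sum: "(\<And>a. a \<in> A \<Longrightarrow> u a differentiable (at x)) \<Longrightarrow>
   dir e (\<lambda>y. \<Sum>a\<in>A. u a y) x = (\<Sum>a\<in>A. dir e (u a) x)"
  by (simp add: dir_def partial_d_sum sum_distrib_left) (rule sum.swap)

lemma dir_cong: "open S \<Longrightarrow> x \<in> S \<Longrightarrow> (\<And>y. y \<in> S \<Longrightarrow> u y = v y) \<Longrightarrow> dir e u x = dir e v x"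
  unfolding dir_def by (rule sum.cong[OF refl]) (use partial_d_cong[of S x u v] in simp)

lemma vdir_cong: "open S \<Longrightarrow> x \<in> S \<Longrightarrow> (\<And>y. y \<in> S \<Longrightarrow> X y = Y y) \<Longrightarrow> vdir e X x = vdir e Y x"
  unfolding vdir_def vec_eq_iff vec_lambda_beta by (intro allI dir_cong) auto

lemma C_k_on_dir: "open S \<Longrightarrow> C_k_on (Suc k) S u \<Longrightarrow> C_k_on k S (dir e u)"
  unfolding dir_def[abs_def] by (intro C_k_on_sum C_k_on_cmult) auto

lemma dir_commute:
  assumes "open S" "x \<in> S" "C_k_on 2 S u"
  shows "dir a (dir b u) x = dir b (dir a u) x"
proof -
  have d: "partial_d m u differentiable (at x)" for m
    using assms by (simp add: numeral_2_eq_2)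
  have "dir a (dir b u) x = (\<Sum>m\<in>UNIV. \<Sum>l\<in>UNIV. a $ l * b $ m * partial_d l (partial_d m u) x)" for a b
  proof -
    have "dir a (dir b u) x = (\<Sum>m\<in>UNIV. b $ m * dir a (partial_d m u) x)"
      unfolding dir_def[of b u, abs_def] using d by (subst dir_sum) (auto simp: dir_cmult)
    then show ?thesis by (simp add: dir_def sum_distrib_left mult_ac)
  qed
  then have "dir a (dir b u) x = (\<Sum>m\<in>UNIV. \<Sum>l\<in>UNIV. a $ l * b $ m * partial_d l (partial_d m u) x)"
    "dir b (dir a u) x = (\<Sum>l\<in>UNIV. \<Sum>m\<in>UNIV. b $ m * a $ l * partial_d m (partial_d l u) x)" by auto
  then show ?thesis
    using partial_d_commute[OF assms] by (subst (asm) sum.swap) (simp add: mult_ac)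
qed

lemma vdir_add_vec [simp]: "vdir (a + b) X x = vdir a X x + vdir b X x"
  by (simp add: vdir_def vec_eq_iff)

lemma vdir_scale_vec [simp]: "vdir (c *\<^sub>R a) X x = c *\<^sub>R vdir a X x"
  by (simp add: vdir_def vec_eq_iff)

lemma vdir_const [simp]: "vdir e (\<lambda>y. c) x = 0"
  by (simp add: vdir_def vec_eq_iff)

lemma vdir_component: "vdir e X x $ k = dir e (\<lambda>y. X y $ k) x"
  by (simp add: vdir_def)

lemma vdir_add: "(\<And>k. (\<lambda>y. X y $ k) differentiable (at x)) \<Longrightarrow> (\<And>k. (\<lambda>y. Y y $ k) differentiable (at x)) \<Longrightarrow>
   vdir e (\<lambda>y. X y + Y y) x = vdir e X x + vdir e Y x"
  by (simp add: vdir_def vec_eq_iff dir_add)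

lemma vdir_commute:
  assumes "open S" "x \<in> S" "\<And>k. C_k_on 2 S (\<lambda>y. X y $ k)"
  shows "vdir a (vdir b X) x = vdir b (vdir a X) x"
  using dir_commute[OF assms(1,2) assms(3)] by (simp add: vdir_def vec_eq_iff)

section \<open>Bilinear forms, connection and curvature in vector notation\<close>

definition bform :: "real^'n^'n::finite \<Rightarrow> real^'n \<Rightarrow> real^'n \<Rightarrow> real" where
  "bform A v w = (\<Sum>i\<in>UNIV. \<Sum>j\<in>UNIV. A $ i $ j * v $ i * w $ j)"

lemma bform_add [simp]: "bform A (a + b) w = bform A a w + bform A b w"
   "bform A v (a + b) = bform A v a + bform A v b"
  by (simp_all add: bform_def sum.distrib algebra_simps)

lemma bform_scale [simp]: "bform A (c *\<^sub>R a) w = c * bform A a w"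
   "bform A v (c *\<^sub>R a) = c * bform A v a"
  by (simp_all add: bform_def sum_distrib_left mult_ac)

lemma bform_minus [simp]: "bform A (- a) w = - bform A a w" "bform A v (- a) = - bform A v a"
  using bform_scale(1)[of A "-1" a w] bform_scale(2)[of A v "-1" a] by simp_all

lemma bform_diff [simp]: "bform A (a - b) w = bform A a w - bform A b w"
   "bform A v (a - b) = bform A v a - bform A v b"
  using bform_add(1)[of A a "- b" w] bform_add(2)[of A v a "- b"] by simp_all

lemma bform_zero [simp]: "bform A 0 w = 0" "bform A v 0 = 0"
  by (simp_all add: bform_def)

lemma bform_commute:
  assumes "\<And>i j. A $ i $ j = A $ j $ i" shows "bform A v w = bform A w v"
  unfolding bform_def by (subst sum.swap) (simp add: assms[of _ j for j] mult_ac assms)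

text \<open>The Christoffel symbols as a vector valued bilinear map, which allows index-free computations.\<close>

definition Gam :: "(real^'n::finite \<Rightarrow> real^'n^'n) \<Rightarrow> real^'n \<Rightarrow> real^'n \<Rightarrow> real^'n \<Rightarrow> real^'n" where
  "Gam G x v w = (\<chi> k. \<Sum>i\<in>UNIV. \<Sum>j\<in>UNIV. christoffel G k i j x * v $ i * w $ j)"

lemma Gam_add [simp]: "Gam G x (a + b) w = Gam G x a w + Gam G x b w"
   "Gam G x v (a + b) = Gam G x v a + Gam G x v b"
  by (simp_all add: Gam_def vec_eq_iff sum.distrib algebra_simps)

lemma Gam_scale [simp]: "Gam G x (c *\<^sub>R a) w = c *\<^sub>R Gam G x a w"
   "Gam G x v (c *\<^sub>R a) = c *\<^sub>R Gam G x v a"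
  by (simp_all add: Gam_def vec_eq_iff sum_distrib_left mult_ac)

lemma Gam_zero [simp]: "Gam G x 0 w = 0" "Gam G x v 0 = 0"
  by (simp_all add: Gam_def vec_eq_iff)

text \<open>The derivative of the Christoffel symbols, with constant vectors inserted.\<close>

definition DGam :: "(real^'n::finite \<Rightarrow> real^'n^'n) \<Rightarrow> real^'n \<Rightarrow> real^'n \<Rightarrow> real^'n \<Rightarrow> real^'n \<Rightarrow> real^'n" where
  "DGam G x e v w = vdir e (\<lambda>y. Gam G y v w) x"

definition nab :: "(real^'n::finite \<Rightarrow> real^'n^'n) \<Rightarrow> real^'n \<Rightarrow> (real^'n \<Rightarrow> real^'n) \<Rightarrow> real^'n \<Rightarrow> real^'n" where
  "nab G e X x = vdir e X x + Gam G x e (X x)"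

definition Riem :: "(real^'n::finite \<Rightarrow> real^'n^'n) \<Rightarrow> real^'n \<Rightarrow> real^'n \<Rightarrow> real^'n \<Rightarrow> real^'n \<Rightarrow> real^'n" where
  "Riem G x X Y Z = DGam G x X Y Z - DGam G x Y X Z + Gam G x X (Gam G x Y Z) - Gam G x Y (Gam G x X Z)"

definition Hess :: "(real^'n::finite \<Rightarrow> real^'n^'n) \<Rightarrow> (real^'n \<Rightarrow> real) \<Rightarrow> real^'n \<Rightarrow> real^'n \<Rightarrow> real^'n \<Rightarrow> real" where
  "Hess G u x v w = dir v (dir w u) x - dir (Gam G x v w) u x"

text \<open>Completeness rather than orthonormality is used as the definition of an orthonormal basis; for \<open>CARD('n)\<close> vectors both are
equivalent (\<open>onbI\<close>, \<open>onb_orthonormal\<close>), and this form turns traces into sums over the basis at once.\<close>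

definition onb :: "(real^'n::finite \<Rightarrow> real^'n^'n) \<Rightarrow> real^'n \<Rightarrow> ('n \<Rightarrow> real^'n) \<Rightarrow> bool" where
  "onb G x V \<longleftrightarrow> (\<forall>i j. (\<Sum>a\<in>UNIV. V a $ i * V a $ j) = matrix_inv (G x) $ i $ j)"

definition Ric :: "(real^'n::finite \<Rightarrow> real^'n^'n) \<Rightarrow> real^'n \<Rightarrow> real^'n \<Rightarrow> real^'n \<Rightarrow> real" where
  "Ric G x v w = (\<Sum>i\<in>UNIV. Riem G x (axis i 1) v w $ i)"

definition Lap :: "(real^'n::finite \<Rightarrow> real^'n^'n) \<Rightarrow> (real^'n \<Rightarrow> real) \<Rightarrow> real^'n \<Rightarrow> real" where
  "Lap G u x = (\<Sum>k\<in>UNIV. \<Sum>l\<in>UNIV. matrix_inv (G x) $ k $ l * Hess G u x (axis k 1) (axis l 1))"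

definition grad :: "(real^'n::finite \<Rightarrow> real^'n^'n) \<Rightarrow> (real^'n \<Rightarrow> real) \<Rightarrow> real^'n \<Rightarrow> real^'n" where
  "grad G u x = (\<chi> k. \<Sum>l\<in>UNIV. matrix_inv (G x) $ k $ l * partial_d l u x)"

section \<open>The metric in a coordinate patch\<close>

locale coord_metric =
  fixes D :: "(real^'n::finite) set" and G :: "real^'n \<Rightarrow> real^'n^'n"
  assumes open_D: "open D"
    and G_sym: "x \<in> D \<Longrightarrow> G x $ i $ j = G x $ j $ i"
    and G_pos: "x \<in> D \<Longrightarrow> v \<noteq> 0 \<Longrightarrow> bform (G x) v v > 0"
    and G_smooth: "C_k_on k D (\<lambda>x. G x $ i $ j)"
begin

lemma bform_G_commute: "x \<in> D \<Longrightarrow> bform (G x) v w = bform (G x) w v"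
  by (rule bform_commute) (rule G_sym)

lemma bform_G_inner: "bform A v w = v \<bullet> (A *v w)"
  by (simp add: bform_def inner_vec_def matrix_vector_mult_def sum_distrib_left mult_ac)

lemma invertible_G: assumes "x \<in> D" shows "invertible (G x)"
proof -
  have "\<forall>v. G x *v v = 0 \<longrightarrow> v = 0"
    using G_pos[OF assms] by (metis bform_G_inner inner_zero_right less_irrefl)
  then show ?thesis
    by (simp add: invertible_left_inverse matrix_left_invertible_ker)
qed

lemma matrix_inv_G:
  assumes "x \<in> D"
  shows "G x ** matrix_inv (G x) = mat 1" "matrix_inv (G x) ** G x = mat 1"
proof -
  have "G x ** matrix_inv (G x) = mat 1 \<and> matrix_inv (G x) ** G x = mat 1"
    unfolding matrix_inv_def by (rule someI_ex) (use invertible_G[OF assms] in \<open>auto simp: invertible_def\<close>)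
  then show "G x ** matrix_inv (G x) = mat 1" "matrix_inv (G x) ** G x = mat 1" by auto
qed

lemma G_inv_sum:
  assumes "x \<in> D"
  shows "(\<Sum>k\<in>UNIV. G x $ i $ k * matrix_inv (G x) $ k $ j) = (if i = j then 1 else 0)"
    "(\<Sum>k\<in>UNIV. matrix_inv (G x) $ i $ k * G x $ k $ j) = (if i = j then 1 else 0)"
  using matrix_inv_G[OF assms] by (auto simp: matrix_matrix_mult_def mat_def vec_eq_iff)

lemma inv_sym: assumes "x \<in> D" shows "matrix_inv (G x) $ i $ j = matrix_inv (G x) $ j $ i"
proof -
  have t: "transpose (G x) = G x" by (simp add: transpose_def vec_eq_iff G_sym[OF assms])
  define H where "H = matrix_inv (G x)"
  have GH: "G x ** H = mat 1" using matrix_inv_G[OF assms] by (simp add: H_def)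
  have "transpose (G x ** H) = mat 1" by (simp only: GH transpose_mat)
  then have HG: "transpose H ** G x = mat 1" by (simp add: matrix_transpose_mul t)
  have "transpose H = transpose H ** (G x ** H)" by (simp add: GH)
  also have "\<dots> = H" by (simp add: matrix_mul_assoc HG)
  finally have "transpose H $ i $ j = H $ i $ j" by simp
  then show ?thesis by (simp add: transpose_def H_def)
qed

text \<open>By Cramer's rule the entries of the inverse matrix are quotients of determinants of the metric.\<close>

lemma inv_smooth: "C_k_on k D (\<lambda>x. matrix_inv (G x) $ i $ j)"
proof -
  have det0: "det (G x) \<noteq> 0" if "x \<in> D" for x
    using invertible_G[OF that] by (simp add: invertible_det_nz)
  have eq: "matrix_inv (G x) $ i $ j =
     det (\<chi> a b. if b = i then axis j 1 $ a else G x $ a $ b) / det (G x)" if x: "x \<in> D" for x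
  proof -
    have "G x *v column j (matrix_inv (G x)) = axis j 1"
      using matrix_inv_G(1)[OF x]
      by (simp add: vec_eq_iff matrix_vector_mult_def column_def matrix_matrix_mult_def mat_def axis_def)
    then have "column j (matrix_inv (G x)) = (\<chi> k. det (\<chi> a b. if b = k then axis j 1 $ a else G x $ a $ b) / det (G x))"
      using cramer[OF det0[OF x]] by blast
    then have "column j (matrix_inv (G x)) $ i = det (\<chi> a b. if b = i then axis j 1 $ a else G x $ a $ b) / det (G x)"
      by simp
    then show ?thesis by (simp add: column_def)
  qed
  have "C_k_on k D (\<lambda>x. det (\<chi> a b. if b = i then axis j 1 $ a else G x $ a $ b) / det (G x))"
  proof (rule C_k_on_divide[OF open_D _ _ det0])
    show "C_k_on k D (\<lambda>x. det (G x))"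
      unfolding det_def by (intro C_k_on_sum C_k_on_cmult C_k_on_prod open_D G_smooth)
    have c: "C_k_on k D (\<lambda>x. if b = i then axis j 1 $ a else G x $ a $ b)" for a b
      by (cases "b = i") (simp_all add: G_smooth)
    show "C_k_on k D (\<lambda>x. det (\<chi> a b. if b = i then axis j 1 $ a else G x $ a $ b))"
      unfolding det_def vec_lambda_beta by (intro C_k_on_sum C_k_on_cmult C_k_on_prod open_D c)
  qed
  then show ?thesis by (rule C_k_on_congI[OF open_D _ eq])
qed

lemma christoffel_smooth: "C_k_on k D (christoffel G m i j)"
proof -
  have "C_k_on k D (partial_d l (\<lambda>x. G x $ i $ j))" for l i j
    using G_smooth[of "Suc k" i j] by simp
  then show ?thesis
    unfolding christoffel_def[abs_def]
    by (intro C_k_on_cmult C_k_on_sum C_k_on_mult C_k_on_add C_k_on_diff open_D inv_smooth)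
qed

lemma differentiable_basic:
  assumes "x \<in> D"
  shows "(\<lambda>x. G x $ i $ j) differentiable (at x)" "(\<lambda>x. matrix_inv (G x) $ i $ j) differentiable (at x)"
    "christoffel G m i j differentiable (at x)"
  using assms C_k_on_differentiable[of 0 D] G_smooth inv_smooth christoffel_smooth by metis+

lemma levi_civita:
  assumes "x \<in> D"
  shows "christoffel G k i j x = christoffel G k j i x"
    "partial_d k (\<lambda>y. G y $ i $ j) x =
        (\<Sum>l\<in>UNIV. christoffel G l k i x * G x $ l $ j + christoffel G l k j x * G x $ i $ l)"
  using christoffel_levi_civita[of D x G "\<lambda>k i j. christoffel G k i j x"] open_D assms invertible_G[OF assms] G_sym
  by blast+

lemma Gam_commute: "x \<in> D \<Longrightarrow> Gam G x v w = Gam G x w v"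
  unfolding Gam_def vec_eq_iff vec_lambda_beta
  by (subst sum.swap) (auto simp: levi_civita(1)[of x _ i j for i j] mult_ac intro!: sum.cong)

lemma dir_bform_const:
  assumes x: "x \<in> D"
  shows "dir e (\<lambda>y. bform (G y) v w) x = bform (G x) (Gam G x e v) w + bform (G x) v (Gam G x e w)"
proof -
  have 1: "bform (G x) (Gam G x e v) w = (\<Sum>i\<in>UNIV. \<Sum>j\<in>UNIV. \<Sum>k\<in>UNIV. \<Sum>l\<in>UNIV. e $ k * (christoffel G l k i x * G x $ l $ j) * v $ i * w $ j)" for v w
  proof -
    have "bform (G x) (Gam G x e v) w = (\<Sum>l\<in>UNIV. \<Sum>j\<in>UNIV. \<Sum>k\<in>UNIV. \<Sum>i\<in>UNIV. e $ k * (christoffel G l k i x * G x $ l $ j) * v $ i * w $ j)"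
      by (simp add: bform_def Gam_def sum_distrib_left sum_distrib_right mult_ac)
    also have "\<dots> = (\<Sum>j\<in>UNIV. \<Sum>l\<in>UNIV. \<Sum>k\<in>UNIV. \<Sum>i\<in>UNIV. e $ k * (christoffel G l k i x * G x $ l $ j) * v $ i * w $ j)"
      by (rule sum.swap)
    also have "\<dots> = (\<Sum>j\<in>UNIV. \<Sum>i\<in>UNIV. \<Sum>k\<in>UNIV. \<Sum>l\<in>UNIV. e $ k * (christoffel G l k i x * G x $ l $ j) * v $ i * w $ j)"
      by (rule sum.cong[OF refl], subst sum.swap, subst (2) sum.swap, rule sum.cong[OF refl], rule sum.swap)
    also have "\<dots> = (\<Sum>i\<in>UNIV. \<Sum>j\<in>UNIV. \<Sum>k\<in>UNIV. \<Sum>l\<in>UNIV. e $ k * (christoffel G l k i x * G x $ l $ j) * v $ i * w $ j)"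
      by (rule sum.swap)
    finally show ?thesis .
  qed
  have 2: "bform (G x) v (Gam G x e w) = (\<Sum>i\<in>UNIV. \<Sum>j\<in>UNIV. \<Sum>k\<in>UNIV. \<Sum>l\<in>UNIV. e $ k * (christoffel G l k j x * G x $ i $ l) * v $ i * w $ j)"
    unfolding bform_G_commute[OF x, of v] 1
    by (subst sum.swap) (simp add: G_sym[OF x] mult_ac)
  have "dir e (\<lambda>y. bform (G y) v w) x = (\<Sum>i\<in>UNIV. \<Sum>j\<in>UNIV. dir e (\<lambda>y. G y $ i $ j * v $ i * w $ j) x)"
    unfolding bform_def
    using differentiable_basic(1)[OF x] by (simp add: dir_sum differentiable_mult differentiable_sum)
  also have "\<dots> = (\<Sum>i\<in>UNIV. \<Sum>j\<in>UNIV. \<Sum>k\<in>UNIV. e $ k * partial_d k (\<lambda>y. G y $ i $ j) x * v $ i * w $ j)"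
    using differentiable_basic(1)[OF x]
    by (simp add: dir_mult differentiable_mult) (simp add: dir_def sum_distrib_right)
  also have "\<dots> = (\<Sum>i\<in>UNIV. \<Sum>j\<in>UNIV. \<Sum>k\<in>UNIV. \<Sum>l\<in>UNIV. e $ k * (christoffel G l k i x * G x $ l $ j) * v $ i * w $ j + e $ k * (christoffel G l k j x * G x $ i $ l) * v $ i * w $ j)"
    by (simp add: levi_civita(2)[OF x] sum_distrib_left sum_distrib_right distrib_left distrib_right mult.assoc)
  also have "\<dots> = bform (G x) (Gam G x e v) w + bform (G x) v (Gam G x e w)"
    unfolding 1 2 by (simp add: sum.distrib)
  finally show ?thesis .
qed

lemma dir_bform:
  assumes x: "x \<in> D" and X: "\<And>k. (\<lambda>y. X y $ k) differentiable (at x)" and Y: "\<And>k. (\<lambda>y. Y y $ k) differentiable (at x)"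
  shows "dir e (\<lambda>y. bform (G y) (X y) (Y y)) x = bform (G x) (nab G e X x) (Y x) + bform (G x) (X x) (nab G e Y x)"
proof -
  note d = differentiable_basic(1)[OF x]
  have exp: "dir e (\<lambda>y. bform (G y) (X y) (Y y)) x = (\<Sum>i\<in>UNIV. \<Sum>j\<in>UNIV. dir e (\<lambda>y. G y $ i $ j * X y $ i * Y y $ j) x)"
    if "\<And>k. (\<lambda>y. X y $ k) differentiable (at x)" "\<And>k. (\<lambda>y. Y y $ k) differentiable (at x)" for X Y :: "real^'n \<Rightarrow> real^'n"
    unfolding bform_def
    using d that by (simp add: dir_sum differentiable_mult differentiable_sum)
  have "dir e (\<lambda>y. bform (G y) (X y) (Y y)) x = (\<Sum>i\<in>UNIV. \<Sum>j\<in>UNIV. dir e (\<lambda>y. G y $ i $ j) x * X x $ i * Y x $ j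
      + G x $ i $ j * vdir e X x $ i * Y x $ j + G x $ i $ j * X x $ i * vdir e Y x $ j)"
    unfolding exp[OF X Y] using d X Y
    by (simp add: dir_mult differentiable_mult vdir_def algebra_simps)
  also have "\<dots> = dir e (\<lambda>y. bform (G y) (X x) (Y x)) x + bform (G x) (vdir e X x) (Y x) + bform (G x) (X x) (vdir e Y x)"
    using d exp[of "\<lambda>y. X x" "\<lambda>y. Y x"] by (simp add: dir_mult differentiable_mult sum.distrib bform_def)
  finally show ?thesis by (simp add: dir_bform_const[OF x] nab_def)
qed

lemma Gam_differentiable: "x \<in> D \<Longrightarrow> (\<lambda>y. Gam G y v w $ k) differentiable (at x)"
  unfolding Gam_def vec_lambda_beta
  by (intro differentiable_sum ballI differentiable_mult differentiable_basic differentiable_const finite)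

lemma Gam_smooth: "C_k_on k D (\<lambda>y. Gam G y v w $ m)"
  unfolding Gam_def vec_lambda_beta
  by (intro C_k_on_sum C_k_on_mult christoffel_smooth open_D C_k_on_const)

lemma Gam_smooth':
  "(\<And>m. C_k_on k D (\<lambda>y. X y $ m)) \<Longrightarrow> (\<And>m. C_k_on k D (\<lambda>y. Y y $ m)) \<Longrightarrow> C_k_on k D (\<lambda>y. Gam G y (X y) (Y y) $ m)"
  unfolding Gam_def vec_lambda_beta
  by (intro C_k_on_sum C_k_on_mult christoffel_smooth open_D)

lemma vdir_Gam:
  assumes x: "x \<in> D" and X: "\<And>k. (\<lambda>y. X y $ k) differentiable (at x)" and Y: "\<And>k. (\<lambda>y. Y y $ k) differentiable (at x)"
  shows "vdir e (\<lambda>y. Gam G y (X y) (Y y)) x = DGam G x e (X x) (Y x) + Gam G x (vdir e X x) (Y x) + Gam G x (X x) (vdir e Y x)"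
proof -
  note d = differentiable_basic(3)[OF x]
  have exp: "dir e (\<lambda>y. Gam G y (X y) (Y y) $ k) x = (\<Sum>i\<in>UNIV. \<Sum>j\<in>UNIV. dir e (\<lambda>y. christoffel G k i j y * X y $ i * Y y $ j) x)"
    if "\<And>k. (\<lambda>y. X y $ k) differentiable (at x)" "\<And>k. (\<lambda>y. Y y $ k) differentiable (at x)" for X Y :: "real^'n \<Rightarrow> real^'n" and k
    unfolding Gam_def vec_lambda_beta
    using d that by (simp add: dir_sum differentiable_mult differentiable_sum)
  have "dir e (\<lambda>y. Gam G y (X y) (Y y) $ k) x = (DGam G x e (X x) (Y x) + Gam G x (vdir e X x) (Y x) + Gam G x (X x) (vdir e Y x)) $ k" for k
  proof -
    have "dir e (\<lambda>y. Gam G y (X y) (Y y) $ k) x = (\<Sum>i\<in>UNIV. \<Sum>j\<in>UNIV. dir e (christoffel G k i j) x * X x $ i * Y x $ j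
      + christoffel G k i j x * vdir e X x $ i * Y x $ j + christoffel G k i j x * X x $ i * vdir e Y x $ j)"
      unfolding exp[OF X Y] using d X Y
      by (simp add: dir_mult differentiable_mult vdir_def algebra_simps)
    also have "\<dots> = dir e (\<lambda>y. Gam G y (X x) (Y x) $ k) x + Gam G x (vdir e X x) (Y x) $ k + Gam G x (X x) (vdir e Y x) $ k"
      using d exp[of "\<lambda>y. X x" "\<lambda>y. Y x"] by (simp add: dir_mult differentiable_mult sum.distrib Gam_def)
    finally show ?thesis by (simp add: DGam_def vdir_def)
  qed
  then show ?thesis by (simp add: vec_eq_iff vdir_def)
qed

text \<open>Since second derivatives of the metric on a constant vector commute, expressing them by the connection shows that curvature is skew in its
last two arguments (\<open>Riem_skew_diag\<close>).\<close>

lemma dir_dir_bform: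
  assumes x: "x \<in> D"
  shows "dir e (dir v (\<lambda>y. bform (G y) Z Z)) x =
    2 * (bform (G x) (Gam G x e (Gam G x v Z)) Z + bform (G x) (Gam G x v Z) (Gam G x e Z) + bform (G x) (DGam G x e v Z) Z)"
proof -
  have "dir e (dir v (\<lambda>y. bform (G y) Z Z)) x = dir e (\<lambda>y. 2 * bform (G y) (Gam G y v Z) Z) x"
    by (rule dir_cong[OF open_D x]) (simp add: dir_bform_const bform_G_commute[of _ Z])
  also have "\<dots> = 2 * dir e (\<lambda>y. bform (G y) (Gam G y v Z) Z) x"
  proof (rule dir_cmult)
    show "(\<lambda>y. bform (G y) (Gam G y v Z) Z) differentiable (at x)"
      unfolding bform_def using differentiable_basic(1)[OF x] Gam_differentiable[OF x]
      by (intro differentiable_sum differentiable_mult) auto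
  qed
  also have "dir e (\<lambda>y. bform (G y) (Gam G y v Z) Z) x = bform (G x) (nab G e (\<lambda>y. Gam G y v Z) x) Z + bform (G x) (Gam G x v Z) (nab G e (\<lambda>y. Z) x)"
    by (rule dir_bform[OF x]) (auto intro: Gam_differentiable[OF x])
  finally show ?thesis by (simp add: nab_def DGam_def algebra_simps)
qed

lemma bform_G_smooth:
  "(\<And>m. C_k_on k D (\<lambda>y. X y $ m)) \<Longrightarrow> (\<And>m. C_k_on k D (\<lambda>y. Y y $ m)) \<Longrightarrow> C_k_on k D (\<lambda>y. bform (G y) (X y) (Y y))"
  unfolding bform_def by (intro C_k_on_sum C_k_on_mult G_smooth open_D)

lemma Riem_skew_diag: "x \<in> D \<Longrightarrow> bform (G x) (Riem G x X Y Z) Z = 0"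
  using dir_commute[OF open_D, of x "\<lambda>y. bform (G y) Z Z" X Y] bform_G_smooth[of 2 "\<lambda>y. Z" "\<lambda>y. Z"]
  by (simp add: dir_dir_bform Riem_def bform_G_commute)

lemma DGam_add [simp]: "x \<in> D \<Longrightarrow> DGam G x e v (a + b) = DGam G x e v a + DGam G x e v b"
  unfolding DGam_def Gam_add by (rule vdir_add) (rule Gam_differentiable, assumption)+

lemma Riem_skew:
  assumes x: "x \<in> D" shows "bform (G x) (Riem G x X Y Z) W = - bform (G x) (Riem G x X Y W) Z"
proof -
  have "Riem G x X Y (Z + W) = Riem G x X Y Z + Riem G x X Y W"
    using x by (simp add: Riem_def algebra_simps)
  then show ?thesis
    using Riem_skew_diag[OF x, of X Y "Z + W"] Riem_skew_diag[OF x, of X Y Z] Riem_skew_diag[OF x, of X Y W] by simp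
qed

end

section \<open>Bilinear traces\<close>

lemma bilinear_expand:
  fixes T :: "real^'n::finite \<Rightarrow> real^'n \<Rightarrow> real"
  assumes "bilinear T"
  shows "T v w = (\<Sum>k\<in>UNIV. \<Sum>l\<in>UNIV. v $ k * w $ l * T (axis k 1) (axis l 1))"
proof -
  have l1: "linear (\<lambda>x. T x y)" and l2: "linear (T y)" for y using assms by (auto simp: bilinear_def)
  have "T v w = T (\<Sum>k\<in>UNIV. v $ k *\<^sub>R axis k 1) (\<Sum>l\<in>UNIV. w $ l *\<^sub>R axis l 1)"
    using basis_expansion[of v] basis_expansion[of w] by (simp add: scalar_mult_eq_scaleR)
  also have "\<dots> = (\<Sum>k\<in>UNIV. \<Sum>l\<in>UNIV. v $ k * w $ l * T (axis k 1) (axis l 1))"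
    by (simp add: linear_sum[OF l1] linear_sum[OF l2] linear_cmul[OF l1] linear_cmul[OF l2] sum_distrib_left mult_ac)
      (rule sum.swap)
  finally show ?thesis .
qed

lemma bilinearI':
  fixes T :: "real^'n::finite \<Rightarrow> real^'n \<Rightarrow> real"
  assumes "\<And>a b w. T (a + b) w = T a w + T b w" "\<And>c a w. T (c *\<^sub>R a) w = c * T a w"
    "\<And>a b w. T w (a + b) = T w a + T w b" "\<And>c a w. T w (c *\<^sub>R a) = c * T w a"
  shows "bilinear T"
  using assms by (auto simp: bilinear_def intro!: linearI)

lemma onb_sum_bilinear:
  assumes "onb G x V" "bilinear T"
  shows "(\<Sum>a\<in>UNIV. T (V a) (V a)) = (\<Sum>k\<in>UNIV. \<Sum>l\<in>UNIV. matrix_inv (G x) $ k $ l * T (axis k 1) (axis l 1))"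
proof -
  have "(\<Sum>a\<in>UNIV. T (V a) (V a)) = (\<Sum>a\<in>UNIV. \<Sum>k\<in>UNIV. \<Sum>l\<in>UNIV. V a $ k * V a $ l * T (axis k 1) (axis l 1))"
    by (rule sum.cong[OF refl]) (rule bilinear_expand[OF assms(2)])
  also have "\<dots> = (\<Sum>k\<in>UNIV. \<Sum>l\<in>UNIV. \<Sum>a\<in>UNIV. V a $ k * V a $ l * T (axis k 1) (axis l 1))"
    by (subst sum.swap, rule sum.cong[OF refl], rule sum.swap)
  also have "\<dots> = (\<Sum>k\<in>UNIV. \<Sum>l\<in>UNIV. matrix_inv (G x) $ k $ l * T (axis k 1) (axis l 1))"
    using assms(1) by (simp add: onb_def flip: sum_distrib_right)
  finally show ?thesis .
qed

lemma dir_dir_expand: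
  assumes "open S" "x \<in> S" "C_k_on 2 S u"
  shows "dir v (dir w u) x = (\<Sum>k\<in>UNIV. \<Sum>l\<in>UNIV. v $ k * w $ l * partial_d k (partial_d l u) x)"
proof -
  have d: "partial_d m u differentiable (at x)" for m
    using assms by (simp add: numeral_2_eq_2)
  have "dir v (dir w u) x = (\<Sum>l\<in>UNIV. w $ l * dir v (partial_d l u) x)"
    unfolding dir_def[of w u, abs_def] using d by (subst dir_sum) (auto simp: dir_cmult)
  also have "\<dots> = (\<Sum>l\<in>UNIV. \<Sum>k\<in>UNIV. v $ k * w $ l * partial_d k (partial_d l u) x)"
    by (simp add: dir_def sum_distrib_left mult_ac)
  finally show ?thesis by (subst sum.swap) simp
qed

context coord_metric
begin

lemma DGam_expand:
  assumes x: "x \<in> D"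
  shows "DGam G x e v w $ k = (\<Sum>m\<in>UNIV. \<Sum>i\<in>UNIV. \<Sum>j\<in>UNIV. e $ m * v $ i * w $ j * partial_d m (christoffel G k i j) x)"
proof -
  have "DGam G x e v w $ k = (\<Sum>i\<in>UNIV. \<Sum>j\<in>UNIV. dir e (\<lambda>y. christoffel G k i j y * v $ i * w $ j) x)"
    unfolding DGam_def vdir_def Gam_def vec_lambda_beta
    using differentiable_basic(3)[OF x] by (simp add: dir_sum differentiable_mult differentiable_sum)
  also have "\<dots> = (\<Sum>i\<in>UNIV. \<Sum>j\<in>UNIV. \<Sum>m\<in>UNIV. e $ m * v $ i * w $ j * partial_d m (christoffel G k i j) x)"
    using differentiable_basic(3)[OF x]
    by (simp add: dir_mult differentiable_mult) (simp add: dir_def sum_distrib_left mult_ac)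
  also have "\<dots> = (\<Sum>i\<in>UNIV. \<Sum>m\<in>UNIV. \<Sum>j\<in>UNIV. e $ m * v $ i * w $ j * partial_d m (christoffel G k i j) x)"
    by (rule sum.cong[OF refl], rule sum.swap)
  finally show ?thesis by (subst sum.swap) simp
qed

lemma DGam_linear:
  assumes "x \<in> D"
  shows "DGam G x (a + b) v w = DGam G x a v w + DGam G x b v w"
    "DGam G x (c *\<^sub>R a) v w = c *\<^sub>R DGam G x a v w"
    "DGam G x v (a + b) w = DGam G x v a w + DGam G x v b w"
    "DGam G x v (c *\<^sub>R a) w = c *\<^sub>R DGam G x v a w"
    "DGam G x v w (a + b) = DGam G x v w a + DGam G x v w b"
    "DGam G x v w (c *\<^sub>R a) = c *\<^sub>R DGam G x v w a"
  by (simp_all add: vec_eq_iff DGam_expand[OF assms] sum.distrib sum_distrib_left algebra_simps)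

lemma DGam_commute:
  assumes x: "x \<in> D" shows "DGam G x e v w = DGam G x e w v"
  unfolding DGam_def by (rule vdir_cong[OF open_D x]) (rule Gam_commute)

lemma Riem_linear_first:
  assumes "x \<in> D"
  shows "Riem G x (a + b) v w = Riem G x a v w + Riem G x b v w"
    "Riem G x (c *\<^sub>R a) v w = c *\<^sub>R Riem G x a v w"
  by (simp_all add: Riem_def DGam_linear[OF assms] algebra_simps)

lemma bform_axis_left: "bform A (axis i 1) w = (\<Sum>j\<in>UNIV. A $ i $ j * w $ j)"
proof -
  have "bform A (axis i 1) w = (\<Sum>k\<in>UNIV. axis i 1 $ k * (\<Sum>j\<in>UNIV. A $ k $ j * w $ j))"
    unfolding bform_def sum_distrib_left by (simp only: mult_ac)
  then show ?thesis by (simp only: sum_axis)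
qed

lemma onb_trace:
  assumes x: "x \<in> D" and V: "onb G x V"
    and L: "\<And>a b. L (a + b) = L a + L b" "\<And>c a. L (c *\<^sub>R a) = c *\<^sub>R L a"
  shows "(\<Sum>a\<in>UNIV. bform (G x) (V a) (L (V a))) = (\<Sum>i\<in>UNIV. L (axis i 1) $ i)"
proof -
  have "(\<Sum>a\<in>UNIV. bform (G x) (V a) (L (V a)))
     = (\<Sum>l\<in>UNIV. \<Sum>k\<in>UNIV. matrix_inv (G x) $ l $ k * bform (G x) (axis k 1) (L (axis l 1)))"
    by (subst onb_sum_bilinear[OF V], rule bilinearI')
      (simp_all add: L, subst sum.swap, simp add: inv_sym[OF x])
  also have "\<dots> = (\<Sum>l\<in>UNIV. \<Sum>j\<in>UNIV. (\<Sum>k\<in>UNIV. matrix_inv (G x) $ l $ k * G x $ k $ j) * L (axis l 1) $ j)"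
    unfolding bform_axis_left sum_distrib_left sum_distrib_right
    by (rule sum.cong[OF refl], subst sum.swap) (simp add: mult_ac)
  also have "\<dots> = (\<Sum>l\<in>UNIV. L (axis l 1) $ l)"
    by (simp add: G_inv_sum[OF x] if_distrib[of "\<lambda>x. x * _"] cong: if_cong)
  finally show ?thesis .
qed

lemma onb_Ric:
  assumes x: "x \<in> D" and V: "onb G x V"
  shows "(\<Sum>a\<in>UNIV. bform (G x) (V a) (Riem G x (V a) v w)) = Ric G x v w"
  unfolding Ric_def by (rule onb_trace[OF x V]) (simp_all add: Riem_linear_first[OF x])

lemma onb_orthonormal:
  assumes x: "x \<in> D" and V: "onb G x V"
  shows "bform (G x) (V a) (V b) = (if a = b then 1 else 0)"
proof -
  define P where "P = (\<chi> i a. V a $ i)"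
  have "P ** transpose P = matrix_inv (G x)"
    using V by (simp add: onb_def P_def vec_eq_iff matrix_matrix_mult_def transpose_def)
  then have "P ** (transpose P ** G x) = mat 1"
    by (simp add: matrix_mul_assoc matrix_inv_G[OF x])
  then have "(transpose P ** G x) ** P = mat 1" by (simp add: matrix_left_right_inverse)
  then have "(transpose P ** (G x ** P)) $ a $ b = (if a = b then 1 else 0)"
    by (simp add: matrix_mul_assoc mat_def)
  then show ?thesis
    by (simp add: bform_def P_def matrix_matrix_mult_def transpose_def sum_distrib_left mult_ac)
qed

lemma bform_nonneg: "x \<in> D \<Longrightarrow> bform (G x) v v \<ge> 0"
  using G_pos[of x v] by (cases "v = 0") auto

lemma bform_Cauchy_Schwarz:
  assumes x: "x \<in> D"
  shows "(bform (G x) v w)\<^sup>2 \<le> bform (G x) v v * bform (G x) w w"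
proof (cases "w = 0")
  case False
  define q where "q = bform (G x) w w"
  have q: "q > 0" using G_pos[OF x False] by (simp add: q_def)
  define t where "t = bform (G x) v w / q"
  have "0 \<le> bform (G x) (v - t *\<^sub>R w) (v - t *\<^sub>R w)" by (rule bform_nonneg[OF x])
  also have "\<dots> = bform (G x) v v - 2 * t * bform (G x) v w + t * t * q"
    using bform_G_commute[OF x, of w v] by (simp add: q_def algebra_simps)
  also have "\<dots> = bform (G x) v v - (bform (G x) v w)\<^sup>2 / q"
    using q by (simp add: t_def power2_eq_square field_simps)
  finally show ?thesis using q by (simp add: q_def[symmetric] field_simps)
qed simp

section \<open>Gradients, Hessians and derivatives of traces\<close>

definition sharp :: "real^'n \<Rightarrow> real^'n \<Rightarrow> real^'n" where
  "sharp x p = (\<chi> k. \<Sum>l\<in>UNIV. matrix_inv (G x) $ k $ l * p $ l)"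

lemma bform_sharp:
  assumes x: "x \<in> D" shows "bform (G x) (sharp x p) v = p \<bullet> v" "bform (G x) v (sharp x p) = p \<bullet> v"
proof -
  have "bform (G x) v (sharp x p) = (\<Sum>i\<in>UNIV. v $ i * (\<Sum>l\<in>UNIV. (\<Sum>j\<in>UNIV. G x $ i $ j * matrix_inv (G x) $ j $ l) * p $ l))"
    unfolding bform_def sharp_def vec_lambda_beta sum_distrib_left sum_distrib_right
    by (rule sum.cong[OF refl], subst sum.swap) (simp add: mult_ac)
  also have "\<dots> = p \<bullet> v"
    by (simp add: G_inv_sum[OF x] if_distrib[of "\<lambda>x. x * _"] inner_vec_def mult.commute[of "v $ _"] cong: if_cong)
  finally show "bform (G x) v (sharp x p) = p \<bullet> v" .
  then show "bform (G x) (sharp x p) v = p \<bullet> v" using bform_G_commute[OF x] by simp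
qed

lemma sharp_smooth: "C_k_on k D (\<lambda>y. sharp y p $ m)"
  unfolding sharp_def vec_lambda_beta by (intro C_k_on_sum C_k_on_mult inv_smooth open_D C_k_on_const)

lemma sharp_onb:
  assumes "onb G x V" shows "sharp x p = (\<Sum>a\<in>UNIV. (p \<bullet> V a) *\<^sub>R V a)"
proof -
  have "(\<Sum>a\<in>UNIV. (p \<bullet> V a) *\<^sub>R V a) $ k = sharp x p $ k" for k
  proof -
    have "(\<Sum>a\<in>UNIV. (p \<bullet> V a) *\<^sub>R V a) $ k = (\<Sum>a\<in>UNIV. \<Sum>l\<in>UNIV. (V a $ k * V a $ l) * p $ l)"
      by (simp add: inner_vec_def sum_distrib_left mult_ac)
    also have "\<dots> = sharp x p $ k"
      using assms by (subst sum.swap) (simp add: sharp_def onb_def flip: sum_distrib_right)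
    finally show ?thesis .
  qed
  then show ?thesis by (simp add: vec_eq_iff)
qed

text \<open>The inverse metric is parallel: differentiate \<open>sharp\<close>, which inverts the metric.\<close>

lemma dir_inv:
  assumes x: "x \<in> D" and V: "onb G x V"
  shows "dir e (\<lambda>y. matrix_inv (G y) $ k $ l) x
     = - (\<Sum>a\<in>UNIV. Gam G x e (V a) $ k * V a $ l + V a $ k * Gam G x e (V a) $ l)"
proof -
  have d: "(\<lambda>y. sharp y p $ m) differentiable (at x)" for p m
    using sharp_smooth[of 1] x by simp
  have key: "q \<bullet> vdir e (\<lambda>y. sharp y p) x = - (q \<bullet> Gam G x e (sharp x p)) - p \<bullet> Gam G x e (sharp x q)" for p q
  proof -
    have "0 = dir e (\<lambda>y. bform (G y) (sharp y p) (sharp x q)) x"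
      by (subst dir_cong[OF open_D x bform_sharp(1)]) auto
    also have "\<dots> = bform (G x) (nab G e (\<lambda>y. sharp y p) x) (sharp x q) + bform (G x) (sharp x p) (nab G e (\<lambda>y. sharp x q) x)"
      by (rule dir_bform[OF x]) (auto intro: d)
    also have "\<dots> = q \<bullet> vdir e (\<lambda>y. sharp y p) x + q \<bullet> Gam G x e (sharp x p) + p \<bullet> Gam G x e (sharp x q)"
      by (simp add: bform_sharp[OF x] nab_def inner_add_right)
    finally show ?thesis by simp
  qed
  have sh: "sharp y (axis l 1) $ k = matrix_inv (G y) $ k $ l" for y k l
    using sum_axis[of l "\<lambda>j. matrix_inv (G y) $ k $ j"] by (simp add: sharp_def mult.commute)
  have gs: "Gam G x e (sharp x (axis l 1)) = (\<Sum>a\<in>UNIV. V a $ l *\<^sub>R Gam G x e (V a))" for l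
  proof -
    have "linear (Gam G x e)" by (rule linearI) auto
    then show ?thesis unfolding sharp_onb[OF V] by (simp add: linear_sum linear_cmul inner_axis')
  qed
  have "dir e (\<lambda>y. matrix_inv (G y) $ k $ l) x = axis k 1 \<bullet> vdir e (\<lambda>y. sharp y (axis l 1)) x"
    by (simp add: inner_axis' vdir_def sh)
  also have "\<dots> = - (\<Sum>a\<in>UNIV. Gam G x e (V a) $ k * V a $ l + V a $ k * Gam G x e (V a) $ l)"
    unfolding key gs by (simp add: inner_axis' sum.distrib mult_ac)
  finally show ?thesis .
qed

text \<open>Metric traces commute with covariant differentiation, here for a family of bilinear forms whose values on constant
vectors are differentiated.\<close>

lemma dir_trace:
  assumes x: "x \<in> D" and V: "onb G x V" and T: "\<And>y. y \<in> D \<Longrightarrow> bilinear (T y)"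
    and d: "\<And>v w. (\<lambda>y. T y v w) differentiable (at x)"
    and T': "bilinear (\<lambda>v w. dir e (\<lambda>y. T y v w) x)"
  shows "dir e (\<lambda>y. \<Sum>k\<in>UNIV. \<Sum>l\<in>UNIV. matrix_inv (G y) $ k $ l * T y (axis k 1) (axis l 1)) x
    = (\<Sum>a\<in>UNIV. dir e (\<lambda>y. T y (V a) (V a)) x - T x (Gam G x e (V a)) (V a) - T x (V a) (Gam G x e (V a)))"
proof -
  have "dir e (\<lambda>y. \<Sum>k\<in>UNIV. \<Sum>l\<in>UNIV. matrix_inv (G y) $ k $ l * T y (axis k 1) (axis l 1)) x
     = (\<Sum>k\<in>UNIV. \<Sum>l\<in>UNIV. dir e (\<lambda>y. matrix_inv (G y) $ k $ l) x * T x (axis k 1) (axis l 1)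
         + matrix_inv (G x) $ k $ l * dir e (\<lambda>y. T y (axis k 1) (axis l 1)) x)"
    using differentiable_basic(2)[OF x] d
    by (simp add: dir_sum differentiable_mult differentiable_sum dir_mult)
  also have "\<dots> = (\<Sum>k\<in>UNIV. \<Sum>l\<in>UNIV. dir e (\<lambda>y. matrix_inv (G y) $ k $ l) x * T x (axis k 1) (axis l 1))
      + (\<Sum>a\<in>UNIV. dir e (\<lambda>y. T y (V a) (V a)) x)"
    by (simp add: sum.distrib onb_sum_bilinear[OF V T'])
  also have "(\<Sum>k\<in>UNIV. \<Sum>l\<in>UNIV. dir e (\<lambda>y. matrix_inv (G y) $ k $ l) x * T x (axis k 1) (axis l 1))
     = - (\<Sum>a\<in>UNIV. T x (Gam G x e (V a)) (V a) + T x (V a) (Gam G x e (V a)))"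
  proof -
    have "(\<Sum>k\<in>UNIV. \<Sum>l\<in>UNIV. dir e (\<lambda>y. matrix_inv (G y) $ k $ l) x * T x (axis k 1) (axis l 1))
      = - (\<Sum>k\<in>UNIV. \<Sum>l\<in>UNIV. \<Sum>a\<in>UNIV. Gam G x e (V a) $ k * V a $ l * T x (axis k 1) (axis l 1)
           + V a $ k * Gam G x e (V a) $ l * T x (axis k 1) (axis l 1))"
      unfolding dir_inv[OF x V] by (simp add: sum_distrib_right distrib_right left_diff_distrib flip: sum_negf)
    also have "\<dots> = - (\<Sum>k\<in>UNIV. \<Sum>a\<in>UNIV. \<Sum>l\<in>UNIV. Gam G x e (V a) $ k * V a $ l * T x (axis k 1) (axis l 1)
           + V a $ k * Gam G x e (V a) $ l * T x (axis k 1) (axis l 1))"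
      by (rule arg_cong[of _ _ uminus], rule sum.cong[OF refl], rule sum.swap)
    also have "\<dots> = - (\<Sum>a\<in>UNIV. \<Sum>k\<in>UNIV. \<Sum>l\<in>UNIV. Gam G x e (V a) $ k * V a $ l * T x (axis k 1) (axis l 1)
           + V a $ k * Gam G x e (V a) $ l * T x (axis k 1) (axis l 1))"
      by (rule arg_cong[of _ _ uminus], rule sum.swap)
    also have "\<dots> = - (\<Sum>a\<in>UNIV. T x (Gam G x e (V a)) (V a) + T x (V a) (Gam G x e (V a)))"
      unfolding bilinear_expand[OF T[OF x], of "Gam G x e (V a)" "V a" for a] bilinear_expand[OF T[OF x], of "V a" "Gam G x e (V a)" for a]
      by (simp add: sum.distrib)
    finally show ?thesis .
  qed
  finally show ?thesis by (simp add: sum.distrib sum_subtractf algebra_simps)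
qed

end

section \<open>Bochner formula and coupling identity for a steady soliton in coordinates\<close>

locale coord_function = coord_metric D G for D :: "(real^'n::finite) set" and G :: "real^'n \<Rightarrow> real^'n^'n" +
  fixes u :: "real^'n \<Rightarrow> real"
  assumes u_smooth: "C_k_on k D u"
begin

abbreviation X :: "real^'n \<Rightarrow> real^'n" where "X \<equiv> grad G u"

lemma grad_sharp: "X x = sharp x (\<chi> l. partial_d l u x)"
  by (simp add: grad_def sharp_def)

lemma bform_grad:
  assumes "x \<in> D" shows "bform (G x) (X x) v = dir v u x" "bform (G x) v (X x) = dir v u x"
  by (simp_all add: grad_sharp bform_sharp[OF assms] dir_def inner_vec_def mult.commute)

lemma grad_smooth: "C_k_on k D (\<lambda>y. X y $ m)"
  unfolding grad_def vec_lambda_beta using u_smooth[of "Suc k"]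
  by (intro C_k_on_sum C_k_on_mult inv_smooth open_D) simp

lemma vdir_smooth: "(\<And>m. C_k_on (Suc k) D (\<lambda>y. Y y $ m)) \<Longrightarrow> C_k_on k D (\<lambda>y. vdir e Y y $ m)"
  unfolding vdir_def vec_lambda_beta by (rule C_k_on_dir[OF open_D])

lemma nab_smooth: "(\<And>m k. C_k_on k D (\<lambda>y. Y y $ m)) \<Longrightarrow> C_k_on k D (\<lambda>y. nab G e Y y $ m)"
  unfolding nab_def vector_add_component
  by (intro C_k_on_add open_D vdir_smooth Gam_smooth' C_k_on_const)

lemma smooth_differentiable: "x \<in> D \<Longrightarrow> C_k_on 1 D \<phi> \<Longrightarrow> \<phi> differentiable (at x)"
  by simp

lemmas grad_differentiable = smooth_differentiable[OF _ grad_smooth]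
lemmas nab_differentiable = smooth_differentiable[OF _ nab_smooth[OF grad_smooth]]

lemma nab_linear [simp]: "nab G (a + b) Y y = nab G a Y y + nab G b Y y" "nab G (c *\<^sub>R a) Y y = c *\<^sub>R nab G a Y y"
  by (simp_all add: nab_def algebra_simps)

lemma Hess_nab:
  assumes x: "x \<in> D" shows "Hess G u x v w = bform (G x) (nab G v X x) w"
proof -
  have "dir v (dir w u) x = dir v (\<lambda>y. bform (G y) (X y) w) x"
    by (rule dir_cong[OF open_D x]) (simp add: bform_grad)
  also have "\<dots> = bform (G x) (nab G v X x) w + bform (G x) (X x) (Gam G x v w)"
    by (subst dir_bform[OF x]) (auto simp: nab_def intro: grad_differentiable[OF x])
  finally show ?thesis by (simp add: Hess_def bform_grad[OF x])
qed

lemma Hess_bilinear: "x \<in> D \<Longrightarrow> bilinear (Hess G u x)"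
  by (rule bilinearI') (simp_all add: Hess_nab)

lemma Hess_sym: "x \<in> D \<Longrightarrow> Hess G u x v w = Hess G u x w v"
  unfolding Hess_def using dir_commute[OF open_D _ u_smooth] Gam_commute by metis

lemma nab_sym: "x \<in> D \<Longrightarrow> bform (G x) (nab G v X x) w = bform (G x) (nab G w X x) v"
  using Hess_nab Hess_sym by metis

text \<open>The second covariant derivative of the gradient field; the second term makes it tensorial in both arguments.\<close>

definition nab2 :: "real^'n \<Rightarrow> real^'n \<Rightarrow> real^'n \<Rightarrow> real^'n" where
  "nab2 e v x = nab G e (nab G v X) x - nab G (Gam G x e v) X x"

lemma dir_Hess:
  assumes x: "x \<in> D"
  shows "dir e (\<lambda>y. Hess G u y v w) x = bform (G x) (nab G e (nab G v X) x) w + bform (G x) (nab G v X x) (Gam G x e w)"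
proof -
  have "dir e (\<lambda>y. Hess G u y v w) x = dir e (\<lambda>y. bform (G y) (nab G v X y) w) x"
    by (rule dir_cong[OF open_D x]) (simp add: Hess_nab)
  also have "\<dots> = bform (G x) (nab G e (nab G v X) x) w + bform (G x) (nab G v X x) (Gam G x e w)"
    using nab_differentiable[OF x] by (subst dir_bform[OF x]) (auto simp: nab_def[of G e "\<lambda>y. w"])
  finally show ?thesis .
qed

text \<open>The Hessian is symmetric, hence so is its covariant derivative.\<close>

lemma nab2_sym: assumes x: "x \<in> D" shows "bform (G x) (nab2 e v x) w = bform (G x) (nab2 e w x) v"
proof -
  have "dir e (\<lambda>y. Hess G u y v w) x = dir e (\<lambda>y. Hess G u y w v) x"
    by (rule dir_cong[OF open_D x]) (rule Hess_sym)
  then show ?thesis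
    unfolding dir_Hess[OF x] using nab_sym[OF x, of v "Gam G x e w"] nab_sym[OF x, of w "Gam G x e v"]
    by (simp add: nab2_def)
qed

lemma Ricci_identity:
  assumes x: "x \<in> D" shows "nab2 e v x - nab2 v e x = Riem G x e v (X x)"
proof -
  have *: "nab G e (nab G v X) x = vdir e (vdir v X) x + DGam G x e v (X x) + Gam G x v (vdir e X x)
     + Gam G x e (vdir v X x) + Gam G x e (Gam G x v (X x))" for e v
  proof -
    have "vdir e (nab G v X) x = vdir e (\<lambda>y. vdir v X y + Gam G y v (X y)) x"
      by (simp add: nab_def[abs_def])
    also have "\<dots> = vdir e (vdir v X) x + vdir e (\<lambda>y. Gam G y v (X y)) x"
      by (rule vdir_add)
        (rule smooth_differentiable[OF x], intro vdir_smooth grad_smooth Gam_smooth' C_k_on_const)+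
    also have "vdir e (\<lambda>y. Gam G y v (X y)) x = DGam G x e v (X x) + Gam G x v (vdir e X x)"
      by (subst vdir_Gam[OF x]) (auto intro: grad_differentiable[OF x])
    finally show ?thesis by (simp add: nab_def[of G e] nab_def[of G v X x])
  qed
  show ?thesis
    unfolding nab2_def * using vdir_commute[OF open_D x grad_smooth, of e v] Gam_commute[OF x, of e v]
    by (simp add: Riem_def)
qed

lemma nab_nab_linear:
  assumes x: "x \<in> D"
  shows "nab G e (nab G (a + b) X) x = nab G e (nab G a X) x + nab G e (nab G b X) x"
    "nab G e (nab G (c *\<^sub>R a) X) x = c *\<^sub>R nab G e (nab G a X) x"
proof -
  have "nab G (a + b) X = (\<lambda>y. nab G a X y + nab G b X y)" by (rule ext) simp
  moreover have "vdir e (\<lambda>y. nab G a X y + nab G b X y) x = vdir e (nab G a X) x + vdir e (nab G b X) x"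
    by (rule vdir_add) (rule nab_differentiable[OF x])+
  ultimately show "nab G e (nab G (a + b) X) x = nab G e (nab G a X) x + nab G e (nab G b X) x"
    by (simp add: nab_def[of G e])
  have "nab G (c *\<^sub>R a) X = (\<lambda>y. c *\<^sub>R nab G a X y)" by (rule ext) simp
  moreover have "vdir e (\<lambda>y. c *\<^sub>R nab G a X y) x = c *\<^sub>R vdir e (nab G a X) x"
    using dir_cmult[OF nab_differentiable[OF x]] by (simp add: vdir_def vec_eq_iff)
  ultimately show "nab G e (nab G (c *\<^sub>R a) X) x = c *\<^sub>R nab G e (nab G a X) x"
    by (simp add: nab_def[of G e] algebra_simps)
qed

lemma Lap_onb: "x \<in> D \<Longrightarrow> onb G x V \<Longrightarrow> Lap G u x = (\<Sum>a\<in>UNIV. Hess G u x (V a) (V a))"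
  unfolding Lap_def by (subst onb_sum_bilinear) (auto intro: Hess_bilinear)

text \<open>Covariant differentiation commutes with metric traces, by \<open>dir_trace\<close>.\<close>

lemma trace_nab2:
  assumes x: "x \<in> D" and V: "onb G x V"
  shows "(\<Sum>a\<in>UNIV. bform (G x) (nab2 e (V a) x) (V a)) = dir e (Lap G u) x"
proof -
  have sm: "C_k_on 1 D (\<lambda>y. Hess G u y v w)" for v w
  proof (rule C_k_on_congI[OF open_D])
    show "C_k_on 1 D (\<lambda>y. bform (G y) (nab G v X y) w)"
      by (rule bform_G_smooth) (auto intro: nab_smooth grad_smooth simp del: C_k_on.simps One_nat_def)
  qed (rule Hess_nab)
  have "dir e (Lap G u) x = (\<Sum>a\<in>UNIV. dir e (\<lambda>y. Hess G u y (V a) (V a)) x - Hess G u x (Gam G x e (V a)) (V a)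
      - Hess G u x (V a) (Gam G x e (V a)))"
    unfolding Lap_def[abs_def]
  proof (rule dir_trace[OF x V Hess_bilinear])
    show "bilinear (\<lambda>v w. dir e (\<lambda>y. Hess G u y v w) x)"
      unfolding dir_Hess[OF x] by (rule bilinearI') (simp_all add: nab_nab_linear[OF x] algebra_simps)
  qed (use smooth_differentiable[OF x sm] in auto)
  then show ?thesis
    by (simp add: dir_Hess[OF x] Hess_nab[OF x] nab2_def sum_subtractf sum.distrib)
qed

definition energy :: "real^'n \<Rightarrow> real" where "energy y = bform (G y) (X y) (X y)"

lemma energy_smooth: "C_k_on k D energy"
  unfolding energy_def[abs_def] by (rule bform_G_smooth[OF grad_smooth grad_smooth])

lemma dir_energy: "x \<in> D \<Longrightarrow> dir e energy x = 2 * bform (G x) (nab G e X x) (X x)"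
  unfolding energy_def[abs_def]
  by (subst dir_bform) (auto intro: grad_differentiable simp: bform_G_commute)

lemma Hess_energy:
  assumes x: "x \<in> D"
  shows "Hess G energy x e e = 2 * bform (G x) (nab2 e e x) (X x) + 2 * bform (G x) (nab G e X x) (nab G e X x)"
proof -
  have "dir e (dir e energy) x = dir e (\<lambda>y. 2 * bform (G y) (nab G e X y) (X y)) x"
    by (rule dir_cong[OF open_D x]) (rule dir_energy)
  also have "\<dots> = 2 * dir e (\<lambda>y. bform (G y) (nab G e X y) (X y)) x"
    by (rule dir_cmult, rule smooth_differentiable[OF x], rule bform_G_smooth[OF nab_smooth[OF grad_smooth] grad_smooth])
  also have "dir e (\<lambda>y. bform (G y) (nab G e X y) (X y)) x = bform (G x) (nab G e (nab G e X) x) (X x) + bform (G x) (nab G e X x) (nab G e X x)"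
    by (subst dir_bform[OF x]) (auto intro: grad_differentiable[OF x] nab_differentiable[OF x])
  finally show ?thesis by (simp add: Hess_def dir_energy[OF x] nab2_def)
qed

end

locale coord_soliton = coord_function D G u for D :: "(real^'n::finite) set" and G and u +
  assumes ricci: "x \<in> D \<Longrightarrow> Ric G x v v = Hess G u x v v"
    and lap: "x \<in> D \<Longrightarrow> Lap G u x + energy x = 1"
begin

text \<open>Bochner's formula. Commuting derivatives produces \<open>Ric (\<nabla>u, \<nabla>u) = \<nabla>\<nabla>u (\<nabla>u, \<nabla>u)\<close>, which is half the derivative of
\<open>energy\<close> along the gradient, and the trace of the soliton equation turns the derivative of the Laplacian of \<open>u\<close> into minus that
derivative. Both combine with the drift term, and \<open>2 |\<nabla>\<nabla>u|\<^sup>2\<close> remains; this is at least \<open>2 / n\<close> times the squared Laplacian.\<close>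

lemma drift_laplacian_energy:
  assumes x: "x \<in> D" and V: "onb G x V"
  shows "(\<Sum>a\<in>UNIV. Hess G energy x (V a) (V a)) + dir (X x) energy x \<ge> 2 * (1 - energy x)\<^sup>2 / real CARD('n)"
proof -
  define \<xi> where "\<xi> = X x"
  define h where "h a = Hess G u x (V a) (V a)" for a
  have skew: "bform (G x) (nab2 (V a) (V a) x) \<xi> = bform (G x) (nab2 \<xi> (V a) x) (V a) + bform (G x) (V a) (Riem G x (V a) \<xi> \<xi>)" for a
    using nab2_sym[OF x, of "V a" "V a" \<xi>] Ricci_identity[OF x, of "V a" \<xi>] bform_G_commute[OF x]
    by (simp add: \<xi>_def algebra_simps flip: bform_add)
  have "(\<Sum>a\<in>UNIV. bform (G x) (nab2 (V a) (V a) x) \<xi>) = dir \<xi> (Lap G u) x + Ric G x \<xi> \<xi>"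
    unfolding skew sum.distrib trace_nab2[OF x V] onb_Ric[OF x V] ..
  also have "dir \<xi> (Lap G u) x = dir \<xi> (\<lambda>y. 1 - energy y) x"
    by (rule dir_cong[OF open_D x]) (use lap in \<open>simp add: algebra_simps\<close>)
  also have "\<dots> = - dir \<xi> energy x"
    using smooth_differentiable[OF x energy_smooth] by (subst dir_diff) auto
  also have "Ric G x \<xi> \<xi> = dir \<xi> energy x / 2"
    by (simp add: ricci[OF x] Hess_nab[OF x] dir_energy[OF x] \<xi>_def)
  finally have tr: "(\<Sum>a\<in>UNIV. bform (G x) (nab2 (V a) (V a) x) \<xi>) = - dir \<xi> energy x / 2" by simp
  have sq: "(h a)\<^sup>2 \<le> bform (G x) (nab G (V a) X x) (nab G (V a) X x)" for a
    using bform_Cauchy_Schwarz[OF x, of "nab G (V a) X x" "V a"] onb_orthonormal[OF x V, of a a]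
    by (simp add: h_def Hess_nab[OF x])
  have "(\<Sum>a\<in>UNIV. Hess G energy x (V a) (V a)) + dir \<xi> energy x
      = 2 * (\<Sum>a\<in>UNIV. bform (G x) (nab G (V a) X x) (nab G (V a) X x))"
    using tr by (simp add: Hess_energy[OF x] sum.distrib \<xi>_def flip: sum_distrib_left)
  moreover have "(\<Sum>a\<in>UNIV. (h a)\<^sup>2) \<le> (\<Sum>a\<in>UNIV. bform (G x) (nab G (V a) X x) (nab G (V a) X x))"
    by (intro sum_mono sq)
  moreover have "(\<Sum>a\<in>UNIV. h a)\<^sup>2 / real CARD('n) \<le> (\<Sum>a\<in>UNIV. (h a)\<^sup>2)"
    using sum_squared_le_sum_of_squares[of h UNIV] by (simp add: field_simps)
  moreover have "(\<Sum>a\<in>UNIV. h a) = 1 - energy x"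
    using lap[OF x] Lap_onb[OF x V] by (simp add: h_def)
  ultimately show ?thesis by (simp add: \<xi>_def)
qed

text \<open>The vector field of the first-order coefficients of the drift Laplacian in coordinates, so that
\<open>\<Delta>\<phi> + \<nabla>u \<bullet> \<nabla>\<phi> = g\<^sup>i\<^sup>j \<partial>\<^sub>i\<partial>\<^sub>j \<phi> + Z\<^sup>k \<partial>\<^sub>k \<phi>\<close>.\<close>

definition Z :: "real^'n \<Rightarrow> real^'n" where
  "Z y = (\<chi> m. X y $ m - (\<Sum>k\<in>UNIV. \<Sum>l\<in>UNIV. matrix_inv (G y) $ k $ l * Gam G y (axis k 1) (axis l 1) $ m))"

lemma Z_smooth: "C_k_on k D (\<lambda>y. Z y $ m)"
  unfolding Z_def vec_lambda_beta
  by (intro C_k_on_diff C_k_on_sum C_k_on_mult grad_smooth inv_smooth Gam_smooth open_D)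

lemma Z_onb: "x \<in> D \<Longrightarrow> onb G x V \<Longrightarrow> Z x = X x - (\<Sum>a\<in>UNIV. Gam G x (V a) (V a))"
proof -
  assume x: "x \<in> D" and V: "onb G x V"
  have "bilinear (\<lambda>v w. Gam G x v w $ m)" for m by (rule bilinearI') auto
  from onb_sum_bilinear[OF V this]
  have "(\<Sum>a\<in>UNIV. Gam G x (V a) (V a) $ m) = (\<Sum>k\<in>UNIV. \<Sum>l\<in>UNIV. matrix_inv (G x) $ k $ l * Gam G x (axis k 1) (axis l 1) $ m)" for m .
  then show ?thesis by (simp add: Z_def vec_eq_iff)
qed

lemma vdir_Z:
  assumes x: "x \<in> D" and V: "onb G x V"
  shows "vdir e Z x = vdir e X x - (\<Sum>a\<in>UNIV. DGam G x e (V a) (V a) - 2 *\<^sub>R Gam G x (Gam G x e (V a)) (V a))"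
proof -
  have bil: "bilinear (\<lambda>v w. Gam G y v w $ m)" for m y by (rule bilinearI') auto
  have "dir e (\<lambda>y. \<Sum>k\<in>UNIV. \<Sum>l\<in>UNIV. matrix_inv (G y) $ k $ l * Gam G y (axis k 1) (axis l 1) $ m) x
     = (\<Sum>a\<in>UNIV. dir e (\<lambda>y. Gam G y (V a) (V a) $ m) x - Gam G x (Gam G x e (V a)) (V a) $ m - Gam G x (V a) (Gam G x e (V a)) $ m)" for m
  proof (rule dir_trace[OF x V bil Gam_differentiable[OF x]])
    show "bilinear (\<lambda>v w. dir e (\<lambda>y. Gam G y v w $ m) x)"
      unfolding vdir_component[symmetric] DGam_def[symmetric]
      by (rule bilinearI') (simp_all add: DGam_linear[OF x])
  qed
  then have "dir e (\<lambda>y. Z y $ m) x = dir e (\<lambda>y. X y $ m) x - (\<Sum>a\<in>UNIV. DGam G x e (V a) (V a) $ m - 2 * Gam G x (Gam G x e (V a)) (V a) $ m)" for m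
  proof -
    assume tr: "\<And>m. dir e (\<lambda>y. \<Sum>k\<in>UNIV. \<Sum>l\<in>UNIV. matrix_inv (G y) $ k $ l * Gam G y (axis k 1) (axis l 1) $ m) x
     = (\<Sum>a\<in>UNIV. dir e (\<lambda>y. Gam G y (V a) (V a) $ m) x - Gam G x (Gam G x e (V a)) (V a) $ m - Gam G x (V a) (Gam G x e (V a)) $ m)"
    define q where "q = (\<lambda>y. \<Sum>k\<in>UNIV. \<Sum>l\<in>UNIV. matrix_inv (G y) $ k $ l * Gam G y (axis k 1) (axis l 1) $ m)"
    have dq: "q differentiable (at x)"
      unfolding q_def using differentiable_basic(2)[OF x] Gam_differentiable[OF x]
      by (intro differentiable_sum ballI differentiable_mult) auto
    have "dir e (\<lambda>y. Z y $ m) x = dir e (\<lambda>y. X y $ m - q y) x"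
      by (simp add: Z_def q_def)
    also have "\<dots> = dir e (\<lambda>y. X y $ m) x - dir e q x"
      by (rule dir_diff[OF grad_differentiable[OF x] dq])
    finally show ?thesis
      unfolding q_def tr using Gam_commute[OF x]
      by (simp add: DGam_def vdir_component sum_subtractf sum.distrib flip: sum_distrib_left)
  qed
  then show ?thesis by (simp add: vec_eq_iff vdir_def)
qed

text \<open>The infinitesimal reason why the drift diffusion couples with itself. The left-hand side is the limit, as \<open>x\<close> and \<open>y\<close> tend to the
same point along \<open>y - x = \<delta>\<close>, of the second variation of \<open>g\<^sub>x(y - x, y - x)\<close> under parallel motion together with its derivative along the
drift of both points. The connection terms combine to \<open>-2 Ric (\<delta>, \<delta>)\<close>, the drift contributes \<open>2 \<nabla>\<nabla>u (\<delta>, \<delta>)\<close>, and these cancel by the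
soliton equation.\<close>

lemma coupling_identity:
  assumes x: "x \<in> D" and V: "onb G x V"
  shows "(\<Sum>a\<in>UNIV. dir (V a) (dir (V a) (\<lambda>y. bform (G y) \<delta> \<delta>)) x
        - 4 * dir (V a) (\<lambda>y. bform (G y) \<delta> (Gam G x \<delta> (V a))) x
        + 2 * bform (G x) (Gam G x \<delta> (V a)) (Gam G x \<delta> (V a)))
      + dir (Z x) (\<lambda>y. bform (G y) \<delta> \<delta>) x + 2 * bform (G x) \<delta> (vdir \<delta> Z x) = 0"
proof -
  have lin: "linear (\<lambda>e. dir e (\<lambda>y. bform (G y) \<delta> \<delta>) x)" "linear (bform (G x) \<delta>)"
    by (auto intro!: linearI)
  have Zterm: "dir (Z x) (\<lambda>y. bform (G y) \<delta> \<delta>) x = dir (X x) (\<lambda>y. bform (G y) \<delta> \<delta>) x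
      - (\<Sum>a\<in>UNIV. dir (Gam G x (V a) (V a)) (\<lambda>y. bform (G y) \<delta> \<delta>) x)"
    by (simp add: Z_onb[OF x V] linear_sum[OF lin(1), symmetric])
  have vZ: "bform (G x) \<delta> (vdir \<delta> Z x) = bform (G x) \<delta> (vdir \<delta> X x)
      - (\<Sum>a\<in>UNIV. bform (G x) \<delta> (DGam G x \<delta> (V a) (V a)) - 2 * bform (G x) \<delta> (Gam G x (Gam G x \<delta> (V a)) (V a)))"
  proof -
    have "bform (G x) \<delta> (\<Sum>a\<in>UNIV. DGam G x \<delta> (V a) (V a) - 2 *\<^sub>R Gam G x (Gam G x \<delta> (V a)) (V a))
      = (\<Sum>a\<in>UNIV. bform (G x) \<delta> (DGam G x \<delta> (V a) (V a)) - 2 * bform (G x) \<delta> (Gam G x (Gam G x \<delta> (V a)) (V a)))"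
      by (simp add: linear_sum[OF lin(2)])
    then show ?thesis by (simp add: vdir_Z[OF x V])
  qed
  have H: "dir (X x) (\<lambda>y. bform (G y) \<delta> \<delta>) x + 2 * bform (G x) \<delta> (vdir \<delta> X x) = 2 * Ric G x \<delta> \<delta>"
    using Gam_commute[OF x, of "X x" \<delta>]
    by (simp add: ricci[OF x] Hess_nab[OF x] dir_bform_const[OF x] nab_def bform_G_commute[OF x, of _ \<delta>])
  have R: "(\<Sum>a\<in>UNIV. bform (G x) (Riem G x (V a) \<delta> (V a)) \<delta>) = - Ric G x \<delta> \<delta>"
    by (simp add: Riem_skew[OF x, of _ \<delta> _ \<delta>] sum_negf bform_G_commute[OF x, of _ "V _"] onb_Ric[OF x V])
  have point: "dir v (dir v (\<lambda>y. bform (G y) \<delta> \<delta>)) x - 4 * dir v (\<lambda>y. bform (G y) \<delta> (Gam G x \<delta> v)) x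
        + 2 * bform (G x) (Gam G x \<delta> v) (Gam G x \<delta> v) - dir (Gam G x v v) (\<lambda>y. bform (G y) \<delta> \<delta>) x
        - 2 * (bform (G x) \<delta> (DGam G x \<delta> v v) - 2 * bform (G x) \<delta> (Gam G x (Gam G x \<delta> v) v))
      = 2 * bform (G x) (Riem G x v \<delta> v) \<delta>" for v
    using Gam_commute[OF x, of v \<delta>] Gam_commute[OF x, of "Gam G x v v" \<delta>] Gam_commute[OF x, of v "Gam G x \<delta> v"]
    by (simp add: dir_dir_bform[OF x] dir_bform_const[OF x] Riem_def bform_G_commute[OF x, of _ \<delta>]
        DGam_commute[OF x, of v v \<delta>])
  show ?thesis
  proof -
    have "(\<Sum>a\<in>UNIV. 2 * bform (G x) (Riem G x (V a) \<delta> (V a)) \<delta>) = - 2 * Ric G x \<delta> \<delta>"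
      using R by (simp flip: sum_distrib_left)
    then show ?thesis
      unfolding Zterm vZ point[symmetric] using H
      by (simp add: sum.distrib sum_subtractf sum_distrib_left algebra_simps)
  qed
qed

end

context coord_metric
begin

section \<open>Orthonormal frames\<close>

lemma onbI:
  assumes x: "x \<in> D" and V: "\<And>a b. bform (G x) (V a) (V b) = (if a = b then 1 else 0)"
  shows "onb G x V"
proof -
  define P where "P = (\<chi> i a. V a $ i)"
  have "(transpose P ** (G x ** P)) $ a $ b = (if a = b then 1 else 0)" for a b
    using V[of a b]
    by (simp add: bform_def P_def matrix_matrix_mult_def transpose_def sum_distrib_left mult_ac)
  then have "(transpose P ** G x) ** P = mat 1"
    by (simp add: matrix_mul_assoc mat_def vec_eq_iff)
  then have "P ** (transpose P ** G x) = mat 1" by (simp add: matrix_left_right_inverse)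
  then have "(P ** transpose P) ** (G x ** matrix_inv (G x)) = matrix_inv (G x)"
    by (simp add: matrix_mul_assoc)
  then have "P ** transpose P = matrix_inv (G x)" by (simp add: matrix_inv_G[OF x])
  then have "(P ** transpose P) $ i $ j = matrix_inv (G x) $ i $ j" for i j by simp
  then show ?thesis
    by (simp add: onb_def P_def matrix_matrix_mult_def transpose_def)
qed

lemma onb_exists:
  assumes x: "x \<in> D" obtains V where "onb G x V"
proof -
  have "\<exists>V. \<forall>a\<in>A. \<forall>b\<in>A. bform (G x) (V a) (V b) = (if a = b then 1 else 0)" for A :: "'n set"
  proof (induction A rule: finite_induct[OF finite])
    case (2 c A)
    then obtain V where V: "\<And>a b. a \<in> A \<Longrightarrow> b \<in> A \<Longrightarrow> bform (G x) (V a) (V b) = (if a = b then 1 else 0)"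
      by blast
    have "A \<subset> UNIV" using 2 by auto
    then have "card A < CARD('n)" by (intro psubset_card_mono) auto
    then have "dim ((\<lambda>a. G x *v V a) ` A) < DIM(real^'n)"
      using dim_le_card'[of "(\<lambda>a. G x *v V a) ` A"] card_image_le[of A "\<lambda>a. G x *v V a"] by simp
    then obtain w where w: "w \<noteq> 0" "\<And>y. y \<in> span ((\<lambda>a. G x *v V a) ` A) \<Longrightarrow> orthogonal w y"
      using orthogonal_to_subspace_exists by metis
    have wV: "bform (G x) w (V a) = 0" if "a \<in> A" for a
      using w(2)[OF span_base, of "G x *v V a"] that by (simp add: bform_G_inner orthogonal_def)
    define q where "q = bform (G x) w w"
    have q: "q > 0" using G_pos[OF x w(1)] by (simp add: q_def)
    define V' where "V' = V(c := (1 / sqrt q) *\<^sub>R w)"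
    have cc: "bform (G x) ((1 / sqrt q) *\<^sub>R w) ((1 / sqrt q) *\<^sub>R w) = 1"
      using q by (simp flip: q_def)
    have "\<forall>a\<in>insert c A. \<forall>b\<in>insert c A. bform (G x) (V' a) (V' b) = (if a = b then 1 else 0)"
    proof (intro ballI)
      fix a b assume "a \<in> insert c A" "b \<in> insert c A"
      moreover have "bform (G x) (V a) w = 0" if "a \<in> A" for a
        using wV[OF that] bform_G_commute[OF x, of w] by simp
      ultimately show "bform (G x) (V' a) (V' b) = (if a = b then 1 else 0)"
        using 2(2) q by (cases "a = c"; cases "b = c") (auto simp: V'_def V wV simp flip: q_def)
    qed
    then show ?case by blast
  qed auto
  from this[of UNIV] show ?thesis using onbI[OF x] that by fastforce
qed

lemma bform_smooth_on:
  assumes "open S" "S \<subseteq> D" "\<And>m. C_k_on k S (\<lambda>y. Y y $ m)" "\<And>m. C_k_on k S (\<lambda>y. Z y $ m)"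
  shows "C_k_on k S (\<lambda>y. bform (G y) (Y y) (Z y))"
  unfolding bform_def
  by (intro C_k_on_sum C_k_on_mult assms(1,3,4) C_k_on_subset[OF G_smooth assms(2)])

lemma bform_sum_right: "bform A v (\<Sum>b\<in>B. f b) = (\<Sum>b\<in>B. bform A v (f b))"
  by (rule linear_sum) (auto intro!: linearI)

text \<open>Gram-Schmidt, started from fields that are orthonormal and parallel at \<open>z\<close>, changes neither values nor first derivatives at \<open>z\<close>:
the coefficients and normalising factors have vanishing derivative there, because the metric is parallel.\<close>

lemma gram_schmidt_parallel:
  fixes v :: "'n \<Rightarrow> real^'n \<Rightarrow> real^'n" and A :: "'n set"
  assumes z: "z \<in> D" and v: "\<And>a m. C_k_on 1 D (\<lambda>y. v a y $ m)"
    and on: "\<And>a b. bform (G z) (v a z) (v b z) = (if a = b then 1 else 0)"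
    and par: "\<And>a e. nab G e (v a) z = 0"
  shows "\<exists>S E. open S \<and> z \<in> S \<and> S \<subseteq> D \<and> (\<forall>a\<in>A. \<forall>m. C_k_on 1 S (\<lambda>y. E a y $ m)) \<and>
     (\<forall>y\<in>S. \<forall>a\<in>A. \<forall>b\<in>A. bform (G y) (E a y) (E b y) = (if a = b then 1 else 0)) \<and>
     (\<forall>a\<in>A. E a z = v a z \<and> (\<forall>e. vdir e (E a) z = vdir e (v a) z))"
proof (induction A rule: finite_induct[OF finite])
  case 1
  show ?case using open_D z by auto
next
  case (2 c A)
  from 2(3) obtain S E where S: "open S" "z \<in> S" "S \<subseteq> D"
    and E0: "\<forall>a\<in>A. \<forall>m. C_k_on 1 S (\<lambda>y. E a y $ m)"
      "\<forall>y\<in>S. \<forall>a\<in>A. \<forall>b\<in>A. bform (G y) (E a y) (E b y) = (if a = b then 1 else 0)"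
      "\<forall>a\<in>A. E a z = v a z \<and> (\<forall>e. vdir e (E a) z = vdir e (v a) z)"
    by (elim exE conjE) (rule that)
  have E: "C_k_on 1 S (\<lambda>y. E a y $ m)" if "a \<in> A" for a m using E0(1) that by blast
  have EE: "bform (G y) (E a y) (E b y) = (if a = b then 1 else 0)" if "y \<in> S" "a \<in> A" "b \<in> A" for y a b
    using E0(2) that by blast
  have Ez: "E a z = v a z" "vdir e (E a) z = vdir e (v a) z" if "a \<in> A" for a e
    using E0(3) that by blast+
  have vS: "C_k_on 1 S (\<lambda>y. v a y $ m)" for a m using C_k_on_subset[OF v S(3)] .
  have diff: "\<phi> differentiable (at z)" if "C_k_on 1 S \<phi>" for \<phi> using that S(2) by simp
  define k where "k b y = bform (G y) (v c y) (E b y)" for b y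
  have k: "C_k_on 1 S (k b)" if "b \<in> A" for b
    unfolding k_def[abs_def] by (rule bform_smooth_on[OF S(1,3) vS E[OF that]])
  have nabE: "nab G e (E b) z = 0" if "b \<in> A" for b e
    using par[of e b] Ez that by (simp add: nab_def)
  have kz: "k b z = 0" if "b \<in> A" for b
    using on[of c b] Ez(1)[OF that] 2(2) that by (auto simp: k_def)
  have dkz: "dir e (k b) z = 0" if "b \<in> A" for b e
    unfolding k_def[abs_def] using diff[OF vS] diff[OF E[OF that]] par nabE[OF that] by (subst dir_bform[OF z]) auto
  define w where "w y = v c y - (\<Sum>b\<in>A. k b y *\<^sub>R E b y)" for y
  have w: "C_k_on 1 S (\<lambda>y. w y $ m)" for m
    unfolding w_def vector_minus_component sum_component vector_scaleR_component real_scaleR_def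
    by (intro C_k_on_diff C_k_on_sum C_k_on_mult vS k E S(1))
  have wz: "w z = v c z" by (simp add: w_def kz)
  have dwz: "vdir e w z = vdir e (v c) z" for e
  proof -
    have "dir e (\<lambda>y. w y $ m) z = dir e (\<lambda>y. v c y $ m) z" for m
    proof -
      have "dir e (\<lambda>y. \<Sum>b\<in>A. k b y * E b y $ m) z = (\<Sum>b\<in>A. dir e (k b) z * E b z $ m + k b z * dir e (\<lambda>y. E b y $ m) z)"
        using diff[OF k] diff[OF E] by (simp add: dir_sum dir_mult differentiable_mult)
      also have "\<dots> = 0" by (simp add: kz dkz)
      finally show ?thesis
        unfolding w_def vector_minus_component sum_component vector_scaleR_component real_scaleR_def
        using diff[OF vS] diff[OF k] diff[OF E] by (subst dir_diff) (auto intro!: differentiable_sum differentiable_mult)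
    qed
    then show ?thesis by (simp add: vdir_def)
  qed
  define q where "q y = bform (G y) (w y) (w y)" for y
  have q: "C_k_on 1 S q" unfolding q_def[abs_def] by (rule bform_smooth_on[OF S(1,3) w w])
  have qz: "q z = 1" by (simp add: q_def wz on)
  have dqz: "dir e q z = 0" for e
  proof -
    have "nab G e w z = 0" using par[of e c] by (simp add: nab_def wz dwz)
    then show ?thesis
      unfolding q_def[abs_def] using diff[OF w] by (subst dir_bform[OF z]) auto
  qed
  define S' where "S' = {y \<in> S. q y > 0}"
  have "S' = S \<inter> q -` {0<..}" by (auto simp: S'_def)
  then have S': "open S'" "S' \<subseteq> S" "z \<in> S'"
    using continuous_on_open_vimage[OF S(1), of q] C_k_on_continuous_on[OF q] S(2) qz
    by (auto simp: S'_def Int_commute)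
  define r where "r y = inverse (sqrt (q y))" for y
  have r: "C_k_on 1 S' r"
    unfolding r_def[abs_def]
    by (intro C_k_on_inverse C_k_on_sqrt S'(1) C_k_on_subset[OF q S'(2)]) (auto simp: S'_def)
  have drz: "dir e r z = 0" for e
  proof -
    have d: "((\<lambda>t. inverse (sqrt t)) has_real_derivative - (1/2)) (at (q z))"
      unfolding qz by (auto intro!: derivative_eq_intros)
    have "partial_d m r z = - (1/2) * partial_d m q z" for m
      unfolding r_def[abs_def] by (rule partial_d_chain_real[where h = "\<lambda>t. inverse (sqrt t)", OF diff[OF q] d])
    then have "dir e r z = - (1/2) * dir e q z" by (simp add: dir_def sum_distrib_left)
    then show ?thesis by (simp add: dqz)
  qed
  define E' where "E' = E(c := (\<lambda>y. r y *\<^sub>R w y))"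
  have E': "C_k_on 1 S' (\<lambda>y. E' a y $ m)" if "a \<in> insert c A" for a m
  proof (cases "a = c")
    case True
    then show ?thesis
      unfolding E'_def by (simp only: fun_upd_same vector_scaleR_component real_scaleR_def)
        (intro C_k_on_mult S'(1) r C_k_on_subset[OF w S'(2)])
  next
    case False
    then show ?thesis using that C_k_on_subset[OF E S'(2)] by (simp add: E'_def)
  qed
  have wE: "bform (G y) (w y) (E b y) = 0" if "y \<in> S" "b \<in> A" for y b
  proof -
    have yD: "y \<in> D" using that S by auto
    have "bform (G y) (E b y) (w y) = k b y - (\<Sum>a\<in>A. k a y * (if b = a then 1 else 0))"
    proof -
      have "bform (G y) (E b y) (\<Sum>a\<in>A. k a y *\<^sub>R E a y) = (\<Sum>a\<in>A. k a y * (if b = a then 1 else 0))"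
        unfolding bform_sum_right using that by (intro sum.cong) (auto simp: EE)
      then show ?thesis by (simp add: w_def k_def[of b] bform_G_commute[OF yD, of "E b y" "v c y"])
    qed
    also have "\<dots> = 0" using that by (simp add: if_distrib[of "\<lambda>x. _ * x"] cong: if_cong)
    finally show ?thesis by (simp add: bform_G_commute[OF yD, of "w y"])
  qed
  have EE': "bform (G y) (E' a y) (E' b y) = (if a = b then 1 else 0)"
    if "y \<in> S'" "a \<in> insert c A" "b \<in> insert c A" for y a b
  proof -
    have yS: "y \<in> S" "y \<in> D" using that S' S by auto
    have qy: "q y > 0" using that by (simp add: S'_def)
    have 1: "r y * (r y * bform (G y) (w y) (w y)) = 1"
      using qy by (simp add: r_def field_simps flip: q_def)
    have Ew: "bform (G y) (E b y) (w y) = 0" if "b \<in> A" for b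
      using wE[OF yS(1) that] bform_G_commute[OF yS(2), of "w y"] by simp
    show ?thesis
      using that(2,3) 2(2) by (cases "a = c"; cases "b = c") (auto simp: E'_def 1 wE[OF yS(1)] EE[OF yS(1)] Ew)
  qed
  have rz: "r z = 1" by (simp add: r_def qz)
  have dc: "vdir e (\<lambda>y. r y *\<^sub>R w y) z = vdir e (v c) z" for e
  proof -
    have "dir e (\<lambda>y. r y * w y $ m) z = dir e (\<lambda>y. w y $ m) z" for m
      using r S'(3) diff[OF w] by (subst dir_mult) (auto simp: drz rz)
    then show ?thesis using dwz[of e] by (simp add: vdir_def)
  qed
  have Ez': "E' a z = v a z \<and> (\<forall>e. vdir e (E' a) z = vdir e (v a) z)" if "a \<in> insert c A" for a
    using that Ez dc 2(2) by (auto simp: E'_def rz wz)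
  show ?case
    by (rule exI[of _ S'], rule exI[of _ E']) (use S' S E' EE' Ez' in blast)
qed

text \<open>Such fields exist: correct constant vectors by a linear term that cancels the connection at \<open>z\<close>. Away from \<open>z\<close> the frame is
orthonormal but not parallel, which is all that the variation estimates near \<open>z\<close> use.\<close>

lemma parallel_frame:
  assumes z: "z \<in> D"
  obtains S E where "open S" "z \<in> S" "S \<subseteq> D" "\<And>a m. C_k_on 1 S (\<lambda>y. E a y $ m)"
    "\<And>y. y \<in> S \<Longrightarrow> onb G y (\<lambda>a. E a y)" "\<And>a e. vdir e (E a) z = - Gam G z e (E a z)"
proof -
  obtain V where V: "onb G z V" using onb_exists[OF z] .
  \<comment> \<open>The linear term makes the field parallel at \<open>z\<close>.\<close>
  define v where "v a y = V a - Gam G z (y - z) (V a)" for a y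
  have v: "C_k_on k D (\<lambda>y. v a y $ m)" for a m k
    unfolding v_def Gam_def vector_minus_component vec_lambda_beta
    by (intro C_k_on_diff C_k_on_sum C_k_on_mult open_D C_k_on_const C_k_on_coord)
  have vz: "v a z = V a" for a by (simp add: v_def)
  have dv: "vdir e (v a) z = - Gam G z e (V a)" for a e
  proof -
    have "dir e (\<lambda>y. v a y $ m) z = - Gam G z e (V a) $ m" for m
    proof -
      have "dir e (\<lambda>y. y $ i) z = e $ i" for i
        using sum_axis[of i "\<lambda>j. e $ j"] by (simp add: dir_def if_distrib[of "\<lambda>x. _ * x"] cong: if_cong)
      then have "dir e (\<lambda>y. \<Sum>i\<in>UNIV. \<Sum>j\<in>UNIV. christoffel G m i j z * (y $ i - z $ i) * V a $ j) z = Gam G z e (V a) $ m"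
        by (simp add: dir_sum dir_mult dir_diff differentiable_mult differentiable_sum differentiable_diff Gam_def)
      then show ?thesis
        unfolding v_def Gam_def vector_minus_component vec_lambda_beta
        by (subst dir_diff) (auto intro!: differentiable_sum differentiable_mult differentiable_diff simp: Gam_def)
    qed
    then show ?thesis by (simp add: vdir_def vec_eq_iff)
  qed
  have par: "nab G e (v a) z = 0" for a e by (simp add: nab_def dv vz)
  have on0: "bform (G z) (v a z) (v b z) = (if a = b then 1 else 0)" for a b
    by (simp add: vz onb_orthonormal[OF z V])
  from gram_schmidt_parallel[OF z v on0 par, of UNIV] obtain S E where S: "open S" "z \<in> S" "S \<subseteq> D"
    and E: "\<forall>a\<in>UNIV. \<forall>m. C_k_on 1 S (\<lambda>y. E a y $ m)"
      "\<forall>y\<in>S. \<forall>a\<in>UNIV. \<forall>b\<in>UNIV. bform (G y) (E a y) (E b y) = (if a = b then 1 else 0)"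
      "\<forall>a\<in>UNIV. E a z = v a z \<and> (\<forall>e. vdir e (E a) z = vdir e (v a) z)"
    by (elim exE conjE) (rule that)
  show ?thesis
  proof (rule that[OF S])
    show "C_k_on 1 S (\<lambda>y. E a y $ m)" for a m using E(1) by blast
    show "onb G y (\<lambda>a. E a y)" if "y \<in> S" for y
      using E(2) S(3) that by (intro onbI) blast+
    show "vdir e (E a) z = - Gam G z e (E a z)" for a e
      using E(3) dv vz by simp
  qed
qed

section \<open>Comparison of nearby metrics\<close>

lemma bform_perturb:
  assumes z: "z \<in> D" and e: "e > 0"
  obtains d where "d > 0" "ball z d \<subseteq> D"
    "\<And>x h. x \<in> ball z d \<Longrightarrow> \<bar>bform (G x) h h - bform (G z) h h\<bar> \<le> e * (norm h)\<^sup>2"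
proof -
  define e' where "e' = e / (real CARD('n) * real CARD('n))"
  have e': "e' > 0" using e by (simp add: e'_def)
  obtain r where r: "r > 0" "ball z r \<subseteq> D" using open_D z open_contains_ball by blast
  have "\<forall>i j. \<exists>d>0. \<forall>x\<in>ball z d. \<bar>G x $ i $ j - G z $ i $ j\<bar> < e'"
  proof (intro allI)
    fix i j
    have "continuous_on D (\<lambda>x. G x $ i $ j)" using C_k_on_continuous_on G_smooth by blast
    then have "isCont (\<lambda>x. G x $ i $ j) z" using open_D z continuous_on_eq_continuous_at by blast
    then show "\<exists>d>0. \<forall>x\<in>ball z d. \<bar>G x $ i $ j - G z $ i $ j\<bar> < e'"
      using e' unfolding continuous_at_eps_delta by (metis dist_commute dist_real_def mem_ball)
  qed
  then obtain d where d: "\<And>i j. d i j > 0" "\<And>i j x. x \<in> ball z (d i j) \<Longrightarrow> \<bar>G x $ i $ j - G z $ i $ j\<bar> < e'"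
    by metis
  define \<delta> where "\<delta> = min r (Min (range (\<lambda>(i, j). d i j)))"
  have "\<delta> > 0" using d(1) r by (auto simp: \<delta>_def)
  have le: "\<delta> \<le> d i j" for i j
    unfolding \<delta>_def by (rule min.coboundedI2, rule Min_le) auto
  show ?thesis
  proof (rule that[of \<delta>])
    show "ball z \<delta> \<subseteq> D" using r by (auto simp: \<delta>_def)
    fix x h assume x: "x \<in> ball z \<delta>"
    have "bform (G x) h h - bform (G z) h h = (\<Sum>i\<in>UNIV. \<Sum>j\<in>UNIV. (G x $ i $ j - G z $ i $ j) * h $ i * h $ j)"
      by (simp add: bform_def sum_subtractf left_diff_distrib)
    also have "\<bar>\<dots>\<bar> \<le> (\<Sum>i\<in>(UNIV::'n set). \<Sum>j\<in>(UNIV::'n set). e' * (norm h)\<^sup>2)"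
    proof (intro order_trans[OF sum_abs] sum_mono)
      fix i j
      have "x \<in> ball z (d i j)" using x le[of i j] by auto
      from d(2)[OF this] have "\<bar>G x $ i $ j - G z $ i $ j\<bar> \<le> e'" by simp
      moreover have "\<bar>h $ i\<bar> * \<bar>h $ j\<bar> \<le> norm h * norm h"
        by (intro mult_mono) (auto simp: component_le_norm_cart)
      ultimately show "\<bar>(G x $ i $ j - G z $ i $ j) * h $ i * h $ j\<bar> \<le> e' * (norm h)\<^sup>2"
        unfolding abs_mult mult.assoc power2_eq_square by (rule mult_mono) (use e' in auto)
    qed
    also have "\<dots> = e * (norm h)\<^sup>2" by (simp add: e'_def)
    finally show "\<bar>bform (G x) h h - bform (G z) h h\<bar> \<le> e * (norm h)\<^sup>2" .
  qed (rule \<open>\<delta> > 0\<close>)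
qed

lemma bform_pos_lower:
  assumes z: "z \<in> D" obtains m where "m > 0" "\<And>h. m * (norm h)\<^sup>2 \<le> bform (G z) h h"
proof -
  have c: "continuous_on (sphere 0 1) (\<lambda>h. bform (G z) h h)"
    unfolding bform_def by (intro continuous_intros)
  have "axis undefined 1 \<in> sphere (0::real^'n) 1" by simp
  then obtain h0 where h0: "h0 \<in> sphere 0 1" "\<And>h. h \<in> sphere 0 1 \<Longrightarrow> bform (G z) h0 h0 \<le> bform (G z) h h"
    using continuous_attains_inf[OF compact_sphere _ c] by blast
  define m where "m = bform (G z) h0 h0"
  have m: "m > 0" unfolding m_def by (rule G_pos[OF z]) (use h0 in auto)
  have "m * (norm h)\<^sup>2 \<le> bform (G z) h h" for h
  proof (cases "h = 0")
    case False
    have "m \<le> bform (G z) ((1 / norm h) *\<^sub>R h) ((1 / norm h) *\<^sub>R h)"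
      unfolding m_def by (rule h0(2)) (use False in simp)
    also have "\<dots> = bform (G z) h h / (norm h)\<^sup>2" by (simp add: power2_eq_square)
    finally show ?thesis using False by (simp add: field_simps)
  qed simp
  then show ?thesis using that m by blast
qed

lemma bform_compare:
  assumes z: "z \<in> D" and e: "e > 0"
  obtains d m where "d > 0" "m > 0" "ball z d \<subseteq> D"
    "\<And>x h. x \<in> ball z d \<Longrightarrow> m * (norm h)\<^sup>2 \<le> bform (G x) h h"
    "\<And>x h. x \<in> ball z d \<Longrightarrow> bform (G x) h h \<le> (1 + e) * bform (G z) h h"
    "\<And>x h. x \<in> ball z d \<Longrightarrow> bform (G z) h h \<le> (1 + e) * bform (G x) h h"
proof -
  obtain m where m: "m > 0" "\<And>h. m * (norm h)\<^sup>2 \<le> bform (G z) h h" using bform_pos_lower[OF z] by blast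
  define e' where "e' = m * min (1/2) (e / (1 + e))"
  have e': "e' > 0" using m e by (simp add: e'_def)
  obtain d where d: "d > 0" "ball z d \<subseteq> D"
    "\<And>x h. x \<in> ball z d \<Longrightarrow> \<bar>bform (G x) h h - bform (G z) h h\<bar> \<le> e' * (norm h)\<^sup>2"
    using bform_perturb[OF z e'] by blast
  have *: "e' * (norm h)\<^sup>2 \<le> min (1/2) (e / (1 + e)) * bform (G z) h h" for h
    unfolding e'_def using mult_left_mono[OF m(2)[of h], of "min (1/2) (e / (1 + e))"] e by (simp add: mult_ac)
  have half: "e' * (norm h)\<^sup>2 \<le> 1/2 * bform (G z) h h" and ee: "e' * (norm h)\<^sup>2 \<le> e / (1 + e) * bform (G z) h h" for h
    using *[of h] mult_right_mono[OF min.cobounded1[of "1/2" "e / (1 + e)"] bform_nonneg[OF z, of h]]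
      mult_right_mono[OF min.cobounded2[of "1/2" "e / (1 + e)"] bform_nonneg[OF z, of h]] by linarith+
  show ?thesis
  proof (rule that[of d "m / 2"])
    fix x h assume x: "x \<in> ball z d"
    note dx = d(3)[OF x, of h]
    show "m / 2 * (norm h)\<^sup>2 \<le> bform (G x) h h" using dx half[of h] m(2)[of h] by linarith
    have "e / (1 + e) * bform (G z) h h \<le> e * bform (G z) h h"
      using e bform_nonneg[OF z, of h] by (intro mult_right_mono) (auto simp: field_simps)
    then show "bform (G x) h h \<le> (1 + e) * bform (G z) h h" using dx ee[of h] by (simp add: algebra_simps)
    have "(1 - e / (1 + e)) * bform (G z) h h \<le> bform (G x) h h" using dx ee[of h] by (simp add: algebra_simps)
    then have "(1 + e) * ((1 - e / (1 + e)) * bform (G z) h h) \<le> (1 + e) * bform (G x) h h"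
      using e by (intro mult_left_mono) auto
    moreover have "(1 + e) * ((1 - e / (1 + e)) * bform (G z) h h) = bform (G z) h h"
      using e by (simp add: field_simps)
    ultimately show "bform (G z) h h \<le> (1 + e) * bform (G x) h h" by simp
  qed (use d m in auto)
qed

end

section \<open>Two-point functions vanishing to higher order on the diagonal\<close>

text \<open>Smallness against the squared distance of two points that both vary near \<open>z\<close>. Coefficients may then be frozen at \<open>z\<close>, so that
continuity of second derivatives suffices throughout.\<close>

definition small2 :: "real^'n::finite \<Rightarrow> (real^'n \<Rightarrow> real^'n \<Rightarrow> real) \<Rightarrow> bool" where
  "small2 z K \<longleftrightarrow> (\<forall>e>0. \<exists>d>0. \<forall>x\<in>ball z d. \<forall>y\<in>ball z d. \<bar>K x y\<bar> \<le> e * (norm (y - x))\<^sup>2)"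

lemma small2_zero [simp]: "small2 z (\<lambda>x y. 0)"
  unfolding small2_def by (auto intro!: exI[of _ 1])

lemma small2D:
  assumes "small2 z K" "e > 0"
  obtains d where "d > 0" "\<And>x y. x \<in> ball z d \<Longrightarrow> y \<in> ball z d \<Longrightarrow> \<bar>K x y\<bar> \<le> e * (norm (y - x))\<^sup>2"
  using assms unfolding small2_def by blast

lemma small2_add:
  assumes "small2 z K" "small2 z L" shows "small2 z (\<lambda>x y. K x y + L x y)"
  unfolding small2_def
proof (intro allI impI)
  fix e :: real assume e: "e > 0"
  then have "e / 2 > 0" by simp
  obtain d1 where d1: "d1 > 0"
     "\<And>x y. x \<in> ball z d1 \<Longrightarrow> y \<in> ball z d1 \<Longrightarrow> \<bar>K x y\<bar> \<le> e / 2 * (norm (y - x))\<^sup>2"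
    using small2D[OF assms(1) \<open>e / 2 > 0\<close>] by blast
  obtain d2 where d2: "d2 > 0"
     "\<And>x y. x \<in> ball z d2 \<Longrightarrow> y \<in> ball z d2 \<Longrightarrow> \<bar>L x y\<bar> \<le> e / 2 * (norm (y - x))\<^sup>2"
    using small2D[OF assms(2) \<open>e / 2 > 0\<close>] by blast
  show "\<exists>d>0. \<forall>x\<in>ball z d. \<forall>y\<in>ball z d. \<bar>K x y + L x y\<bar> \<le> e * (norm (y - x))\<^sup>2"
  proof (intro exI[of _ "min d1 d2"] conjI ballI)
    fix x y assume "x \<in> ball z (min d1 d2)" "y \<in> ball z (min d1 d2)"
    then have "\<bar>K x y\<bar> \<le> e / 2 * (norm (y - x))\<^sup>2" "\<bar>L x y\<bar> \<le> e / 2 * (norm (y - x))\<^sup>2"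
      using d1(2) d2(2) by auto
    then show "\<bar>K x y + L x y\<bar> \<le> e * (norm (y - x))\<^sup>2" by linarith
  qed (use d1 d2 in auto)
qed

lemma small2_sum: "(\<And>i. i \<in> A \<Longrightarrow> small2 z (K i)) \<Longrightarrow> small2 z (\<lambda>x y. \<Sum>i\<in>A. K i x y)"
  by (induction A rule: infinite_finite_induct) (auto intro: small2_add)

lemma small2_cmult: assumes "small2 z K" shows "small2 z (\<lambda>x y. c * K x y)"
  unfolding small2_def
proof (intro allI impI)
  fix e :: real assume e: "e > 0"
  then have "e / (\<bar>c\<bar> + 1) > 0" by simp
  from small2D[OF assms this] obtain d where d: "d > 0"
     "\<And>x y. x \<in> ball z d \<Longrightarrow> y \<in> ball z d \<Longrightarrow> \<bar>K x y\<bar> \<le> e / (\<bar>c\<bar> + 1) * (norm (y - x))\<^sup>2"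
    by blast
  show "\<exists>d>0. \<forall>x\<in>ball z d. \<forall>y\<in>ball z d. \<bar>c * K x y\<bar> \<le> e * (norm (y - x))\<^sup>2"
  proof (intro exI[of _ d] conjI ballI d(1))
    fix x y assume "x \<in> ball z d" "y \<in> ball z d"
    then have "\<bar>c * K x y\<bar> \<le> (\<bar>c\<bar> + 1) * (e / (\<bar>c\<bar> + 1) * (norm (y - x))\<^sup>2)"
      unfolding abs_mult by (intro mult_mono d(2)) auto
    then show "\<bar>c * K x y\<bar> \<le> e * (norm (y - x))\<^sup>2" by simp
  qed
qed

lemma small2_cong:
  assumes "small2 z K" "open S" "z \<in> S" "\<And>x y. x \<in> S \<Longrightarrow> y \<in> S \<Longrightarrow> L x y = K x y"
  shows "small2 z L"
  unfolding small2_def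
proof (intro allI impI)
  fix e :: real assume e: "e > 0"
  from small2D[OF assms(1) this] obtain d where d: "d > 0"
     "\<And>x y. x \<in> ball z d \<Longrightarrow> y \<in> ball z d \<Longrightarrow> \<bar>K x y\<bar> \<le> e * (norm (y - x))\<^sup>2"
    by blast
  obtain r where r: "r > 0" "ball z r \<subseteq> S" using assms(2,3) open_contains_ball by blast
  show "\<exists>d>0. \<forall>x\<in>ball z d. \<forall>y\<in>ball z d. \<bar>L x y\<bar> \<le> e * (norm (y - x))\<^sup>2"
  proof (intro exI[of _ "min d r"] conjI ballI)
    fix x y assume xy: "x \<in> ball z (min d r)" "y \<in> ball z (min d r)"
    then have "x \<in> S" "y \<in> S" using r by auto
    then show "\<bar>L x y\<bar> \<le> e * (norm (y - x))\<^sup>2" using assms(4) d(2) xy by simp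
  qed (use d r in auto)
qed

lemma abs_dir_le: "\<bar>dir h u z\<bar> \<le> norm h * (\<Sum>m\<in>UNIV. \<bar>partial_d m u z\<bar>)"
  unfolding dir_def sum_distrib_left
  by (intro order_trans[OF sum_abs] sum_mono) (auto simp: abs_mult component_le_norm_cart intro!: mult_right_mono)

text \<open>The basic expansion: differences of continuously differentiable functions are replaced by their differentials at \<open>z\<close>, by strict
differentiability, and the coefficient by its value at \<open>z\<close>.\<close>

lemma small2_product:
  fixes \<phi> \<psi> k :: "real^'n::finite \<Rightarrow> real"
  assumes S: "open S" "z \<in> S" and \<phi>: "C_k_on 1 S \<phi>" and \<psi>: "C_k_on 1 S \<psi>" and k: "continuous_on S k"
  shows "small2 z (\<lambda>x y. k x * (\<phi> y - \<phi> x) * (\<psi> y - \<psi> x) - k z * dir (y - x) \<phi> z * dir (y - x) \<psi> z)"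
  unfolding small2_def
proof (intro allI impI)
  fix e :: real assume e: "e > 0"
  define M where "M = \<bar>k z\<bar> + (\<Sum>m\<in>UNIV. \<bar>partial_d m \<phi> z\<bar>) + (\<Sum>m\<in>UNIV. \<bar>partial_d m \<psi> z\<bar>) + 1"
  have sn: "(\<Sum>m\<in>UNIV. \<bar>partial_d m \<phi> z\<bar>) \<ge> 0" "(\<Sum>m\<in>UNIV. \<bar>partial_d m \<psi> z\<bar>) \<ge> 0"
    by (auto intro: sum_nonneg)
  have M: "M \<ge> 1" using sn by (simp add: M_def)
  define \<eta> where "\<eta> = min 1 (e / (3 * (M + 1)\<^sup>2))"
  have \<eta>: "\<eta> > 0" "\<eta> \<le> 1" "3 * (M + 1)\<^sup>2 * \<eta> \<le> e"
  proof -
    have p: "3 * (M + 1)\<^sup>2 > 0" using M by simp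
    then show "\<eta> > 0" "\<eta> \<le> 1" using e by (auto simp: \<eta>_def)
    have "\<eta> \<le> e / (3 * (M + 1)\<^sup>2)" by (simp add: \<eta>_def)
    then show "3 * (M + 1)\<^sup>2 * \<eta> \<le> e" using p by (simp add: field_simps)
  qed
  obtain d1 where d1: "d1 > 0" "\<And>x y. x \<in> ball z d1 \<Longrightarrow> y \<in> ball z d1 \<Longrightarrow>
       \<bar>\<phi> y - \<phi> x - dir (y - x) \<phi> z\<bar> \<le> \<eta> * norm (y - x)"
    by (rule strict_differentiability[OF S \<phi> \<eta>(1)]) (auto simp: dir_def)
  obtain d2 where d2: "d2 > 0" "\<And>x y. x \<in> ball z d2 \<Longrightarrow> y \<in> ball z d2 \<Longrightarrow>
       \<bar>\<psi> y - \<psi> x - dir (y - x) \<psi> z\<bar> \<le> \<eta> * norm (y - x)"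
    by (rule strict_differentiability[OF S \<psi> \<eta>(1)]) (auto simp: dir_def)
  have "isCont k z" using S k continuous_on_eq_continuous_at by blast
  then obtain d3 where d3: "d3 > 0" "\<And>x. x \<in> ball z d3 \<Longrightarrow> \<bar>k x - k z\<bar> < \<eta>"
    using \<eta>(1) unfolding continuous_at_eps_delta by (metis dist_commute dist_real_def mem_ball)
  show "\<exists>d>0. \<forall>x\<in>ball z d. \<forall>y\<in>ball z d.
      \<bar>k x * (\<phi> y - \<phi> x) * (\<psi> y - \<psi> x) - k z * dir (y - x) \<phi> z * dir (y - x) \<psi> z\<bar> \<le> e * (norm (y - x))\<^sup>2"
  proof (intro exI[of _ "min d1 (min d2 d3)"] conjI ballI)
    fix x y assume xy: "x \<in> ball z (min d1 (min d2 d3))" "y \<in> ball z (min d1 (min d2 d3))"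
    define r where "r = norm (y - x)"
    define p q p' q' where "p = dir (y - x) \<phi> z" "q = dir (y - x) \<psi> z" "p' = \<phi> y - \<phi> x" "q' = \<psi> y - \<psi> x"
    have r: "r \<ge> 0" by (simp add: r_def)
    have a: "\<bar>p' - p\<bar> \<le> \<eta> * r" using d1(2)[of x y] xy by (simp add: p_q_p'_q'_def r_def)
    have b: "\<bar>q' - q\<bar> \<le> \<eta> * r" using d2(2)[of x y] xy by (simp add: p_q_p'_q'_def r_def)
    have c: "\<bar>k x - k z\<bar> \<le> \<eta>" using d3(2)[of x] xy by simp
    have p: "\<bar>p\<bar> \<le> M * r"
    proof -
      have "\<bar>p\<bar> \<le> r * (\<Sum>m\<in>UNIV. \<bar>partial_d m \<phi> z\<bar>)" unfolding p_q_p'_q'_def r_def by (rule abs_dir_le)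
      also have "\<dots> \<le> r * M" using r sn by (intro mult_left_mono) (auto simp: M_def)
      finally show ?thesis by (simp add: mult.commute)
    qed
    have q: "\<bar>q\<bar> \<le> M * r"
    proof -
      have "\<bar>q\<bar> \<le> r * (\<Sum>m\<in>UNIV. \<bar>partial_d m \<psi> z\<bar>)" unfolding p_q_p'_q'_def r_def by (rule abs_dir_le)
      also have "\<dots> \<le> r * M" using r sn by (intro mult_left_mono) (auto simp: M_def)
      finally show ?thesis by (simp add: mult.commute)
    qed
    have "\<bar>q'\<bar> \<le> \<bar>q\<bar> + \<bar>q' - q\<bar>" by simp
    also have "\<dots> \<le> M * r + 1 * r" using q b \<eta>(2) mult_right_mono[OF \<eta>(2) r] by linarith
    finally have q': "\<bar>q'\<bar> \<le> (M + 1) * r" by (simp add: algebra_simps)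
    have "\<bar>p'\<bar> \<le> \<bar>p\<bar> + \<bar>p' - p\<bar>" by simp
    also have "\<dots> \<le> M * r + 1 * r" using p a \<eta>(2) mult_right_mono[OF \<eta>(2) r] by linarith
    finally have p': "\<bar>p'\<bar> \<le> (M + 1) * r" by (simp add: algebra_simps)
    have kz: "\<bar>k z\<bar> \<le> M + 1" "M \<le> M + 1" using sn by (auto simp: M_def)
    have "k x * p' * q' - k z * p * q = (k x - k z) * p' * q' + k z * (p' - p) * q' + k z * p * (q' - q)"
      by (simp add: algebra_simps)
    also have "\<bar>\<dots>\<bar> \<le> \<bar>(k x - k z) * p' * q'\<bar> + \<bar>k z * (p' - p) * q'\<bar> + \<bar>k z * p * (q' - q)\<bar>" by linarith
    also have "\<dots> \<le> \<eta> * ((M + 1) * r) * ((M + 1) * r) + (M + 1) * (\<eta> * r) * ((M + 1) * r) + (M + 1) * (M * r) * (\<eta> * r)"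
      unfolding abs_mult by (intro add_mono mult_mono a b c p q p' q' kz) (use r M \<eta> in \<open>auto intro!: mult_nonneg_nonneg\<close>)
    also have "\<dots> \<le> \<eta> * ((M + 1) * r) * ((M + 1) * r) + (M + 1) * (\<eta> * r) * ((M + 1) * r) + (M + 1) * ((M + 1) * r) * (\<eta> * r)"
      using r M \<eta> by (intro add_left_mono mult_right_mono mult_left_mono) auto
    also have "\<dots> = (3 * (M + 1)\<^sup>2 * \<eta>) * r\<^sup>2" by (simp add: power2_eq_square algebra_simps)
    also have "\<dots> \<le> e * r\<^sup>2" using \<eta>(3) by (intro mult_right_mono) auto
    finally show "\<bar>k x * (\<phi> y - \<phi> x) * (\<psi> y - \<psi> x) - k z * dir (y - x) \<phi> z * dir (y - x) \<psi> z\<bar> \<le> e * (norm (y - x))\<^sup>2"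
      by (simp add: p_q_p'_q'_def r_def)
  qed (use d1 d2 d3 in auto)
qed

lemma dir_coord: "dir h (\<lambda>y. y $ i) z = h $ i"
  using sum_axis[of i "\<lambda>j. h $ j"] by (simp add: dir_def if_distrib[of "\<lambda>x. _ * x"] cong: if_cong)

section \<open>First and second variation of a squared length\<close>

text \<open>For a coefficient matrix field \<open>A\<close> the two-point function \<open>\<Sum> A\<^sub>i\<^sub>j(x) (y - x)\<^sub>i (y - x)\<^sub>j\<close> approximates the squared distance if
\<open>A\<close> is close to the metric. The three quantities after it are its derivatives when \<open>x\<close> and \<open>y\<close> move with velocities \<open>V\<close> and \<open>W\<close> and without covariant
acceleration (see \<open>sq_jet\<close>); the last one is polarised, since its trace is needed in different bases.\<close>

definition sq :: "(real^'n::finite \<Rightarrow> real^'n^'n) \<Rightarrow> real^'n \<Rightarrow> real^'n \<Rightarrow> real" where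
  "sq A x y = bform (A x) (y - x) (y - x)"

definition sq_dx :: "(real^'n::finite \<Rightarrow> real^'n^'n) \<Rightarrow> real^'n \<Rightarrow> real^'n \<Rightarrow> real^'n \<Rightarrow> real" where
  "sq_dx A x y V = dir V (\<lambda>\<xi>. bform (A \<xi>) (y - x) (y - x)) x - 2 * bform (A x) (y - x) V"

definition sq_dy :: "(real^'n::finite \<Rightarrow> real^'n^'n) \<Rightarrow> real^'n \<Rightarrow> real^'n \<Rightarrow> real^'n \<Rightarrow> real" where
  "sq_dy A x y W = 2 * bform (A x) (y - x) W"

definition sq_hess :: "(real^'n::finite \<Rightarrow> real^'n^'n) \<Rightarrow> (real^'n \<Rightarrow> real^'n^'n) \<Rightarrow> real^'n \<Rightarrow> real^'n \<Rightarrow>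
    (real^'n) \<times> (real^'n) \<Rightarrow> (real^'n) \<times> (real^'n) \<Rightarrow> real" where
  "sq_hess G A x y P Q = Hess G (\<lambda>\<xi>. bform (A \<xi>) (y - x) (y - x)) x (fst P) (fst Q)
     + 2 * dir (fst P) (\<lambda>\<xi>. bform (A \<xi>) (y - x) (snd Q - fst Q)) x
     + 2 * dir (fst Q) (\<lambda>\<xi>. bform (A \<xi>) (y - x) (snd P - fst P)) x
     + 2 * bform (A x) (snd P - fst P) (snd Q - fst Q)
     + 2 * bform (A x) (y - x) (Gam G x (fst P) (fst Q) - Gam G y (snd P) (snd Q))"

text \<open>For frames at two points that are rotated by the same orthogonal matrix: \<open>P b\<close> will be a pair of vectors.\<close>

lemma orthogonal_trace:
  fixes Q :: "'a::real_vector \<Rightarrow> 'a \<Rightarrow> real" and C :: "'n::finite \<Rightarrow> 'n \<Rightarrow> real"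
  assumes Q: "bilinear Q" and C: "\<And>b b'. (\<Sum>a\<in>UNIV. C a b * C a b') = (if b = b' then 1 else 0)"
  shows "(\<Sum>a\<in>UNIV. Q (\<Sum>b\<in>UNIV. C a b *\<^sub>R P b) (\<Sum>b\<in>UNIV. C a b *\<^sub>R P b)) = (\<Sum>b\<in>UNIV. Q (P b) (P b))"
proof -
  have l1: "linear (\<lambda>x. Q x y)" and l2: "linear (Q y)" for y using Q by (auto simp: bilinear_def)
  have "(\<Sum>a\<in>UNIV. Q (\<Sum>b\<in>UNIV. C a b *\<^sub>R P b) (\<Sum>b\<in>UNIV. C a b *\<^sub>R P b))
     = (\<Sum>a\<in>UNIV. \<Sum>b\<in>UNIV. \<Sum>b'\<in>UNIV. (C a b * C a b') * Q (P b) (P b'))"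
    by (simp add: linear_sum[OF l1] linear_sum[OF l2] linear_cmul[OF l1] linear_cmul[OF l2] sum_distrib_left mult_ac)
      (rule sum.cong[OF refl], subst sum.swap, simp add: mult_ac)
  also have "\<dots> = (\<Sum>b\<in>UNIV. \<Sum>b'\<in>UNIV. \<Sum>a\<in>UNIV. (C a b * C a b') * Q (P b) (P b'))"
    by (subst sum.swap, rule sum.cong[OF refl], rule sum.swap)
  also have "\<dots> = (\<Sum>b\<in>UNIV. Q (P b) (P b))"
    unfolding sum_distrib_right[symmetric] C by (simp add: if_distrib[of "\<lambda>x. x * _"] cong: if_cong)
  finally show ?thesis .
qed

lemma small2_bform:
  fixes \<Phi> \<Psi> :: "real^'n::finite \<Rightarrow> real^'n"
  assumes S: "open S" "z \<in> S" and \<Phi>: "\<And>m. C_k_on 1 S (\<lambda>y. \<Phi> y $ m)" and \<Psi>: "\<And>m. C_k_on 1 S (\<lambda>y. \<Psi> y $ m)"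
    and M: "\<And>i j. continuous_on S (\<lambda>x. M x $ i $ j)"
  shows "small2 z (\<lambda>x y. bform (M x) (\<Phi> y - \<Phi> x) (\<Psi> y - \<Psi> x) - bform (M z) (vdir (y - x) \<Phi> z) (vdir (y - x) \<Psi> z))"
proof -
  have "small2 z (\<lambda>x y. \<Sum>i\<in>UNIV. \<Sum>j\<in>UNIV. M x $ i $ j * (\<Phi> y $ i - \<Phi> x $ i) * (\<Psi> y $ j - \<Psi> x $ j)
      - M z $ i $ j * dir (y - x) (\<lambda>y. \<Phi> y $ i) z * dir (y - x) (\<lambda>y. \<Psi> y $ j) z)"
    by (intro small2_sum small2_product[OF S \<Phi> \<Psi> M])
  then show ?thesis by (simp add: bform_def vdir_def sum_subtractf)
qed

lemma vdir_id [simp]: "vdir h (\<lambda>y. y) z = h"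
  by (simp add: vdir_def dir_coord vec_eq_iff)

context coord_metric
begin

lemma onb_expand:
  assumes x: "x \<in> D" and E: "onb G x E" shows "v = (\<Sum>b\<in>UNIV. bform (G x) v (E b) *\<^sub>R E b)"
proof -
  define p where "p = (\<chi> l. \<Sum>k\<in>UNIV. G x $ l $ k * v $ k)"
  have pw: "p \<bullet> w = bform (G x) w v" for w
    by (simp add: p_def inner_vec_def bform_def sum_distrib_left mult_ac)
  have "sharp x p $ i = v $ i" for i
  proof -
    have "sharp x p $ i = (\<Sum>k\<in>UNIV. (\<Sum>l\<in>UNIV. matrix_inv (G x) $ i $ l * G x $ l $ k) * v $ k)"
      unfolding sharp_def p_def vec_lambda_beta sum_distrib_left sum_distrib_right
      by (subst sum.swap) (simp add: mult_ac)
    then show ?thesis by (simp add: G_inv_sum[OF x] if_distrib[of "\<lambda>x. x * _"] cong: if_cong)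
  qed
  then have "v = sharp x p" by (simp add: vec_eq_iff)
  also have "\<dots> = (\<Sum>b\<in>UNIV. bform (G x) v (E b) *\<^sub>R E b)"
    unfolding sharp_onb[OF E] pw by (simp add: bform_G_commute[OF x, of v])
  finally show ?thesis .
qed

lemma bform_sum_left: "bform A (\<Sum>b\<in>B. f b) v = (\<Sum>b\<in>B. bform A (f b) v)"
  by (rule linear_sum[of "\<lambda>w. bform A w v"]) (auto intro!: linearI)

lemma bform_comb:
  assumes "y \<in> D" "onb G y E"
  shows "bform (G y) (\<Sum>b\<in>UNIV. c b *\<^sub>R E b) (\<Sum>b\<in>UNIV. d b *\<^sub>R E b) = (\<Sum>b\<in>UNIV. c b * d b)"
  by (simp add: bform_sum_left bform_sum_right onb_orthonormal[OF assms] if_distrib[of "\<lambda>x. _ * x"] mult.commute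
      cong: if_cong)

end

lemma Hess_bilinear_C2:
  fixes \<phi> :: "real^'n::finite \<Rightarrow> real"
  assumes "open S" "x \<in> S" "C_k_on 2 S \<phi>"
  shows "bilinear (Hess G \<phi> x)"
  unfolding Hess_def dir_dir_expand[OF assms]
  by (rule bilinearI') (simp_all add: sum.distrib sum_distrib_left algebra_simps)

text \<open>The step cost of a chain uses the metric times a cutoff. All that the estimates need is that the coefficient field \<open>A\<close> agrees with the
metric to second order at \<open>z\<close>.\<close>

locale coord_osculating = coord_soliton D G u for D :: "(real^'n::finite) set" and G and u +
  fixes A :: "real^'n \<Rightarrow> real^'n^'n" and z
  assumes z: "z \<in> D" and A_C2: "C_k_on 2 D (\<lambda>x. A x $ i $ j)"
    and A_sym: "x \<in> D \<Longrightarrow> A x $ i $ j = A x $ j $ i"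
    and A0: "A z = G z"
    and A1: "dir e (\<lambda>x. A x $ i $ j) z = dir e (\<lambda>x. G x $ i $ j) z"
    and A2: "dir e (dir e (\<lambda>x. A x $ i $ j)) z = dir e (dir e (\<lambda>x. G x $ i $ j)) z"
begin

definition DA :: "real^'n \<Rightarrow> real^'n \<Rightarrow> real^'n^'n" where
  "DA e x = (\<chi> i j. dir e (\<lambda>x. A x $ i $ j) x)"

definition DDA :: "real^'n \<Rightarrow> real^'n \<Rightarrow> real^'n^'n" where
  "DDA e x = (\<chi> i j. dir e (dir e (\<lambda>x. A x $ i $ j)) x)"

lemma A_differentiable: "x \<in> D \<Longrightarrow> (\<lambda>x. A x $ i $ j) differentiable (at x)"
  using A_C2[of i j] by (simp add: numeral_2_eq_2)

lemma dirA_C1: "C_k_on 1 D (dir e (\<lambda>x. A x $ i $ j))"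
  using A_C2[of i j] by (intro C_k_on_dir open_D) (simp add: numeral_2_eq_2)

lemma bform_A_C2: "C_k_on 2 D (\<lambda>x. bform (A x) v w)"
  unfolding bform_def by (intro C_k_on_sum C_k_on_mult open_D A_C2 C_k_on_const)

lemma dir_bform_entries:
  assumes "\<And>i j. (\<lambda>x. B x $ i $ j) differentiable (at x)"
  shows "dir e (\<lambda>x. bform (B x) v w) x = bform (\<chi> i j. dir e (\<lambda>x. B x $ i $ j) x) v w"
  unfolding bform_def using assms
  by (simp add: dir_sum differentiable_sum differentiable_mult dir_mult)

lemma dir_A: "x \<in> D \<Longrightarrow> dir e (\<lambda>x. bform (A x) v w) x = bform (DA e x) v w"
  unfolding DA_def by (rule dir_bform_entries) (rule A_differentiable)

lemma dir_dir_A: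
  assumes x: "x \<in> D" shows "dir e (dir e (\<lambda>x. bform (A x) v w)) x = bform (DDA e x) v w"
proof -
  have "dir e (dir e (\<lambda>x. bform (A x) v w)) x = dir e (\<lambda>x. bform (DA e x) v w) x"
    by (rule dir_cong[OF open_D x]) (rule dir_A)
  also have "\<dots> = bform (DDA e x) v w"
    unfolding DA_def DDA_def using dirA_C1 x by (subst dir_bform_entries) auto
  finally show ?thesis .
qed

lemma dir_dir_G:
  assumes x: "x \<in> D" shows "dir e (dir e (\<lambda>x. bform (G x) v w)) x = bform (\<chi> i j. dir e (dir e (\<lambda>x. G x $ i $ j)) x) v w"
proof -
  have "dir e (dir e (\<lambda>x. bform (G x) v w)) x = dir e (\<lambda>x. bform (\<chi> i j. dir e (\<lambda>x. G x $ i $ j) x) v w) x"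
    by (rule dir_cong[OF open_D x]) (rule dir_bform_entries, rule differentiable_basic)
  also have "\<dots> = bform (\<chi> i j. dir e (dir e (\<lambda>x. G x $ i $ j)) x) v w"
  proof (subst dir_bform_entries)
    have "C_k_on 1 D (dir e (\<lambda>x. G x $ i $ j))" for i j by (rule C_k_on_dir[OF open_D G_smooth])
    then show "(\<lambda>x. (\<chi> i j. dir e (\<lambda>x. G x $ i $ j) x) $ i $ j) differentiable at x" for i j
      using x by simp
  qed simp
  finally show ?thesis .
qed

lemma DA_z: "bform (DA e z) v w = dir e (\<lambda>x. bform (G x) v w) z"
  by (subst dir_bform_entries) (simp_all add: DA_def A1 differentiable_basic(1)[OF z])

lemma DDA_z: "bform (DDA e z) v w = dir e (dir e (\<lambda>x. bform (G x) v w)) z"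
  by (simp add: dir_dir_G[OF z] DDA_def A2)

lemma sq_hess_diag:
  assumes x: "x \<in> D"
  shows "sq_hess G A x y (V, W) (V, W) = bform (DDA V x) (y - x) (y - x) - bform (DA (Gam G x V V) x) (y - x) (y - x)
     + 4 * bform (DA V x) (y - x) (W - V) + 2 * bform (A x) (W - V) (W - V)
     + 2 * bform (A x) (y - x) (Gam G x V V - Gam G y W W)"
  unfolding sq_hess_def Hess_def fst_conv snd_conv dir_A[OF x] dir_dir_A[OF x] by simp

lemma sq_hess_bilinear:
  assumes x: "x \<in> D" and y: "y \<in> D"
  shows "bilinear (sq_hess G A x y)"
proof -
  have H: "bilinear (Hess G (\<lambda>\<xi>. bform (A \<xi>) (y - x) (y - x)) x)"
    by (rule Hess_bilinear_C2[OF open_D x bform_A_C2])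
  define H where "H = Hess G (\<lambda>\<xi>. bform (A \<xi>) (y - x) (y - x)) x"
  define d where "d = y - x"
  have Hl: "linear (\<lambda>v. H v w)" "linear (H w)" for w
    using H by (auto simp: bilinear_def H_def)
  have DAl: "bform (DA (a + b) x) v w = bform (DA a x) v w + bform (DA b x) v w"
    "bform (DA (c *\<^sub>R a) x) v w = c * bform (DA a x) v w" for a b c v w
    using dir_A[OF x, symmetric] by simp_all
  have eq: "sq_hess G A x y P Q = H (fst P) (fst Q) + 2 * bform (DA (fst P) x) d (snd Q - fst Q)
     + 2 * bform (DA (fst Q) x) d (snd P - fst P) + 2 * bform (A x) (snd P - fst P) (snd Q - fst Q)
     + 2 * bform (A x) d (Gam G x (fst P) (fst Q) - Gam G y (snd P) (snd Q))" for P Q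
    by (simp only: sq_hess_def dir_A[OF x] d_def H_def)
  show ?thesis
    unfolding bilinear_def eq[abs_def]
    by (auto intro!: linearI simp: linear_add[OF Hl(1)] linear_add[OF Hl(2)] linear_cmul[OF Hl(1)]
        linear_cmul[OF Hl(2)] DAl algebra_simps)
qed

lemma sq_dx_linear: "sq_dx A x y (\<Sum>a\<in>I. c a *\<^sub>R V a) = (\<Sum>a\<in>I. c a * sq_dx A x y (V a))"
proof -
  have l: "linear (sq_dx A x y)" by (rule linearI) (simp_all add: sq_dx_def algebra_simps)
  show ?thesis by (simp add: linear_sum[OF l] linear_cmul[OF l])
qed

lemma sq_dy_linear: "sq_dy A x y (\<Sum>a\<in>I. c a *\<^sub>R V a) = (\<Sum>a\<in>I. c a * sq_dy A x y (V a))"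
proof -
  have l: "linear (sq_dy A x y)" by (rule linearI) (simp_all add: sq_dy_def algebra_simps)
  show ?thesis by (simp add: linear_sum[OF l] linear_cmul[OF l])
qed

context
  fixes S E
  assumes S: "open S" "z \<in> S" "S \<subseteq> D" and E: "\<And>a m. C_k_on 1 S (\<lambda>y. E a y $ m)"
    and onbE: "\<And>y. y \<in> S \<Longrightarrow> onb G y (\<lambda>a. E a y)" and dE: "\<And>a e. vdir e (E a) z = - Gam G z e (E a z)"
begin

lemma coord_C1: "C_k_on 1 S (\<lambda>y. y $ m)" by simp

lemma Z_C1: "C_k_on 1 S (\<lambda>y. Z y $ m)" using C_k_on_subset[OF Z_smooth S(3)] .

lemma cont_entries:
  shows "continuous_on S (\<lambda>x. A x $ i $ j)"
    "continuous_on S (\<lambda>x. DA (E b x) x $ i $ j)" "continuous_on S (\<lambda>x. DA (Z x) x $ i $ j)"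
    "continuous_on S (\<lambda>x. DDA (E b x) x $ i $ j)"
proof -
  have p1: "continuous_on S (partial_d m (\<lambda>x. A x $ i $ j))" for m
    using C_k_on_continuous_on[OF C_k_on_partial, of 1 S "\<lambda>x. A x $ i $ j"] C_k_on_subset[OF A_C2 S(3)]
    by (metis Suc_1)
  have p2: "continuous_on S (partial_d k (partial_d m (\<lambda>x. A x $ i $ j)))" for m k
    using C_k_on_subset[OF A_C2 S(3), of i j] by (simp add: numeral_2_eq_2)
  have cE: "continuous_on S (\<lambda>x. E b x $ m)" for m using C_k_on_continuous_on[OF E] .
  show "continuous_on S (\<lambda>x. A x $ i $ j)" using C_k_on_continuous_on C_k_on_subset[OF A_C2 S(3)] by blast
  show "continuous_on S (\<lambda>x. DA (E b x) x $ i $ j)"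
    unfolding DA_def dir_def vec_lambda_beta by (intro continuous_on_sum continuous_on_mult cE p1)
  show "continuous_on S (\<lambda>x. DA (Z x) x $ i $ j)"
    unfolding DA_def dir_def vec_lambda_beta
    by (intro continuous_on_sum continuous_on_mult C_k_on_continuous_on[OF Z_C1] p1)
  have "continuous_on S (\<lambda>x. \<Sum>k\<in>UNIV. \<Sum>l\<in>UNIV. E b x $ k * E b x $ l * partial_d k (partial_d l (\<lambda>x. A x $ i $ j)) x)"
    by (intro continuous_on_sum continuous_on_mult cE p2)
  then show "continuous_on S (\<lambda>x. DDA (E b x) x $ i $ j)"
  proof (rule continuous_on_eq)
    fix x assume "x \<in> S"
    from dir_dir_expand[OF S(1) this C_k_on_subset[OF A_C2 S(3)]]
    show "(\<Sum>k\<in>UNIV. \<Sum>l\<in>UNIV. E b x $ k * E b x $ l * partial_d k (partial_d l (\<lambda>x. A x $ i $ j)) x) = DDA (E b x) x $ i $ j"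
      by (simp add: DDA_def)
  qed
qed

text \<open>To leading order the first variation under parallel motion of both points is the derivative of the length of a parallel field,
which is zero.\<close>

lemma first_variation_small: "small2 z (\<lambda>x y. sq_dx A x y (E b x) + sq_dy A x y (E b y))"
proof -
  have a: "small2 z (\<lambda>x y. bform (DA (E b x) x) (y - x) (y - x) - bform (DA (E b z) z) (y - x) (y - x))"
    using small2_bform[OF S(1,2) coord_C1 coord_C1, of "\<lambda>x. DA (E b x) x"] cont_entries by simp
  have c: "small2 z (\<lambda>x y. 2 * (bform (A x) (y - x) (E b y - E b x) - bform (A z) (y - x) (vdir (y - x) (E b) z)))"
    using small2_bform[OF S(1,2) coord_C1 E, of A] cont_entries by (intro small2_cmult) simp
  have lim: "bform (DA (E b z) z) h h + 2 * bform (A z) h (vdir h (E b) z) = 0" for h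
    by (simp add: DA_z A0 dE dir_bform_const[OF z] Gam_commute[OF z, of h] bform_G_commute[OF z, of _ h])
  have "small2 z (\<lambda>x y. bform (DA (E b x) x) (y - x) (y - x) + 2 * bform (A x) (y - x) (E b y - E b x))"
    using small2_add[OF a c]
  proof (rule small2_cong[OF _ S(1,2)])
    fix x y
    show "bform (DA (E b x) x) (y - x) (y - x) + 2 * bform (A x) (y - x) (E b y - E b x)
      = bform (DA (E b x) x) (y - x) (y - x) - bform (DA (E b z) z) (y - x) (y - x)
       + 2 * (bform (A x) (y - x) (E b y - E b x) - bform (A z) (y - x) (vdir (y - x) (E b) z))"
      using lim[of "y - x"] by (simp only: right_diff_distrib)
  qed
  then show ?thesis
  proof (rule small2_cong[OF _ S(1,2)])
    fix x y assume "x \<in> S" "y \<in> S"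
    then have x: "x \<in> D" using S by auto
    show "sq_dx A x y (E b x) + sq_dy A x y (E b y) = bform (DA (E b x) x) (y - x) (y - x) + 2 * bform (A x) (y - x) (E b y - E b x)"
      unfolding sq_dx_def sq_dy_def dir_A[OF x] bform_diff(2)[of _ _ "E b y"] by (simp add: algebra_simps)
  qed
qed

text \<open>Freezing all coefficients at \<open>z\<close> leaves the quadratic form of \<open>coupling_identity\<close> in \<open>y - x\<close>, which vanishes.\<close>

lemma second_variation_small:
  "small2 z (\<lambda>x y. (\<Sum>b\<in>UNIV. sq_hess G A x y (E b x, E b y) (E b x, E b y)) + sq_dx A x y (X x) + sq_dy A x y (X y))"
proof -
  let ?f = "\<lambda>b x y. bform (DDA (E b x) x) (y - x) (y - x) + 4 * bform (DA (E b x) x) (y - x) (E b y - E b x)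
      + 2 * bform (A x) (E b y - E b x) (E b y - E b x)"
  let ?fz = "\<lambda>b h. bform (DDA (E b z) z) h h + 4 * bform (DA (E b z) z) h (vdir h (E b) z)
      + 2 * bform (A z) (vdir h (E b) z) (vdir h (E b) z)"
  let ?k = "\<lambda>x y. bform (DA (Z x) x) (y - x) (y - x) + 2 * bform (A x) (y - x) (Z y - Z x)"
  let ?kz = "\<lambda>h. bform (DA (Z z) z) h h + 2 * bform (A z) h (vdir h Z z)"
  have f: "small2 z (\<lambda>x y. ?f b x y - ?fz b (y - x))" for b
  proof -
    have 1: "small2 z (\<lambda>x y. bform (DDA (E b x) x) (y - x) (y - x) - bform (DDA (E b z) z) (y - x) (y - x))"
      using small2_bform[OF S(1,2) coord_C1 coord_C1, of "\<lambda>x. DDA (E b x) x"] cont_entries by simp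
    have 2: "small2 z (\<lambda>x y. 4 * (bform (DA (E b x) x) (y - x) (E b y - E b x) - bform (DA (E b z) z) (y - x) (vdir (y - x) (E b) z)))"
      using small2_bform[OF S(1,2) coord_C1 E, of "\<lambda>x. DA (E b x) x"] cont_entries by (intro small2_cmult) simp
    have 3: "small2 z (\<lambda>x y. 2 * (bform (A x) (E b y - E b x) (E b y - E b x) - bform (A z) (vdir (y - x) (E b) z) (vdir (y - x) (E b) z)))"
      using small2_bform[OF S(1,2) E E, of A] cont_entries by (intro small2_cmult) simp
    have eq: "?f b x y - ?fz b (y - x) = (bform (DDA (E b x) x) (y - x) (y - x) - bform (DDA (E b z) z) (y - x) (y - x))
       + (4 * (bform (DA (E b x) x) (y - x) (E b y - E b x) - bform (DA (E b z) z) (y - x) (vdir (y - x) (E b) z))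
       + 2 * (bform (A x) (E b y - E b x) (E b y - E b x) - bform (A z) (vdir (y - x) (E b) z) (vdir (y - x) (E b) z)))" for x y
      by (simp only: right_diff_distrib)
    show ?thesis unfolding eq by (intro small2_add 1 2 3)
  qed
  have k: "small2 z (\<lambda>x y. ?k x y - ?kz (y - x))"
  proof -
    have 1: "small2 z (\<lambda>x y. bform (DA (Z x) x) (y - x) (y - x) - bform (DA (Z z) z) (y - x) (y - x))"
      using small2_bform[OF S(1,2) coord_C1 coord_C1, of "\<lambda>x. DA (Z x) x"] cont_entries by simp
    have 2: "small2 z (\<lambda>x y. 2 * (bform (A x) (y - x) (Z y - Z x) - bform (A z) (y - x) (vdir (y - x) Z z)))"
      using small2_bform[OF S(1,2) coord_C1 Z_C1, of A] cont_entries by (intro small2_cmult) simp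
    have eq: "?k x y - ?kz (y - x) = (bform (DA (Z x) x) (y - x) (y - x) - bform (DA (Z z) z) (y - x) (y - x))
       + 2 * (bform (A x) (y - x) (Z y - Z x) - bform (A z) (y - x) (vdir (y - x) Z z))" for x y
      by (simp only: right_diff_distrib)
    show ?thesis unfolding eq by (intro small2_add 1 2)
  qed
  have lim: "(\<Sum>b\<in>UNIV. ?fz b h) + ?kz h = 0" for h
    using coupling_identity[OF z onbE[OF S(2)], of h]
    by (simp add: DA_z DDA_z A0 dE)
  have tot: "small2 z (\<lambda>x y. (\<Sum>b\<in>UNIV. ?f b x y) + ?k x y)"
    using small2_add[OF small2_sum[of UNIV z "\<lambda>b x y. ?f b x y - ?fz b (y - x)", OF f] k]
  proof (rule small2_cong[OF _ S(1,2)])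
    fix x y
    show "(\<Sum>b\<in>UNIV. ?f b x y) + ?k x y = (\<Sum>b\<in>UNIV. ?f b x y - ?fz b (y - x)) + (?k x y - ?kz (y - x))"
      unfolding sum_subtractf using lim[of "y - x"] by linarith
  qed
  from tot show ?thesis
  proof (rule small2_cong[OF _ S(1,2)])
    fix x y assume xy: "x \<in> S" "y \<in> S"
    then have x: "x \<in> D" and y: "y \<in> D" using S by auto
    let ?d = "y - x"
    have "bform (DA (Z x) x) ?d ?d = bform (DA (X x) x) ?d ?d - (\<Sum>b\<in>UNIV. bform (DA (Gam G x (E b x) (E b x)) x) ?d ?d)"
    proof -
      have lin: "linear (\<lambda>e. dir e (\<lambda>\<xi>. bform (A \<xi>) ?d ?d) x)" by (auto intro!: linearI)
      show ?thesis
        unfolding dir_A[OF x, symmetric] Z_onb[OF x onbE[OF xy(1)]] dir_vec_diff linear_sum[OF lin] ..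
    qed
    moreover have "bform (A x) ?d (Z y - Z x) = bform (A x) ?d (X y) - bform (A x) ?d (X x)
       + (\<Sum>b\<in>UNIV. bform (A x) ?d (Gam G x (E b x) (E b x) - Gam G y (E b y) (E b y)))"
      by (simp only: Z_onb[OF x onbE[OF xy(1)]] Z_onb[OF y onbE[OF xy(2)]] bform_diff(2)[of _ ?d] bform_sum_right[of _ ?d]
          sum_subtractf)
    ultimately show "(\<Sum>b\<in>UNIV. sq_hess G A x y (E b x, E b y) (E b x, E b y)) + sq_dx A x y (X x) + sq_dy A x y (X y)
       = (\<Sum>b\<in>UNIV. ?f b x y) + ?k x y"
      unfolding sq_hess_diag[OF x] sq_dx_def sq_dy_def dir_A[OF x]
      by (simp only: sum.distrib sum_subtractf sum_distrib_left[symmetric] distrib_left right_diff_distrib)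
  qed
qed

end

end

context coord_soliton
begin

lemma sum_dir_grad:
  assumes x: "x \<in> D" and V: "onb G x V" shows "(\<Sum>a\<in>UNIV. dir (V a) u x *\<^sub>R V a) = X x"
  unfolding grad_sharp sharp_onb[OF V]
  by (rule sum.cong[OF refl]) (simp add: dir_def inner_vec_def mult.commute)

end

context coord_osculating
begin

text \<open>An orthonormal basis is transported from \<open>x\<close> to \<open>y\<close> by keeping its coefficients in a frame that is parallel at \<open>z\<close>. By
\<open>orthogonal_trace\<close> the trace of the second variation does not see this rotation, and by \<open>sum_dir_grad\<close> the drift terms are derivatives along
the gradient; hence the sum is that of the parallel frame, which is negligible by \<open>second_variation_small\<close>. The other two
estimates bound the first variation when both points move, and crudely when only \<open>y\<close> moves. The factor \<open>v\<close> is the cutoff of the step cost.\<close>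

lemma pair_estimate:
  assumes v: "\<And>x. x \<in> D \<Longrightarrow> A x = v x *\<^sub>R G x" "\<And>x. x \<in> D \<Longrightarrow> v x \<ge> 1" "v z = 1" "continuous_on D v"
    and e: "e > 0"
  obtains d where "d > 0" "ball z d \<subseteq> D"
    "\<And>x y V. x \<in> ball z d \<Longrightarrow> y \<in> ball z d \<Longrightarrow> onb G x V \<Longrightarrow> \<exists>W. onb G y W \<and>
      \<bar>(\<Sum>a\<in>UNIV. sq_hess G A x y (V a, W a) (V a, W a)) +
        (\<Sum>a\<in>UNIV. dir (V a) u x * sq_dx A x y (V a) + dir (W a) u y * sq_dy A x y (W a))\<bar> \<le> e * sq A x y \<and>
      (\<forall>a. \<bar>sq_dx A x y (V a) + sq_dy A x y (W a)\<bar> \<le> e * sq A x y) \<and>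
      (\<forall>a. \<bar>sq_dy A x y (W a)\<bar> \<le> 3 * sqrt (sq A x y))"
proof -
  obtain S E where S: "open S" "z \<in> S" "S \<subseteq> D" and E: "\<And>a m. C_k_on 1 S (\<lambda>y. E a y $ m)"
    and onbE: "\<And>y. y \<in> S \<Longrightarrow> onb G y (\<lambda>a. E a y)" and dE: "\<And>a e. vdir e (E a) z = - Gam G z e (E a z)"
    using parallel_frame[OF z] by metis
  note second = second_variation_small[OF S E onbE dE]
  note first = first_variation_small[OF S E onbE dE]
  obtain d0 m where d0: "d0 > 0" "m > 0" "ball z d0 \<subseteq> D"
    "\<And>x h. x \<in> ball z d0 \<Longrightarrow> m * (norm h)\<^sup>2 \<le> bform (G x) h h"
    "\<And>x h. x \<in> ball z d0 \<Longrightarrow> bform (G x) h h \<le> (1 + 1/4) * bform (G z) h h"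
    "\<And>x h. x \<in> ball z d0 \<Longrightarrow> bform (G z) h h \<le> (1 + 1/4) * bform (G x) h h"
    using bform_compare[OF z, of "1/4"] by (metis zero_less_divide_1_iff zero_less_numeral)
  define n where "n = real CARD('n)"
  have n: "n \<ge> 1" by (simp add: n_def Suc_leI)
  define e' where "e' = e * m / n"
  have e': "e' > 0" using e d0 n by (simp add: e'_def)
  obtain d1 where d1: "d1 > 0" "\<And>x y. x \<in> ball z d1 \<Longrightarrow> y \<in> ball z d1 \<Longrightarrow>
     \<bar>(\<Sum>b\<in>UNIV. sq_hess G A x y (E b x, E b y) (E b x, E b y)) + sq_dx A x y (X x) + sq_dy A x y (X y)\<bar> \<le> e' * (norm (y - x))\<^sup>2"
    using small2D[OF second e'] by blast
  have "\<forall>b. \<exists>d>0. \<forall>x\<in>ball z d. \<forall>y\<in>ball z d. \<bar>sq_dx A x y (E b x) + sq_dy A x y (E b y)\<bar> \<le> e' * (norm (y - x))\<^sup>2"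
    using first e' unfolding small2_def by blast
  then obtain d2 where d2: "\<And>b. d2 b > 0" "\<And>b x y. x \<in> ball z (d2 b) \<Longrightarrow> y \<in> ball z (d2 b) \<Longrightarrow>
     \<bar>sq_dx A x y (E b x) + sq_dy A x y (E b y)\<bar> \<le> e' * (norm (y - x))\<^sup>2"
    by metis
  have "isCont v z" using v(4) open_D z continuous_on_eq_continuous_at by blast
  then have "\<exists>d>0. \<forall>x. dist x z < d \<longrightarrow> dist (v x) (v z) < 1/4"
    unfolding continuous_at_eps_delta by (metis zero_less_divide_1_iff zero_less_numeral)
  then obtain d3 where d3: "d3 > 0" "\<And>x. dist x z < d3 \<Longrightarrow> dist (v x) (v z) < 1/4" by blast
  have d3': "v x \<le> 1 + 1/4" if "x \<in> ball z d3" for x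
  proof -
    have "dist x z < d3" using that by (simp add: dist_commute)
    then have "\<bar>v x - 1\<bar> < 1/4" using d3(2)[of x] v(3) by (simp only: dist_real_def)
    then show ?thesis by linarith
  qed
  obtain r where r: "r > 0" "ball z r \<subseteq> S" using S open_contains_ball by blast
  define d where "d = Min (insert d0 (insert d1 (insert d3 (insert r (range d2)))))"
  have d: "d > 0" using d0 d1 d2 d3 r by (simp add: d_def)
  have dle: "d \<le> d0" "d \<le> d1" "d \<le> d3" "d \<le> r" "d \<le> d2 b" for b
    unfolding d_def by (rule Min_le; simp)+
  show ?thesis
  proof (rule that[OF d])
    show "ball z d \<subseteq> D" using dle(1) d0(3) by auto
    fix x y V assume xy: "x \<in> ball z d" "y \<in> ball z d" and V: "onb G x V"
    have xyb: "x \<in> ball z d0" "y \<in> ball z d0" "x \<in> ball z d1" "y \<in> ball z d1" "x \<in> ball z d3"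
      "x \<in> ball z (d2 b)" "y \<in> ball z (d2 b)" "x \<in> S" "y \<in> S" for b
      using xy r subset_ball[OF dle(1), of z] subset_ball[OF dle(2), of z] subset_ball[OF dle(3), of z]
        subset_ball[OF dle(4), of z] subset_ball[OF dle(5)[of b], of z] by blast+
    have xD: "x \<in> D" and yD: "y \<in> D" using xyb S by auto
    have vx: "1 \<le> v x" "v x \<le> 1 + 1/4" using v(2)[OF xD] d3'[OF xyb(5)] by auto
    have Ax: "bform (A x) h k = v x * bform (G x) h k" for h k
      by (simp add: v(1)[OF xD] bform_def sum_distrib_left mult_ac)
    define s where "s = sq A x y"
    have s: "m * (norm (y - x))\<^sup>2 \<le> s"
    proof -
      have "m * (norm (y - x))\<^sup>2 \<le> 1 * bform (G x) (y - x) (y - x)" using d0(4)[OF xyb(1)] by (simp only: mult_1)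
      also have "\<dots> \<le> v x * bform (G x) (y - x) (y - x)"
        by (rule mult_right_mono[OF vx(1) bform_nonneg[OF xD]])
      finally show ?thesis by (simp only: s_def sq_def Ax)
    qed
    have s0: "s \<ge> 0" using s d0(2) by (smt (verit) mult_nonneg_nonneg zero_le_power2)
    have small: "e' * (norm (y - x))\<^sup>2 \<le> e / n * s"
    proof -
      have "e / n * (m * (norm (y - x))\<^sup>2) \<le> e / n * s" using s e n by (intro mult_left_mono) auto
      then show ?thesis by (simp add: e'_def)
    qed
    have "e / n \<le> e" using n e by (simp add: field_simps)
    then have small': "e / n * s \<le> e * s" using s0 by (intro mult_right_mono) auto
    \<comment> \<open>Transport: the same coefficients with respect to the frame at the other point.\<close>
    define C where "C a b = bform (G x) (V a) (E b x)" for a b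
    define W where "W a = (\<Sum>b\<in>UNIV. C a b *\<^sub>R E b y)" for a
    have VE: "V a = (\<Sum>b\<in>UNIV. C a b *\<^sub>R E b x)" for a
      unfolding C_def by (rule onb_expand[OF xD onbE[OF xyb(8)]])
    have Crow: "(\<Sum>b\<in>UNIV. C a b * C a' b) = (if a = a' then 1 else 0)" for a a'
      using bform_comb[OF xD onbE[OF xyb(8)], of "C a" "C a'"] onb_orthonormal[OF xD V, of a a'] VE by simp
    have Ccol: "(\<Sum>a\<in>UNIV. C a b * C a b') = (if b = b' then 1 else 0)" for b b'
    proof -
      have EV: "E b x = (\<Sum>a\<in>UNIV. C a b *\<^sub>R V a)" for b
        using onb_expand[OF xD V, of "E b x"] by (simp add: C_def bform_G_commute[OF xD, of "E b x"])
      show ?thesis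
        using bform_comb[OF xD V, of "\<lambda>a. C a b" "\<lambda>a. C a b'"] EV
          onb_orthonormal[OF xD onbE[OF xyb(8)], of b b'] by simp
    qed
    have Wonb: "onb G y W"
      by (rule onbI[OF yD]) (simp add: W_def bform_comb[OF yD onbE[OF xyb(9)]] Crow)
    have Cle: "\<bar>C a b\<bar> \<le> 1" for a b
    proof -
      have "(C a b)\<^sup>2 \<le> (\<Sum>b\<in>UNIV. (C a b)\<^sup>2)" by (rule member_le_sum) auto
      also have "\<dots> = 1" using Crow[of a a] by (simp add: power2_eq_square)
      finally show ?thesis by (simp add: abs_square_le_1)
    qed
    have pairs: "(V a, W a) = (\<Sum>b\<in>UNIV. C a b *\<^sub>R (E b x, E b y))" for a
      by (simp add: VE[of a] W_def scaleR_prod_def prod_eq_iff fst_sum snd_sum)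
    have P1: "\<bar>(\<Sum>a\<in>UNIV. sq_hess G A x y (V a, W a) (V a, W a)) +
        (\<Sum>a\<in>UNIV. dir (V a) u x * sq_dx A x y (V a) + dir (W a) u y * sq_dy A x y (W a))\<bar> \<le> e * s"
    proof -
      have "(\<Sum>a\<in>UNIV. sq_hess G A x y (V a, W a) (V a, W a)) = (\<Sum>b\<in>UNIV. sq_hess G A x y (E b x, E b y) (E b x, E b y))"
        unfolding pairs by (rule orthogonal_trace[OF sq_hess_bilinear[OF xD yD] Ccol])
      moreover have "(\<Sum>a\<in>UNIV. dir (V a) u x * sq_dx A x y (V a)) = sq_dx A x y (X x)"
        unfolding sum_dir_grad[OF xD V, symmetric] sq_dx_linear ..
      moreover have "(\<Sum>a\<in>UNIV. dir (W a) u y * sq_dy A x y (W a)) = sq_dy A x y (X y)"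
        unfolding sum_dir_grad[OF yD Wonb, symmetric] sq_dy_linear ..
      ultimately show ?thesis
        using d1(2)[OF xyb(3,4)] small small' by (simp add: sum.distrib)
    qed
    have P2: "\<bar>sq_dx A x y (V a) + sq_dy A x y (W a)\<bar> \<le> e * s" for a
    proof -
      have "sq_dx A x y (V a) + sq_dy A x y (W a) = (\<Sum>b\<in>UNIV. C a b * (sq_dx A x y (E b x) + sq_dy A x y (E b y)))"
        unfolding VE[of a] W_def sq_dx_linear sq_dy_linear by (simp add: sum.distrib distrib_left)
      also have "\<bar>\<dots>\<bar> \<le> (\<Sum>b\<in>(UNIV::'n set). e / n * s)"
      proof (intro order_trans[OF sum_abs] sum_mono)
        fix b
        have "\<bar>C a b * (sq_dx A x y (E b x) + sq_dy A x y (E b y))\<bar> \<le> 1 * (e / n * s)"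
          unfolding abs_mult by (intro mult_mono Cle order_trans[OF d2(2)[OF xyb(6,7)] small]) auto
        then show "\<bar>C a b * (sq_dx A x y (E b x) + sq_dy A x y (E b y))\<bar> \<le> e / n * s" by simp
      qed
      also have "\<dots> = e * s" using n by (simp add: n_def)
      finally show ?thesis .
    qed
    have P3: "\<bar>sq_dy A x y (W a)\<bar> \<le> 3 * sqrt s" for a
    proof -
      have W1: "bform (G y) (W a) (W a) = 1" using onb_orthonormal[OF yD Wonb, of a a] by simp
      have "bform (G x) (W a) (W a) \<le> (1 + 1/4) * bform (G z) (W a) (W a)" by (rule d0(5)[OF xyb(1)])
      also have "\<dots> \<le> (1 + 1/4) * ((1 + 1/4) * 1)" using d0(6)[OF xyb(2), of "W a"] W1 by (intro mult_left_mono) auto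
      finally have gx: "bform (G x) (W a) (W a) \<le> 25/16" by simp
      have "(sq_dy A x y (W a))\<^sup>2 = 4 * (v x)\<^sup>2 * (bform (G x) (y - x) (W a))\<^sup>2"
        unfolding sq_dy_def Ax by (simp add: power_mult_distrib)
      also have "\<dots> \<le> 4 * (v x)\<^sup>2 * (bform (G x) (y - x) (y - x) * bform (G x) (W a) (W a))"
        by (intro mult_left_mono bform_Cauchy_Schwarz[OF xD]) auto
      also have "\<dots> = 4 * s * (v x * bform (G x) (W a) (W a))"
        by (simp only: s_def sq_def Ax power2_eq_square mult_ac)
      also have "\<dots> \<le> 4 * s * ((1 + 1/4) * (25/16))"
        using s0 vx bform_nonneg[OF xD, of "W a"] gx by (intro mult_left_mono mult_mono) auto
      also have "\<dots> \<le> (3 * sqrt s)\<^sup>2" using s0 by (simp add: power_mult_distrib)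
      finally have "\<bar>sq_dy A x y (W a)\<bar> \<le> \<bar>3 * sqrt s\<bar>" by (simp only: abs_le_square_iff)
      then show ?thesis using s0 by simp
    qed
    show "\<exists>W. onb G y W \<and>
      \<bar>(\<Sum>a\<in>UNIV. sq_hess G A x y (V a, W a) (V a, W a)) +
        (\<Sum>a\<in>UNIV. dir (V a) u x * sq_dx A x y (V a) + dir (W a) u y * sq_dy A x y (W a))\<bar> \<le> e * sq A x y \<and>
      (\<forall>a. \<bar>sq_dx A x y (V a) + sq_dy A x y (W a)\<bar> \<le> e * sq A x y) \<and>
      (\<forall>a. \<bar>sq_dy A x y (W a)\<bar> \<le> 3 * sqrt (sq A x y))"
      using Wonb P1 P2 P3 unfolding s_def by blast
  qed
qed

end

text \<open>Without covariant acceleration the connection terms cancel, and the second derivative along the path is a value of the Hessian.\<close>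

lemma jet2_unaccelerated:
  assumes j: "\<And>i. jet2 (\<lambda>\<epsilon>. \<zeta> \<epsilon> $ i) (V $ i) (- Gam G x V V $ i)" and x: "\<zeta> 0 = x"
    and S: "open S" "x \<in> S" and \<phi>: "C_k_on 2 S \<phi>"
  shows "jet2 (\<lambda>\<epsilon>. \<phi> (\<zeta> \<epsilon>)) (dir V \<phi> x) (Hess G \<phi> x V V)"
proof -
  have "jet2 (\<lambda>\<epsilon>. \<phi> (\<zeta> \<epsilon>)) (\<Sum>k\<in>UNIV. partial_d k \<phi> (\<zeta> 0) * V $ k)
     ((\<Sum>k\<in>UNIV. \<Sum>l\<in>UNIV. partial_d k (partial_d l \<phi>) (\<zeta> 0) * V $ k * V $ l)
       + (\<Sum>k\<in>UNIV. partial_d k \<phi> (\<zeta> 0) * (- Gam G x V V $ k)))"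
    by (rule jet2_along[OF j S(1) _ \<phi>]) (simp add: x S)
  moreover have "Hess G \<phi> x V V = (\<Sum>k\<in>UNIV. \<Sum>l\<in>UNIV. V $ k * V $ l * partial_d k (partial_d l \<phi>) x)
      - (\<Sum>k\<in>UNIV. Gam G x V V $ k * partial_d k \<phi> x)"
    unfolding Hess_def dir_dir_expand[OF S \<phi>] unfolding dir_def ..
  ultimately show ?thesis by (simp add: x dir_def mult_ac sum_negf)
qed

context coord_metric
begin

lemma sq_jet:
  assumes A: "\<And>i j. C_k_on 2 D (\<lambda>x. A x $ i $ j)" and As: "\<And>x i j. x \<in> D \<Longrightarrow> A x $ i $ j = A x $ j $ i"
    and x: "\<zeta> 0 = x" "x \<in> D" and y: "\<omega> 0 = y" "y \<in> D"
    and \<zeta>: "\<And>i. jet2 (\<lambda>\<epsilon>. \<zeta> \<epsilon> $ i) (V $ i) (- Gam G x V V $ i)"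
    and \<omega>: "\<And>i. jet2 (\<lambda>\<epsilon>. \<omega> \<epsilon> $ i) (W $ i) (- Gam G y W W $ i)"
  shows "jet2 (\<lambda>\<epsilon>. sq A (\<zeta> \<epsilon>) (\<omega> \<epsilon>)) (sq_dx A x y V + sq_dy A x y W) (sq_hess G A x y (V, W) (V, W))"
proof -
  define p where "p = y - x"
  define q where "q = W - V"
  define r where "r = Gam G x V V - Gam G y W W"
  have jA: "jet2 (\<lambda>\<epsilon>. A (\<zeta> \<epsilon>) $ i $ j) (dir V (\<lambda>x. A x $ i $ j) x) (Hess G (\<lambda>x. A x $ i $ j) x V V)" for i j
    by (rule jet2_unaccelerated[OF \<zeta> x(1) open_D x(2) A])
  have jd: "jet2 (\<lambda>\<epsilon>. (\<omega> \<epsilon> - \<zeta> \<epsilon>) $ i) (q $ i) (r $ i)" for i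
    using jet2_diff[OF \<omega>[of i] \<zeta>[of i]] by (simp add: q_def r_def)
  have d0: "\<omega> 0 $ i - x $ i = p $ i" for i by (simp add: x y p_def)
  have "jet2 (\<lambda>\<epsilon>. sq A (\<zeta> \<epsilon>) (\<omega> \<epsilon>))
     (\<Sum>i\<in>UNIV. \<Sum>j\<in>UNIV. (dir V (\<lambda>x. A x $ i $ j) x * p $ i + A x $ i $ j * q $ i) * p $ j + A x $ i $ j * p $ i * q $ j)
     (\<Sum>i\<in>UNIV. \<Sum>j\<in>UNIV. (Hess G (\<lambda>x. A x $ i $ j) x V V * p $ i + 2 * dir V (\<lambda>x. A x $ i $ j) x * q $ i + A x $ i $ j * r $ i) * p $ j
        + 2 * (dir V (\<lambda>x. A x $ i $ j) x * p $ i + A x $ i $ j * q $ i) * q $ j + A x $ i $ j * p $ i * r $ j)"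
    unfolding sq_def bform_def
    by (intro jet2_sum) (use jet2_mult[OF jet2_mult[OF jA jd] jd] in \<open>simp add: d0 x(1)\<close>)
  moreover have "(\<Sum>i\<in>UNIV. \<Sum>j\<in>UNIV. (dir V (\<lambda>x. A x $ i $ j) x * p $ i + A x $ i $ j * q $ i) * p $ j + A x $ i $ j * p $ i * q $ j)
     = sq_dx A x y V + sq_dy A x y W"
  proof -
    have Ad: "(\<lambda>x. A x $ i $ j) differentiable at x" for i j using A[of i j] x(2) by (simp add: numeral_2_eq_2)
    have "dir V (\<lambda>\<xi>. bform (A \<xi>) p p) x = (\<Sum>i\<in>UNIV. \<Sum>j\<in>UNIV. dir V (\<lambda>x. A x $ i $ j) x * p $ i * p $ j)"
      unfolding bform_def using Ad by (simp add: dir_sum differentiable_sum differentiable_mult dir_mult)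
    moreover have "(\<Sum>i\<in>UNIV. \<Sum>j\<in>UNIV. A x $ i $ j * q $ i * p $ j) = bform (A x) p q"
      using bform_commute[OF As[OF x(2)], of p q] by (simp add: bform_def)
    moreover have "(\<Sum>i\<in>UNIV. \<Sum>j\<in>UNIV. A x $ i $ j * p $ i * q $ j) = bform (A x) p q"
      by (simp add: bform_def)
    ultimately show ?thesis
      unfolding sq_dx_def sq_dy_def p_def[symmetric]
      by (simp add: distrib_right sum.distrib) (simp add: q_def)
  qed
  moreover have "(\<Sum>i\<in>UNIV. \<Sum>j\<in>UNIV. (Hess G (\<lambda>x. A x $ i $ j) x V V * p $ i + 2 * dir V (\<lambda>x. A x $ i $ j) x * q $ i + A x $ i $ j * r $ i) * p $ j
        + 2 * (dir V (\<lambda>x. A x $ i $ j) x * p $ i + A x $ i $ j * q $ i) * q $ j + A x $ i $ j * p $ i * r $ j)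
      = sq_hess G A x y (V, W) (V, W)"
  proof -
    have Ad: "(\<lambda>x. A x $ i $ j) differentiable at y" if "y \<in> D" for i j y using A[of i j] that by (simp add: numeral_2_eq_2)
    have dA: "dir e (\<lambda>\<xi>. bform (A \<xi>) h k) y = (\<Sum>i\<in>UNIV. \<Sum>j\<in>UNIV. dir e (\<lambda>x. A x $ i $ j) y * h $ i * k $ j)"
      if "y \<in> D" for e h k y
      unfolding bform_def using Ad[OF that] by (simp add: dir_sum differentiable_sum differentiable_mult dir_mult)
    have ddA: "dir V (dir V (\<lambda>\<xi>. bform (A \<xi>) p p)) x = (\<Sum>i\<in>UNIV. \<Sum>j\<in>UNIV. dir V (dir V (\<lambda>x. A x $ i $ j)) x * p $ i * p $ j)"
    proof -
      have d1: "dir V (\<lambda>x. A x $ i $ j) differentiable at x" for i j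
        using C_k_on_dir[OF open_D, of 1 "\<lambda>x. A x $ i $ j" V] A[of i j] x(2) by (simp add: numeral_2_eq_2)
      have "dir V (dir V (\<lambda>\<xi>. bform (A \<xi>) p p)) x = dir V (\<lambda>y. \<Sum>i\<in>UNIV. \<Sum>j\<in>UNIV. dir V (\<lambda>x. A x $ i $ j) y * p $ i * p $ j) x"
        by (rule dir_cong[OF open_D x(2)]) (rule dA)
      then show ?thesis
        using d1 by (simp add: dir_sum differentiable_sum differentiable_mult dir_mult)
    qed
    have H: "Hess G (\<lambda>\<xi>. bform (A \<xi>) p p) x V V = (\<Sum>i\<in>UNIV. \<Sum>j\<in>UNIV. Hess G (\<lambda>x. A x $ i $ j) x V V * p $ i * p $ j)"
      by (simp add: Hess_def ddA dA[OF x(2)] sum_subtractf left_diff_distrib)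
    have sym: "dir e (\<lambda>x. A x $ i $ j) x = dir e (\<lambda>x. A x $ j $ i) x" for e i j
      by (rule dir_cong[OF open_D x(2)]) (rule As)
    have c1: "(\<Sum>i\<in>UNIV. \<Sum>j\<in>UNIV. dir V (\<lambda>x. A x $ i $ j) x * q $ i * p $ j) = (\<Sum>i\<in>UNIV. \<Sum>j\<in>UNIV. dir V (\<lambda>x. A x $ i $ j) x * p $ i * q $ j)"
      by (subst sum.swap) (simp add: sym[of _ _ j for j] mult_ac sym)
    have c2: "(\<Sum>i\<in>UNIV. \<Sum>j\<in>UNIV. A x $ i $ j * r $ i * p $ j) = (\<Sum>i\<in>UNIV. \<Sum>j\<in>UNIV. A x $ i $ j * p $ i * r $ j)"
      using bform_commute[OF As[OF x(2)], of r p] by (simp add: bform_def)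
    have "sq_hess G A x y (V, W) (V, W) = (\<Sum>i\<in>UNIV. \<Sum>j\<in>UNIV. Hess G (\<lambda>x. A x $ i $ j) x V V * p $ i * p $ j)
       + 4 * (\<Sum>i\<in>UNIV. \<Sum>j\<in>UNIV. dir V (\<lambda>x. A x $ i $ j) x * p $ i * q $ j)
       + 2 * (\<Sum>i\<in>UNIV. \<Sum>j\<in>UNIV. A x $ i $ j * q $ i * q $ j) + 2 * (\<Sum>i\<in>UNIV. \<Sum>j\<in>UNIV. A x $ i $ j * p $ i * r $ j)"
      unfolding sq_hess_def fst_conv snd_conv p_def[symmetric] q_def[symmetric] r_def[symmetric] H dA[OF x(2)]
      by (simp add: bform_def)
    also have "\<dots> = (\<Sum>i\<in>UNIV. \<Sum>j\<in>UNIV. Hess G (\<lambda>x. A x $ i $ j) x V V * p $ i * p $ j)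
       + 2 * (\<Sum>i\<in>UNIV. \<Sum>j\<in>UNIV. dir V (\<lambda>x. A x $ i $ j) x * q $ i * p $ j) + 2 * (\<Sum>i\<in>UNIV. \<Sum>j\<in>UNIV. dir V (\<lambda>x. A x $ i $ j) x * p $ i * q $ j)
       + 2 * (\<Sum>i\<in>UNIV. \<Sum>j\<in>UNIV. A x $ i $ j * q $ i * q $ j) + (\<Sum>i\<in>UNIV. \<Sum>j\<in>UNIV. A x $ i $ j * r $ i * p $ j)
       + (\<Sum>i\<in>UNIV. \<Sum>j\<in>UNIV. A x $ i $ j * p $ i * r $ j)"
      unfolding c1 c2 by simp
    also have "\<dots> = (\<Sum>i\<in>UNIV. \<Sum>j\<in>UNIV. (Hess G (\<lambda>x. A x $ i $ j) x V V * p $ i + 2 * dir V (\<lambda>x. A x $ i $ j) x * q $ i + A x $ i $ j * r $ i) * p $ j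
        + 2 * (dir V (\<lambda>x. A x $ i $ j) x * p $ i + A x $ i $ j * q $ i) * q $ j + A x $ i $ j * p $ i * r $ j)"
      by (simp add: distrib_left distrib_right sum.distrib sum_distrib_left mult.assoc)
    finally show ?thesis by simp
  qed
  ultimately show ?thesis by simp
qed

end

section \<open>Charts of a Riemannian manifold\<close>

lemma Gam_axis: "Gam G x (axis i 1) (axis j 1) $ k = christoffel G k i j x"
proof -
  have "Gam G x (axis i 1) (axis j 1) $ k = (\<Sum>a\<in>UNIV. axis i 1 $ a * (\<Sum>b\<in>UNIV. axis j 1 $ b * christoffel G k a b x))"
    unfolding Gam_def vec_lambda_beta sum_distrib_left by (simp only: mult_ac)
  then show ?thesis by (simp only: sum_axis)
qed

lemma hessian_coord_eq: "hessian_coord G u i j x = Hess G u x (axis i 1) (axis j 1)"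
proof -
  have "dir (axis j 1) u = partial_d j u" by (rule ext) simp
  then have "dir (axis i 1) (dir (axis j 1) u) x = partial_d i (partial_d j u) x" by simp
  then show ?thesis
    by (simp only: hessian_coord_def Hess_def) (simp add: dir_def Gam_axis)
qed

lemma ricci_coord_eq: "ricci_coord G j k x = Ric G x (axis j 1) (axis k 1)"
proof -
  have D: "DGam G x (axis i 1) (axis j 1) (axis k 1) $ l = partial_d i (christoffel G l j k) x" for i j k l
  proof -
    have "(\<lambda>y. Gam G y (axis j 1) (axis k 1) $ l) = christoffel G l j k" by (rule ext) (rule Gam_axis)
    then show ?thesis by (simp add: DGam_def vdir_def)
  qed
  have GG: "Gam G x (axis i 1) (Gam G x (axis j 1) (axis k 1)) $ l = (\<Sum>m\<in>UNIV. christoffel G l i m x * christoffel G m j k x)" for i j k l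
  proof -
    have "Gam G x (axis i 1) w $ l = (\<Sum>a\<in>UNIV. axis i 1 $ a * (\<Sum>b\<in>UNIV. christoffel G l a b x * w $ b))" for w
      unfolding Gam_def vec_lambda_beta sum_distrib_left by (simp only: mult_ac)
    then show ?thesis by (simp only: sum_axis Gam_axis)
  qed
  show ?thesis
    unfolding ricci_coord_def riemann_coord_def Ric_def Riem_def
    by (intro sum.cong refl) (simp add: D GG sum_subtractf)
qed

locale riemannian =
  fixes \<A> :: "('m::{t2_space,second_countable_topology}, 'n::finite) chart set" and g :: "'m metric"
  assumes atlas: "smooth_atlas \<A>" and metric: "riemannian_metric \<A> g"
begin

lemma chart_open: "c \<in> \<A> \<Longrightarrow> open (fst c)" "c \<in> \<A> \<Longrightarrow> open (coord_range c)"
  using atlas by (auto simp: smooth_atlas_def)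

lemma chart_homeo: "c \<in> \<A> \<Longrightarrow> homeomorphism (fst c) (coord_range c) (snd c) (chart_inv c)"
  using atlas by (auto simp: smooth_atlas_def)

lemma chart_inv_chart [simp]: "c \<in> \<A> \<Longrightarrow> p \<in> fst c \<Longrightarrow> chart_inv c (snd c p) = p"
  using chart_homeo by (auto simp: homeomorphism_def)

lemma chart_chart_inv [simp]: "c \<in> \<A> \<Longrightarrow> x \<in> coord_range c \<Longrightarrow> snd c (chart_inv c x) = x"
  using chart_homeo by (auto simp: homeomorphism_def)

lemma chart_inv_in: "c \<in> \<A> \<Longrightarrow> x \<in> coord_range c \<Longrightarrow> chart_inv c x \<in> fst c"
proof -
  assume "c \<in> \<A>" "x \<in> coord_range c"
  then have "chart_inv c ` coord_range c = fst c" using chart_homeo[of c] by (simp add: homeomorphism_def)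
  then show ?thesis using \<open>x \<in> coord_range c\<close> by blast
qed

lemma chart_in [simp]: "p \<in> fst c \<Longrightarrow> snd c p \<in> coord_range c"
  by (simp add: coord_range_def)

lemma chart_continuous: "c \<in> \<A> \<Longrightarrow> continuous_on (fst c) (snd c)" "c \<in> \<A> \<Longrightarrow> continuous_on (coord_range c) (chart_inv c)"
  using chart_homeo by (auto simp: homeomorphism_def)

lemma chart_cover: obtains c where "c \<in> \<A>" "p \<in> fst c"
proof -
  have "p \<in> (\<Union>c\<in>\<A>. fst c)" using atlas by (simp add: smooth_atlas_def)
  then show ?thesis using that by blast
qed

lemma chart_at: "chart_at \<A> p \<in> \<A>" "p \<in> fst (chart_at \<A> p)"
proof -
  have "\<exists>c. c \<in> \<A> \<and> p \<in> fst c" using chart_cover[of p] by metis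
  then have "chart_at \<A> p \<in> \<A> \<and> p \<in> fst (chart_at \<A> p)" unfolding chart_at_def by (rule someI_ex)
  then show "chart_at \<A> p \<in> \<A>" "p \<in> fst (chart_at \<A> p)" by auto
qed

lemma open_chart_image:
  assumes c: "c \<in> \<A>" and S: "open S"
  shows "open (snd c ` (fst c \<inter> S))"
proof -
  have "snd c ` (fst c \<inter> S) = coord_range c \<inter> chart_inv c -` S"
    using c by (auto simp: coord_range_def chart_inv_in)
  then show ?thesis
    using continuous_on_open_vimage[OF chart_open(2)[OF c], THEN iffD1, OF chart_continuous(2)[OF c]] S
    by (simp add: Int_commute)
qed

lemma chart_vimage_open:
  assumes c: "c \<in> \<A>" and U: "open U" shows "open {p \<in> fst c. snd c p \<in> U}"
proof -
  have "open (snd c -` U \<inter> fst c)"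
    by (rule continuous_on_open_vimage[OF chart_open(1)[OF c], THEN iffD1, OF chart_continuous(1)[OF c], rule_format, OF U])
  moreover have "snd c -` U \<inter> fst c = {p \<in> fst c. snd c p \<in> U}" by auto
  ultimately show ?thesis by simp
qed

abbreviation ov :: "('m, 'n) chart \<Rightarrow> ('m, 'n) chart \<Rightarrow> (real^'n) set" where
  "ov c c' \<equiv> snd c ` (fst c \<inter> fst c')"

abbreviation tr :: "('m, 'n) chart \<Rightarrow> ('m, 'n) chart \<Rightarrow> real^'n \<Rightarrow> real^'n" where
  "tr c c' \<equiv> \<lambda>x. snd c' (chart_inv c x)"

abbreviation G :: "('m, 'n) chart \<Rightarrow> real^'n \<Rightarrow> real^'n^'n" where
  "G \<equiv> metric_coord \<A> g"

lemma open_ov: "c \<in> \<A> \<Longrightarrow> c' \<in> \<A> \<Longrightarrow> open (ov c c')"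
  by (rule open_chart_image) (auto simp: chart_open)

lemma tr_smooth: "c \<in> \<A> \<Longrightarrow> c' \<in> \<A> \<Longrightarrow> C_k_on k (ov c c') (\<lambda>x. tr c c' x $ i)"
  using atlas by (auto simp: smooth_atlas_def C_infinity_on_def)

section \<open>Tangent vectors and the change of the metric\<close>

lemma smooth_fun_on_subset: "smooth_fun_on \<A> S u \<Longrightarrow> T \<subseteq> S \<Longrightarrow> smooth_fun_on \<A> T u"
  unfolding smooth_fun_on_def C_infinity_on_def by (meson C_k_on_subset Int_mono image_mono order_refl)

lemma smooth_near_lin:
  assumes "u \<in> smooth_near \<A> p" "v \<in> smooth_near \<A> p"
  shows "(\<lambda>q. a * u q + b * v q) \<in> smooth_near \<A> p" "(\<lambda>q. u q * v q) \<in> smooth_near \<A> p"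
proof -
  obtain S T where S: "open S" "p \<in> S" "smooth_fun_on \<A> S u" and T: "open T" "p \<in> T" "smooth_fun_on \<A> T v"
    using assms unfolding smooth_near_def by blast
  have o: "open (S \<inter> T)" "p \<in> S \<inter> T" using S T by auto
  have uv: "smooth_fun_on \<A> (S \<inter> T) u" "smooth_fun_on \<A> (S \<inter> T) v"
    using S T smooth_fun_on_subset by auto
  have "smooth_fun_on \<A> (S \<inter> T) (\<lambda>q. a * u q + b * v q)" "smooth_fun_on \<A> (S \<inter> T) (\<lambda>q. u q * v q)"
    using uv open_chart_image[OF _ o(1)] unfolding smooth_fun_on_def C_infinity_on_def
    by (auto intro!: C_k_on_add C_k_on_mult C_k_on_cmult)
  then show "(\<lambda>q. a * u q + b * v q) \<in> smooth_near \<A> p" "(\<lambda>q. u q * v q) \<in> smooth_near \<A> p"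
    using o unfolding smooth_near_def by blast+
qed

lemma smooth_near_chart:
  assumes "u \<in> smooth_near \<A> p" "c \<in> \<A>" "p \<in> fst c"
  obtains S where "open S" "snd c p \<in> S" "S \<subseteq> coord_range c" "\<And>k. C_k_on k S (\<lambda>x. u (chart_inv c x))"
proof -
  obtain S where S: "open S" "p \<in> S" "smooth_fun_on \<A> S u"
    using assms unfolding smooth_near_def by blast
  show ?thesis
    by (rule that[of "snd c ` (fst c \<inter> S)"])
      (use S assms open_chart_image in \<open>auto simp: smooth_fun_on_def C_infinity_on_def coord_range_def\<close>)
qed

lemma smooth_near_differentiable:
  assumes "u \<in> smooth_near \<A> p" "c \<in> \<A>" "p \<in> fst c"
  shows "(\<lambda>x. u (chart_inv c x)) differentiable (at (snd c p))"
  using smooth_near_chart[OF assms] C_k_on_differentiable by metis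

lemma coord_fun_smooth_near:
  assumes "c \<in> \<A>" "p \<in> fst c" shows "(\<lambda>q. snd c q $ i) \<in> smooth_near \<A> p"
proof -
  have "smooth_fun_on \<A> (fst c) (\<lambda>q. snd c q $ i)"
    unfolding smooth_fun_on_def C_infinity_on_def using tr_smooth assms by blast
  then show ?thesis unfolding smooth_near_def using chart_open(1)[OF assms(1)] assms(2) by blast
qed

lemma coord_vector_tangent:
  assumes c: "c \<in> \<A>" "p \<in> fst c" shows "coord_vector \<A> c p i \<in> tangent_space \<A> p"
  unfolding tangent_space_def
proof (intro CollectI conjI ballI allI impI)
  fix u v a b assume uv: "u \<in> smooth_near \<A> p" "v \<in> smooth_near \<A> p"
  note d = smooth_near_differentiable[OF _ c]
  show "coord_vector \<A> c p i (\<lambda>q. a * u q + b * v q) = a * coord_vector \<A> c p i u + b * coord_vector \<A> c p i v"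
    using uv smooth_near_lin[OF uv] d[OF uv(1)] d[OF uv(2)]
    by (simp add: coord_vector_def partial_d_add partial_d_cmult differentiable_mult)
  show "coord_vector \<A> c p i (\<lambda>q. u q * v q) = u p * coord_vector \<A> c p i v + v p * coord_vector \<A> c p i u"
    using uv smooth_near_lin[OF uv] d[OF uv(1)] d[OF uv(2)] c
    by (simp add: coord_vector_def partial_d_mult)
qed (simp add: coord_vector_def)

lemma tangent_lin:
  assumes "X \<in> tangent_space \<A> p" "Y \<in> tangent_space \<A> p"
  shows "(\<lambda>u. a * X u + b * Y u) \<in> tangent_space \<A> p"
proof -
  note T = assms[unfolded tangent_space_def mem_Collect_eq]
  show ?thesis
    unfolding tangent_space_def
  proof (intro CollectI conjI ballI allI impI)
    fix u assume "u \<notin> smooth_near \<A> p"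
    then show "a * X u + b * Y u = 0" using T by simp
  next
    fix u v a' b' assume uv: "u \<in> smooth_near \<A> p" "v \<in> smooth_near \<A> p"
    then show "a * X (\<lambda>q. a' * u q + b' * v q) + b * Y (\<lambda>q. a' * u q + b' * v q) = a' * (a * X u + b * Y u) + b' * (a * X v + b * Y v)"
      using T by (simp add: algebra_simps)
    show "a * X (\<lambda>q. u q * v q) + b * Y (\<lambda>q. u q * v q) = u p * (a * X v + b * Y v) + v p * (a * X u + b * Y u)"
      using T uv by (simp add: algebra_simps)
  qed
qed

lemma tangent_zero: "(\<lambda>u. 0) \<in> tangent_space \<A> p"
  by (simp add: tangent_space_def)

lemma tangent_sum:
  assumes "\<And>i. i \<in> I \<Longrightarrow> X i \<in> tangent_space \<A> p" "finite I"
  shows "(\<lambda>u. \<Sum>i\<in>I. a i * X i u) \<in> tangent_space \<A> p"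
  using assms(2,1)
proof induction
  case (insert i I)
  then show ?case using tangent_lin[of "X i" p "\<lambda>u. \<Sum>i\<in>I. a i * X i u" "a i" 1] by simp
qed (simp add: tangent_zero)

lemma g_sym: "X \<in> tangent_space \<A> p \<Longrightarrow> Y \<in> tangent_space \<A> p \<Longrightarrow> g p X Y = g p Y X"
  using metric unfolding riemannian_metric_def by blast

lemma g_lin: "X \<in> tangent_space \<A> p \<Longrightarrow> Y \<in> tangent_space \<A> p \<Longrightarrow> Z \<in> tangent_space \<A> p \<Longrightarrow>
    g p (\<lambda>u. a * X u + b * Y u) Z = a * g p X Z + b * g p Y Z"
  using metric unfolding riemannian_metric_def by blast

lemma g_pos: "X \<in> tangent_space \<A> p \<Longrightarrow> X \<noteq> (\<lambda>u. 0) \<Longrightarrow> g p X X > 0"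
  using metric unfolding riemannian_metric_def by blast

lemma g_sum_left:
  assumes "finite I" "\<And>i. i \<in> I \<Longrightarrow> X i \<in> tangent_space \<A> p" "Z \<in> tangent_space \<A> p"
  shows "g p (\<lambda>u. \<Sum>i\<in>I. a i * X i u) Z = (\<Sum>i\<in>I. a i * g p (X i) Z)"
  using assms
proof induction
  case empty
  then show ?case using g_lin[OF tangent_zero tangent_zero empty(2), of 0 0] by simp
next
  case (insert i I)
  then show ?case using g_lin[of "X i" p "\<lambda>u. \<Sum>i\<in>I. a i * X i u" Z "a i" 1] tangent_sum[of I X p a] by simp
qed

lemma g_sum:
  assumes "\<And>i. X i \<in> tangent_space \<A> p" "\<And>i. Y i \<in> tangent_space \<A> p"
  shows "g p (\<lambda>u. \<Sum>i\<in>UNIV. a (i::'n) * X i u) (\<lambda>u. \<Sum>j\<in>UNIV. b (j::'n) * Y j u)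
    = (\<Sum>i\<in>UNIV. \<Sum>j\<in>UNIV. a i * b j * g p (X i) (Y j))"
proof -
  have Yt: "(\<lambda>u. \<Sum>j\<in>UNIV. b j * Y j u) \<in> tangent_space \<A> p" by (rule tangent_sum) (auto simp: assms)
  have "g p (X i) (\<lambda>u. \<Sum>j\<in>UNIV. b j * Y j u) = (\<Sum>j\<in>UNIV. b j * g p (X i) (Y j))" for i
    using g_sym[OF assms(1) Yt] g_sum_left[of UNIV Y p "X i" b] g_sym[OF assms(1) assms(2)] assms by simp
  then show ?thesis
    using g_sum_left[of UNIV X p _ a] Yt assms by (simp add: sum_distrib_left mult_ac)
qed

definition vec_tangent :: "('m, 'n) chart \<Rightarrow> 'm \<Rightarrow> real^'n \<Rightarrow> 'm tangent" where
  "vec_tangent c p v = (\<lambda>u. \<Sum>i\<in>UNIV. v $ i * coord_vector \<A> c p i u)"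

lemma vec_tangent_tangent: "c \<in> \<A> \<Longrightarrow> p \<in> fst c \<Longrightarrow> vec_tangent c p v \<in> tangent_space \<A> p"
  unfolding vec_tangent_def by (rule tangent_sum) (auto intro: coord_vector_tangent)

lemma g_vec_tangent:
  assumes c: "c \<in> \<A>" "p \<in> fst c"
  shows "g p (vec_tangent c p v) (vec_tangent c p w) = bform (G c (snd c p)) v w"
  unfolding vec_tangent_def g_sum[of "coord_vector \<A> c p" p "coord_vector \<A> c p", OF coord_vector_tangent[OF c] coord_vector_tangent[OF c]]
  using c by (simp add: bform_def metric_coord_def mult_ac)

lemma vec_tangent_dir:
  assumes c: "c \<in> \<A>" "p \<in> fst c" and u: "u \<in> smooth_near \<A> p"
  shows "vec_tangent c p v u = dir v (\<lambda>x. u (chart_inv c x)) (snd c p)"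
  using u by (simp add: vec_tangent_def coord_vector_def dir_def)

lemma vec_tangent_nonzero:
  assumes c: "c \<in> \<A>" "p \<in> fst c" and v: "v \<noteq> 0" shows "vec_tangent c p v \<noteq> (\<lambda>u. 0)"
proof
  assume z: "vec_tangent c p v = (\<lambda>u. 0)"
  have "v $ i = 0" for i
  proof -
    have "vec_tangent c p v (\<lambda>q. snd c q $ i) = dir v (\<lambda>x. snd c (chart_inv c x) $ i) (snd c p)"
      by (rule vec_tangent_dir[OF c coord_fun_smooth_near[OF c]])
    also have "\<dots> = dir v (\<lambda>x. x $ i) (snd c p)"
      by (rule dir_cong[OF chart_open(2)[OF c(1)]]) (use c in auto)
    finally show ?thesis by (simp add: z dir_coord)
  qed
  then show False using v by (simp add: vec_eq_iff)
qed

lemma coord_metric_chart: assumes c: "c \<in> \<A>" shows "coord_metric (coord_range c) (G c)"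
proof
  show "open (coord_range c)" by (rule chart_open(2)[OF c])
  fix x assume x: "x \<in> coord_range c"
  let ?p = "chart_inv c x"
  have p: "?p \<in> fst c" "snd c ?p = x" using chart_inv_in[OF c x] c x by auto
  show "G c x $ i $ j = G c x $ j $ i" for i j
    using g_sym[OF coord_vector_tangent[OF c p(1)] coord_vector_tangent[OF c p(1)]] by (simp add: metric_coord_def)
  show "bform (G c x) v v > 0" if "v \<noteq> 0" for v
    using g_pos[OF vec_tangent_tangent[OF c p(1)] vec_tangent_nonzero[OF c p(1) that]] g_vec_tangent[OF c p(1), of v v] p(2)
    by simp
next
  show "C_k_on k (coord_range c) (\<lambda>x. G c x $ i $ j)" for k i j
    using metric c by (auto simp: riemannian_metric_def C_infinity_on_def)
qed

lemma dir_tr: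
  assumes c: "c \<in> \<A>" "c' \<in> \<A>" and x: "x \<in> ov c c'" and \<phi>: "\<phi> differentiable (at (tr c c' x))"
  shows "dir v (\<lambda>x. \<phi> (tr c c' x)) x = dir (vdir v (tr c c') x) \<phi> (tr c c' x)"
proof -
  have d: "(\<lambda>x. tr c c' x $ i) differentiable (at x)" for i
    using C_k_on_differentiable[OF tr_smooth[OF c] x] .
  have "dir v (\<lambda>x. \<phi> (tr c c' x)) x = (\<Sum>m\<in>UNIV. \<Sum>k\<in>UNIV. v $ m * (partial_d k \<phi> (tr c c' x) * partial_d m (\<lambda>x. tr c c' x $ k) x))"
    by (simp add: dir_def partial_d_compose(1)[OF d \<phi>] sum_distrib_left)
  also have "\<dots> = dir (vdir v (tr c c') x) \<phi> (tr c c' x)"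
    by (subst sum.swap) (simp add: dir_def vdir_def sum_distrib_left sum_distrib_right mult_ac)
  finally show ?thesis .
qed

lemma vec_tangent_change:
  assumes c: "c \<in> \<A>" "c' \<in> \<A>" and p: "p \<in> fst c" "p \<in> fst c'"
  shows "vec_tangent c p v = vec_tangent c' p (vdir v (tr c c') (snd c p))"
proof
  fix u
  show "vec_tangent c p v u = vec_tangent c' p (vdir v (tr c c') (snd c p)) u"
  proof (cases "u \<in> smooth_near \<A> p")
    case True
    have x: "snd c p \<in> ov c c'" using p by auto
    have "dir v (\<lambda>x. u (chart_inv c x)) (snd c p) = dir v (\<lambda>x. u (chart_inv c' (tr c c' x))) (snd c p)"
      by (rule dir_cong[OF open_ov[OF c] x]) (use c in auto)
    also have "\<dots> = dir (vdir v (tr c c') (snd c p)) (\<lambda>x. u (chart_inv c' x)) (tr c c' (snd c p))"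
      by (rule dir_tr[OF c x]) (use smooth_near_differentiable[OF True c(2) p(2)] c p in simp)
    finally show ?thesis
      using c p by (simp add: vec_tangent_dir[OF _ _ True])
  qed (simp add: vec_tangent_def coord_vector_def)
qed

text \<open>The derivative of the transition map takes the components of a vector in one chart to those in the other, because both describe
the same derivation.\<close>

lemma metric_change:
  assumes c: "c \<in> \<A>" "c' \<in> \<A>" and x: "x \<in> ov c c'"
  shows "bform (G c x) v w = bform (G c' (tr c c' x)) (vdir v (tr c c') x) (vdir w (tr c c') x)"
proof -
  obtain p where p: "p \<in> fst c" "p \<in> fst c'" "x = snd c p" using x by auto
  show ?thesis
    using g_vec_tangent[OF c(1) p(1), of v w] c p
    by (simp add: vec_tangent_change[OF c p(1,2)] g_vec_tangent[OF c(2) p(2)])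
qed

section \<open>Transformation of the connection\<close>

lemma vdir_tr_smooth:
  assumes c: "c \<in> \<A>" "c' \<in> \<A>" shows "C_k_on k (ov c c') (\<lambda>x. vdir v (tr c c') x $ m)"
  unfolding vdir_def vec_lambda_beta by (rule C_k_on_dir[OF open_ov[OF c] tr_smooth[OF c]])

lemma vdir_tr_onto:
  assumes c: "c \<in> \<A>" "c' \<in> \<A>" and x: "x \<in> ov c c'"
  obtains w where "vdir w (tr c c') x = h"
proof -
  interpret M: coord_metric "coord_range c" "G c" by (rule coord_metric_chart[OF c(1)])
  have xD: "x \<in> coord_range c" using x by (auto simp: coord_range_def)
  have lin: "linear (\<lambda>w. vdir w (tr c c') x)" by (rule linearI) auto
  have "inj (\<lambda>w. vdir w (tr c c') x)"
    unfolding linear_injective_0[OF lin]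
  proof (intro allI impI)
    fix w assume "vdir w (tr c c') x = 0"
    then have "bform (G c x) w w = 0" by (simp add: metric_change[OF c x])
    then show "w = 0" using M.G_pos[OF xD, of w] by fastforce
  qed
  then have "surj (\<lambda>w. vdir w (tr c c') x)" using lin linear_injective_imp_surjective by blast
  then obtain w where "h = vdir w (tr c c') x" by (rule surjE)
  then show ?thesis using that by simp
qed

text \<open>The transformation law of the Christoffel symbols. The difference of both sides is symmetric in \<open>v\<close> and \<open>w\<close>; paired with a third vector it
is skew in another pair of arguments, by differentiating \<open>metric_change\<close>. As in the uniqueness proof for the Levi-Civita connection, it
vanishes.\<close>

lemma christoffel_change:
  assumes c: "c \<in> \<A>" "c' \<in> \<A>" and x: "x \<in> ov c c'"
  shows "vdir v (vdir w (tr c c')) x + Gam (G c') (tr c c' x) (vdir v (tr c c') x) (vdir w (tr c c') x)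
     = vdir (Gam (G c) x v w) (tr c c') x"
proof -
  interpret M: coord_metric "coord_range c" "G c" by (rule coord_metric_chart[OF c(1)])
  interpret M': coord_metric "coord_range c'" "G c'" by (rule coord_metric_chart[OF c(2)])
  let ?J = "\<lambda>v. vdir v (tr c c')"
  let ?y = "tr c c' x"
  have xD: "x \<in> coord_range c" using x by (auto simp: coord_range_def)
  have yD: "?y \<in> coord_range c'" using x c by (auto simp: coord_range_def)
  define T where "T v w = vdir v (?J w) x + Gam (G c') ?y (?J v x) (?J w x) - ?J (Gam (G c) x v w) x" for v w
  have Tsym: "T v w = T w v" for v w
    using vdir_commute[OF open_ov[OF c] x tr_smooth[OF c], of v w] M'.Gam_commute[OF yD, of "?J v x"] M.Gam_commute[OF xD, of v]
    by (simp add: T_def)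
  define t where "t z v w = bform (G c' ?y) (T z v) (?J w x)" for z v w
  have skew: "t z v w + t z w v = 0" for z v w
  proof -
    have JJ: "(\<lambda>x. ?J v x $ k) differentiable (at x)" for v k
      using C_k_on_differentiable[OF vdir_tr_smooth[OF c] x] .
    have sub: "tr c c' ` (ov c c') \<subseteq> coord_range c'" using c by (auto simp: coord_range_def)
    have "C_k_on 1 (ov c c') (\<lambda>x. G c' (tr c c' x) $ i $ j)" for i j
      by (rule C_k_on_compose[OF open_ov[OF c] tr_smooth[OF c] sub M'.G_smooth])
    then have Gd: "(\<lambda>x. G c' (tr c c' x) $ i $ j) differentiable (at x)" for i j
      using C_k_on_differentiable[of 0, OF _ x] by simp
    have bd: "(\<lambda>y. bform (G c' y) a b) differentiable (at ?y)" for a b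
      unfolding bform_def using M'.differentiable_basic(1)[OF yD] by (intro differentiable_sum differentiable_mult) auto
    have "dir z (\<lambda>x. bform (G c' (tr c c' x)) (?J v x) (?J w x)) x
       = dir z (\<lambda>x. bform (G c' (tr c c' x)) (?J v x0) (?J w x0)) x
         + bform (G c' ?y) (vdir z (?J v) x) (?J w x) + bform (G c' ?y) (?J v x) (vdir z (?J w) x)"
      if "x0 = x" for x0
      unfolding bform_def using that JJ Gd
      by (simp add: dir_sum dir_mult differentiable_sum differentiable_mult vdir_component[symmetric] sum.distrib algebra_simps)
    from this[OF refl] have "dir z (\<lambda>x. bform (G c' (tr c c' x)) (?J v x) (?J w x)) x
       = dir (?J z x) (\<lambda>y. bform (G c' y) (?J v x) (?J w x)) ?y
         + bform (G c' ?y) (vdir z (?J v) x) (?J w x) + bform (G c' ?y) (?J v x) (vdir z (?J w) x)"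
      using dir_tr[OF c x bd] by simp
    also have "dir (?J z x) (\<lambda>y. bform (G c' y) (?J v x) (?J w x)) ?y
       = bform (G c' ?y) (Gam (G c') ?y (?J z x) (?J v x)) (?J w x) + bform (G c' ?y) (?J v x) (Gam (G c') ?y (?J z x) (?J w x))"
      by (rule M'.dir_bform_const[OF yD])
    also have "dir z (\<lambda>x. bform (G c' (tr c c' x)) (?J v x) (?J w x)) x = dir z (\<lambda>x. bform (G c x) v w) x"
      by (rule dir_cong[OF open_ov[OF c] x]) (rule metric_change[OF c, symmetric])
    also have "dir z (\<lambda>x. bform (G c x) v w) x = bform (G c' ?y) (?J (Gam (G c) x z v) x) (?J w x) + bform (G c' ?y) (?J v x) (?J (Gam (G c) x z w) x)"
      by (simp add: M.dir_bform_const[OF xD] metric_change[OF c x])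
    finally show ?thesis
      unfolding t_def T_def using M'.bform_G_commute[OF yD, of "?J v x"] by simp
  qed
  have t0: "t z v w = 0" for z v w
  proof -
    have s: "t a b d = t b a d" for a b d by (simp add: t_def Tsym)
    show ?thesis using skew[of z v w] skew[of v w z] skew[of w z v] s by (smt (verit))
  qed
  obtain h where "?J h x = T v w" using vdir_tr_onto[OF c x] .
  then have "bform (G c' ?y) (T v w) (T v w) = 0" using t0[of v w h] by (simp add: t_def)
  then have "T v w = 0" using M'.G_pos[OF yD, of "T v w"] by fastforce
  then show ?thesis by (simp add: T_def)
qed

end

lemma (in coord_function) energy_onb:
  assumes x: "x \<in> D" and V: "onb G x V" shows "energy x = (\<Sum>a\<in>UNIV. (dir (V a) u x)\<^sup>2)"
proof -
  have "X x = (\<Sum>a\<in>UNIV. dir (V a) u x *\<^sub>R V a)"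
    unfolding grad_sharp sharp_onb[OF V]
    by (rule sum.cong[OF refl]) (simp add: dir_def inner_vec_def mult.commute)
  then show ?thesis by (simp add: energy_def bform_comb[OF x V] power2_eq_square)
qed

lemma (in coord_metric) Ric_bilinear: assumes x: "x \<in> D" shows "bilinear (Ric G x)"
  by (rule bilinearI') (simp_all add: Ric_def Riem_def DGam_linear[OF x] sum.distrib sum_subtractf sum_distrib_left algebra_simps)

lemma Hess_neg:
  assumes "open S" "x \<in> S" "C_k_on 2 S u" shows "Hess G (\<lambda>y. - u y) x v w = - Hess G u x v w"
proof -
  have d: "u differentiable (at y)" if "y \<in> S" for y using assms that by (simp add: numeral_2_eq_2)
  have d2: "dir w u differentiable (at x)"
  proof -
    have "C_k_on (Suc 0) S (dir w u)" by (rule C_k_on_dir[OF assms(1)]) (use assms(3) in \<open>simp add: numeral_2_eq_2\<close>)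
    then show ?thesis using assms(2) by (rule C_k_on_differentiable)
  qed
  have "dir v (dir w (\<lambda>y. - u y)) x = dir v (\<lambda>y. - dir w u y) x"
    by (rule dir_cong[OF assms(1,2)]) (rule dir_minus[OF d])
  then show ?thesis by (simp add: Hess_def dir_minus[OF d2] dir_minus[OF d[OF assms(2)]])
qed

context riemannian
begin

section \<open>Frames of paths without covariant acceleration\<close>

definition frame_in :: "('m, 'n) chart \<Rightarrow> 'm \<Rightarrow> ('n \<Rightarrow> real \<Rightarrow> 'm) \<Rightarrow> ('n \<Rightarrow> real^'n) \<Rightarrow> bool" where
  "frame_in c p \<kappa> V \<longleftrightarrow> onb (G c) (snd c p) V \<and>
     (\<forall>a i. jet2 (\<lambda>\<epsilon>. snd c (\<kappa> a \<epsilon>) $ i) (V a $ i) (- Gam (G c) (snd c p) (V a) (V a) $ i))"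

text \<open>A frame at \<open>p\<close> as a family of paths: in every chart they have orthonormal velocities and the accelerations of geodesics at \<open>p\<close>.
Second derivatives along them are values of the Hessian, so that Laplacians and gradients of functions on the manifold can be read off from
jets, and no vector has to be transformed between charts.\<close>

definition osc :: "'m \<Rightarrow> ('n \<Rightarrow> real \<Rightarrow> 'm) \<Rightarrow> bool" where
  "osc p \<kappa> \<longleftrightarrow> (\<forall>a. \<kappa> a 0 = p \<and> isCont (\<kappa> a) 0) \<and> (\<forall>c\<in>\<A>. p \<in> fst c \<longrightarrow> (\<exists>V. frame_in c p \<kappa> V))"

lemma osc_base: "osc p \<kappa> \<Longrightarrow> \<kappa> a 0 = p" "osc p \<kappa> \<Longrightarrow> isCont (\<kappa> a) 0"
  by (auto simp: osc_def)

lemma isCont_eventually_in: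
  fixes \<gamma> :: "real \<Rightarrow> 'm"
  assumes "isCont \<gamma> t" "open S" "\<gamma> t \<in> S" shows "\<forall>\<^sub>F \<epsilon> in nhds t. \<gamma> \<epsilon> \<in> S"
proof -
  have "(\<gamma> \<longlongrightarrow> \<gamma> t) (nhds t)" using assms(1) by (simp add: isCont_def tendsto_at_iff_tendsto_nhds)
  then show ?thesis using topological_tendstoD assms by blast
qed

lemma jet_frame:
  assumes c: "c \<in> \<A>" "p \<in> fst c" and \<kappa>: "\<kappa> a 0 = p" "isCont (\<kappa> a) 0" and F: "frame_in c p \<kappa> V"
    and S: "open S" "snd c p \<in> S" and \<phi>: "C_k_on 2 S (\<lambda>x. \<phi> (chart_inv c x))"
  shows "jet2 (\<lambda>\<epsilon>. \<phi> (\<kappa> a \<epsilon>)) (dir (V a) (\<lambda>x. \<phi> (chart_inv c x)) (snd c p))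
     (Hess (G c) (\<lambda>x. \<phi> (chart_inv c x)) (snd c p) (V a) (V a))"
proof -
  let ?\<phi> = "\<lambda>x. \<phi> (chart_inv c x)" and ?x = "snd c p"
  have j: "jet2 (\<lambda>\<epsilon>. snd c (\<kappa> a \<epsilon>) $ i) (V a $ i) (- Gam (G c) ?x (V a) (V a) $ i)" for i
    using F by (simp add: frame_in_def)
  have "jet2 (\<lambda>\<epsilon>. ?\<phi> (snd c (\<kappa> a \<epsilon>))) (dir (V a) ?\<phi> ?x) (Hess (G c) ?\<phi> ?x (V a) (V a))"
    by (rule jet2_unaccelerated[OF j _ S \<phi>]) (simp add: \<kappa>)
  moreover have "\<forall>\<^sub>F \<epsilon> in nhds 0. \<phi> (\<kappa> a \<epsilon>) = ?\<phi> (snd c (\<kappa> a \<epsilon>))"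
    using isCont_eventually_in[OF \<kappa>(2) chart_open(1)[OF c(1)]] c \<kappa>(1)
    by (auto elim!: eventually_mono)
  ultimately show ?thesis by (rule jet2_cong)
qed

text \<open>Having no covariant acceleration does not depend on the chart, by the transformation law of the connection.\<close>

lemma frame_change:
  assumes c: "c \<in> \<A>" "c' \<in> \<A>" "p \<in> fst c" "p \<in> fst c'" and \<kappa>: "\<And>a. \<kappa> a 0 = p" "\<And>a. isCont (\<kappa> a) 0"
    and F: "frame_in c p \<kappa> V"
  shows "frame_in c' p \<kappa> (\<lambda>a. vdir (V a) (tr c c') (snd c p))"
proof -
  interpret M: coord_metric "coord_range c" "G c" by (rule coord_metric_chart[OF c(1)])
  interpret M': coord_metric "coord_range c'" "G c'" by (rule coord_metric_chart[OF c(2)])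
  let ?x = "snd c p"
  have x: "?x \<in> ov c c'" using c by auto
  have V: "onb (G c) ?x V" using F by (simp add: frame_in_def)
  have tx: "tr c c' ?x = snd c' p" using c by simp
  have "onb (G c') (snd c' p) (\<lambda>a. vdir (V a) (tr c c') ?x)"
  proof (rule M'.onbI)
    show "bform (G c' (snd c' p)) (vdir (V a) (tr c c') ?x) (vdir (V b) (tr c c') ?x) = (if a = b then 1 else 0)" for a b
      using metric_change[OF c(1,2) x, of "V a" "V b"] M.onb_orthonormal[OF _ V, of a b] c tx by simp
  qed (use c in simp)
  moreover have "jet2 (\<lambda>\<epsilon>. snd c' (\<kappa> a \<epsilon>) $ i) (vdir (V a) (tr c c') ?x $ i)
      (- Gam (G c') (snd c' p) (vdir (V a) (tr c c') ?x) (vdir (V a) (tr c c') ?x) $ i)" for a i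
  proof -
    have "jet2 (\<lambda>\<epsilon>. snd c' (\<kappa> a \<epsilon>) $ i) (dir (V a) (\<lambda>x. tr c c' x $ i) ?x) (Hess (G c) (\<lambda>x. tr c c' x $ i) ?x (V a) (V a))"
      by (rule jet_frame[OF c(1,3) \<kappa> F open_ov[OF c(1,2)] x tr_smooth[OF c(1,2)]])
    moreover have "Hess (G c) (\<lambda>x. tr c c' x $ i) ?x (V a) (V a)
      = (vdir (V a) (vdir (V a) (tr c c')) ?x - vdir (Gam (G c) ?x (V a) (V a)) (tr c c') ?x) $ i"
      by (simp add: Hess_def vdir_def)
    moreover have "vdir (V a) (vdir (V a) (tr c c')) ?x - vdir (Gam (G c) ?x (V a) (V a)) (tr c c') ?x
       = - Gam (G c') (snd c' p) (vdir (V a) (tr c c') ?x) (vdir (V a) (tr c c') ?x)"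
      using christoffel_change[OF c(1,2) x, of "V a" "V a"] tx by (simp add: algebra_simps eq_neg_iff_add_eq_0)
    ultimately show ?thesis by (simp only: vdir_component vector_uminus_component)
  qed
  ultimately show ?thesis by (simp add: frame_in_def)
qed

lemma osc_exists:
  assumes c: "c \<in> \<A>" "p \<in> fst c" and V: "onb (G c) (snd c p) V"
  obtains \<kappa> where "osc p \<kappa>" "frame_in c p \<kappa> V"
proof -
  let ?x = "snd c p"
  \<comment> \<open>The second-order Taylor polynomial of a geodesic.\<close>
  define \<zeta> where "\<zeta> a \<epsilon> = ?x + \<epsilon> *\<^sub>R V a - (\<epsilon>\<^sup>2 / 2) *\<^sub>R Gam (G c) ?x (V a) (V a)" for a \<epsilon>
  have \<zeta>c: "continuous_on UNIV (\<zeta> a)" for a unfolding \<zeta>_def by (intro continuous_intros) simp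
  have \<zeta>0: "\<zeta> a 0 = ?x" for a by (simp add: \<zeta>_def)
  define \<kappa> where "\<kappa> a \<epsilon> = chart_inv c (\<zeta> a \<epsilon>)" for a \<epsilon>
  have \<kappa>0: "\<kappa> a 0 = p" for a using c by (simp add: \<kappa>_def \<zeta>0)
  have \<zeta>i: "isCont (\<zeta> a) 0" for a using \<zeta>c continuous_on_eq_continuous_at by blast
  have ci: "isCont (chart_inv c) ?x"
    using continuous_on_eq_continuous_at[OF chart_open(2)[OF c(1)], of "chart_inv c"] chart_continuous(2)[OF c(1)] chart_in[OF c(2)]
    by simp
  have \<kappa>i: "isCont (\<kappa> a) 0" for a
    unfolding \<kappa>_def[abs_def] using isCont_o2[OF \<zeta>i[of a], of "chart_inv c"] ci \<zeta>0 by simp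
  have "(\<zeta> a \<longlongrightarrow> ?x) (nhds 0)" for a
    using \<zeta>i[of a, unfolded isCont_def tendsto_at_iff_tendsto_nhds] \<zeta>0[of a] by simp
  then have ev: "\<forall>\<^sub>F \<epsilon> in nhds 0. \<zeta> a \<epsilon> \<in> coord_range c" for a
    by (rule topological_tendstoD[OF _ chart_open(2)[OF c(1)] chart_in[OF c(2)]])
  have "jet2 (\<lambda>\<epsilon>. snd c (\<kappa> a \<epsilon>) $ i) (V a $ i) (- Gam (G c) ?x (V a) (V a) $ i)" for a i
  proof (rule jet2_cong)
    have id: "jet2 (\<lambda>\<epsilon>. \<epsilon>) 1 0"
      unfolding jet2_def by (rule exI[of _ "\<lambda>\<epsilon>. 1"]) auto
    have "jet2 (\<lambda>\<epsilon>. ?x $ i + V a $ i * \<epsilon> + (- Gam (G c) ?x (V a) (V a) $ i / 2) * (\<epsilon> * \<epsilon>)) (0 + V a $ i * 1 + (- Gam (G c) ?x (V a) (V a) $ i / 2) * (1 * 0 + 0 * 1))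
       (0 + V a $ i * 0 + (- Gam (G c) ?x (V a) (V a) $ i / 2) * (0 * 0 + 2 * 1 * 1 + 0 * 0))"
      by (intro jet2_add jet2_const jet2_cmult jet2_mult id)
    then show "jet2 (\<lambda>\<epsilon>. \<zeta> a \<epsilon> $ i) (V a $ i) (- Gam (G c) ?x (V a) (V a) $ i)"
      by (simp add: \<zeta>_def power2_eq_square algebra_simps)
    show "\<forall>\<^sub>F \<epsilon> in nhds 0. snd c (\<kappa> a \<epsilon>) $ i = \<zeta> a \<epsilon> $ i"
      using ev[of a] by eventually_elim (simp add: \<kappa>_def c)
  qed
  then have F: "frame_in c p \<kappa> V" using V by (simp add: frame_in_def)
  have "osc p \<kappa>"
    unfolding osc_def using \<kappa>0 \<kappa>i frame_change[OF c(1) _ c(2) _ \<kappa>0 \<kappa>i F] by blast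
  then show ?thesis using that F by blast
qed

lemma osc_exists': obtains \<kappa> where "osc p \<kappa>"
proof -
  interpret M: coord_metric "coord_range (chart_at \<A> p)" "G (chart_at \<A> p)" by (rule coord_metric_chart[OF chart_at(1)])
  obtain V where "onb (G (chart_at \<A> p)) (snd (chart_at \<A> p) p) V"
    using M.onb_exists[of "snd (chart_at \<A> p) p"] chart_at(2) by auto
  then show ?thesis using osc_exists[OF chart_at] that by metis
qed

end

section \<open>The soliton in charts\<close>

locale soliton = riemannian \<A> g for \<A> :: "('m::{t2_space,second_countable_topology}, 'n::finite) chart set" and g :: "'m metric" +
  fixes f :: "'m \<Rightarrow> real"
  assumes f_smooth: "smooth_fun_on \<A> UNIV f"
    and steady: "c \<in> \<A> \<Longrightarrow> p \<in> fst c \<Longrightarrow> ricci \<A> g c p i j = - hessian \<A> g c f p i j"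
    and normalized: "scalar_curvature \<A> g p + (tangent_norm g p (gradient \<A> g f p))\<^sup>2 = 1"
begin

text \<open>With these signs the soliton equation reads \<open>Ric = \<nabla>\<nabla>u\<close>, and \<open>w\<close> is the squared gradient of \<open>u\<close> by the normalisation.\<close>

definition u :: "'m \<Rightarrow> real" where "u p = - f p"
definition w :: "'m \<Rightarrow> real" where "w p = 1 - scalar_curvature \<A> g p"

abbreviation uc :: "('m, 'n) chart \<Rightarrow> real^'n \<Rightarrow> real" where "uc c \<equiv> \<lambda>x. u (chart_inv c x)"

lemma fc_smooth: "c \<in> \<A> \<Longrightarrow> C_k_on k (coord_range c) (\<lambda>x. f (chart_inv c x))"
  using f_smooth by (auto simp: smooth_fun_on_def C_infinity_on_def coord_range_def)

lemma uc_smooth: "c \<in> \<A> \<Longrightarrow> C_k_on k (coord_range c) (uc c)"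
  unfolding u_def by (rule C_k_on_minus[OF chart_open(2) fc_smooth])

lemma coord_function_chart: "c \<in> \<A> \<Longrightarrow> coord_function (coord_range c) (G c) (uc c)"
  by (intro coord_function.intro coord_metric_chart coord_function_axioms.intro uc_smooth)

abbreviation en :: "('m, 'n) chart \<Rightarrow> real^'n \<Rightarrow> real" where "en c \<equiv> coord_function.energy (G c) (uc c)"

lemma energy_jets:
  assumes c: "c \<in> \<A>" "p \<in> fst c" and o: "osc p \<kappa>" and j: "\<And>a. jet2 (\<lambda>\<epsilon>. u (\<kappa> a \<epsilon>)) (d a) (h a)"
  shows "en c (snd c p) = (\<Sum>a\<in>UNIV. (d a)\<^sup>2)" "Lap (G c) (uc c) (snd c p) = (\<Sum>a\<in>UNIV. h a)"
proof -
  interpret M: coord_function "coord_range c" "G c" "uc c" by (rule coord_function_chart[OF c(1)])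
  obtain V where F: "frame_in c p \<kappa> V" using o c by (auto simp: osc_def)
  have V: "onb (G c) (snd c p) V" using F by (simp add: frame_in_def)
  have x: "snd c p \<in> coord_range c" using c by simp
  have "jet2 (\<lambda>\<epsilon>. u (\<kappa> a \<epsilon>)) (dir (V a) (uc c) (snd c p)) (Hess (G c) (uc c) (snd c p) (V a) (V a))" for a
    by (rule jet_frame[OF c osc_base[OF o] F M.open_D x M.u_smooth])
  from jet2_unique[OF this j]
  have eq: "dir (V a) (uc c) (snd c p) = d a" "Hess (G c) (uc c) (snd c p) (V a) (V a) = h a" for a by auto
  show "en c (snd c p) = (\<Sum>a\<in>UNIV. (d a)\<^sup>2)" by (simp add: M.energy_onb[OF x V] eq)
  show "Lap (G c) (uc c) (snd c p) = (\<Sum>a\<in>UNIV. h a)" by (simp add: M.Lap_onb[OF x V] eq)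
qed

lemma u_jet_exists:
  assumes "osc p \<kappa>" obtains d h where "\<And>a. jet2 (\<lambda>\<epsilon>. u (\<kappa> a \<epsilon>)) (d a) (h a)"
proof -
  let ?c = "chart_at \<A> p"
  obtain V where F: "frame_in ?c p \<kappa> V" using assms chart_at[of p] unfolding osc_def by blast
  show ?thesis
    by (rule that, rule jet_frame[OF chart_at osc_base[OF assms] F chart_open(2)[OF chart_at(1)] _ uc_smooth[OF chart_at(1)]])
      (rule chart_in[OF chart_at(2)])
qed

lemma f_smooth_near: "f \<in> smooth_near \<A> p"
  unfolding smooth_near_def using f_smooth by auto

lemma w_chart_at:
  fixes p :: 'm
  defines "c \<equiv> chart_at \<A> p"
  shows "w p = en c (snd c p)" "scalar_curvature \<A> g p = Lap (G c) (uc c) (snd c p)"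
proof -
  have c: "c \<in> \<A>" "p \<in> fst c" unfolding c_def by (rule chart_at)+
  interpret M: coord_function "coord_range c" "G c" "uc c" by (rule coord_function_chart[OF c(1)])
  let ?x = "snd c p"
  have x: "?x \<in> coord_range c" using c by simp
  have pd: "partial_d j (\<lambda>x. f (chart_inv c x)) ?x = - partial_d j (uc c) ?x" for j
    using partial_d_minus[OF C_k_on_differentiable[OF M.u_smooth x], of j] by (simp add: u_def)
  have "gradient \<A> g f p = vec_tangent c p (- grad (G c) (uc c) ?x)"
    unfolding gradient_def Let_def c_def[symmetric]
    using f_smooth_near
    by (simp add: vec_tangent_def grad_def coord_vector_def pd sum_distrib_right sum_negf)
  then have "tangent_norm g p (gradient \<A> g f p) = sqrt (en c ?x)"
    by (simp add: tangent_norm_def g_vec_tangent[OF c] M.energy_def)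
  moreover have "en c ?x \<ge> 0" unfolding M.energy_def by (rule M.bform_nonneg[OF x])
  ultimately have "(tangent_norm g p (gradient \<A> g f p))\<^sup>2 = en c ?x" by simp
  then show "w p = en c ?x" using normalized[of p] by (simp add: w_def)
  have H: "Hess (G c) (\<lambda>x. f (chart_inv c x)) ?x v v' = - Hess (G c) (uc c) ?x v v'" for v v'
    using Hess_neg[OF M.open_D x M.u_smooth, of "G c" v v'] by (simp add: u_def)
  have "ricci_coord (G c) j k ?x = Hess (G c) (uc c) ?x (axis j 1) (axis k 1)" for j k
    using steady[OF c, of j k] by (simp add: ricci_def hessian_def hessian_coord_eq H)
  then show "scalar_curvature \<A> g p = Lap (G c) (uc c) ?x"
    by (simp add: scalar_curvature_def Let_def c_def[symmetric] scalar_coord_def Lap_def)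
qed

lemma w_chart: assumes c: "c \<in> \<A>" "p \<in> fst c" shows "w p = en c (snd c p)" "Lap (G c) (uc c) (snd c p) + w p = 1"
proof -
  obtain \<kappa> where o: "osc p \<kappa>" using osc_exists' .
  obtain d h where j: "\<And>a. jet2 (\<lambda>\<epsilon>. u (\<kappa> a \<epsilon>)) (d a) (h a)" using u_jet_exists[OF o] by metis
  note 1 = energy_jets[OF c o j] and 2 = energy_jets[OF chart_at o j] and 3 = w_chart_at[of p]
  show "w p = en c (snd c p)" using 1 2 3 by simp
  show "Lap (G c) (uc c) (snd c p) + w p = 1" using 1 2 3 by (simp add: w_def)
qed

lemma coord_soliton_chart: assumes c: "c \<in> \<A>" shows "coord_soliton (coord_range c) (G c) (uc c)"
proof -
  interpret M: coord_function "coord_range c" "G c" "uc c" by (rule coord_function_chart[OF c])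
  show ?thesis
  proof
    fix x v assume x: "x \<in> coord_range c"
    define p where "p = chart_inv c x"
    have p: "p \<in> fst c" "snd c p = x" using chart_inv_in[OF c x] c x by (auto simp: p_def)
    show "Lap (G c) (uc c) x + M.energy x = 1" using w_chart[OF c p(1)] p(2) by simp
    have H: "Hess (G c) (\<lambda>x. f (chart_inv c x)) x v v' = - Hess (G c) (uc c) x v v'" for v v'
      using Hess_neg[OF M.open_D x M.u_smooth, of "G c" v v'] by (simp add: u_def)
    have "Ric (G c) x (axis j 1) (axis k 1) = Hess (G c) (uc c) x (axis j 1) (axis k 1)" for j k
      using steady[OF c p(1), of j k] by (simp add: ricci_def hessian_def hessian_coord_eq ricci_coord_eq H p(2))
    then show "Ric (G c) x v v = Hess (G c) (uc c) x v v"
      by (simp add: bilinear_expand[OF M.Ric_bilinear[OF x], of v v] bilinear_expand[OF M.Hess_bilinear[OF x], of v v])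
  qed
qed

lemma wc_eq: "c \<in> \<A> \<Longrightarrow> x \<in> coord_range c \<Longrightarrow> w (chart_inv c x) = en c x"
  using w_chart(1)[of c "chart_inv c x"] chart_inv_in[of c x] by simp

lemma wc_smooth: assumes c: "c \<in> \<A>" shows "C_k_on k (coord_range c) (\<lambda>x. w (chart_inv c x))"
proof -
  interpret M: coord_function "coord_range c" "G c" "uc c" by (rule coord_function_chart[OF c])
  show ?thesis by (rule C_k_on_congI[OF M.open_D M.energy_smooth wc_eq[OF c]])
qed

lemma w_nonneg: "w p \<ge> 0"
proof -
  interpret M: coord_function "coord_range (chart_at \<A> p)" "G (chart_at \<A> p)" "uc (chart_at \<A> p)"
    by (rule coord_function_chart[OF chart_at(1)])
  show ?thesis unfolding w_chart_at(1) M.energy_def by (rule M.bform_nonneg) (rule chart_in[OF chart_at(2)])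
qed

text \<open>All that is used of the soliton equation from here on: in terms of a frame of paths, the drift Laplacian of \<open>u\<close> is \<open>1\<close>, and the
drift Laplacian of \<open>w\<close> is bounded below by Bochner's formula.\<close>

lemma soliton_jets:
  assumes o: "osc p \<kappa>"
  obtains ud uh wd wh where "\<And>a. jet2 (\<lambda>\<epsilon>. u (\<kappa> a \<epsilon>)) (ud a) (uh a)" "\<And>a. jet2 (\<lambda>\<epsilon>. w (\<kappa> a \<epsilon>)) (wd a) (wh a)"
    "(\<Sum>a\<in>UNIV. (ud a)\<^sup>2) = w p" "(\<Sum>a\<in>UNIV. uh a) = 1 - w p"
    "(\<Sum>a\<in>UNIV. wh a) + (\<Sum>a\<in>UNIV. ud a * wd a) \<ge> 2 * (1 - w p)\<^sup>2 / real CARD('n)"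
proof -
  define c where "c = chart_at \<A> p"
  have c: "c \<in> \<A>" "p \<in> fst c" unfolding c_def by (rule chart_at)+
  interpret M: coord_soliton "coord_range c" "G c" "uc c" by (rule coord_soliton_chart[OF c(1)])
  obtain V where F: "frame_in c p \<kappa> V" using o c by (auto simp: osc_def)
  have V: "onb (G c) (snd c p) V" using F by (simp add: frame_in_def)
  let ?x = "snd c p" and ?w = "\<lambda>x. w (chart_inv c x)"
  have x: "?x \<in> coord_range c" using c by simp
  have ju: "jet2 (\<lambda>\<epsilon>. u (\<kappa> a \<epsilon>)) (dir (V a) (uc c) ?x) (Hess (G c) (uc c) ?x (V a) (V a))" for a
    by (rule jet_frame[OF c osc_base[OF o] F M.open_D x M.u_smooth])
  have jw: "jet2 (\<lambda>\<epsilon>. w (\<kappa> a \<epsilon>)) (dir (V a) ?w ?x) (Hess (G c) ?w ?x (V a) (V a))" for a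
    by (rule jet_frame[OF c osc_base[OF o] F M.open_D x wc_smooth[OF c(1)]])
  have dw: "dir v ?w y = dir v M.energy y" if "y \<in> coord_range c" for v y
    by (rule dir_cong[OF M.open_D that wc_eq[OF c(1)]])
  have Hw: "Hess (G c) ?w ?x v v' = Hess (G c) M.energy ?x v v'" for v v'
  proof -
    have "dir v (dir v' ?w) ?x = dir v (dir v' M.energy) ?x"
      by (rule dir_cong[OF M.open_D x]) (rule dw)
    then show ?thesis by (simp add: Hess_def dw[OF x])
  qed
  show ?thesis
  proof (rule that[OF ju jw])
    show "(\<Sum>a\<in>UNIV. (dir (V a) (uc c) ?x)\<^sup>2) = w p"
      using M.energy_onb[OF x V] w_chart(1)[OF c] by simp
    show "(\<Sum>a\<in>UNIV. Hess (G c) (uc c) ?x (V a) (V a)) = 1 - w p"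
      using M.Lap_onb[OF x V] w_chart(2)[OF c] by simp
    have "(\<Sum>a\<in>UNIV. dir (V a) (uc c) ?x * dir (V a) ?w ?x) = dir (M.X ?x) M.energy ?x"
    proof -
      have l: "linear (\<lambda>e. dir e M.energy ?x)" by (rule linearI) auto
      show ?thesis
        by (simp add: M.sum_dir_grad[OF x V, symmetric] linear_sum[OF l] dw[OF x])
    qed
    then show "(\<Sum>a\<in>UNIV. Hess (G c) ?w ?x (V a) (V a)) + (\<Sum>a\<in>UNIV. dir (V a) (uc c) ?x * dir (V a) ?w ?x) \<ge> 2 * (1 - w p)\<^sup>2 / real CARD('n)"
      using M.drift_laplacian_energy[OF x V] w_chart(1)[OF c] by (simp add: Hw)
  qed
qed

lemma continuous_from_charts:
  assumes "\<And>c. c \<in> \<A> \<Longrightarrow> continuous_on (coord_range c) (\<lambda>x. \<phi> (chart_inv c x))"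
  shows "continuous_on UNIV \<phi>"
proof -
  have "isCont \<phi> p" for p
  proof -
    obtain c where c: "c \<in> \<A>" "p \<in> fst c" using chart_cover .
    have "continuous_on (fst c) (\<lambda>q. \<phi> (chart_inv c (snd c q)))"
      by (rule continuous_on_compose2[OF assms[OF c(1)] chart_continuous(1)[OF c(1)]]) auto
    then have "continuous_on (fst c) \<phi>" using c(1) by (simp add: continuous_on_cong[OF refl, of "fst c" "\<lambda>q. \<phi> (chart_inv c (snd c q))" \<phi>])
    then show ?thesis using c chart_open(1)[OF c(1)] continuous_on_eq_continuous_at by blast
  qed
  then show ?thesis by (simp add: continuous_at_imp_continuous_on)
qed

lemma u_continuous: "continuous_on UNIV u"
  by (rule continuous_from_charts) (rule C_k_on_continuous_on[OF uc_smooth])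

lemma w_continuous: "continuous_on UNIV w"
  by (rule continuous_from_charts) (rule C_k_on_continuous_on[OF wc_smooth])

end

lemma continuous_on_open_isCont: "continuous_on S h \<Longrightarrow> open S \<Longrightarrow> x \<in> S \<Longrightarrow> isCont h x"
  by (simp add: continuous_on_eq_continuous_at)

context riemannian
begin

section \<open>Lengths of piecewise continuously differentiable curves\<close>

definition speed :: "(real \<Rightarrow> 'm) \<Rightarrow> real \<Rightarrow> real" where
  "speed \<gamma> t = sqrt (g (\<gamma> t) (velocity \<A> \<gamma> t) (velocity \<A> \<gamma> t))"

text \<open>Curves over an arbitrary interval, with their exceptional set, in order to glue and to reparametrise them.\<close>

definition pcurve :: "real \<Rightarrow> real \<Rightarrow> (real \<Rightarrow> 'm) \<Rightarrow> real set \<Rightarrow> bool" where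
  "pcurve a b \<gamma> T \<longleftrightarrow> continuous_on {a..b} \<gamma> \<and> finite T \<and>
     (\<forall>c\<in>\<A>. (\<lambda>t. snd c (\<gamma> t)) C1_differentiable_on {t\<in>{a<..<b} - T. \<gamma> t \<in> fst c})"

definition len :: "real \<Rightarrow> real \<Rightarrow> (real \<Rightarrow> 'm) \<Rightarrow> ennreal" where
  "len a b \<gamma> = (\<integral>\<^sup>+t\<in>{a..b}. ennreal (speed \<gamma> t) \<partial>lborel)"

lemma piecewise_pcurve: "piecewise_C1_curve \<A> \<gamma> \<longleftrightarrow> (\<exists>T. pcurve 0 1 \<gamma> T)"
  by (auto simp: piecewise_C1_curve_def pcurve_def)

lemma curve_length_len: "curve_length \<A> g \<gamma> = len 0 1 \<gamma>"
  by (simp add: curve_length_def len_def speed_def)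

lemma speed_chart:
  assumes c: "c \<in> \<A>" "\<gamma> t \<in> fst c" and cont: "isCont \<gamma> t"
    and D: "((\<lambda>s. snd c (\<gamma> s)) has_vector_derivative D) (at t)"
  shows "speed \<gamma> t = sqrt (bform (G c (snd c (\<gamma> t))) D D)"
proof -
  have "velocity \<A> \<gamma> t = vec_tangent c (\<gamma> t) D"
  proof
    fix v
    show "velocity \<A> \<gamma> t v = vec_tangent c (\<gamma> t) D v"
    proof (cases "v \<in> smooth_near \<A> (\<gamma> t)")
      case True
      let ?v = "\<lambda>x. v (chart_inv c x)"
      have "((\<lambda>s. snd c (\<gamma> s) $ i) has_real_derivative D $ i) (at t)" for i
        using D by (simp add: has_vector_derivative_def has_derivative_vec_iff has_field_derivative_def mult_commute_abs)
      from has_real_derivative_along[OF this smooth_near_differentiable[OF True c]]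
      have "((\<lambda>s. ?v (snd c (\<gamma> s))) has_real_derivative dir D ?v (snd c (\<gamma> t))) (at t)"
        by (simp add: dir_def mult.commute)
      moreover have ev: "\<forall>\<^sub>F s in nhds t. ?v (snd c (\<gamma> s)) = v (\<gamma> s)"
        using isCont_eventually_in[OF cont chart_open(1)[OF c(1)] c(2)] by eventually_elim (simp add: c)
      ultimately have "((\<lambda>s. v (\<gamma> s)) has_real_derivative dir D ?v (snd c (\<gamma> t))) (at t)"
        using DERIV_cong_ev[OF refl ev refl] by blast
      then have "vector_derivative (\<lambda>s. v (\<gamma> s)) (at t) = dir D ?v (snd c (\<gamma> t))"
        by (simp add: has_real_derivative_iff_has_vector_derivative vector_derivative_at)
      then show ?thesis using True by (simp add: velocity_def vec_tangent_dir[OF c True])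
    qed (simp add: velocity_def vec_tangent_def coord_vector_def)
  qed
  then show ?thesis by (simp add: speed_def g_vec_tangent[OF c])
qed

lemma open_pieces: "finite T \<Longrightarrow> open ({a<..<b::real} - T)"
  by (simp add: open_Diff finite_imp_closed)

lemma pcurve_isCont:
  assumes "pcurve a b \<gamma> T" "t \<in> {a<..<b}" shows "isCont \<gamma> t"
proof -
  have "continuous_on {a<..<b} \<gamma>" using assms(1) unfolding pcurve_def by (auto intro: continuous_on_subset)
  then show ?thesis by (rule continuous_on_open_isCont[OF _ open_greaterThanLessThan assms(2)])
qed

lemma pcurve_open:
  assumes "pcurve a b \<gamma> T" "c \<in> \<A>" shows "open {t\<in>{a<..<b} - T. \<gamma> t \<in> fst c}"
proof -
  have o: "open ({a<..<b} - T)" using assms(1) open_pieces by (simp add: pcurve_def)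
  have "continuous_on ({a<..<b} - T) \<gamma>" using assms(1) unfolding pcurve_def by (auto intro: continuous_on_subset)
  then have "open (\<gamma> -` fst c \<inter> ({a<..<b} - T))"
    using continuous_on_open_vimage[OF o] chart_open(1)[OF assms(2)] by blast
  moreover have "\<gamma> -` fst c \<inter> ({a<..<b} - T) = {t\<in>{a<..<b} - T. \<gamma> t \<in> fst c}" by auto
  ultimately show ?thesis by simp
qed

lemma pcurve_derivative:
  assumes "pcurve a b \<gamma> T" "c \<in> \<A>"
  obtains D where "continuous_on {t\<in>{a<..<b} - T. \<gamma> t \<in> fst c} D"
    "\<And>t. t \<in> {a<..<b} - T \<Longrightarrow> \<gamma> t \<in> fst c \<Longrightarrow> ((\<lambda>s. snd c (\<gamma> s)) has_vector_derivative D t) (at t)"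
    "\<And>t. t \<in> {a<..<b} - T \<Longrightarrow> \<gamma> t \<in> fst c \<Longrightarrow> speed \<gamma> t = sqrt (bform (G c (snd c (\<gamma> t))) (D t) (D t))"
proof -
  have "(\<lambda>t. snd c (\<gamma> t)) C1_differentiable_on {t\<in>{a<..<b} - T. \<gamma> t \<in> fst c}"
    using assms unfolding pcurve_def by blast
  then obtain D where D: "\<And>t. t \<in> {t\<in>{a<..<b} - T. \<gamma> t \<in> fst c} \<Longrightarrow> ((\<lambda>s. snd c (\<gamma> s)) has_vector_derivative D t) (at t)"
     "continuous_on {t\<in>{a<..<b} - T. \<gamma> t \<in> fst c} D"
    unfolding C1_differentiable_on_def by blast
  show ?thesis
  proof (rule that[OF D(2)])
    fix t assume t: "t \<in> {a<..<b} - T" "\<gamma> t \<in> fst c"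
    show d: "((\<lambda>s. snd c (\<gamma> s)) has_vector_derivative D t) (at t)" by (rule D(1)) (use t in auto)
    show "speed \<gamma> t = sqrt (bform (G c (snd c (\<gamma> t))) (D t) (D t))"
      by (rule speed_chart[OF assms(2) t(2) pcurve_isCont[OF assms(1)] d]) (use t in auto)
  qed
qed

lemma continuous_on_bform_G:
  assumes c: "c \<in> \<A>" and \<xi>: "continuous_on V \<xi>" "\<xi> ` V \<subseteq> coord_range c" and D: "continuous_on V D"
  shows "continuous_on V (\<lambda>t. bform (G c (\<xi> t)) (D t) (D t))"
proof -
  interpret M: coord_metric "coord_range c" "G c" by (rule coord_metric_chart[OF c])
  have Gc: "continuous_on (coord_range c) (\<lambda>x. G c x $ i $ j)" for i j
    by (rule C_k_on_continuous_on[OF M.G_smooth])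
  have "continuous_on V (\<lambda>t. G c (\<xi> t) $ i $ j)" for i j
    by (rule continuous_on_compose2[OF Gc \<xi>])
  moreover have "continuous_on V (\<lambda>t. D t $ i)" for i by (intro continuous_on_component D)
  ultimately show ?thesis
    unfolding bform_def by (intro continuous_on_sum continuous_on_mult)
qed

lemma speed_continuous:
  assumes P: "pcurve a b \<gamma> T" shows "continuous_on ({a<..<b} - T) (speed \<gamma>)"
proof (rule continuous_at_imp_continuous_on, rule ballI)
  fix t assume t: "t \<in> {a<..<b} - T"
  obtain c where c: "c \<in> \<A>" "\<gamma> t \<in> fst c" using chart_cover .
  define V where "V = {t\<in>{a<..<b} - T. \<gamma> t \<in> fst c}"
  obtain D where D: "continuous_on V D" "\<And>t. t \<in> V \<Longrightarrow> speed \<gamma> t = sqrt (bform (G c (snd c (\<gamma> t))) (D t) (D t))"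
    by (rule pcurve_derivative[OF P c(1)]) (auto simp: V_def)
  have V: "open V" "t \<in> V" using pcurve_open[OF P c(1)] t c by (auto simp: V_def)
  have \<gamma>V: "continuous_on V \<gamma>"
    using P unfolding pcurve_def V_def by (elim conjE continuous_on_subset) auto
  have "continuous_on V (\<lambda>t. snd c (\<gamma> t))"
    by (rule continuous_on_compose2[OF chart_continuous(1)[OF c(1)] \<gamma>V]) (auto simp: V_def)
  then have "continuous_on V (\<lambda>t. bform (G c (snd c (\<gamma> t))) (D t) (D t))"
    by (rule continuous_on_bform_G[OF c(1) _ _ D(1)]) (auto simp: V_def)
  then have "continuous_on V (\<lambda>t. sqrt (bform (G c (snd c (\<gamma> t))) (D t) (D t)))"
    by (rule continuous_on_real_sqrt)
  then have "continuous_on V (speed \<gamma>)" by (rule continuous_on_eq) (simp add: D(2))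
  then show "isCont (speed \<gamma>) t" by (rule continuous_on_open_isCont[OF _ V])
qed

lemma speed_measurable:
  assumes P: "pcurve a b \<gamma> T"
  shows "(\<lambda>t. ennreal (speed \<gamma> t) * indicator ({a<..<b} - T) t) \<in> borel_measurable borel"
proof -
  have "open ({a<..<b} - T)" using P open_pieces by (simp add: pcurve_def)
  then have "(\<lambda>t. indicator ({a<..<b} - T) t *\<^sub>R speed \<gamma> t) \<in> borel_measurable borel"
    by (intro borel_measurable_continuous_on_indicator speed_continuous[OF P]) simp
  then have "(\<lambda>t. ennreal (indicator ({a<..<b} - T) t *\<^sub>R speed \<gamma> t)) \<in> borel_measurable borel"
    by simp
  moreover have "(\<lambda>t. ennreal (indicator ({a<..<b} - T) t *\<^sub>R speed \<gamma> t)) = (\<lambda>t. ennreal (speed \<gamma> t) * indicator ({a<..<b} - T) t)"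
    by (auto simp: indicator_def)
  ultimately show ?thesis by simp
qed

text \<open>End points and the exceptional set are null sets; discarding them leaves a measurable integrand.\<close>

lemma len_eq:
  assumes P: "pcurve a b \<gamma> T"
  shows "len a b \<gamma> = (\<integral>\<^sup>+t. ennreal (speed \<gamma> t) * indicator ({a<..<b} - T) t \<partial>lborel)"
  unfolding len_def
proof (rule nn_integral_cong_AE)
  have "finite (insert a (insert b T))" using P by (simp add: pcurve_def)
  then have "insert a (insert b T) \<in> null_sets lborel" by (rule finite_imp_null_set_lborel)
  then have "AE t in lborel. t \<notin> insert a (insert b T)" by (rule AE_not_in)
  then show "AE t in lborel. ennreal (speed \<gamma> t) * indicator {a..b} t = ennreal (speed \<gamma> t) * indicator ({a<..<b} - T) t"
    by eventually_elim (auto simp: indicator_def)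
qed

text \<open>The substitution \<open>t \<mapsto> \<alpha> + \<beta> t\<close> with either sign of \<open>\<beta>\<close>, for reversing curves and for concatenating them.\<close>

lemma pcurve_affine:
  assumes P: "pcurve 0 1 \<gamma> T" and \<beta>: "\<beta> \<noteq> 0"
    and h: "\<And>t. t \<in> {a..b} \<longleftrightarrow> \<alpha> + \<beta> * t \<in> {0..1}" "\<And>t. t \<in> {a<..<b} \<longleftrightarrow> \<alpha> + \<beta> * t \<in> {0<..<1}"
    and \<delta>: "\<And>t. t \<in> {a..b} \<Longrightarrow> \<delta> t = \<gamma> (\<alpha> + \<beta> * t)"
  shows "pcurve a b \<delta> {t. \<alpha> + \<beta> * t \<in> T}" "len a b \<delta> = len 0 1 \<gamma>"
proof -
  let ?h = "\<lambda>t. \<alpha> + \<beta> * t" and ?T = "{t. \<alpha> + \<beta> * t \<in> T}"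
  have fin: "finite T" using P by (simp add: pcurve_def)
  have "inj ?h" using \<beta> by (auto simp: inj_on_def)
  then have finT: "finite ?T" using finite_vimageI[OF fin, of ?h] by (simp add: vimage_def)
  have hc: "continuous_on S ?h" for S by (intro continuous_intros)
  have cd: "continuous_on {a..b} \<delta>"
  proof (rule continuous_on_eq)
    show "continuous_on {a..b} (\<lambda>t. \<gamma> (?h t))"
      by (rule continuous_on_compose2[OF _ hc, of "{0..1}" \<gamma>]) (use P h in \<open>auto simp: pcurve_def\<close>)
  qed (simp add: \<delta>)
  have main: "\<exists>D. continuous_on {t\<in>{a<..<b} - ?T. \<delta> t \<in> fst c} D \<and>
      (\<forall>t\<in>{t\<in>{a<..<b} - ?T. \<delta> t \<in> fst c}. ((\<lambda>s. snd c (\<delta> s)) has_vector_derivative D t) (at t) \<and>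
         sqrt (bform (G c (snd c (\<delta> t))) (D t) (D t)) = \<bar>\<beta>\<bar> * speed \<gamma> (?h t))" if c: "c \<in> \<A>" for c
  proof -
    obtain D where D: "continuous_on {t\<in>{0<..<1} - T. \<gamma> t \<in> fst c} D"
      "\<And>t. t \<in> {0<..<1} - T \<Longrightarrow> \<gamma> t \<in> fst c \<Longrightarrow> ((\<lambda>s. snd c (\<gamma> s)) has_vector_derivative D t) (at t)"
      "\<And>t. t \<in> {0<..<1} - T \<Longrightarrow> \<gamma> t \<in> fst c \<Longrightarrow> speed \<gamma> t = sqrt (bform (G c (snd c (\<gamma> t))) (D t) (D t))"
      by (rule pcurve_derivative[OF P c]) (rule that, assumption+)
    have maps: "?h t \<in> {0<..<1} - T" "\<gamma> (?h t) \<in> fst c" "\<delta> t = \<gamma> (?h t)" if "t \<in> {t\<in>{a<..<b} - ?T. \<delta> t \<in> fst c}" for t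
      using that h(2)[of t] \<delta>[of t] by auto
    show ?thesis
    proof (intro exI[of _ "\<lambda>t. \<beta> *\<^sub>R D (?h t)"] conjI ballI)
      show "continuous_on {t\<in>{a<..<b} - ?T. \<delta> t \<in> fst c} (\<lambda>t. \<beta> *\<^sub>R D (?h t))"
        by (intro continuous_on_scaleR continuous_on_const continuous_on_compose2[OF D(1) hc]) (use maps in blast)
      fix t assume t: "t \<in> {t\<in>{a<..<b} - ?T. \<delta> t \<in> fst c}"
      have "(?h has_vector_derivative \<beta>) (at t)"
        by (auto intro!: derivative_eq_intros)
      from vector_diff_chain_at[OF this D(2)[OF maps(1,2)[OF t]]]
      have "((\<lambda>s. snd c (\<gamma> (?h s))) has_vector_derivative \<beta> *\<^sub>R D (?h t)) (at t)" by (simp add: o_def)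
      then show "((\<lambda>s. snd c (\<delta> s)) has_vector_derivative \<beta> *\<^sub>R D (?h t)) (at t)"
        by (rule has_vector_derivative_transform_within_open[of _ _ _ "{a<..<b}"]) (use t \<delta> in auto)
      show "sqrt (bform (G c (snd c (\<delta> t))) (\<beta> *\<^sub>R D (?h t)) (\<beta> *\<^sub>R D (?h t))) = \<bar>\<beta>\<bar> * speed \<gamma> (?h t)"
        unfolding D(3)[OF maps(1,2)[OF t]] maps(3)[OF t] by (simp add: real_sqrt_mult flip: mult.assoc)
    qed
  qed
  show P': "pcurve a b \<delta> ?T"
    unfolding pcurve_def
  proof (intro conjI ballI cd finT)
    fix c assume "c \<in> \<A>"
    from main[OF this] show "(\<lambda>t. snd c (\<delta> t)) C1_differentiable_on {t\<in>{a<..<b} - ?T. \<delta> t \<in> fst c}"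
      unfolding C1_differentiable_on_def by (elim exE conjE) blast
  qed
  have sp: "speed \<delta> t = \<bar>\<beta>\<bar> * speed \<gamma> (?h t)" if t: "t \<in> {a<..<b} - ?T" for t
  proof -
    obtain c where c: "c \<in> \<A>" "\<delta> t \<in> fst c" using chart_cover .
    obtain D where D: "((\<lambda>s. snd c (\<delta> s)) has_vector_derivative D t) (at t)"
       "sqrt (bform (G c (snd c (\<delta> t))) (D t) (D t)) = \<bar>\<beta>\<bar> * speed \<gamma> (?h t)"
      using main[OF c(1)] t c(2) by blast
    show ?thesis
      using speed_chart[OF c pcurve_isCont[OF P'] D(1)] D(2) t by simp
  qed
  let ?F = "\<lambda>t. ennreal (speed \<gamma> t) * indicator ({0<..<1} - T) t"
  have "len a b \<delta> = (\<integral>\<^sup>+t. ennreal \<bar>\<beta>\<bar> * ?F (?h t) \<partial>lborel)"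
    unfolding len_eq[OF P']
  proof (rule nn_integral_cong)
    fix t
    show "ennreal (speed \<delta> t) * indicator ({a<..<b} - ?T) t = ennreal \<bar>\<beta>\<bar> * ?F (?h t)"
    proof (cases "t \<in> {a<..<b} - ?T")
      case True
      then have "?h t \<in> {0<..<1} - T" using h(2) by auto
      then show ?thesis using True sp[OF True] by (simp add: ennreal_mult')
    next
      case False
      then have "?h t \<notin> {0<..<1} - T" using h(2) by auto
      then have "indicator ({0<..<1} - T) (?h t) = (0::ennreal)" by (rule indicator_simps(2))
      moreover have "indicator ({a<..<b} - ?T) t = (0::ennreal)" by (rule indicator_simps(2)[OF False])
      ultimately show ?thesis by (simp only: mult_zero_right)
    qed
  qed
  also have "\<dots> = ennreal \<bar>\<beta>\<bar> * (\<integral>\<^sup>+t. ?F (?h t) \<partial>lborel)"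
    by (intro nn_integral_cmult measurable_compose[OF _ speed_measurable[OF P]]) simp
  also have "\<dots> = (\<integral>\<^sup>+t. ?F t \<partial>lborel)"
    using nn_integral_real_affine[OF speed_measurable[OF P] \<beta>, of \<alpha>] by simp
  also have "\<dots> = len 0 1 \<gamma>" by (rule len_eq[OF P, symmetric])
  finally show "len a b \<delta> = len 0 1 \<gamma>" .
qed

lemma pcurve_mono:
  assumes P: "pcurve a b \<gamma> T" and T: "T \<subseteq> T'" "finite T'" shows "pcurve a b \<gamma> T'"
  unfolding pcurve_def
proof (intro conjI ballI T(2))
  show "continuous_on {a..b} \<gamma>" using P by (simp add: pcurve_def)
  fix c assume "c \<in> \<A>"
  then have "(\<lambda>t. snd c (\<gamma> t)) C1_differentiable_on {t\<in>{a<..<b} - T. \<gamma> t \<in> fst c}"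
    using P by (simp add: pcurve_def)
  then show "(\<lambda>t. snd c (\<gamma> t)) C1_differentiable_on {t\<in>{a<..<b} - T'. \<gamma> t \<in> fst c}"
    by (rule C1_differentiable_on_subset) (use T(1) in blast)
qed

lemma pcurve_glue:
  assumes P1: "pcurve a b \<gamma> T1" and P2: "pcurve b c \<gamma> T2" and ab: "a < b" "b < c"
  obtains T where "pcurve a c \<gamma> T" "len a c \<gamma> = len a b \<gamma> + len b c \<gamma>"
proof -
  define T where "T = insert b (T1 \<union> T2)"
  have fT: "finite T" using P1 P2 by (simp add: T_def pcurve_def)
  have Q1: "pcurve a b \<gamma> T" and Q2: "pcurve b c \<gamma> T"
    by (rule pcurve_mono[OF P1 _ fT], simp add: T_def subset_insertI2) (rule pcurve_mono[OF P2 _ fT], simp add: T_def subset_insertI2)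
  have P: "pcurve a c \<gamma> T"
    unfolding pcurve_def
  proof (intro conjI ballI fT)
    have "{a..c} = {a..b} \<union> {b..c}" using ab by auto
    then show "continuous_on {a..c} \<gamma>"
      using P1 P2 continuous_on_closed_Un[of "{a..b}" "{b..c}" \<gamma>] by (simp add: pcurve_def)
    fix k assume k: "k \<in> \<A>"
    let ?S1 = "{t\<in>{a<..<b} - T. \<gamma> t \<in> fst k}" and ?S2 = "{t\<in>{b<..<c} - T. \<gamma> t \<in> fst k}"
    have eq: "{t\<in>{a<..<c} - T. \<gamma> t \<in> fst k} = ?S1 \<union> ?S2" using ab by (auto simp: T_def)
    have "(\<lambda>t. snd k (\<gamma> t)) C1_differentiable_on ?S1" "(\<lambda>t. snd k (\<gamma> t)) C1_differentiable_on ?S2"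
      using Q1 Q2 k unfolding pcurve_def by blast+
    then show "(\<lambda>t. snd k (\<gamma> t)) C1_differentiable_on {t\<in>{a<..<c} - T. \<gamma> t \<in> fst k}"
      unfolding eq C1_differentiable_on_eq
      using continuous_on_open_Un[OF pcurve_open[OF Q1 k] pcurve_open[OF Q2 k]] by blast
  qed
  have "len a c \<gamma> = (\<integral>\<^sup>+t. ennreal (speed \<gamma> t) * indicator ({a<..<b} - T) t + ennreal (speed \<gamma> t) * indicator ({b<..<c} - T) t \<partial>lborel)"
    unfolding len_eq[OF P] by (rule nn_integral_cong) (use ab in \<open>auto simp: indicator_def T_def\<close>)
  also have "\<dots> = len a b \<gamma> + len b c \<gamma>"
    unfolding len_eq[OF Q1] len_eq[OF Q2]
    using speed_measurable[OF Q1] speed_measurable[OF Q2] by (intro nn_integral_add) simp_all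
  finally show ?thesis using that P by blast
qed

section \<open>The distance\<close>

abbreviation ds :: "'m \<Rightarrow> 'm \<Rightarrow> ennreal" where "ds \<equiv> riemannian_dist \<A> g"

lemma ds_less_iff: "ds p q < e \<longleftrightarrow> (\<exists>\<gamma> T. pcurve 0 1 \<gamma> T \<and> \<gamma> 0 = p \<and> \<gamma> 1 = q \<and> len 0 1 \<gamma> < e)"
  unfolding riemannian_dist_def INF_less_iff by (auto simp: piecewise_pcurve curve_length_len)

lemma ds_le: "pcurve 0 1 \<gamma> T \<Longrightarrow> ds (\<gamma> 0) (\<gamma> 1) \<le> len 0 1 \<gamma>"
  unfolding riemannian_dist_def by (rule INF_lower2[of \<gamma>]) (auto simp: piecewise_pcurve curve_length_len)

lemma ds_sym: assumes "ds p q < e" shows "ds q p < e"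
proof -
  obtain \<gamma> T where \<gamma>: "pcurve 0 1 \<gamma> T" "\<gamma> 0 = p" "\<gamma> 1 = q" "len 0 1 \<gamma> < e"
    using assms ds_less_iff by blast
  define \<delta> where "\<delta> t = \<gamma> (1 + (-1) * t)" for t
  have "pcurve 0 1 \<delta> {t. 1 + (-1) * t \<in> T}" "len 0 1 \<delta> = len 0 1 \<gamma>"
    by (rule pcurve_affine[where \<alpha> = 1 and \<beta> = "-1", OF \<gamma>(1)]; auto simp: \<delta>_def)+
  then show ?thesis using \<gamma> ds_less_iff[of q p e] by (auto simp: \<delta>_def)
qed

text \<open>With strict bounds the infimum in the definition of the distance never has to be attained.\<close>

lemma ds_triangle:
  assumes "ds p q < ennreal a" "ds q r < ennreal b" "a \<ge> 0" "b \<ge> 0" shows "ds p r < ennreal (a + b)"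
proof -
  obtain \<gamma>1 T1 where \<gamma>1: "pcurve 0 1 \<gamma>1 T1" "\<gamma>1 0 = p" "\<gamma>1 1 = q" "len 0 1 \<gamma>1 < ennreal a"
    using assms ds_less_iff by blast
  obtain \<gamma>2 T2 where \<gamma>2: "pcurve 0 1 \<gamma>2 T2" "\<gamma>2 0 = q" "\<gamma>2 1 = r" "len 0 1 \<gamma>2 < ennreal b"
    using assms ds_less_iff by blast
  define \<delta> where "\<delta> t = (if t \<le> 1/2 then \<gamma>1 (0 + 2 * t) else \<gamma>2 (-1 + 2 * t))" for t
  have 1: "pcurve 0 (1/2) \<delta> {t. 0 + 2 * t \<in> T1}" "len 0 (1/2) \<delta> = len 0 1 \<gamma>1"
    by (rule pcurve_affine[where \<alpha> = 0 and \<beta> = 2, OF \<gamma>1(1)]; auto simp: \<delta>_def)+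
  have join: "\<delta> t = \<gamma>2 (-1 + 2 * t)" if "t \<in> {1/2..1}" for t
  proof (cases "t = 1/2")
    case True
    show ?thesis unfolding True using \<gamma>1(3) \<gamma>2(2) by (simp add: \<delta>_def)
  qed (use that in \<open>auto simp: \<delta>_def\<close>)
  have 2: "pcurve (1/2) 1 \<delta> {t. -1 + 2 * t \<in> T2}" "len (1/2) 1 \<delta> = len 0 1 \<gamma>2"
    by (rule pcurve_affine[where \<alpha> = "-1" and \<beta> = 2, OF \<gamma>2(1) _ _ _ join]; auto)+
  obtain T where T: "pcurve 0 1 \<delta> T" "len 0 1 \<delta> = len 0 (1/2) \<delta> + len (1/2) 1 \<delta>"
    using pcurve_glue[OF 1(1) 2(1)] by auto
  have "len 0 1 \<delta> < ennreal a + ennreal b"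
    unfolding T(2) 1(2) 2(2) by (rule add_strict_mono[OF \<gamma>1(4) \<gamma>2(4)])
  then have "len 0 1 \<delta> < ennreal (a + b)" using assms by (simp add: ennreal_plus)
  moreover have "\<delta> 0 = p" "\<delta> 1 = r" using \<gamma>1 \<gamma>2 by (auto simp: \<delta>_def)
  ultimately show ?thesis using T(1) ds_less_iff by blast
qed

text \<open>The straight segment in a chart is a competitor.\<close>

lemma ds_segment:
  assumes c: "c \<in> \<A>" and seg: "\<And>t. t \<in> {0..1} \<Longrightarrow> x + t *\<^sub>R (y - x) \<in> coord_range c"
    and M: "\<And>t. t \<in> {0..1} \<Longrightarrow> bform (G c (x + t *\<^sub>R (y - x))) (y - x) (y - x) \<le> M\<^sup>2" "M \<ge> 0"
  shows "ds (chart_inv c x) (chart_inv c y) \<le> ennreal M"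
proof -
  define \<xi> where "\<xi> t = x + t *\<^sub>R (y - x)" for t :: real
  define \<gamma> where "\<gamma> t = chart_inv c (\<xi> t)" for t
  have \<xi>c: "continuous_on S \<xi>" for S unfolding \<xi>_def by (intro continuous_intros)
  have \<gamma>in: "\<gamma> t \<in> fst c" "snd c (\<gamma> t) = \<xi> t" if "t \<in> {0..1}" for t
    using seg[OF that] chart_inv_in[OF c] c by (auto simp: \<gamma>_def \<xi>_def)
  have d: "(\<xi> has_vector_derivative (y - x)) (at t)" for t
    unfolding \<xi>_def by (auto intro!: derivative_eq_intros simp: has_vector_derivative_def)
  have P: "pcurve 0 1 \<gamma> {}"
    unfolding pcurve_def
  proof (intro conjI ballI finite.emptyI)
    show "continuous_on {0..1} \<gamma>"
      unfolding \<gamma>_def by (rule continuous_on_compose2[OF chart_continuous(2)[OF c] \<xi>c]) (use seg in \<open>auto simp: \<xi>_def\<close>)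
    fix c' assume c': "c' \<in> \<A>"
    have in_ov: "\<xi> t \<in> ov c c'" if "t \<in> {t\<in>{0<..<1} - {}. \<gamma> t \<in> fst c'}" for t
      using \<gamma>in[of t] that by force
    show "(\<lambda>t. snd c' (\<gamma> t)) C1_differentiable_on {t\<in>{0<..<1} - {}. \<gamma> t \<in> fst c'}"
      unfolding C1_differentiable_on_def
    proof (intro exI[of _ "\<lambda>t. vdir (y - x) (tr c c') (\<xi> t)"] conjI ballI)
      fix t assume t: "t \<in> {t\<in>{0<..<1} - {}. \<gamma> t \<in> fst c'}"
      have "((\<lambda>s. \<xi> s $ i) has_real_derivative (y - x) $ i) (at t)" for i
        using d[of t] by (simp add: has_vector_derivative_def has_derivative_vec_iff has_field_derivative_def mult_commute_abs)
      from has_real_derivative_along[OF this C_k_on_differentiable[OF tr_smooth[OF c c'] in_ov[OF t]]]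
      have "((\<lambda>s. tr c c' (\<xi> s) $ i) has_real_derivative vdir (y - x) (tr c c') (\<xi> t) $ i) (at t)" for i
        by (simp add: vdir_def dir_def mult.commute)
      then show "((\<lambda>t. snd c' (\<gamma> t)) has_vector_derivative vdir (y - x) (tr c c') (\<xi> t)) (at t)"
        unfolding \<gamma>_def by (simp add: has_vector_derivative_def has_derivative_vec_iff has_field_derivative_def mult_commute_abs)
    next
      have "continuous_on (ov c c') (\<lambda>x'. vdir (y - x) (tr c c') x' $ i)" for i
        by (rule C_k_on_continuous_on[OF vdir_tr_smooth[OF c c']])
      then have "continuous_on (ov c c') (\<lambda>x'. \<chi> i. vdir (y - x) (tr c c') x' $ i)"
        by (intro continuous_on_vec_lambda)
      then have "continuous_on (ov c c') (vdir (y - x) (tr c c'))" by simp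
      then show "continuous_on {t\<in>{0<..<1} - {}. \<gamma> t \<in> fst c'} (\<lambda>t. vdir (y - x) (tr c c') (\<xi> t))"
        by (rule continuous_on_compose2[OF _ \<xi>c]) (use in_ov in blast)
    qed
  qed
  have sp: "speed \<gamma> t \<le> M" if t: "t \<in> {0<..<1}" for t
  proof -
    have t01: "t \<in> {0..1}" using t by auto
    have "((\<lambda>s. snd c (\<gamma> s)) has_vector_derivative (y - x)) (at t)"
      by (rule has_vector_derivative_transform_within_open[OF d[of t], of "{0<..<1}"]) (use t \<gamma>in in auto)
    from speed_chart[OF c \<gamma>in(1)[OF t01] pcurve_isCont[OF P t] this]
    have "speed \<gamma> t = sqrt (bform (G c (\<xi> t)) (y - x) (y - x))" by (simp only: \<gamma>in(2)[OF t01])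
    also have "\<dots> \<le> sqrt (M\<^sup>2)" using M(1)[OF t01] by (simp only: \<xi>_def real_sqrt_le_iff)
    finally show ?thesis using M(2) by simp
  qed
  have "len 0 1 \<gamma> \<le> (\<integral>\<^sup>+t. ennreal M * indicator {0<..<1::real} t \<partial>lborel)"
    unfolding len_eq[OF P]
    by (rule nn_integral_mono) (auto simp: indicator_def intro!: ennreal_leI sp)
  also have "\<dots> = ennreal M" by (simp add: nn_integral_cmult_indicator)
  finally have "len 0 1 \<gamma> \<le> ennreal M" .
  moreover have "\<gamma> 0 = chart_inv c x" "\<gamma> 1 = chart_inv c y" by (auto simp: \<gamma>_def \<xi>_def)
  ultimately show ?thesis using ds_le[OF P] by simp
qed

end

context riemannian
begin

section \<open>The distance and the topology\<close>

text \<open>A curve from \<open>p\<close> that leaves \<open>W\<close> leaves a coordinate ball, inside of which the metric dominates a multiple of the Euclidean one. Up to the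
time of leaving, the Euclidean length of the curve is at least half the radius, and this bounds its length from below.\<close>

lemma ds_near:
  assumes W: "open W" "p \<in> W"
  obtains \<epsilon> where "\<epsilon> > 0" "\<And>q. ds p q < ennreal \<epsilon> \<Longrightarrow> q \<in> W"
proof -
  obtain c where c: "c \<in> \<A>" "p \<in> fst c" using chart_cover .
  interpret M: coord_metric "coord_range c" "G c" by (rule coord_metric_chart[OF c(1)])
  define x0 where "x0 = snd c p"
  have x0D: "x0 \<in> coord_range c" using c by (simp add: x0_def)
  obtain d0 m where dm: "d0 > 0" "m > 0" "ball x0 d0 \<subseteq> coord_range c"
    "\<And>x h. x \<in> ball x0 d0 \<Longrightarrow> m * (norm h)\<^sup>2 \<le> bform (G c x) h h"
    by (rule M.bform_compare[OF x0D zero_less_one]) (rule that, assumption+)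
  have oW: "open (snd c ` (fst c \<inter> W))" by (rule open_chart_image[OF c(1) W(1)])
  have "x0 \<in> snd c ` (fst c \<inter> W)" using c W by (auto simp: x0_def)
  then obtain d1 where d1: "d1 > 0" "ball x0 d1 \<subseteq> snd c ` (fst c \<inter> W)" using oW open_contains_ball by blast
  define r where "r = min d0 d1 / 2"
  have r: "r > 0" "cball x0 r \<subseteq> ball x0 d0" "cball x0 r \<subseteq> ball x0 d1" using dm d1 by (auto simp: r_def)
  have rD: "cball x0 r \<subseteq> coord_range c" using r(2) dm(3) by blast
  define B where "B = chart_inv c ` ball x0 r"
  have BW: "B \<subseteq> W"
  proof
    fix q assume "q \<in> B"
    then obtain x where x: "x \<in> ball x0 r" "q = chart_inv c x" by (auto simp: B_def)
    then have "x \<in> snd c ` (fst c \<inter> W)" using r(3) d1(2) ball_subset_cball by blast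
    then show "q \<in> W" using x c by auto
  qed
  have B_eq: "B = fst c \<inter> snd c -` ball x0 r"
    using rD c by (auto simp: B_def chart_inv_in subset_eq) (metis chart_inv_chart image_eqI mem_ball)
  have oB: "open B"
    using chart_vimage_open[OF c(1) open_ball] unfolding B_eq by (simp add: Int_def vimage_def)
  have pB: "p \<in> B" using c r by (simp add: B_eq x0_def)
  define K where "K = chart_inv c ` cball x0 (r/2)"
  have KB: "K \<subseteq> B" using r by (auto simp: K_def B_def)
  have "compact K"
    unfolding K_def by (rule compact_continuous_image[OF continuous_on_subset[OF chart_continuous(2)[OF c(1)]] compact_cball])
      (use rD r in auto)
  then have cK: "closed K" by (rule compact_imp_closed)
  have "q \<in> W" if q: "ds p q < ennreal (sqrt m * (r / 2))" for q
  proof (rule ccontr)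
    assume "q \<notin> W"
    then have qB: "q \<notin> B" using BW by blast
    obtain \<gamma> T where \<gamma>: "pcurve 0 1 \<gamma> T" "\<gamma> 0 = p" "\<gamma> 1 = q" "len 0 1 \<gamma> < ennreal (sqrt m * (r / 2))"
      using q ds_less_iff by blast
    have c\<gamma>: "continuous_on {0..1} \<gamma>" using \<gamma>(1) by (simp add: pcurve_def)
    have fT: "finite T" using \<gamma>(1) by (simp add: pcurve_def)
    define E where "E = {t \<in> {0..1}. \<gamma> t \<notin> B}"
    have E_eq: "E = {0..1} \<inter> \<gamma> -` (- B)" by (auto simp: E_def)
    have clE: "closed E"
      unfolding E_eq by (rule continuous_closed_preimage[OF c\<gamma>]) (use oB in auto)
    have E1: "1 \<in> E" using \<gamma>(3) qB by (simp add: E_def)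
    have bE: "bdd_below E" by (auto simp: E_def intro: bdd_belowI[of _ 0])
    \<comment> \<open>The first exit time. Shortly before it the curve is outside the half-sized ball, but still inside the chart.\<close>
    define \<tau> where "\<tau> = Inf E"
    have \<tau>E: "\<tau> \<in> E" unfolding \<tau>_def by (rule closed_contains_Inf[OF _ bE clE]) (use E1 in auto)
    have before: "\<gamma> t \<in> B" if "0 \<le> t" "t < \<tau>" for t
    proof (rule ccontr)
      assume "\<gamma> t \<notin> B"
      moreover have "\<tau> \<le> 1" using \<tau>E by (simp add: E_def)
      ultimately have "t \<in> E" using that by (simp add: E_def)
      then have "\<tau> \<le> t" unfolding \<tau>_def by (rule cInf_lower[OF _ bE])
      then show False using that by simp
    qed
    have \<tau>0: "\<tau> > 0"
    proof -
      have "\<tau> \<noteq> 0" using \<tau>E pB \<gamma>(2) by (auto simp: E_def)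
      then show ?thesis using \<tau>E by (simp add: E_def)
    qed
    have \<tau>1: "\<tau> \<le> 1" using \<tau>E by (simp add: E_def)
    have "\<exists>s. 0 \<le> s \<and> s < \<tau> \<and> \<gamma> s \<notin> K"
    proof (rule ccontr)
      assume "\<not> ?thesis"
      then have inK: "\<And>s. s \<in> {0..<\<tau>} \<Longrightarrow> \<gamma> s \<in> K" by auto
      have "\<gamma> \<tau> \<in> K"
      proof -
        have "closure {0..<\<tau>} = {0..\<tau>}" using \<tau>0 by simp
        moreover have "continuous_on (closure {0..<\<tau>}) \<gamma>"
          unfolding calculation by (rule continuous_on_subset[OF c\<gamma>]) (use \<tau>1 in auto)
        moreover have "\<gamma> ` {0..<\<tau>} \<subseteq> K" using inK by auto
        ultimately have "\<gamma> ` {0..\<tau>} \<subseteq> K" using image_closure_subset cK by metis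
        then show ?thesis using \<tau>0 by auto
      qed
      then show False using KB \<tau>E by (auto simp: E_def)
    qed
    then obtain s where s: "0 \<le> s" "s < \<tau>" "\<gamma> s \<notin> K" by blast
    define \<xi> where "\<xi> t = snd c (\<gamma> t)" for t
    have inB: "\<gamma> t \<in> B" if "t \<in> {0..s}" for t using before[of t] that s by auto
    have inc: "\<gamma> t \<in> fst c" "\<xi> t \<in> ball x0 r" if "t \<in> {0..s}" for t
      using inB[OF that] by (auto simp: B_eq \<xi>_def)
    have s01: "{0..s} \<subseteq> {0..1}" using s \<tau>1 by auto
    have \<xi>s: "norm (\<xi> s - \<xi> 0) \<ge> r / 2"
    proof (rule ccontr)
      assume "\<not> ?thesis"
      then have "\<xi> s \<in> cball x0 (r/2)" using \<gamma>(2) by (simp add: \<xi>_def x0_def dist_norm norm_minus_commute)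
      moreover have "\<gamma> s = chart_inv c (\<xi> s)" using inc(1)[of s] s c by (simp add: \<xi>_def)
      ultimately show False using s(3) by (auto simp: K_def)
    qed
    obtain D where D: "continuous_on {t\<in>{0<..<1} - T. \<gamma> t \<in> fst c} D"
      "\<And>t. t \<in> {0<..<1} - T \<Longrightarrow> \<gamma> t \<in> fst c \<Longrightarrow> ((\<lambda>s. snd c (\<gamma> s)) has_vector_derivative D t) (at t)"
      "\<And>t. t \<in> {0<..<1} - T \<Longrightarrow> \<gamma> t \<in> fst c \<Longrightarrow> speed \<gamma> t = sqrt (bform (G c (snd c (\<gamma> t))) (D t) (D t))"
      by (rule pcurve_derivative[OF \<gamma>(1) c(1)]) (rule that, assumption+)
    let ?U = "{0<..<s} - T"
    have U: "t \<in> {0<..<1} - T" "\<gamma> t \<in> fst c" "\<xi> t \<in> ball x0 r" if "t \<in> ?U" for t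
      using that s \<tau>1 inc[of t] by auto
    define F where "F t = indicator ?U t *\<^sub>R D t" for t
    have Fm: "F \<in> borel_measurable lborel"
    proof -
      have "continuous_on ?U D" by (rule continuous_on_subset[OF D(1)]) (use U in blast)
      moreover have "?U \<in> sets borel" using open_pieces[OF fT, of 0 s] by simp
      ultimately show ?thesis unfolding F_def[abs_def] using borel_measurable_continuous_on_indicator by simp
    qed
    have Fsp: "ennreal (sqrt m) * ennreal (norm (F t)) \<le> ennreal (speed \<gamma> t) * indicator ({0<..<1} - T) t" for t
    proof (cases "t \<in> ?U")
      case True
      have "m * (norm (D t))\<^sup>2 \<le> bform (G c (\<xi> t)) (D t) (D t)"
        by (rule dm(4)) (use U(3)[OF True] r(2) ball_subset_cball in blast)
      then have "sqrt (m * (norm (D t))\<^sup>2) \<le> speed \<gamma> t"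
        unfolding D(3)[OF U(1,2)[OF True]] by (simp only: \<xi>_def real_sqrt_le_iff)
      then have "sqrt m * norm (D t) \<le> speed \<gamma> t" by (simp add: real_sqrt_mult)
      then show ?thesis
        using True U(1)[OF True] dm(2) by (simp add: F_def ennreal_mult'[symmetric] ennreal_leI del: ennreal_mult')
    qed (simp add: F_def)
    have "ennreal (sqrt m) * (\<integral>\<^sup>+t. norm (F t) \<partial>lborel) = (\<integral>\<^sup>+t. ennreal (sqrt m) * ennreal (norm (F t)) \<partial>lborel)"
      using Fm by (intro nn_integral_cmult[symmetric]) simp
    also have "\<dots> \<le> len 0 1 \<gamma>"
      unfolding len_eq[OF \<gamma>(1)] by (rule nn_integral_mono) (rule Fsp)
    also note \<gamma>(4)
    finally have lt: "ennreal (sqrt m) * (\<integral>\<^sup>+t. norm (F t) \<partial>lborel) < ennreal (sqrt m * (r / 2))" .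
    have fin: "(\<integral>\<^sup>+t. norm (F t) \<partial>lborel) < \<infinity>"
    proof (rule ccontr)
      assume "\<not> ?thesis"
      then have "(\<integral>\<^sup>+t. norm (F t) \<partial>lborel) = \<infinity>" by (metis infinity_ennreal_def less_top)
      then show False using lt dm(2) by (simp add: ennreal_mult_top)
    qed
    have Fint: "integrable lborel F" using Fm fin by (simp add: integrable_iff_bounded)
    have "(F has_integral (integral\<^sup>L lborel F)) UNIV" by (rule has_integral_integral_lborel[OF Fint])
    moreover have "(F has_integral (\<xi> s - \<xi> 0)) UNIV"
    proof -
      have \<xi>c: "continuous_on {0..s} \<xi>"
        unfolding \<xi>_def by (rule continuous_on_compose2[OF chart_continuous(1)[OF c(1)] continuous_on_subset[OF c\<gamma> s01]])
          (use inc in auto)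
      have "(F has_integral (\<xi> s - \<xi> 0)) {0..s}"
      proof (rule fundamental_theorem_of_calculus_interior_strong[OF fT s(1) _ \<xi>c])
        fix t assume t: "t \<in> {0<..<s} - T"
        then show "(\<xi> has_vector_derivative F t) (at t)"
          using D(2)[OF U(1,2)[OF t]] by (simp add: F_def \<xi>_def[abs_def])
      qed
      then show ?thesis
        by (rule has_integral_on_superset) (auto simp: F_def)
    qed
    ultimately have "\<xi> s - \<xi> 0 = integral\<^sup>L lborel F" by (rule has_integral_unique[symmetric])
    then have "ennreal (norm (\<xi> s - \<xi> 0)) \<le> (\<integral>\<^sup>+t. norm (F t) \<partial>lborel)"
      using integral_norm_bound_ennreal[OF Fint] by simp
    then have "ennreal (sqrt m) * ennreal (norm (\<xi> s - \<xi> 0)) \<le> ennreal (sqrt m) * (\<integral>\<^sup>+t. norm (F t) \<partial>lborel)"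
      by (rule mult_left_mono) simp
    also note lt
    finally have "ennreal (sqrt m * norm (\<xi> s - \<xi> 0)) < ennreal (sqrt m * (r / 2))"
      using dm(2) by (simp add: ennreal_mult')
    then have "sqrt m * norm (\<xi> s - \<xi> 0) < sqrt m * (r / 2)" using dm(2) by (simp add: ennreal_less_iff)
    then show False using \<xi>s dm(2) by simp
  qed
  then show ?thesis using that[of "sqrt m * (r / 2)"] dm(2) r(1) by simp
qed

lemma near_ds:
  assumes \<epsilon>: "\<epsilon> > 0"
  obtains W where "open W" "p \<in> W" "\<And>q. q \<in> W \<Longrightarrow> ds p q < ennreal \<epsilon>"
proof -
  obtain c where c: "c \<in> \<A>" "p \<in> fst c" using chart_cover .
  interpret M: coord_metric "coord_range c" "G c" by (rule coord_metric_chart[OF c(1)])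
  define x0 where "x0 = snd c p"
  have x0D: "x0 \<in> coord_range c" using c by (simp add: x0_def)
  obtain d where d: "d > 0" "ball x0 d \<subseteq> coord_range c"
    "\<And>x h. x \<in> ball x0 d \<Longrightarrow> \<bar>bform (G c x) h h - bform (G c x0) h h\<bar> \<le> 1 * (norm h)\<^sup>2"
    by (rule M.bform_perturb[OF x0D zero_less_one]) (rule that, assumption+)
  have "continuous_on UNIV (\<lambda>h. bform (G c x0) h h)" unfolding bform_def by (intro continuous_intros)
  then have "isCont (\<lambda>h. bform (G c x0) h h) 0" by (rule continuous_on_open_isCont) auto
  then have "\<forall>e>0. \<exists>d>0. \<forall>h. norm h < d \<longrightarrow> \<bar>bform (G c x0) h h\<bar> < e"
    unfolding continuous_at_eps_delta by (simp add: dist_norm)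
  moreover have "(\<epsilon> / 2)\<^sup>2 / 2 > 0" using \<epsilon> by simp
  ultimately obtain d' where d': "d' > 0" "\<And>h. norm h < d' \<Longrightarrow> \<bar>bform (G c x0) h h\<bar> < (\<epsilon> / 2)\<^sup>2 / 2"
    by blast
  define r where "r = min d (min d' (\<epsilon> / 4))"
  have r: "r > 0" using d d' \<epsilon> by (simp add: r_def)
  define W where "W = fst c \<inter> snd c -` ball x0 r"
  have oW: "open W"
    using chart_vimage_open[OF c(1) open_ball] unfolding W_def by (simp add: Int_def vimage_def)
  have pW: "p \<in> W" using c r by (simp add: W_def x0_def)
  have "ds p q < ennreal \<epsilon>" if q: "q \<in> W" for q
  proof -
    define y where "y = snd c q"
    have y: "y \<in> ball x0 r" "q = chart_inv c y" using q c by (auto simp: W_def y_def)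
    have seg: "x0 + t *\<^sub>R (y - x0) \<in> ball x0 d" if "t \<in> {0..1}" for t
    proof -
      have "norm (t *\<^sub>R (y - x0)) \<le> 1 * norm (y - x0)" using that unfolding norm_scaleR by (intro mult_right_mono) auto
      then show ?thesis using y(1) by (simp add: dist_norm norm_minus_commute r_def)
    qed
    have "ds (chart_inv c x0) (chart_inv c y) \<le> ennreal (\<epsilon> / 2)"
    proof (rule ds_segment[OF c(1)])
      fix t :: real assume t: "t \<in> {0..1}"
      show "x0 + t *\<^sub>R (y - x0) \<in> coord_range c" using seg[OF t] d(2) by blast
      have n: "norm (y - x0) < d'" "norm (y - x0) \<le> \<epsilon> / 4" using y(1) by (auto simp: dist_norm norm_minus_commute r_def)
      have "(norm (y - x0))\<^sup>2 \<le> (\<epsilon> / 4)\<^sup>2" using n(2) by (intro power_mono) auto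
      also have "\<dots> \<le> (\<epsilon> / 2)\<^sup>2 / 2" by (simp add: power2_eq_square)
      finally show "bform (G c (x0 + t *\<^sub>R (y - x0))) (y - x0) (y - x0) \<le> (\<epsilon> / 2)\<^sup>2"
        using d(3)[OF seg[OF t], of "y - x0"] d'(2)[OF n(1)] by linarith
    qed (use \<epsilon> in simp)
    also have "\<dots> < ennreal \<epsilon>" using \<epsilon> by (simp add: ennreal_less_iff)
    finally show ?thesis using y c by (simp add: x0_def)
  qed
  then show ?thesis using that oW pW by blast
qed

end

section \<open>Chains with small steps cannot escape\<close>

text \<open>The diagonal argument of total boundedness: if at every scale finitely many centres suffice eventually, a subsequence has
eventually one centre at every scale.\<close>

lemma common_approximation_subsequence:
  fixes P :: "real \<Rightarrow> 'a \<Rightarrow> nat \<Rightarrow> bool"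
  assumes "\<And>e. e > 0 \<Longrightarrow> \<exists>A K. finite A \<and> (\<forall>k\<ge>K. \<exists>a\<in>A. P e a k)"
  shows "\<exists>r :: nat \<Rightarrow> nat. strict_mono r \<and> (\<forall>e>0. \<exists>N a. \<forall>m\<ge>N. \<exists>e'\<le>e. e' > 0 \<and> P e' a (r m))"
proof -
  define \<epsilon> where "\<epsilon> n = inverse (real (Suc n))" for n
  define Q where "Q n s \<longleftrightarrow> (\<exists>a. \<forall>m. P (\<epsilon> n) a (s m))" for n and s :: "nat \<Rightarrow> nat"
  interpret subseqs Q
  proof
    fix n and s :: "nat \<Rightarrow> nat" assume s: "strict_mono s"
    have "\<epsilon> n > 0" by (simp add: \<epsilon>_def)
    then obtain A K where A: "finite A" "\<And>k. k \<ge> K \<Longrightarrow> \<exists>a\<in>A. P (\<epsilon> n) a k" using assms by blast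
    have "{K..} \<subseteq> (\<Union>a\<in>A. {m. P (\<epsilon> n) a (s m)})"
    proof
      fix m assume "m \<in> {K..}"
      then have "s m \<ge> K" using strict_mono_imp_increasing[OF s, of m] by simp
      then show "m \<in> (\<Union>a\<in>A. {m. P (\<epsilon> n) a (s m)})" using A(2) by blast
    qed
    then have "infinite (\<Union>a\<in>A. {m. P (\<epsilon> n) a (s m)})"
      using infinite_Ici[of K] finite_subset by blast
    then obtain a where "infinite {m. P (\<epsilon> n) a (s m)}" using A(1) by blast
    then obtain r :: "nat \<Rightarrow> nat" where r: "strict_mono r" "\<And>m. r m \<in> {m. P (\<epsilon> n) a (s m)}"
      using infinite_enumerate by blast
    then show "\<exists>r'. strict_mono r' \<and> Q n (s \<circ> r')" unfolding Q_def by (intro exI[of _ r]) auto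
  qed
  show ?thesis
  proof (intro exI[of _ diagseq] conjI allI impI subseq_diagseq)
    fix e :: real assume "e > 0"
    then obtain n where n: "\<epsilon> n < e" using reals_Archimedean unfolding \<epsilon>_def by blast
    have "Q n (diagseq \<circ> ((+) (Suc n)))"
      by (rule diagseq_holds) (auto simp: Q_def)
    then obtain a where a: "\<And>m. P (\<epsilon> n) a (diagseq (Suc n + m))" unfolding Q_def by auto
    have "P (\<epsilon> n) a (diagseq m)" if "m \<ge> Suc n" for m
      using a[of "m - Suc n"] that by simp
    then show "\<exists>N a. \<forall>m\<ge>N. \<exists>e'\<le>e. e' > 0 \<and> P e' a (diagseq m)"
      using n by (intro exI[of _ "Suc n"] exI[of _ a]) (auto intro!: exI[of _ "\<epsilon> n"] simp: \<epsilon>_def)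
  qed
qed

context riemannian
begin

text \<open>Steps are bounded by numbers instead of being measured, so that one never computes a distance.\<close>

definition chain :: "nat \<Rightarrow> (nat \<Rightarrow> 'm) \<Rightarrow> (nat \<Rightarrow> real) \<Rightarrow> bool" where
  "chain N x \<sigma> \<longleftrightarrow> (\<forall>i<N. \<sigma> i \<ge> 0 \<and> ds (x i) (x (Suc i)) < ennreal (\<sigma> i))"

lemma ds_self: "\<epsilon> > 0 \<Longrightarrow> ds p p < ennreal \<epsilon>"
  using near_ds by metis

lemma chain_ds:
  assumes C: "chain N x \<sigma>" and i: "i < N" shows "ds (x i) (x N) < ennreal (\<Sum>j=i..<N. \<sigma> j)"
proof -
  have "Suc i + k \<le> N \<Longrightarrow> ds (x i) (x (Suc i + k)) < ennreal (\<Sum>j=i..<Suc i + k. \<sigma> j)" for k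
  proof (induction k)
    case 0
    then show ?case using C by (simp add: chain_def)
  next
    case (Suc k)
    have 1: "ds (x i) (x (Suc i + k)) < ennreal (\<Sum>j=i..<Suc i + k. \<sigma> j)" using Suc by simp
    have 2: "ds (x (Suc i + k)) (x (Suc (Suc i + k))) < ennreal (\<sigma> (Suc i + k))" "\<sigma> (Suc i + k) \<ge> 0"
      using C Suc.prems by (auto simp: chain_def)
    have 3: "(\<Sum>j=i..<Suc i + k. \<sigma> j) \<ge> 0" using C Suc.prems by (intro sum_nonneg) (auto simp: chain_def)
    show ?case using ds_triangle[OF 1 2(1) 3 2(2)] by simp
  qed
  from this[of "N - Suc i"] show ?thesis using i by simp
qed

end

locale proper_riemannian = riemannian \<A> g for \<A> :: "('m::{t2_space,second_countable_topology}, 'n::finite) chart set" and g :: "'m metric" +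
  fixes h :: "'m \<Rightarrow> real"
  assumes complete: "\<And>\<sigma>::nat \<Rightarrow> 'm. (\<forall>e>0. \<exists>N. \<forall>m\<ge>N. \<forall>k\<ge>N. riemannian_dist \<A> g (\<sigma> m) (\<sigma> k) < e) \<Longrightarrow>
        \<exists>p. (\<lambda>k. riemannian_dist \<A> g (\<sigma> k) p) \<longlonglongrightarrow> 0"
    and h_continuous: "continuous_on UNIV h" and h_proper: "compact {x. h x \<le> C}"
begin

text \<open>The substitute for the Hopf-Rinow theorem, by contradiction at the critical total length \<open>l0\<close>: chains shorter than \<open>l0\<close> end in a
compact set if their steps are small. A chain that is barely longer than \<open>l0\<close> is then close to such an end point, so the end points of
longer and longer escaping chains are totally bounded, and by completeness a subsequence converges, which contradicts that
\<open>h\<close> tends to infinity along it. Unlike balls, chains with small steps need no information about length-minimising curves.\<close>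

theorem chains_bounded:
  "\<exists>A s. s > 0 \<and> (\<forall>N x \<sigma>. h (x 0) \<le> c \<longrightarrow> chain N x \<sigma> \<longrightarrow> (\<forall>i<N. \<sigma> i \<le> s) \<longrightarrow> (\<Sum>i<N. \<sigma> i) \<le> L \<longrightarrow> h (x N) \<le> A)"
proof (rule ccontr)
  define good where "good l \<longleftrightarrow> (\<exists>A s. s > 0 \<and> (\<forall>N x \<sigma>. h (x 0) \<le> c \<longrightarrow> chain N x \<sigma> \<longrightarrow> (\<forall>i<N. \<sigma> i \<le> s) \<longrightarrow> (\<Sum>i<N. \<sigma> i) \<le> l \<longrightarrow> h (x N) \<le> A))" for l
  assume "\<not> ?thesis"
  then have badL: "\<not> good L" by (simp add: good_def)
  have mono: "good l'" if "good l" "l' \<le> l" for l l'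
    using that unfolding good_def by (meson order_trans)
  have neg: "good l" if "l < 0" for l
  proof -
    have "\<not> (\<Sum>i<N. \<sigma> i) \<le> l" if "chain N x \<sigma>" for N x \<sigma>
    proof -
      have "(\<Sum>i<N. \<sigma> i) \<ge> 0" using that by (intro sum_nonneg) (auto simp: chain_def)
      then show ?thesis using \<open>l < 0\<close> by simp
    qed
    then show ?thesis unfolding good_def by (intro exI[of _ 0] exI[of _ 1]) auto
  qed
  define l0 where "l0 = Inf {l. \<not> good l}"
  have bdd: "bdd_below {l. \<not> good l}" by (rule bdd_belowI[of _ 0]) (use neg not_less in blast)
  have below: "good l" if "l < l0" for l
  proof (rule ccontr)
    assume "\<not> good l"
    then have "l0 \<le> l" unfolding l0_def by (intro cInf_lower bdd) auto
    then show False using that by simp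
  qed
  have above: "\<not> good l" if "l > l0" for l
  proof
    assume "good l"
    then have "l \<le> l'" if "\<not> good l'" for l' using mono[OF \<open>good l\<close>, of l'] that by linarith
    then have "l \<le> l0" unfolding l0_def using badL by (intro cInf_greatest) auto
    then show False using that by simp
  qed
  define \<eta> where "\<eta> k = inverse (real (Suc k))" for k
  have \<eta>0: "\<eta> k > 0" for k by (simp add: \<eta>_def)
  have "\<exists>N x \<sigma>. h (x 0) \<le> c \<and> chain N x \<sigma> \<and> (\<forall>i<N. \<sigma> i \<le> \<eta> k) \<and> (\<Sum>i<N. \<sigma> i) \<le> l0 + \<eta> k \<and> h (x N) > real k" for k
  proof -
    have "\<not> good (l0 + \<eta> k)" using above \<eta>0[of k] by simp
    then have "\<not> (\<forall>N x \<sigma>. h (x 0) \<le> c \<longrightarrow> chain N x \<sigma> \<longrightarrow> (\<forall>i<N. \<sigma> i \<le> \<eta> k) \<longrightarrow> (\<Sum>i<N. \<sigma> i) \<le> l0 + \<eta> k \<longrightarrow> h (x N) \<le> real k)"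
      using \<eta>0[of k] unfolding good_def by blast
    then show ?thesis by (auto simp: not_le)
  qed
  then obtain N x \<sigma> where C: "\<And>k. h (x k 0) \<le> c" "\<And>k. chain (N k) (x k) (\<sigma> k)" "\<And>k i. i < N k \<Longrightarrow> \<sigma> k i \<le> \<eta> k"
     "\<And>k. (\<Sum>i<N k. \<sigma> k i) \<le> l0 + \<eta> k" "\<And>k. h (x k (N k)) > real k"
    by metis
  define y where "y k = x k (N k)" for k
  have tail: "\<exists>B K. \<forall>k\<ge>K. \<exists>z. h z \<le> B \<and> ds z (y k) < ennreal (4 * \<epsilon>)" if \<epsilon>: "\<epsilon> > 0" for \<epsilon>
  proof -
    have "good (l0 - \<epsilon>)" using below \<epsilon> by simp
    then obtain B s where B: "s > 0" "\<And>N x \<sigma>. h (x 0) \<le> c \<Longrightarrow> chain N x \<sigma> \<Longrightarrow> (\<forall>i<N. \<sigma> i \<le> s) \<Longrightarrow> (\<Sum>i<N. \<sigma> i) \<le> l0 - \<epsilon> \<Longrightarrow> h (x N) \<le> B"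
      unfolding good_def by blast
    have "min s \<epsilon> > 0" using B \<epsilon> by simp
    then obtain K where K: "\<eta> K < min s \<epsilon>" using reals_Archimedean unfolding \<eta>_def by blast
    have "\<exists>z. h z \<le> max B c \<and> ds z (y k) < ennreal (4 * \<epsilon>)" if k: "k \<ge> K" for k
    proof -
      have "\<eta> k \<le> \<eta> K" using k by (simp add: \<eta>_def)
      then have \<eta>k: "\<eta> k \<le> s" "\<eta> k < \<epsilon>" using K by auto
      \<comment> \<open>The last point at which the chain is shorter than \<open>l0 - \<epsilon>\<close>.\<close>
      define J where "J = {i. i \<le> N k \<and> (i = 0 \<or> (\<Sum>j<i. \<sigma> k j) \<le> l0 - \<epsilon>)}"
      have J: "finite J" "0 \<in> J" by (auto simp: J_def)
      define i where "i = Max J"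
      have iJ: "i \<in> J" unfolding i_def by (rule Max_in) (use J in auto)
      have iN: "i \<le> N k" using iJ by (simp add: J_def)
      have "h (x k i) \<le> max B c"
      proof (cases "i = 0")
        case False
        then have "(\<Sum>j<i. \<sigma> k j) \<le> l0 - \<epsilon>" using iJ by (simp add: J_def)
        moreover have "chain i (x k) (\<sigma> k)" using C(2)[of k] iN by (simp add: chain_def)
        moreover have "\<forall>j<i. \<sigma> k j \<le> s" using C(3)[of _ k] iN \<eta>k(1) by (meson le_trans less_le_trans order_trans)
        ultimately show ?thesis using B(2)[of "x k" i "\<sigma> k"] C(1)[of k] by (meson max.coboundedI1)
      qed (use C(1) in \<open>simp add: max.coboundedI2\<close>)
      moreover have "ds (x k i) (y k) < ennreal (4 * \<epsilon>)"
      proof (cases "i = N k")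
        case True
        then show ?thesis using ds_self[of "4 * \<epsilon>" "y k"] \<epsilon> by (simp add: y_def)
      next
        case False
        then have iN': "i < N k" using iN by simp
        have "Suc i \<notin> J" using Max_ge[OF J(1), of "Suc i"] by (auto simp: i_def)
        then have "(\<Sum>j<Suc i. \<sigma> k j) > l0 - \<epsilon>" using iN' by (simp add: J_def)
        then have "(\<Sum>j<i. \<sigma> k j) > l0 - 2 * \<epsilon>" using C(3)[OF iN'] \<eta>k by simp
        moreover have "(\<Sum>j<N k. \<sigma> k j) = (\<Sum>j<i. \<sigma> k j) + (\<Sum>j=i..<N k. \<sigma> k j)"
          using iN by (metis atLeast0LessThan le0 sum.atLeastLessThan_concat)
        ultimately have "(\<Sum>j=i..<N k. \<sigma> k j) \<le> 4 * \<epsilon>" using C(4)[of k] \<eta>k \<epsilon> by linarith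
        then show ?thesis
          using chain_ds[OF C(2) iN'] unfolding y_def by (meson ennreal_leI less_le_trans)
      qed
      ultimately show ?thesis by blast
    qed
    then show ?thesis by blast
  qed
  have net: "\<exists>A K. finite A \<and> (\<forall>k\<ge>K. \<exists>a\<in>A. ds a (y k) < ennreal e)" if e: "e > 0" for e
  proof -
    define \<epsilon> where "\<epsilon> = e / 5"
    have \<epsilon>: "\<epsilon> > 0" using e by (simp add: \<epsilon>_def)
    obtain B K where B: "\<And>k. k \<ge> K \<Longrightarrow> \<exists>z. h z \<le> B \<and> ds z (y k) < ennreal (4 * \<epsilon>)" using tail[OF \<epsilon>] by blast
    have "\<forall>p. \<exists>W. open W \<and> p \<in> W \<and> (\<forall>q\<in>W. ds p q < ennreal \<epsilon>)" using near_ds[OF \<epsilon>] by metis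
    then obtain W where W: "\<And>p. open (W p)" "\<And>p. p \<in> W p" "\<And>p q. q \<in> W p \<Longrightarrow> ds p q < ennreal \<epsilon>" by metis
    have cover: "{x. h x \<le> B} \<subseteq> (\<Union>p\<in>UNIV. W p)" using W(2) by auto
    obtain A where A: "finite A" "{x. h x \<le> B} \<subseteq> (\<Union>p\<in>A. W p)"
      by (rule compactE_image[OF h_proper[of B] W(1) cover]) (rule that)
    have "\<exists>a\<in>A. ds a (y k) < ennreal e" if k: "k \<ge> K" for k
    proof -
      obtain z where z: "h z \<le> B" "ds z (y k) < ennreal (4 * \<epsilon>)" using B[OF k] by auto
      then obtain a where a: "a \<in> A" "z \<in> W a" using subsetD[OF A(2), of z] by auto
      have "ds a (y k) < ennreal (\<epsilon> + 4 * \<epsilon>)" by (rule ds_triangle[OF W(3)[OF a(2)] z(2)]) (use \<epsilon> in auto)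
      then show ?thesis using a(1) by (auto simp: \<epsilon>_def)
    qed
    then show ?thesis using A(1) by blast
  qed
  have "\<exists>r :: nat \<Rightarrow> nat. strict_mono r \<and> (\<forall>e>0. \<exists>N a. \<forall>m\<ge>N. \<exists>e'\<le>e. e' > 0 \<and> ds a (y (r m)) < ennreal e')"
    by (rule common_approximation_subsequence) (rule net)
  then obtain r :: "nat \<Rightarrow> nat" where r: "strict_mono r" "\<forall>e>0. \<exists>N a. \<forall>m\<ge>N. \<exists>e'\<le>e. e' > 0 \<and> ds a (y (r m)) < ennreal e'"
    by (elim exE conjE) (rule that)
  have "\<exists>p. (\<lambda>k. ds (y (r k)) p) \<longlonglongrightarrow> 0"
  proof (rule complete, intro allI impI)
    fix e :: ennreal assume "e > 0"
    then obtain e1 where e1: "0 < e1" "e1 < e" using dense by blast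
    then have "e1 < top" by (meson less_le_trans top_greatest)
    then obtain e2 where e2: "e1 = ennreal e2" "e2 \<ge> 0" by (cases e1) auto
    then have "e2 / 2 > 0" using e1(1) by (cases "e2 = 0") auto
    from r(2)[rule_format, OF this] obtain N :: nat and a where N: "\<And>m. m \<ge> N \<Longrightarrow> \<exists>e'\<le>e2 / 2. e' > 0 \<and> ds a (y (r m)) < ennreal e'" by blast
    have N': "ds a (y (r m)) < ennreal (e2 / 2)" if "m \<ge> N" for m
      using N[OF that] by (meson ennreal_leI less_le_trans)
    have "ds (y (r m)) (y (r k)) < e" if "m \<ge> N" "k \<ge> N" for m k
    proof -
      have "ds (y (r m)) (y (r k)) < ennreal (e2 / 2 + e2 / 2)"
        by (rule ds_triangle[OF ds_sym[OF N'[OF that(1)]] N'[OF that(2)]]) (use e2 in auto)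
      then show ?thesis using e1 e2 by simp
    qed
    then show "\<exists>N. \<forall>m\<ge>N. \<forall>k\<ge>N. ds (y (r m)) (y (r k)) < e" by blast
  qed
  then obtain p where p: "(\<lambda>k. ds (y (r k)) p) \<longlonglongrightarrow> 0" by blast
  have oW: "open {q. h q < h p + 1}"
    using open_Collect_less[OF h_continuous continuous_on_const] .
  obtain \<epsilon> where \<epsilon>: "\<epsilon> > 0" "\<And>q. ds p q < ennreal \<epsilon> \<Longrightarrow> q \<in> {q. h q < h p + 1}"
    using ds_near[OF oW, of p] by auto
  have "\<forall>\<^sub>F k in sequentially. ds (y (r k)) p < ennreal \<epsilon>"
    using order_tendstoD(2)[OF p, of "ennreal \<epsilon>"] \<epsilon>(1) by simp
  then obtain K where K: "\<And>k. k \<ge> K \<Longrightarrow> ds (y (r k)) p < ennreal \<epsilon>" by (auto simp: eventually_sequentially)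
  obtain M :: nat where M: "real M > h p + 1" using reals_Archimedean2 by blast
  define k where "k = max K M"
  have "h (y (r k)) < h p + 1" using \<epsilon>(2)[OF ds_sym[OF K, of k]] by (simp add: k_def)
  moreover have "h (y (r k)) > real (r k)" using C(5) by (simp add: y_def)
  moreover have "r k \<ge> M" using strict_mono_imp_increasing[OF r(1), of k] by (simp add: k_def)
  ultimately show False using M by simp
qed

end

section \<open>A cutoff that is flat on a ball\<close>

text \<open>Equal to \<open>1\<close> on the ball and larger outside of it; the cube makes it twice continuously differentiable, with vanishing first and
second derivatives on the closed ball.\<close>

definition cutoff :: "real^'n::finite \<Rightarrow> real \<Rightarrow> real^'n \<Rightarrow> real" where
  "cutoff q r x = 1 + (max ((\<Sum>i\<in>UNIV. (x $ i - q $ i) * (x $ i - q $ i)) - r * r) 0) ^ 3"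

lemma cutoff_norm: "cutoff q r x = 1 + (max ((norm (x - q))\<^sup>2 - r\<^sup>2) 0) ^ 3"
  unfolding cutoff_def power2_norm_eq_inner inner_vec_def by (simp add: power2_eq_square)

lemma cutoff_ge_1: "cutoff q r x \<ge> 1"
  by (simp add: cutoff_def)

lemma cutoff_eq_1: "r \<ge> 0 \<Longrightarrow> cutoff q r x = 1 \<longleftrightarrow> norm (x - q) \<le> r"
proof -
  assume r: "r \<ge> 0"
  have "cutoff q r x = 1 \<longleftrightarrow> (norm (x - q))\<^sup>2 \<le> r\<^sup>2" by (auto simp: cutoff_norm max_def)
  then show ?thesis using r by simp
qed

context
  fixes q :: "real^'n::finite" and r :: real
begin

private definition \<phi> :: "real^'n \<Rightarrow> real" where "\<phi> x = (\<Sum>i\<in>UNIV. (x $ i - q $ i) * (x $ i - q $ i)) - r * r"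

private lemma \<phi>_smooth: "C_k_on k UNIV \<phi>"
  unfolding \<phi>_def by (intro C_k_on_diff C_k_on_sum C_k_on_mult open_UNIV C_k_on_coord C_k_on_const)

private lemma cutoff_\<phi>: "cutoff q r = (\<lambda>x. 1 + (max (\<phi> x) 0) ^ 3)"
  by (simp add: cutoff_def \<phi>_def fun_eq_iff)

private lemma \<phi>_differentiable: "\<phi> differentiable (at x)" "partial_d i \<phi> differentiable (at x)"
  using C_k_on_differentiable[OF \<phi>_smooth[of "Suc 0"], of x]
    C_k_on_differentiable[OF C_k_on_partial[OF \<phi>_smooth[of "Suc (Suc 0)"]], of x i] by auto

private lemma cutoff_chain:
  "(\<lambda>x. max (\<phi> x) 0 ^ 3) differentiable (at x)" "(\<lambda>x. max (\<phi> x) 0 ^ 2) differentiable (at x)"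
  "partial_d i (\<lambda>x. max (\<phi> x) 0 ^ 3) x = 3 * (max (\<phi> x) 0)\<^sup>2 * partial_d i \<phi> x"
  "partial_d i (\<lambda>x. max (\<phi> x) 0 ^ 2) x = 2 * max (\<phi> x) 0 * partial_d i \<phi> x"
proof -
  have 3: "((\<lambda>t. max t 0 ^ 3) has_real_derivative 3 * (max (\<phi> x) 0)\<^sup>2) (at (\<phi> x))"
    using has_real_derivative_pos_part_power[of 1 "\<phi> x"] by (simp add: eval_nat_numeral)
  have 2: "((\<lambda>t. max t 0 ^ 2) has_real_derivative 2 * max (\<phi> x) 0) (at (\<phi> x))"
    using has_real_derivative_pos_part_power[of 0 "\<phi> x"] by (simp add: eval_nat_numeral)
  show "(\<lambda>x. max (\<phi> x) 0 ^ 3) differentiable (at x)" "(\<lambda>x. max (\<phi> x) 0 ^ 2) differentiable (at x)"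
    by (rule differentiable_chain_real[OF \<phi>_differentiable(1)], rule 3 2)+
  show "partial_d i (\<lambda>x. max (\<phi> x) 0 ^ 3) x = 3 * (max (\<phi> x) 0)\<^sup>2 * partial_d i \<phi> x"
    by (rule partial_d_chain_real[OF \<phi>_differentiable(1) 3])
  show "partial_d i (\<lambda>x. max (\<phi> x) 0 ^ 2) x = 2 * max (\<phi> x) 0 * partial_d i \<phi> x"
    by (rule partial_d_chain_real[OF \<phi>_differentiable(1) 2])
qed

lemma cutoff_smooth: "C_k_on 2 UNIV (cutoff q r)"
proof -
  have "C_k_on 2 UNIV (\<lambda>x. max (\<phi> x) 0 ^ (2 + 1))" by (rule C_k_on_pos_part_power[OF open_UNIV \<phi>_smooth])
  then have "C_k_on 2 UNIV (\<lambda>x. max (\<phi> x) 0 ^ 3)" by (simp only: numeral_Bit1 numeral_One one_add_one[symmetric] add.assoc[symmetric])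
  then show ?thesis unfolding cutoff_\<phi> by (intro C_k_on_add open_UNIV C_k_on_const)
qed

lemma cutoff_flat:
  assumes z: "norm (z - q) \<le> r"
  shows "dir e (cutoff q r) z = 0" "dir e (dir e (cutoff q r)) z = 0"
proof -
  have "(norm (z - q))\<^sup>2 \<le> r\<^sup>2" using z by (rule power_mono) simp
  then have z0: "\<phi> z \<le> 0"
    unfolding \<phi>_def power2_norm_eq_inner inner_vec_def by (simp add: power2_eq_square)
  have p1: "partial_d i (cutoff q r) x = (3 * max (\<phi> x) 0 ^ 2) * partial_d i \<phi> x" for i x
    unfolding cutoff_\<phi> by (subst partial_d_add) (auto simp: cutoff_chain)
  have "partial_d i (cutoff q r) z = 0" for i using z0 by (simp add: p1 max_def)
  then show "dir e (cutoff q r) z = 0" by (simp add: dir_def)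
  have "partial_d j (partial_d i (cutoff q r)) z = 0" for i j
  proof -
    have "partial_d i (cutoff q r) = (\<lambda>x. 3 * max (\<phi> x) 0 ^ 2 * partial_d i \<phi> x)" by (rule ext) (rule p1)
    then have "partial_d j (partial_d i (cutoff q r)) z = partial_d j (\<lambda>x. 3 * (max (\<phi> x) 0 ^ 2 * partial_d i \<phi> x)) z"
      by (simp add: mult.assoc)
    also have "\<dots> = 3 * partial_d j (\<lambda>x. max (\<phi> x) 0 ^ 2 * partial_d i \<phi> x) z"
      by (rule partial_d_cmult) (intro differentiable_mult cutoff_chain \<phi>_differentiable)
    also have "\<dots> = 0" using z0
      by (subst partial_d_mult[OF cutoff_chain(2) \<phi>_differentiable(2)]) (simp add: cutoff_chain(4) max_absorb2)
    finally show ?thesis .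
  qed
  then show "dir e (dir e (cutoff q r)) z = 0"
    by (simp add: dir_dir_expand[OF open_UNIV _ cutoff_smooth])
qed

end

lemma cutoff_continuous: "continuous_on S (cutoff q r)"
  using C_k_on_continuous_on[OF cutoff_smooth] continuous_on_subset by blast

section \<open>Patches and step costs\<close>

type_synonym ('m, 'n) patch = "('m, 'n) chart \<times> (real^'n) \<times> real"

context riemannian
begin

text \<open>A patch is a chart with a ball of radius \<open>2 r\<close> inside its range. A step of a chain is measured in the coordinates of one of finitely
many patches; it may use a patch only within the larger ball, which is compact, and is meant to use it within the ball of radius \<open>r\<close>, the core,
where its cost is the metric itself.\<close>

definition patch :: "('m, 'n) patch \<Rightarrow> bool" where
  "patch P \<longleftrightarrow> fst P \<in> \<A> \<and> snd (snd P) > 0 \<and> cball (fst (snd P)) (2 * snd (snd P)) \<subseteq> coord_range (fst P)"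

definition patch_dom :: "('m, 'n) patch \<Rightarrow> 'm set" where
  "patch_dom P = {p \<in> fst (fst P). snd (fst P) p \<in> cball (fst (snd P)) (2 * snd (snd P))}"

definition patch_int :: "('m, 'n) patch \<Rightarrow> 'm set" where
  "patch_int P = {p \<in> fst (fst P). snd (fst P) p \<in> ball (fst (snd P)) (2 * snd (snd P))}"

definition patch_core :: "('m, 'n) patch \<Rightarrow> 'm set" where
  "patch_core P = {p \<in> fst (fst P). snd (fst P) p \<in> cball (fst (snd P)) (snd (snd P))}"

text \<open>A weight above \<open>1\<close> outside of the core penalises the use of the outer part of a patch.\<close>

definition weight :: "('m, 'n) patch \<Rightarrow> real^'n \<Rightarrow> real" where
  "weight P = cutoff (fst (snd P)) (snd (snd P))"

definition cost_form :: "('m, 'n) patch \<Rightarrow> real^'n \<Rightarrow> real^'n^'n" where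
  "cost_form P x = weight P x *\<^sub>R G (fst P) x"

definition cost :: "('m, 'n) patch \<Rightarrow> 'm \<Rightarrow> 'm \<Rightarrow> real" where
  "cost P p p' = sq (cost_form P) (snd (fst P) p) (snd (fst P) p')"

lemma patch_subsets: "patch P \<Longrightarrow> patch_core P \<subseteq> patch_int P" "patch_int P \<subseteq> patch_dom P" "patch_dom P \<subseteq> fst (fst P)"
  by (auto simp: patch_core_def patch_int_def patch_dom_def patch_def)

lemma patch_int_open: "patch P \<Longrightarrow> open (patch_int P)"
  unfolding patch_int_def patch_def using chart_vimage_open by blast

lemma patch_dom_compact:
  assumes P: "patch P" shows "compact (patch_dom P)"
proof -
  let ?c = "fst P" and ?K = "cball (fst (snd P)) (2 * snd (snd P))"
  have c: "?c \<in> \<A>" and K: "?K \<subseteq> coord_range ?c" using P by (auto simp: patch_def)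
  have "patch_dom P = chart_inv ?c ` ?K"
  proof (intro subset_antisym subsetI)
    fix p assume "p \<in> patch_dom P"
    then show "p \<in> chart_inv ?c ` ?K" using c by (auto simp: patch_dom_def intro!: image_eqI[of _ _ "snd ?c p"])
  next
    fix p assume "p \<in> chart_inv ?c ` ?K"
    then show "p \<in> patch_dom P" using c K chart_inv_in[OF c] by (auto simp: patch_dom_def)
  qed
  moreover have "compact (chart_inv ?c ` ?K)"
    by (rule compact_continuous_image[OF continuous_on_subset[OF chart_continuous(2)[OF c] K] compact_cball])
  ultimately show ?thesis by simp
qed

lemma patch_exists:
  obtains P S where "patch P" "open S" "p \<in> S" "S \<subseteq> patch_core P"
proof -
  obtain c where c: "c \<in> \<A>" "p \<in> fst c" using chart_cover .
  obtain r where r: "r > 0" "ball (snd c p) r \<subseteq> coord_range c"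
    using chart_open(2)[OF c(1)] chart_in[OF c(2)] open_contains_ball by blast
  define P where "P = (c, snd c p, r / 4)"
  have "cball (snd c p) (r / 2) \<subseteq> ball (snd c p) r" using r by auto
  then have "patch P" using c r by (auto simp: P_def patch_def)
  moreover have "open {p' \<in> fst c. snd c p' \<in> ball (snd c p) (r / 4)}" by (rule chart_vimage_open[OF c(1) open_ball])
  moreover have "{p' \<in> fst c. snd c p' \<in> ball (snd c p) (r / 4)} \<subseteq> patch_core P" by (auto simp: patch_core_def P_def)
  ultimately show ?thesis using that[of P "{p' \<in> fst c. snd c p' \<in> ball (snd c p) (r / 4)}"] c r by simp
qed

lemma bform_scaleR: "bform (k *\<^sub>R M) v h = k * bform M v h"
  by (simp add: bform_def sum_distrib_left mult_ac)

lemma cost_eq: "cost P p p' = weight P (snd (fst P) p) * bform (G (fst P) (snd (fst P) p)) (snd (fst P) p' - snd (fst P) p) (snd (fst P) p' - snd (fst P) p)"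
  unfolding cost_def sq_def cost_form_def bform_scaleR ..

lemma cost_self: "cost P p p = 0" by (simp add: cost_eq)

lemma weight_core: "patch P \<Longrightarrow> p \<in> fst (fst P) \<Longrightarrow> weight P (snd (fst P) p) = 1 \<longleftrightarrow> p \<in> patch_core P"
  by (simp add: weight_def cutoff_eq_1 patch_def patch_core_def dist_norm norm_minus_commute)

lemma cost_nonneg:
  assumes P: "patch P" and p: "p \<in> fst (fst P)" shows "cost P p p' \<ge> 0"
proof -
  interpret M: coord_metric "coord_range (fst P)" "G (fst P)" by (rule coord_metric_chart) (use P in \<open>simp add: patch_def\<close>)
  have "weight P (snd (fst P) p) \<ge> 0" using order_trans[OF zero_le_one cutoff_ge_1] by (simp add: weight_def)
  then show ?thesis unfolding cost_eq by (rule mult_nonneg_nonneg) (rule M.bform_nonneg[OF chart_in[OF p]])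
qed

lemma cost_pos:
  assumes P: "patch P" and p: "p \<in> fst (fst P)" "p' \<in> fst (fst P)" "p \<noteq> p'" shows "cost P p p' > 0"
proof -
  have c: "fst P \<in> \<A>" using P by (simp add: patch_def)
  interpret M: coord_metric "coord_range (fst P)" "G (fst P)" by (rule coord_metric_chart[OF c])
  have "snd (fst P) p' - snd (fst P) p \<noteq> 0"
  proof
    assume "snd (fst P) p' - snd (fst P) p = 0"
    then have "snd (fst P) p' = snd (fst P) p" by simp
    then have "chart_inv (fst P) (snd (fst P) p') = chart_inv (fst P) (snd (fst P) p)" by (rule arg_cong)
    then show False using p c by simp
  qed
  note pos = M.G_pos[OF chart_in[OF p(1)] this]
  have "weight P (snd (fst P) p) > 0" using less_le_trans[OF zero_less_one cutoff_ge_1] by (simp add: weight_def)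
  then show ?thesis unfolding cost_eq by (rule mult_pos_pos) (rule pos)
qed

lemma G_continuous: "c \<in> \<A> \<Longrightarrow> continuous_on (coord_range c) (\<lambda>x. G c x $ i $ j)"
  by (rule C_k_on_continuous_on[OF coord_metric.G_smooth[OF coord_metric_chart, where k=0]])

lemma cost_continuous:
  assumes P: "patch P"
  shows "continuous_on (fst (fst P) \<times> fst (fst P)) (\<lambda>z. cost P (fst z) (snd z))"
proof -
  let ?c = "fst P"
  have c: "?c \<in> \<A>" using P by (simp add: patch_def)
  have 1: "continuous_on (fst ?c \<times> fst ?c) (\<lambda>z. snd ?c (fst z))" "continuous_on (fst ?c \<times> fst ?c) (\<lambda>z. snd ?c (snd z))"
    by (rule continuous_on_compose2[OF chart_continuous(1)[OF c]], auto intro!: continuous_intros)+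
  have 2: "continuous_on (fst ?c \<times> fst ?c) (\<lambda>z. G ?c (snd ?c (fst z)) $ i $ j)" for i j
    by (rule continuous_on_compose2[OF G_continuous[OF c] 1(1)]) auto
  have 3: "continuous_on (fst ?c \<times> fst ?c) (\<lambda>z. weight P (snd ?c (fst z)))"
    unfolding weight_def by (rule continuous_on_compose2[OF cutoff_continuous[of UNIV] 1(1)]) auto
  show ?thesis unfolding cost_eq bform_def
    by (intro continuous_on_mult 3 continuous_on_sum 2 continuous_on_component continuous_on_diff 1)
qed

text \<open>In the limit of short steps the costs in two patches are in the ratio of the weights, because the coordinate expressions of the
metric agree. Hence where the weight of a patch exceeds \<open>1\<close>, steps are cheaper in a patch whose core contains them.\<close>

lemma core_cheaper:
  assumes P: "patch P" "z \<in> fst (fst P)" "z \<notin> patch_core P" and P': "patch P'" "z \<in> patch_core P'"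
  obtains S where "open S" "z \<in> S" "S \<subseteq> fst (fst P)" "\<And>p p'. p \<in> S \<Longrightarrow> p' \<in> S \<Longrightarrow> cost P' p p' \<le> cost P p p'"
proof -
  define c where "c = fst P" define c' where "c' = fst P'"
  have c: "c \<in> \<A>" "c' \<in> \<A>" "z \<in> fst c" "z \<in> fst c'"
    using P P' by (auto simp: c_def c'_def patch_def patch_core_def)
  interpret M: coord_metric "coord_range c" "G c" by (rule coord_metric_chart[OF c(1)])
  define x0 where "x0 = snd c z"
  have x0: "x0 \<in> ov c c'" "x0 \<in> coord_range c" using c by (auto simp: x0_def)
  have tx0: "tr c c' x0 = snd c' z" using c by (simp add: x0_def)
  define \<eta> where "\<eta> = weight P x0 - 1"
  have \<eta>: "\<eta> > 0" using weight_core[OF P(1,2)] P(3) cutoff_ge_1[of "fst (snd P)" "snd (snd P)" x0]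
    by (auto simp: \<eta>_def x0_def c_def weight_def)
  define e where "e = min 1 (\<eta> / 4)"
  have e: "e > 0" "(1 + e) * (1 + e) \<le> 1 + 3 * \<eta> / 4"
  proof -
    show "e > 0" using \<eta> by (simp add: e_def)
    have "e * e \<le> 1 * e" by (rule mult_right_mono) (use \<eta> in \<open>auto simp: e_def\<close>)
    moreover have "3 * e \<le> 3 * \<eta> / 4" by (simp add: e_def)
    ultimately show "(1 + e) * (1 + e) \<le> 1 + 3 * \<eta> / 4" by (simp add: algebra_simps)
  qed
  obtain d1 m where d1: "d1 > 0" "m > 0" "ball x0 d1 \<subseteq> coord_range c"
    "\<And>x h. x \<in> ball x0 d1 \<Longrightarrow> m * (norm h)\<^sup>2 \<le> bform (G c x) h h"
    "\<And>x h. x \<in> ball x0 d1 \<Longrightarrow> bform (G c x) h h \<le> (1 + e) * bform (G c x0) h h"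
    "\<And>x h. x \<in> ball x0 d1 \<Longrightarrow> bform (G c x0) h h \<le> (1 + e) * bform (G c x) h h"
    by (rule M.bform_compare[OF x0(2) e(1)]) (rule that, assumption+)
  define K where "K x = cost_form P' (tr c c' x)" for x
  have oov: "open (ov c c')" by (rule open_ov[OF c(1,2)])
  have trc: "continuous_on (ov c c') (tr c c')"
  proof (rule continuous_on_vec_lambda[of _ "\<lambda>i x. tr c c' x $ i", simplified])
    show "continuous_on (ov c c') (\<lambda>x. tr c c' x $ i)" for i by (rule C_k_on_continuous_on[OF tr_smooth[OF c(1,2), where k=0]])
  qed
  have Kc: "continuous_on (ov c c') (\<lambda>x. K x $ i $ j)" for i j
  proof -
    have "continuous_on (ov c c') (\<lambda>x. G c' (tr c c' x) $ i $ j)"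
      by (rule continuous_on_compose2[OF G_continuous[OF c(2)] trc]) (use c in auto)
    moreover have "continuous_on (ov c c') (\<lambda>x. weight P' (tr c c' x))"
      unfolding weight_def by (rule continuous_on_compose2[OF cutoff_continuous[of UNIV] trc]) auto
    ultimately show ?thesis by (simp add: K_def cost_form_def c'_def continuous_on_mult)
  qed
  have w1: "weight P' (snd c' z) = 1" using weight_core[OF P'(1), of z] P'(2) c(4) by (simp add: c'_def)
  have Kx0: "bform (K x0) (vdir h (tr c c') x0) (vdir h (tr c c') x0) = bform (G c x0) h h" for h
    using metric_change[OF c(1,2) x0(1), of h h] w1 by (simp add: K_def cost_form_def bform_scaleR tx0 flip: c'_def)
  have "small2 x0 (\<lambda>x y. bform (K x) (tr c c' y - tr c c' x) (tr c c' y - tr c c' x)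
      - bform (K x0) (vdir (y - x) (tr c c') x0) (vdir (y - x) (tr c c') x0))"
    by (rule small2_bform[OF oov x0(1) tr_smooth[OF c(1,2)] tr_smooth[OF c(1,2)] Kc])
  moreover have "e * m > 0" using e d1 by simp
  ultimately obtain d2 where d2: "d2 > 0" "\<And>x y. x \<in> ball x0 d2 \<Longrightarrow> y \<in> ball x0 d2 \<Longrightarrow>
     \<bar>bform (K x) (tr c c' y - tr c c' x) (tr c c' y - tr c c' x) - bform (K x0) (vdir (y - x) (tr c c') x0) (vdir (y - x) (tr c c') x0)\<bar>
       \<le> e * m * (norm (y - x))\<^sup>2"
    by (rule small2D) (rule that, assumption+)
  have "open {x. weight P x > 1 + 3 * \<eta> / 4}"
    unfolding weight_def by (intro open_Collect_less continuous_on_const cutoff_continuous)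
  moreover have "x0 \<in> {x. weight P x > 1 + 3 * \<eta> / 4}" using \<eta> by (simp add: \<eta>_def field_simps)
  ultimately obtain d3 where d3: "d3 > 0" "ball x0 d3 \<subseteq> {x. weight P x > 1 + 3 * \<eta> / 4}"
    using open_contains_ball by blast
  define d where "d = min d1 (min d2 d3)"
  have d: "d > 0" using d1 d2 d3 by (simp add: d_def)
  define S where "S = {p \<in> fst c. snd c p \<in> ball x0 d}"
  show ?thesis
  proof (rule that[of S])
    show "open S" unfolding S_def by (rule chart_vimage_open[OF c(1) open_ball])
    show "z \<in> S" using c d by (simp add: S_def x0_def)
    show "S \<subseteq> fst (fst P)" by (auto simp: S_def c_def)
    fix p p' assume p: "p \<in> S" "p' \<in> S"
    define x y where "x = snd c p" and "y = snd c p'"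
    have xy: "x \<in> ball x0 d1" "x \<in> ball x0 d2" "y \<in> ball x0 d2" "x \<in> ball x0 d3"
      using p by (auto simp: S_def x_def y_def d_def)
    define b where "b = bform (G c x0) (y - x) (y - x)"
    define b' where "b' = bform (G c x) (y - x) (y - x)"
    have b: "b \<le> (1 + e) * b'" unfolding b_def b'_def by (rule d1(6)[OF xy(1)])
    have bm: "m * (norm (y - x))\<^sup>2 \<le> b" unfolding b_def by (rule d1(4)) (use d1 in simp)
    have b'0: "b' \<ge> 0" unfolding b'_def using M.bform_nonneg xy(1) d1(3) by blast
    have p': "chart_inv c x = p" "chart_inv c y = p'" using p c by (auto simp: S_def x_def y_def)
    have "cost P' p p' = bform (K x) (tr c c' y - tr c c' x) (tr c c' y - tr c c' x)"
      by (simp add: cost_def sq_def K_def p' flip: c'_def)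
    also have "\<dots> \<le> b + e * m * (norm (y - x))\<^sup>2"
      using d2(2)[OF xy(2,3)] unfolding Kx0 b_def abs_le_iff by linarith
    also have "\<dots> \<le> b + e * b" using mult_left_mono[OF bm, of e] e by (simp add: mult.assoc)
    also have "\<dots> = (1 + e) * b" by (simp add: algebra_simps)
    also have "\<dots> \<le> (1 + e) * ((1 + e) * b')" by (rule mult_left_mono[OF b]) (use e in simp)
    also have "\<dots> = ((1 + e) * (1 + e)) * b'" by simp
    also have "\<dots> \<le> weight P x * b'"
      by (rule mult_right_mono) (use e(2) xy(4) d3(2) b'0 in fastforce)+
    also have "\<dots> = cost P p p'" unfolding cost_eq b'_def x_def y_def c_def ..
    finally show "cost P' p p' \<le> cost P p p'" .
  qed
qed

end

context soliton
begin

section \<open>Coupled frames\<close>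

text \<open>The conclusion of \<open>pair_estimate\<close> in terms of jets. Here \<open>\<alpha>\<close> and \<open>\<beta>\<close> are the first variations of the cost when only the first or
only the second point moves, \<open>\<gamma>\<close> is the second variation when both move, and \<open>d\<close>, \<open>d'\<close> are the derivatives of \<open>u\<close>, the components of the drift.\<close>

definition coupled_frames :: "real \<Rightarrow> ('m, 'n) patch \<Rightarrow> 'm \<Rightarrow> 'm \<Rightarrow> ('n \<Rightarrow> real \<Rightarrow> 'm) \<Rightarrow> ('n \<Rightarrow> real \<Rightarrow> 'm) \<Rightarrow> bool" where
  "coupled_frames e P p p' \<kappa> \<kappa>' \<longleftrightarrow> (\<exists>\<alpha> \<beta> \<gamma> d d' h h' k k'.
     (\<forall>a. jet2 (\<lambda>\<epsilon>. u (\<kappa> a \<epsilon>)) (d a) (h a) \<and> jet2 (\<lambda>\<epsilon>. u (\<kappa>' a \<epsilon>)) (d' a) (h' a) \<and>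
       jet2 (\<lambda>\<epsilon>. cost P (\<kappa> a \<epsilon>) p') (\<alpha> a) (k a) \<and> jet2 (\<lambda>\<epsilon>. cost P p (\<kappa>' a \<epsilon>)) (\<beta> a) (k' a) \<and>
       jet2 (\<lambda>\<epsilon>. cost P (\<kappa> a \<epsilon>) (\<kappa>' a \<epsilon>)) (\<alpha> a + \<beta> a) (\<gamma> a) \<and>
       \<bar>\<alpha> a + \<beta> a\<bar> \<le> e * cost P p p' \<and> \<bar>\<beta> a\<bar> \<le> 3 * sqrt (cost P p p')) \<and>
     \<bar>(\<Sum>a\<in>UNIV. \<gamma> a) + (\<Sum>a\<in>UNIV. d a * \<alpha> a + d' a * \<beta> a)\<bar> \<le> e * cost P p p')"

text \<open>What a step of a chain has to satisfy: it lies in the interior of its patch, so that it can be varied; it is short; and every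
frame at its first point can be transported.\<close>

definition coupled_pair :: "real \<Rightarrow> ('m, 'n) patch \<Rightarrow> 'm \<Rightarrow> 'm \<Rightarrow> bool" where
  "coupled_pair e P p p' \<longleftrightarrow> p \<in> patch_int P \<and> p' \<in> patch_int P \<and> ds p p' \<le> ennreal (2 * sqrt (cost P p p')) \<and>
     (\<forall>\<kappa>. osc p \<kappa> \<longrightarrow> (\<exists>\<kappa>'. osc p' \<kappa>' \<and> coupled_frames e P p p' \<kappa> \<kappa>'))"

text \<open>At points of the core the cutoff is \<open>1\<close> to second order.\<close>

lemma coord_osculating_patch:
  assumes P: "patch P" and z: "z \<in> patch_core P"
  shows "coord_osculating (coord_range (fst P)) (G (fst P)) (uc (fst P)) (cost_form P) (snd (fst P) z)"
proof -
  define c where "c = fst P"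
  have c: "c \<in> \<A>" "z \<in> fst c" using P z by (auto simp: c_def patch_def patch_core_def)
  interpret M: coord_soliton "coord_range c" "G c" "uc c" by (rule coord_soliton_chart[OF c(1)])
  let ?x = "snd c z" and ?v = "weight P"
  have x: "?x \<in> coord_range c" using c by simp
  have v1: "?v ?x = 1" using weight_core[OF P, of z] c z by (simp add: c_def)
  have "norm (?x - fst (snd P)) \<le> snd (snd P)" using z by (simp add: patch_core_def c_def dist_norm norm_minus_commute)
  note flat = cutoff_flat[OF this, folded weight_def]
  have vs: "C_k_on 2 (coord_range c) ?v" unfolding weight_def using C_k_on_subset[OF cutoff_smooth] by blast
  have vd: "?v differentiable (at y)" "dir e ?v differentiable (at y)" if "y \<in> coord_range c" for e y
    using C_k_on_differentiable[of 1 _ ?v y] C_k_on_differentiable[of 0 _ "dir e ?v" y] C_k_on_dir[OF M.open_D, of 1 ?v e] vs that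
    by (auto simp: numeral_2_eq_2)
  have Gs: "C_k_on k (coord_range c) (\<lambda>x. G c x $ i $ j)" for i j k by (rule M.G_smooth)
  have Gd: "(\<lambda>x. G c x $ i $ j) differentiable (at y)" "dir e (\<lambda>x. G c x $ i $ j) differentiable (at y)" if "y \<in> coord_range c" for e i j y
    using C_k_on_differentiable[OF Gs[of "Suc 0" i j] that] C_k_on_differentiable[OF C_k_on_dir[OF M.open_D Gs[of "Suc (Suc 0)" i j], of e] that] by auto
  have d1: "dir e (\<lambda>x. ?v x * G c x $ i $ j) y = dir e ?v y * G c y $ i $ j + ?v y * dir e (\<lambda>x. G c x $ i $ j) y"
    if "y \<in> coord_range c" for e i j y by (rule dir_mult) (use vd Gd that in auto)
  have A: "(\<lambda>x. cost_form P x $ i $ j) = (\<lambda>x. ?v x * G c x $ i $ j)" for i j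
    by (simp add: cost_form_def c_def)
  have "coord_osculating (coord_range c) (G c) (uc c) (cost_form P) ?x"
  proof (intro coord_osculating.intro coord_osculating_axioms.intro)
    show "coord_soliton (coord_range c) (G c) (uc c)" by (rule M.coord_soliton_axioms)
    show "?x \<in> coord_range c" by (rule x)
    show "C_k_on 2 (coord_range c) (\<lambda>x. cost_form P x $ i $ j)" for i j
      unfolding A by (intro C_k_on_mult M.open_D vs Gs)
    show "cost_form P y $ i $ j = cost_form P y $ j $ i" if "y \<in> coord_range c" for y i j
      using M.G_sym[OF that, of i j] by (simp add: cost_form_def c_def)
    show "cost_form P ?x = G c ?x" using v1 by (simp add: cost_form_def c_def)
    show "dir e (\<lambda>x. cost_form P x $ i $ j) ?x = dir e (\<lambda>x. G c x $ i $ j) ?x" for e i j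
      unfolding A d1[OF x] using flat v1 by simp
    show "dir e (dir e (\<lambda>x. cost_form P x $ i $ j)) ?x = dir e (dir e (\<lambda>x. G c x $ i $ j)) ?x" for e i j
    proof -
      have "dir e (dir e (\<lambda>x. cost_form P x $ i $ j)) ?x
          = dir e (\<lambda>y. dir e ?v y * G c y $ i $ j + ?v y * dir e (\<lambda>x. G c x $ i $ j) y) ?x"
        unfolding A by (rule dir_cong[OF M.open_D x]) (rule d1)
      also have "\<dots> = dir e (\<lambda>y. dir e ?v y * G c y $ i $ j) ?x + dir e (\<lambda>y. ?v y * dir e (\<lambda>x. G c x $ i $ j) y) ?x"
        by (rule dir_add) (intro differentiable_mult vd Gd x)+
      also have "\<dots> = dir e (dir e (\<lambda>x. G c x $ i $ j)) ?x"
        by (subst (1 2) dir_mult) (use vd[OF x] Gd[OF x] flat v1 in auto)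
      finally show ?thesis .
    qed
  qed
  then show ?thesis by (simp add: c_def)
qed

lemma coupled_pair_in_core:
  assumes P: "patch P" and z: "z \<in> patch_core P" and e: "e > 0"
  obtains S where "open S" "z \<in> S" "\<And>p p'. p \<in> S \<Longrightarrow> p' \<in> S \<Longrightarrow> coupled_pair e P p p'"
proof -
  define c where "c = fst P"
  have c: "c \<in> \<A>" "z \<in> fst c" using P z by (auto simp: c_def patch_def patch_core_def)
  interpret M: coord_osculating "coord_range c" "G c" "uc c" "cost_form P" "snd c z"
    unfolding c_def by (rule coord_osculating_patch[OF P z])
  let ?z = "snd c z"
  have v1: "weight P ?z = 1" using weight_core[OF P, of z] c z by (simp add: c_def)
  obtain d1 where d1: "d1 > 0" "ball ?z d1 \<subseteq> coord_range c"
    "\<And>x y V. x \<in> ball ?z d1 \<Longrightarrow> y \<in> ball ?z d1 \<Longrightarrow> onb (G c) x V \<Longrightarrow> \<exists>W. onb (G c) y W \<and>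
      \<bar>(\<Sum>a\<in>UNIV. sq_hess (G c) (cost_form P) x y (V a, W a) (V a, W a)) +
        (\<Sum>a\<in>UNIV. dir (V a) (uc c) x * sq_dx (cost_form P) x y (V a) + dir (W a) (uc c) y * sq_dy (cost_form P) x y (W a))\<bar>
          \<le> e * sq (cost_form P) x y \<and>
      (\<forall>a. \<bar>sq_dx (cost_form P) x y (V a) + sq_dy (cost_form P) x y (W a)\<bar> \<le> e * sq (cost_form P) x y) \<and>
      (\<forall>a. \<bar>sq_dy (cost_form P) x y (W a)\<bar> \<le> 3 * sqrt (sq (cost_form P) x y))"
    by (rule M.pair_estimate[of "weight P", OF _ _ v1 _ e])
      (simp add: cost_form_def c_def, simp add: weight_def cutoff_ge_1, simp add: weight_def cutoff_continuous, rule that, assumption+)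
  obtain d2 m where d2: "d2 > 0" "m > 0" "ball ?z d2 \<subseteq> coord_range c"
    "\<And>x h. x \<in> ball ?z d2 \<Longrightarrow> m * (norm h)\<^sup>2 \<le> bform (G c x) h h"
    "\<And>x h. x \<in> ball ?z d2 \<Longrightarrow> bform (G c x) h h \<le> (1 + 1) * bform (G c ?z) h h"
    "\<And>x h. x \<in> ball ?z d2 \<Longrightarrow> bform (G c ?z) h h \<le> (1 + 1) * bform (G c x) h h"
    by (rule M.bform_compare[OF M.z zero_less_one]) (rule that, assumption+)
  have "z \<in> patch_int P" using patch_subsets(1)[OF P] z by blast
  then obtain d3 where d3: "d3 > 0" "ball ?z d3 \<subseteq> ball (fst (snd P)) (2 * snd (snd P))"
    using open_contains_ball[of "ball (fst (snd P)) (2 * snd (snd P))"] by (auto simp: patch_int_def c_def simp del: mem_ball)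
  define d where "d = min d1 (min d2 d3)"
  have d: "d > 0" "d \<le> d1" "d \<le> d2" "d \<le> d3" using d1 d2 d3 by (auto simp: d_def)
  define S where "S = {p \<in> fst c. snd c p \<in> ball ?z d}"
  show ?thesis
  proof (rule that[of S])
    show "open S" unfolding S_def by (rule chart_vimage_open[OF c(1) open_ball])
    show "z \<in> S" using c d by (simp add: S_def)
    have "ball ?z d \<subseteq> ball (fst (snd P)) (2 * snd (snd P))" using subset_ball[OF d(4)] d3(2) by (rule subset_trans)
    then have SP: "S \<subseteq> patch_int P" unfolding S_def patch_int_def c_def by blast
    fix p p' assume p: "p \<in> S" "p' \<in> S"
    define x y where "x = snd c p" and "y = snd c p'"
    have xy: "x \<in> ball ?z d" "y \<in> ball ?z d" "x \<in> coord_range c" "y \<in> coord_range c" using p by (auto simp: S_def x_def y_def)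
    have pc: "p \<in> fst c" "p' \<in> fst c" using p by (auto simp: S_def)
    have inv: "chart_inv c x = p" "chart_inv c y = p'" using p c by (auto simp: S_def x_def y_def)
    have cs: "cost P p p' = sq (cost_form P) x y" by (simp add: cost_def x_def y_def c_def)
    have c0: "cost P p p' \<ge> 0" by (rule cost_nonneg[OF P]) (use pc in \<open>simp add: c_def\<close>)
    have "ds (chart_inv c x) (chart_inv c y) \<le> ennreal (2 * sqrt (cost P p p'))"
    proof (rule ds_segment[OF c(1)])
      fix t :: real assume t: "t \<in> {0..1}"
      have "x + t *\<^sub>R (y - x) = (1 - t) *\<^sub>R x + t *\<^sub>R y" by (simp add: algebra_simps)
      then have "x + t *\<^sub>R (y - x) \<in> ball ?z d"
        using convexD[OF convex_ball xy(1,2), of "1 - t" t] t by simp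
      then have 1: "x + t *\<^sub>R (y - x) \<in> ball ?z d2" using d(3) by auto
      then show "x + t *\<^sub>R (y - x) \<in> coord_range c" using d2(3) by blast
      have "bform (G c (x + t *\<^sub>R (y - x))) (y - x) (y - x) \<le> 2 * bform (G c ?z) (y - x) (y - x)"
        using d2(5)[OF 1, of "y - x"] by (simp only: one_add_one)
      also have "\<dots> \<le> 2 * (2 * bform (G c x) (y - x) (y - x))"
        using d2(6)[of x "y - x"] xy(1) d(3) by (auto simp only: one_add_one mem_ball intro: mult_left_mono)
      also have "\<dots> \<le> 2 * (2 * (weight P x * bform (G c x) (y - x) (y - x)))"
        using mult_right_mono[OF cutoff_ge_1 M.bform_nonneg[OF xy(3), of "y - x"], of "fst (snd P)" "snd (snd P)" x]
        unfolding weight_def by linarith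
      also have "\<dots> = 4 * cost P p p'" by (simp only: cost_eq x_def y_def c_def)
      also have "\<dots> = (2 * sqrt (cost P p p'))\<^sup>2" using c0 by (simp add: power_mult_distrib)
      finally show "bform (G c (x + t *\<^sub>R (y - x))) (y - x) (y - x) \<le> (2 * sqrt (cost P p p'))\<^sup>2" .
    qed (use c0 in simp)
    then have near: "ds p p' \<le> ennreal (2 * sqrt (cost P p p'))" by (simp add: inv)
    have frames: "\<exists>\<kappa>'. osc p' \<kappa>' \<and> coupled_frames e P p p' \<kappa> \<kappa>'" if o: "osc p \<kappa>" for \<kappa>
    proof -
    obtain V where F: "frame_in c p \<kappa> V" using o c(1) pc by (auto simp: osc_def)
    have V: "onb (G c) x V" using F by (simp add: frame_in_def x_def)
    have "x \<in> ball ?z d1" "y \<in> ball ?z d1" using xy d by auto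
    from d1(3)[OF this V] obtain W where W: "onb (G c) y W"
      and est: "\<bar>(\<Sum>a\<in>UNIV. sq_hess (G c) (cost_form P) x y (V a, W a) (V a, W a)) +
        (\<Sum>a\<in>UNIV. dir (V a) (uc c) x * sq_dx (cost_form P) x y (V a) + dir (W a) (uc c) y * sq_dy (cost_form P) x y (W a))\<bar>
          \<le> e * sq (cost_form P) x y"
        "\<And>a. \<bar>sq_dx (cost_form P) x y (V a) + sq_dy (cost_form P) x y (W a)\<bar> \<le> e * sq (cost_form P) x y"
        "\<And>a. \<bar>sq_dy (cost_form P) x y (W a)\<bar> \<le> 3 * sqrt (sq (cost_form P) x y)"
      by blast
    have "onb (G c) (snd c p') W" using W by (simp add: y_def)
    then obtain \<kappa>' where o': "osc p' \<kappa>'" and F': "frame_in c p' \<kappa>' W"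
      using osc_exists[OF c(1) pc(2)] by blast
    have ju: "jet2 (\<lambda>\<epsilon>. u (\<kappa> a \<epsilon>)) (dir (V a) (uc c) x) (Hess (G c) (uc c) x (V a) (V a))" for a
      unfolding x_def by (rule jet_frame[OF c(1) pc(1) osc_base[OF o] F M.open_D _ uc_smooth[OF c(1)]]) (use pc in simp)
    have ju': "jet2 (\<lambda>\<epsilon>. u (\<kappa>' a \<epsilon>)) (dir (W a) (uc c) y) (Hess (G c) (uc c) y (W a) (W a))" for a
      unfolding y_def by (rule jet_frame[OF c(1) pc(2) osc_base[OF o'] F' M.open_D _ uc_smooth[OF c(1)]]) (use pc in simp)
    have j: "jet2 (\<lambda>\<epsilon>. snd c (\<kappa> a \<epsilon>) $ i) (V a $ i) (- Gam (G c) x (V a) (V a) $ i)" for a i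
      using F by (simp add: frame_in_def x_def)
    have j': "jet2 (\<lambda>\<epsilon>. snd c (\<kappa>' a \<epsilon>) $ i) (W a $ i) (- Gam (G c) y (W a) (W a) $ i)" for a i
      using F' by (simp add: frame_in_def y_def)
    have k: "jet2 (\<lambda>\<epsilon>. v $ i) ((0::real^'n) $ i) (- Gam (G c) v' 0 0 $ i)" for v v' :: "real^'n" and i by simp
    have b: "snd c (\<kappa> a 0) = x" "snd c (\<kappa>' a 0) = y" for a
      using osc_base(1)[OF o] osc_base(1)[OF o'] by (auto simp: x_def y_def)
    note sj = M.sq_jet[OF M.A_C2 M.A_sym]
    have 1: "jet2 (\<lambda>\<epsilon>. cost P (\<kappa> a \<epsilon>) p') (sq_dx (cost_form P) x y (V a) + sq_dy (cost_form P) x y 0)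
        (sq_hess (G c) (cost_form P) x y (V a, 0) (V a, 0))" for a
      unfolding cost_def c_def[symmetric] y_def[symmetric]
      by (rule sj[OF _ b(1) xy(3) refl xy(4) j k])
    have 2: "jet2 (\<lambda>\<epsilon>. cost P p (\<kappa>' a \<epsilon>)) (sq_dx (cost_form P) x y 0 + sq_dy (cost_form P) x y (W a))
        (sq_hess (G c) (cost_form P) x y (0, W a) (0, W a))" for a
      unfolding cost_def c_def[symmetric] x_def[symmetric]
      by (rule sj[OF _ refl xy(3) b(2) xy(4) k j'])
    have 3: "jet2 (\<lambda>\<epsilon>. cost P (\<kappa> a \<epsilon>) (\<kappa>' a \<epsilon>)) (sq_dx (cost_form P) x y (V a) + sq_dy (cost_form P) x y (W a))
        (sq_hess (G c) (cost_form P) x y (V a, W a) (V a, W a))" for a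
      unfolding cost_def c_def[symmetric] by (rule sj[OF _ b(1) xy(3) b(2) xy(4) j j'])
    have z0: "sq_dx (cost_form P) x y 0 = 0" "sq_dy (cost_form P) x y 0 = 0"
      by (simp_all add: sq_dx_def sq_dy_def dir_def)
    have "coupled_frames e P p p' \<kappa> \<kappa>'"
      unfolding coupled_frames_def
      apply (rule exI[of _ "\<lambda>a. sq_dx (cost_form P) x y (V a)"], rule exI[of _ "\<lambda>a. sq_dy (cost_form P) x y (W a)"],
        rule exI[of _ "\<lambda>a. sq_hess (G c) (cost_form P) x y (V a, W a) (V a, W a)"],
        rule exI[of _ "\<lambda>a. dir (V a) (uc c) x"], rule exI[of _ "\<lambda>a. dir (W a) (uc c) y"],
        rule exI[of _ "\<lambda>a. Hess (G c) (uc c) x (V a) (V a)"], rule exI[of _ "\<lambda>a. Hess (G c) (uc c) y (W a) (W a)"],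
        rule exI[of _ "\<lambda>a. sq_hess (G c) (cost_form P) x y (V a, 0) (V a, 0)"],
        rule exI[of _ "\<lambda>a. sq_hess (G c) (cost_form P) x y (0, W a) (0, W a)"])
      unfolding cs using ju ju' 1 2 3 est unfolding z0 add_0_left add_0_right by blast
    then show ?thesis using o' by blast
    qed
    show "coupled_pair e P p p'" unfolding coupled_pair_def using p SP near frames by blast
  qed
qed

text \<open>Either \<open>z\<close> lies in the core of its patch, or a patch whose core contains \<open>z\<close> is cheaper nearby. Relabelling a minimal chain with
short steps therefore leaves it minimal.\<close>

lemma coupled_pair_relabel:
  assumes P: "patch P" and z: "z \<in> patch_dom P" and P': "patch P'" "z \<in> patch_core P'" and e: "e > 0"
  obtains Q S where "Q \<in> {P, P'}" "open S" "z \<in> S"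
    "\<And>p p'. p \<in> S \<Longrightarrow> p' \<in> S \<Longrightarrow> coupled_pair e Q p p' \<and> cost Q p p' \<le> cost P p p'"
proof (cases "z \<in> patch_core P")
  case True
  obtain S where S: "open S" "z \<in> S" "\<And>p p'. p \<in> S \<Longrightarrow> p' \<in> S \<Longrightarrow> coupled_pair e P p p'"
    by (rule coupled_pair_in_core[OF P True e]) (rule that, assumption+)
  show ?thesis by (rule that[of P S]) (use S in auto)
next
  case False
  obtain S where S: "open S" "z \<in> S" "\<And>p p'. p \<in> S \<Longrightarrow> p' \<in> S \<Longrightarrow> coupled_pair e P' p p'"
    by (rule coupled_pair_in_core[OF P' e]) (rule that, assumption+)
  have zP: "z \<in> fst (fst P)" using z by (simp add: patch_dom_def)
  obtain T where T: "open T" "z \<in> T" "T \<subseteq> fst (fst P)" "\<And>p p'. p \<in> T \<Longrightarrow> p' \<in> T \<Longrightarrow> cost P' p p' \<le> cost P p p'"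
    by (rule core_cheaper[OF P zP False P']) (rule that, assumption+)
  show ?thesis by (rule that[of P' "S \<inter> T"]) (use S T in auto)
qed

end

lemma sum_sqrt_le:
  assumes "\<And>i. i < N \<Longrightarrow> S i \<ge> 0" shows "(\<Sum>i<N. sqrt (S i)) \<le> sqrt (real N * (\<Sum>i<N. S i))"
proof (rule real_le_rsqrt)
  have "(\<Sum>i<N. sqrt (S i) * 1)\<^sup>2 \<le> (\<Sum>i<N. (sqrt (S i))\<^sup>2) * (\<Sum>i<N. 1\<^sup>2)" by (rule Cauchy_Schwarz_ineq_sum)
  then show "(\<Sum>i<N. sqrt (S i))\<^sup>2 \<le> real N * (\<Sum>i<N. S i)" using assms by (simp add: mult.commute)
qed

context soliton
begin

section \<open>Variation of a minimal chain\<close>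

text \<open>First and second variation of a minimal chain. The vanishing first variations of the single points may be added with arbitrary
weights \<open>q\<close>. With \<open>q\<^sub>i = i / N\<close> the two contributions of a step nearly cancel, since both its ends move almost equally, and what is left bounds
\<open>\<nabla>F\<close>. With \<open>q\<close> the derivative of \<open>u\<close> in the same direction they supply the drift terms that complete the second variation of simultaneous motion to
the expression that is negligible by \<open>pair_estimate\<close>. The end \<open>x\<^sub>0\<close> contributes \<open>\<mu> (\<Delta>u + |\<nabla>u|\<^sup>2) = \<mu>\<close>.\<close>

lemma chain_variation:
  fixes F :: "'m \<Rightarrow> real" and x :: "nat \<Rightarrow> 'm"
  defines "\<Psi> \<equiv> \<lambda>l N \<mu> \<theta> y. F (y N) + \<mu> * u (y 0) + \<theta> * real N * (\<Sum>i<N. cost (l i) (y i) (y (Suc i)))"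
  assumes e: "e \<ge> 0" and N: "N > 0" and \<theta>: "\<theta> > 0"
    and o: "\<And>i. osc (x i) (\<kappa> i)"
    and cp: "\<And>i. i < N \<Longrightarrow> coupled_frames e (l i) (x i) (x (Suc i)) (\<kappa> i) (\<kappa> (Suc i))"
    and cost0: "\<And>i. i < N \<Longrightarrow> cost (l i) (x i) (x (Suc i)) \<ge> 0"
    and small: "\<theta> * real N * (\<Sum>i<N. cost (l i) (x i) (x (Suc i))) \<le> 1"
    and min: "\<And>y :: nat \<Rightarrow> real \<Rightarrow> 'm. (\<And>i. y i 0 = x i) \<Longrightarrow> (\<And>i. isCont (y i) 0) \<Longrightarrow>
       \<forall>\<^sub>F \<epsilon> in nhds 0. \<Psi> l N \<mu> \<theta> x \<le> \<Psi> l N \<mu> \<theta> (\<lambda>i. y i \<epsilon>)"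
    and jF: "\<And>a. jet2 (\<lambda>\<epsilon>. F (\<kappa> N a \<epsilon>)) (Fd a) (Fh a)" and ju: "\<And>a. jet2 (\<lambda>\<epsilon>. u (\<kappa> N a \<epsilon>)) (ud a) (uh a)"
  shows "(\<Sum>a\<in>UNIV. Fh a) + (\<Sum>a\<in>UNIV. ud a * Fd a) + \<mu> + e \<ge> 0" "\<bar>Fd a\<bar> \<le> e + 3 * sqrt \<theta>"
proof -
  define S where "S i = cost (l i) (x i) (x (Suc i))" for i
  define L where "L = \<theta> * real N"
  have S0: "S i \<ge> 0" if "i < N" for i using cost0 that by (simp add: S_def)
  have LS: "L * (\<Sum>i<N. S i) \<le> 1" using small by (simp add: S_def L_def)
  have L0: "L > 0" using \<theta> N by (simp add: L_def)
  have "\<exists>d h. \<forall>a. jet2 (\<lambda>\<epsilon>. u (\<kappa> i a \<epsilon>)) (d a) (h a)" for i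
    by (rule u_jet_exists[OF o[of i]]) blast
  then obtain D H where DH: "\<And>i a. jet2 (\<lambda>\<epsilon>. u (\<kappa> i a \<epsilon>)) (D i a) (H i a)" by metis
  have DN: "D N a = ud a" for a using jet2_unique(1)[OF DH ju] .
  have D0: "(\<Sum>a\<in>UNIV. (D 0 a)\<^sup>2) + (\<Sum>a\<in>UNIV. H 0 a) = 1"
  proof -
    obtain d h where dh: "\<And>a. jet2 (\<lambda>\<epsilon>. u (\<kappa> 0 a \<epsilon>)) (d a) (h a)"
      "(\<Sum>a\<in>UNIV. (d a)\<^sup>2) = w (x 0)" "(\<Sum>a\<in>UNIV. h a) = 1 - w (x 0)"
      by (rule soliton_jets[OF o[of 0]]) (rule that, assumption+)
    then show ?thesis using jet2_unique[OF DH[of 0] dh(1)] by simp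
  qed
  define Q where "Q i \<alpha> \<beta> \<gamma> k k' \<longleftrightarrow> (\<forall>a. jet2 (\<lambda>\<epsilon>. cost (l i) (\<kappa> i a \<epsilon>) (x (Suc i))) (\<alpha> a) (k a) \<and>
       jet2 (\<lambda>\<epsilon>. cost (l i) (x i) (\<kappa> (Suc i) a \<epsilon>)) (\<beta> a) (k' a) \<and>
       jet2 (\<lambda>\<epsilon>. cost (l i) (\<kappa> i a \<epsilon>) (\<kappa> (Suc i) a \<epsilon>)) (\<alpha> a + \<beta> a) (\<gamma> a) \<and>
       \<bar>\<alpha> a + \<beta> a\<bar> \<le> e * S i \<and> \<bar>\<beta> a\<bar> \<le> 3 * sqrt (S i)) \<and>
     \<bar>(\<Sum>a\<in>UNIV. \<gamma> a) + (\<Sum>a\<in>UNIV. D i a * \<alpha> a + D (Suc i) a * \<beta> a)\<bar> \<le> e * S i" for i \<alpha> \<beta> \<gamma> k k'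
  have "\<exists>\<alpha> \<beta> \<gamma> k k'. Q i \<alpha> \<beta> \<gamma> k k'" if i: "i < N" for i
  proof -
    from cp[OF i] obtain \<alpha> \<beta> \<gamma> d d' h h' k k' where
      1: "\<forall>a. jet2 (\<lambda>\<epsilon>. u (\<kappa> i a \<epsilon>)) (d a) (h a) \<and> jet2 (\<lambda>\<epsilon>. u (\<kappa> (Suc i) a \<epsilon>)) (d' a) (h' a) \<and>
       jet2 (\<lambda>\<epsilon>. cost (l i) (\<kappa> i a \<epsilon>) (x (Suc i))) (\<alpha> a) (k a) \<and>
       jet2 (\<lambda>\<epsilon>. cost (l i) (x i) (\<kappa> (Suc i) a \<epsilon>)) (\<beta> a) (k' a) \<and>
       jet2 (\<lambda>\<epsilon>. cost (l i) (\<kappa> i a \<epsilon>) (\<kappa> (Suc i) a \<epsilon>)) (\<alpha> a + \<beta> a) (\<gamma> a) \<and>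
       \<bar>\<alpha> a + \<beta> a\<bar> \<le> e * S i \<and> \<bar>\<beta> a\<bar> \<le> 3 * sqrt (S i)"
      and 2: "\<bar>(\<Sum>a\<in>UNIV. \<gamma> a) + (\<Sum>a\<in>UNIV. d a * \<alpha> a + d' a * \<beta> a)\<bar> \<le> e * S i"
      unfolding coupled_frames_def S_def[symmetric] by (elim exE conjE) (rule that, assumption+)
    have "d a = D i a" for a by (rule jet2_unique(1)[OF 1[rule_format, THEN conjunct1] DH])
    moreover have "d' a = D (Suc i) a" for a by (rule jet2_unique(1)[OF 1[rule_format, THEN conjunct2, THEN conjunct1] DH])
    ultimately have "d = D i" "d' = D (Suc i)" by auto
    then have "Q i \<alpha> \<beta> \<gamma> k k'" unfolding Q_def using 1 2 by simp
    then show ?thesis by (intro exI)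
  qed
  then obtain \<alpha> \<beta> \<gamma> k k' where Q: "\<And>i. i < N \<Longrightarrow> Q i (\<alpha> i) (\<beta> i) (\<gamma> i) (k i) (k' i)" by metis
  have C: "\<And>i a. i < N \<Longrightarrow> jet2 (\<lambda>\<epsilon>. cost (l i) (\<kappa> i a \<epsilon>) (x (Suc i))) (\<alpha> i a) (k i a)"
     "\<And>i a. i < N \<Longrightarrow> jet2 (\<lambda>\<epsilon>. cost (l i) (x i) (\<kappa> (Suc i) a \<epsilon>)) (\<beta> i a) (k' i a)"
     "\<And>i a. i < N \<Longrightarrow> jet2 (\<lambda>\<epsilon>. cost (l i) (\<kappa> i a \<epsilon>) (\<kappa> (Suc i) a \<epsilon>)) (\<alpha> i a + \<beta> i a) (\<gamma> i a)"
     "\<And>i a. i < N \<Longrightarrow> \<bar>\<alpha> i a + \<beta> i a\<bar> \<le> e * S i" "\<And>i a. i < N \<Longrightarrow> \<bar>\<beta> i a\<bar> \<le> 3 * sqrt (S i)"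
     "\<And>i. i < N \<Longrightarrow> \<bar>(\<Sum>a\<in>UNIV. \<gamma> i a) + (\<Sum>a\<in>UNIV. D i a * \<alpha> i a + D (Suc i) a * \<beta> i a)\<bar> \<le> e * S i"
    using Q unfolding Q_def by simp_all
  \<comment> \<open>Only one point moves, so that only the two adjacent steps contribute.\<close>
  have slot: "(if i = N then Fd a else 0) + \<mu> * (if i = 0 then D 0 a else 0)
      + L * (\<Sum>j<N. (if j = i then \<alpha> j a else 0) + (if Suc j = i then \<beta> j a else 0)) = 0" for i a
  proof -
    define y where "y j \<epsilon> = (if j = i then \<kappa> i a \<epsilon> else x j)" for j \<epsilon>
    have y: "y j 0 = x j" "isCont (y j) 0" for j
      using osc_base[OF o[of i], of a] by (cases "j = i"; simp add: y_def[abs_def])+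
    have "jet2 (\<lambda>\<epsilon>. F (y N \<epsilon>)) (if i = N then Fd a else 0) (if i = N then Fh a else 0)"
      using jF[of a] by (simp add: y_def)
    moreover have "jet2 (\<lambda>\<epsilon>. u (y 0 \<epsilon>)) (if i = 0 then D 0 a else 0) (if i = 0 then H 0 a else 0)"
      using DH[of 0 a] by (simp add: y_def)
    moreover have "jet2 (\<lambda>\<epsilon>. cost (l j) (y j \<epsilon>) (y (Suc j) \<epsilon>)) ((if j = i then \<alpha> j a else 0) + (if Suc j = i then \<beta> j a else 0))
        ((if j = i then k j a else 0) + (if Suc j = i then k' j a else 0))" if "j < N" for j
      using C(1,2)[OF that, of a] by (auto simp: y_def)
    ultimately have "jet2 (\<lambda>\<epsilon>. \<Psi> l N \<mu> \<theta> (\<lambda>i. y i \<epsilon>)) ((if i = N then Fd a else 0) + \<mu> * (if i = 0 then D 0 a else 0)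
      + L * (\<Sum>j<N. (if j = i then \<alpha> j a else 0) + (if Suc j = i then \<beta> j a else 0)))
      ((if i = N then Fh a else 0) + \<mu> * (if i = 0 then H 0 a else 0)
      + L * (\<Sum>j<N. (if j = i then k j a else 0) + (if Suc j = i then k' j a else 0)))"
      unfolding \<Psi>_def L_def by (intro jet2_add jet2_cmult jet2_sum) auto
    from jet2_local_min(1)[OF this] min[of y] y show ?thesis by simp
  qed
  have weighted: "q N * Fd a + \<mu> * q 0 * D 0 a + L * (\<Sum>j<N. q j * \<alpha> j a + q (Suc j) * \<beta> j a) = 0" for q :: "nat \<Rightarrow> real" and a
  proof -
    have "0 = (\<Sum>i\<le>N. q i * ((if i = N then Fd a else 0) + \<mu> * (if i = 0 then D 0 a else 0)
      + L * (\<Sum>j<N. (if j = i then \<alpha> j a else 0) + (if Suc j = i then \<beta> j a else 0))))"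
      unfolding slot by simp
    also have "\<dots> = (\<Sum>i\<le>N. if i = N then q i * Fd a else 0) + (\<Sum>i\<le>N. if i = 0 then \<mu> * q i * D 0 a else 0)
      + L * (\<Sum>i\<le>N. \<Sum>j<N. (if j = i then q i * \<alpha> j a else 0) + (if Suc j = i then q i * \<beta> j a else 0))"
      unfolding sum_distrib_left sum.distrib[symmetric]
      by (intro sum.cong refl) (auto simp: algebra_simps sum_distrib_left intro!: sum.cong)
    also have "(\<Sum>i\<le>N. \<Sum>j<N. (if j = i then q i * \<alpha> j a else 0) + (if Suc j = i then q i * \<beta> j a else 0))
       = (\<Sum>j<N. (\<Sum>i\<le>N. if j = i then q i * \<alpha> j a else 0) + (\<Sum>i\<le>N. if Suc j = i then q i * \<beta> j a else 0))"
      by (subst sum.swap) (simp add: sum.distrib)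
    also have "\<dots> = (\<Sum>j<N. q j * \<alpha> j a + q (Suc j) * \<beta> j a)"
      by (intro sum.cong refl arg_cong2[of _ _ _ _ "(+)"]) auto
    finally show ?thesis by simp
  qed
  \<comment> \<open>All points move along their frames at once.\<close>
  have all: "Fh a + \<mu> * H 0 a + L * (\<Sum>j<N. \<gamma> j a) \<ge> 0" for a
  proof -
    have "jet2 (\<lambda>\<epsilon>. \<Psi> l N \<mu> \<theta> (\<lambda>i. \<kappa> i a \<epsilon>)) (Fd a + \<mu> * D 0 a + L * (\<Sum>j<N. \<alpha> j a + \<beta> j a))
        (Fh a + \<mu> * H 0 a + L * (\<Sum>j<N. \<gamma> j a))"
      unfolding \<Psi>_def L_def by (intro jet2_add jet2_cmult jet2_sum jF DH C(3)) auto
    from jet2_local_min(2)[OF this] min[of "\<lambda>i. \<kappa> i a"] osc_base[OF o] show ?thesis by simp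
  qed
  show "\<bar>Fd a\<bar> \<le> e + 3 * sqrt \<theta>"
  proof -
    have eq: "Fd a = - L * (\<Sum>j<N. real j / N * \<alpha> j a + real (Suc j) / N * \<beta> j a)"
      using weighted[of "\<lambda>i. real i / N" a] N by simp
    have each: "\<bar>real j / N * \<alpha> j a + real (Suc j) / N * \<beta> j a\<bar> \<le> e * S j + 3 / N * sqrt (S j)" if j: "j < N" for j
    proof -
      have "real j / N * \<alpha> j a + real (Suc j) / N * \<beta> j a = real j / N * (\<alpha> j a + \<beta> j a) + 1 / N * \<beta> j a"
        by (simp add: algebra_simps add_divide_distrib)
      then have "\<bar>real j / N * \<alpha> j a + real (Suc j) / N * \<beta> j a\<bar> \<le> \<bar>real j / N * (\<alpha> j a + \<beta> j a)\<bar> + \<bar>1 / N * \<beta> j a\<bar>"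
        by (simp only: abs_triangle_ineq)
      moreover have "\<bar>real j / N * (\<alpha> j a + \<beta> j a)\<bar> \<le> 1 * (e * S j)"
        unfolding abs_mult by (rule mult_mono) (use j C(4) in auto)
      moreover have "\<bar>1 / N * \<beta> j a\<bar> \<le> 1 / N * (3 * sqrt (S j))"
        unfolding abs_mult by (rule mult_mono) (use j C(5) in auto)
      ultimately show ?thesis by simp
    qed
    have "\<bar>Fd a\<bar> = L * \<bar>\<Sum>j<N. real j / N * \<alpha> j a + real (Suc j) / N * \<beta> j a\<bar>"
      unfolding eq using L0 by (simp add: abs_mult)
    also have "\<dots> \<le> L * (\<Sum>j<N. e * S j + 3 / N * sqrt (S j))"
      using L0 by (intro mult_left_mono order_trans[OF sum_abs] sum_mono each) auto
    also have "\<dots> = e * (L * (\<Sum>j<N. S j)) + 3 * (\<theta> * (\<Sum>j<N. sqrt (S j)))"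
    proof -
      have "L * (\<Sum>j<N. e * S j + 3 / N * sqrt (S j)) = e * (L * (\<Sum>j<N. S j)) + L * (3 / N) * (\<Sum>j<N. sqrt (S j))"
        unfolding sum.distrib sum_distrib_left[symmetric] distrib_left by (simp only: mult_ac)
      then show ?thesis using N by (simp add: L_def)
    qed
    also have "\<dots> \<le> e * 1 + 3 * sqrt \<theta>"
    proof (intro add_mono mult_left_mono LS e)
      have "(\<Sum>j<N. sqrt (S j))\<^sup>2 \<le> (sqrt (real N * (\<Sum>j<N. S j)))\<^sup>2"
        by (rule power_mono[OF sum_sqrt_le]) (auto intro!: sum_nonneg S0)
      also have "\<dots> = real N * (\<Sum>j<N. S j)" using sum_nonneg[of "{..<N}" S] S0 by simp
      finally have "\<theta>\<^sup>2 * (\<Sum>j<N. sqrt (S j))\<^sup>2 \<le> \<theta>\<^sup>2 * (real N * (\<Sum>j<N. S j))"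
        by (intro mult_left_mono) auto
      also have "\<dots> = \<theta> * (L * (\<Sum>j<N. S j))" by (simp add: L_def power2_eq_square)
      also have "\<dots> \<le> \<theta> * 1" using \<theta> by (intro mult_left_mono LS) simp
      finally have "(\<theta> * (\<Sum>j<N. sqrt (S j)))\<^sup>2 \<le> \<theta>" by (simp add: power_mult_distrib)
      then show "\<theta> * (\<Sum>j<N. sqrt (S j)) \<le> sqrt \<theta>" by (rule real_le_rsqrt)
    qed simp
    finally show ?thesis by simp
  qed
  have "0 \<le> (\<Sum>a\<in>UNIV. Fh a + \<mu> * H 0 a + L * (\<Sum>j<N. \<gamma> j a))" by (intro sum_nonneg all)
  also have "\<dots> = (\<Sum>a\<in>UNIV. Fh a) + \<mu> * (\<Sum>a\<in>UNIV. H 0 a) + L * (\<Sum>j<N. \<Sum>a\<in>UNIV. \<gamma> j a)"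
    by (simp add: sum.distrib sum_distrib_left sum.swap[of _ UNIV "{..<N}"])
  finally have A: "0 \<le> (\<Sum>a\<in>UNIV. Fh a) + \<mu> * (\<Sum>a\<in>UNIV. H 0 a) + L * (\<Sum>j<N. \<Sum>a\<in>UNIV. \<gamma> j a)" .
  have "0 = (\<Sum>a\<in>UNIV. D N a * Fd a + \<mu> * D 0 a * D 0 a + L * (\<Sum>j<N. D j a * \<alpha> j a + D (Suc j) a * \<beta> j a))"
    unfolding weighted[of "\<lambda>i. D i _"] by simp
  also have "\<dots> = (\<Sum>a\<in>UNIV. ud a * Fd a) + \<mu> * (\<Sum>a\<in>UNIV. (D 0 a)\<^sup>2)
      + L * (\<Sum>j<N. \<Sum>a\<in>UNIV. D j a * \<alpha> j a + D (Suc j) a * \<beta> j a)"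
    by (simp add: sum.distrib sum.swap[of _ "{..<N}" UNIV] DN power2_eq_square mult.assoc flip: sum_distrib_left)
  finally have B: "0 = (\<Sum>a\<in>UNIV. ud a * Fd a) + \<mu> * (\<Sum>a\<in>UNIV. (D 0 a)\<^sup>2)
      + L * (\<Sum>j<N. \<Sum>a\<in>UNIV. D j a * \<alpha> j a + D (Suc j) a * \<beta> j a)" .
  have "L * (\<Sum>j<N. (\<Sum>a\<in>UNIV. \<gamma> j a) + (\<Sum>a\<in>UNIV. D j a * \<alpha> j a + D (Suc j) a * \<beta> j a)) \<le> L * (\<Sum>j<N. e * S j)"
    using L0 by (intro mult_left_mono sum_mono order_trans[OF abs_ge_self C(6)]) auto
  also have "\<dots> = e * (L * (\<Sum>j<N. S j))" by (simp add: sum_distrib_left[symmetric])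
  also have "\<dots> \<le> e * 1" by (rule mult_left_mono[OF LS e])
  finally have Cc: "L * (\<Sum>j<N. \<Sum>a\<in>UNIV. \<gamma> j a) + L * (\<Sum>j<N. \<Sum>a\<in>UNIV. D j a * \<alpha> j a + D (Suc j) a * \<beta> j a) \<le> e"
    by (simp add: sum.distrib distrib_left)
  have "\<mu> * (\<Sum>a\<in>UNIV. (D 0 a)\<^sup>2) + \<mu> * (\<Sum>a\<in>UNIV. H 0 a) = \<mu>"
    unfolding distrib_left[symmetric] D0 by simp
  then show "(\<Sum>a\<in>UNIV. Fh a) + (\<Sum>a\<in>UNIV. ud a * Fd a) + \<mu> + e \<ge> 0"
    using A B Cc by linarith
qed

end

section \<open>Minimal chains\<close>

lemma compact_product_sequence:
  fixes E :: "nat \<Rightarrow> 'a::topological_space set"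
  assumes "\<And>i. compact (E i)" shows "compact {x. \<forall>i. x i \<in> E i}"
proof -
  have "compactin (product_topology (\<lambda>i. euclidean) UNIV) (PiE UNIV E)"
    unfolding compactin_PiE using assms by simp
  then have "compact (PiE UNIV E)" by (simp add: euclidean_product_topology)
  moreover have "PiE UNIV E = {x. \<forall>i. x i \<in> E i}" by auto
  ultimately show ?thesis by simp
qed

context riemannian
begin

definition admissible :: "('m, 'n) patch set \<Rightarrow> 'm set \<Rightarrow> nat \<Rightarrow>
    (nat \<Rightarrow> ('m, 'n) patch) \<Rightarrow> (nat \<Rightarrow> 'm) \<Rightarrow> bool" where
  "admissible \<P> B N l x \<longleftrightarrow> (\<forall>i. x i \<in> B) \<and> (\<forall>i<N. l i \<in> \<P> \<and> x i \<in> patch_dom (l i) \<and> x (Suc i) \<in> patch_dom (l i))"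

text \<open>For fixed labels the admissible chains form a product of compact sets, on which the functional is continuous; there are only
finitely many sequences of labels.\<close>

lemma minimal_chain:
  fixes F0 F1 :: "'m \<Rightarrow> real" and L :: real
  defines "\<Psi> \<equiv> \<lambda>l N x. F1 (x N) + F0 (x 0) + L * (\<Sum>i<N. cost (l i) (x i) (x (Suc i)))"
  assumes \<P>: "finite \<P>" "\<And>P. P \<in> \<P> \<Longrightarrow> patch P" and B: "compact B"
    and F: "continuous_on UNIV F0" "continuous_on UNIV F1" and ex: "admissible \<P> B N l0 x0"
  obtains l x where "admissible \<P> B N l x" "\<And>l' x'. admissible \<P> B N l' x' \<Longrightarrow> \<Psi> l N x \<le> \<Psi> l' N x'"
proof -
  define X where "X l = {x. admissible \<P> B N l x}" for l
  have min: "\<exists>x\<in>X l. \<forall>x'\<in>X l. \<Psi> l N x \<le> \<Psi> l N x'" if ne: "X l \<noteq> {}" for l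
  proof (rule continuous_attains_inf[OF _ ne])
    have l: "l i \<in> \<P>" if "i < N" for i using ne that by (auto simp: X_def admissible_def)
    \<comment> \<open>Each point lies in the domains of the labels of both adjacent steps.\<close>
    define E where "E i = (if i < N then B \<inter> patch_dom (l i) else B) \<inter> (if 0 < i \<and> i - 1 < N then B \<inter> patch_dom (l (i - 1)) else B)" for i
    have cB: "compact (B \<inter> patch_dom (l i))" if "i < N" for i
      by (intro compact_Int B patch_dom_compact \<P> l that)
    have "compact (E i)" for i
      unfolding E_def by (intro compact_Int) (use cB B in auto)
    then have "compact {x. \<forall>i. x i \<in> E i}" by (rule compact_product_sequence)
    moreover have "{x. \<forall>i. x i \<in> E i} = X l"
    proof (intro set_eqI iffI)
      fix x assume "x \<in> {x. \<forall>i. x i \<in> E i}"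
      then have x: "x i \<in> E i" for i by simp
      show "x \<in> X l"
        unfolding X_def admissible_def mem_Collect_eq
      proof (intro allI impI conjI)
        show "x i \<in> B" for i using x[of i] by (auto simp: E_def split: if_splits)
        fix i assume i: "i < N"
        show "l i \<in> \<P>" "x i \<in> patch_dom (l i)" "x (Suc i) \<in> patch_dom (l i)"
          using l[OF i] x[of i] x[of "Suc i"] i by (auto simp: E_def)
      qed
    next
      fix x assume x: "x \<in> X l"
      have "x i \<in> E i" for i
        using x unfolding X_def admissible_def E_def by (cases i) auto
      then show "x \<in> {x. \<forall>i. x i \<in> E i}" by simp
    qed
    ultimately show "compact (X l)" by simp
    have "continuous_on (X l) (\<lambda>x. cost (l i) (x i) (x (Suc i)))" if i: "i < N" for i
    proof -
      have "continuous_on (X l) (\<lambda>x. (x i, x (Suc i)))"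
        by (intro continuous_on_Pair continuous_on_product_then_coordinatewise[OF continuous_on_id])
      moreover have "(\<lambda>x. (x i, x (Suc i))) ` X l \<subseteq> fst (fst (l i)) \<times> fst (fst (l i))"
        using i patch_subsets(3)[of "l i"] by (auto simp: X_def admissible_def)
      ultimately have "continuous_on (X l) (\<lambda>x. (\<lambda>z. cost (l i) (fst z) (snd z)) (x i, x (Suc i)))"
        using continuous_on_compose2[OF cost_continuous[OF \<P>(2)[OF l[OF i]]]] by blast
      then show ?thesis by simp
    qed
    moreover have "continuous_on (X l) (\<lambda>x. F1 (x N))" "continuous_on (X l) (\<lambda>x. F0 (x 0))"
      by (rule continuous_on_compose2[OF F(2)] continuous_on_compose2[OF F(1)];
        auto intro: continuous_on_product_then_coordinatewise[OF continuous_on_id])+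
    ultimately show "continuous_on (X l) (\<Psi> l N)"
      unfolding \<Psi>_def by (intro continuous_on_add continuous_on_mult continuous_on_const continuous_on_sum) auto
  qed
  define M where "M = {l \<in> {..<N} \<rightarrow>\<^sub>E \<P>. X l \<noteq> {}}"
  have restr: "X (restrict l {..<N}) = X l" "\<Psi> (restrict l {..<N}) N x = \<Psi> l N x" for l x
    by (auto simp: X_def admissible_def \<Psi>_def)
  have inM: "restrict l {..<N} \<in> M" if "x \<in> X l" for l x
  proof -
    have "restrict l {..<N} \<in> {..<N} \<rightarrow>\<^sub>E \<P>" using that by (auto simp: X_def admissible_def)
    moreover have "X (restrict l {..<N}) \<noteq> {}" unfolding restr using that by auto
    ultimately show ?thesis by (simp add: M_def)
  qed
  have fM: "finite M" unfolding M_def using finite_PiE[of "{..<N}" "\<lambda>_. \<P>"] \<P>(1) by auto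
  have "\<forall>l\<in>M. \<exists>x. x \<in> X l \<and> (\<forall>x'\<in>X l. \<Psi> l N x \<le> \<Psi> l N x')" using min by (auto simp: M_def)
  then obtain m where m: "\<And>l. l \<in> M \<Longrightarrow> m l \<in> X l" "\<And>l x'. l \<in> M \<Longrightarrow> x' \<in> X l \<Longrightarrow> \<Psi> l N (m l) \<le> \<Psi> l N x'" by metis
  have "M \<noteq> {}" using inM[of x0 l0] ex by (auto simp: X_def)
  define v where "v = Min ((\<lambda>l. \<Psi> l N (m l)) ` M)"
  have "v \<in> (\<lambda>l. \<Psi> l N (m l)) ` M" unfolding v_def by (rule Min_in) (use fM \<open>M \<noteq> {}\<close> in auto)
  then obtain l where l: "l \<in> M" "v = \<Psi> l N (m l)" by auto
  show ?thesis
  proof (rule that[of l "m l"])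
    show "admissible \<P> B N l (m l)" using m(1)[OF l(1)] by (simp add: X_def)
    fix l' x' assume a: "admissible \<P> B N l' x'"
    then have x': "x' \<in> X l'" by (simp add: X_def)
    note r = inM[OF x']
    have "\<Psi> l N (m l) \<le> \<Psi> (restrict l' {..<N}) N (m (restrict l' {..<N}))"
      unfolding l(2)[symmetric] v_def by (rule Min_le) (use fM r in auto)
    also have "\<dots> \<le> \<Psi> (restrict l' {..<N}) N x'" by (rule m(2)[OF r]) (use x' restr in auto)
    also have "\<dots> = \<Psi> l' N x'" by (rule restr)
    finally show "\<Psi> l N (m l) \<le> \<Psi> l' N x'" .
  qed
qed

end

context soliton
begin

text \<open>Steps that cost little are near the diagonal, where \<open>coupled_pair_relabel\<close> applies; by compactness one threshold suffices, namely the minimal cost of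
a step outside a neighbourhood of the diagonal.\<close>

lemma relabel_patch:
  assumes B: "compact B" and \<P>: "\<And>P. P \<in> \<P> \<Longrightarrow> patch P" "B \<subseteq> (\<Union>P\<in>\<P>. patch_core P)" and e: "e > 0" and P: "P \<in> \<P>"
  obtains s where "s > 0" "\<And>p p'. p \<in> B \<inter> patch_dom P \<Longrightarrow> p' \<in> B \<inter> patch_dom P \<Longrightarrow> cost P p p' < s \<Longrightarrow>
     \<exists>Q\<in>\<P>. coupled_pair e Q p p' \<and> cost Q p p' \<le> cost P p p'"
proof -
  define K where "K = B \<inter> patch_dom P"
  have K: "compact K" unfolding K_def by (intro compact_Int B patch_dom_compact \<P> P)
  have KP: "K \<subseteq> fst (fst P)" using patch_subsets(3)[of P] by (auto simp: K_def)
  define R where "R z S \<longleftrightarrow> open S \<and> z \<in> S \<and> (\<exists>Q\<in>\<P>. \<forall>p\<in>S. \<forall>p'\<in>S. coupled_pair e Q p p' \<and> cost Q p p' \<le> cost P p p')" for z S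
  have "\<exists>S. R z S" if z: "z \<in> K" for z
  proof -
    obtain P' where P': "P' \<in> \<P>" "z \<in> patch_core P'" using \<P>(2) z by (auto simp: K_def)
    have zd: "z \<in> patch_dom P" using z by (simp add: K_def)
    obtain Q S where Q: "Q \<in> {P, P'}" "open S" "z \<in> S"
      "\<And>p p'. p \<in> S \<Longrightarrow> p' \<in> S \<Longrightarrow> coupled_pair e Q p p' \<and> cost Q p p' \<le> cost P p p'"
      by (rule coupled_pair_relabel[OF \<P>(1)[OF P] zd \<P>(1)[OF P'(1)] P'(2) e]) (rule that, assumption+)
    then have "R z S" unfolding R_def using P P'(1) by blast
    then show ?thesis by blast
  qed
  then obtain S where S: "\<And>z. z \<in> K \<Longrightarrow> R z (S z)" by metis
  define U where "U = (\<Union>z\<in>K. S z \<times> S z)"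
  have "open U" unfolding U_def using S by (intro open_UN ballI open_Times) (auto simp: R_def)
  then have C: "compact (K \<times> K - U)" by (intro compact_diff compact_Times K)
  have inU: "\<exists>Q\<in>\<P>. coupled_pair e Q p p' \<and> cost Q p p' \<le> cost P p p'" if p: "(p, p') \<in> U" for p p'
  proof -
    obtain z where z: "z \<in> K" "p \<in> S z" "p' \<in> S z" using p by (auto simp: U_def)
    then show ?thesis using S[OF z(1)] unfolding R_def by blast
  qed
  show ?thesis
  proof (cases "K \<times> K - U = {}")
    case True
    show ?thesis
    proof (rule that[of 1])
      fix p p' assume "p \<in> B \<inter> patch_dom P" "p' \<in> B \<inter> patch_dom P"
      then have "(p, p') \<in> U" using True by (auto simp: K_def)
      then show "\<exists>Q\<in>\<P>. coupled_pair e Q p p' \<and> cost Q p p' \<le> cost P p p'" by (rule inU)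
    qed simp
  next
    case False
    have "K \<times> K - U \<subseteq> fst (fst P) \<times> fst (fst P)" using KP by auto
    from continuous_attains_inf[OF C False continuous_on_subset[OF cost_continuous[OF \<P>(1)[OF P]] this]]
    obtain z where z: "z \<in> K \<times> K - U" "\<And>z'. z' \<in> K \<times> K - U \<Longrightarrow> cost P (fst z) (snd z) \<le> cost P (fst z') (snd z')"
      by blast
    show ?thesis
    proof (rule that[of "cost P (fst z) (snd z)"])
      have zK: "fst z \<in> K" "snd z \<in> K" "(fst z, snd z) \<notin> U" using z(1) by auto
      have "(fst z, fst z) \<in> U" using S[OF zK(1)] zK(1) unfolding U_def R_def by blast
      then have "fst z \<noteq> snd z" using zK(3) by metis
      then show "cost P (fst z) (snd z) > 0" by (intro cost_pos \<P>(1) P) (use zK KP in auto)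
      fix p p' assume p: "p \<in> B \<inter> patch_dom P" "p' \<in> B \<inter> patch_dom P" "cost P p p' < cost P (fst z) (snd z)"
      have "(p, p') \<in> U"
      proof (rule ccontr)
        assume "(p, p') \<notin> U"
        then have "(p, p') \<in> K \<times> K - U" using p by (auto simp: K_def)
        from z(2)[OF this] p(3) show False by simp
      qed
      then show "\<exists>Q\<in>\<P>. coupled_pair e Q p p' \<and> cost Q p p' \<le> cost P p p'" by (rule inU)
    qed
  qed
qed

lemma relabel_uniform:
  assumes B: "compact B" and \<P>: "finite \<P>" "\<And>P. P \<in> \<P> \<Longrightarrow> patch P" "B \<subseteq> (\<Union>P\<in>\<P>. patch_core P)" and e: "e > 0"
  obtains s where "s > 0" "\<And>P p p'. P \<in> \<P> \<Longrightarrow> p \<in> B \<inter> patch_dom P \<Longrightarrow> p' \<in> B \<inter> patch_dom P \<Longrightarrow> cost P p p' < s \<Longrightarrow>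
     \<exists>Q\<in>\<P>. coupled_pair e Q p p' \<and> cost Q p p' \<le> cost P p p'"
proof -
  define R where "R P s \<longleftrightarrow> s > 0 \<and> (\<forall>p p'. p \<in> B \<inter> patch_dom P \<longrightarrow> p' \<in> B \<inter> patch_dom P \<longrightarrow> cost P p p' < s \<longrightarrow>
     (\<exists>Q\<in>\<P>. coupled_pair e Q p p' \<and> cost Q p p' \<le> cost P p p'))" for P s
  have "\<exists>s. R P s" if "P \<in> \<P>" for P
    using relabel_patch[OF B \<P>(2,3) e that] unfolding R_def by metis
  then obtain s where s: "\<And>P. P \<in> \<P> \<Longrightarrow> R P (s P)" by metis
  show ?thesis
  proof (rule that[of "Min (insert 1 (s ` \<P>))"])
    show "Min (insert 1 (s ` \<P>)) > 0" using \<P>(1) s by (auto simp: R_def)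
    fix P p p' assume a: "P \<in> \<P>" "p \<in> B \<inter> patch_dom P" "p' \<in> B \<inter> patch_dom P" "cost P p p' < Min (insert 1 (s ` \<P>))"
    have "Min (insert 1 (s ` \<P>)) \<le> s P" by (rule Min_le) (use \<P>(1) a(1) in auto)
    then have "cost P p p' < s P" using a(4) by linarith
    then show "\<exists>Q\<in>\<P>. coupled_pair e Q p p' \<and> cost Q p p' \<le> cost P p p'" using s[OF a(1)] a(2,3) unfolding R_def by blast
  qed
qed

end

section \<open>The scalar curvature is nonnegative\<close>

text \<open>A bounded decreasing function of \<open>w\<close>. For \<open>b = barrier\<close> one has \<open>b' = - b\<^sup>3 / 2\<close> and \<open>b'' = 3 b\<^sup>5 / 4\<close>, so that in the drift Laplacian of \<open>b \<circ> w\<close> the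
gradient term can be absorbed into \<open>|\<nabla>(b \<circ> w)|\<^sup>2\<close>, while the quadratic growth of the Bochner term survives at infinity.\<close>

definition barrier :: "real \<Rightarrow> real" where "barrier t = 1 / sqrt (1 + t)"

lemma barrier_derivative:
  assumes "t > -1"
  shows "(barrier has_real_derivative - (barrier t ^ 3 / 2)) (at t)"
    "((\<lambda>t. - (barrier t ^ 3 / 2)) has_real_derivative 3 / 4 * (barrier t) ^ 5) (at t)"
proof -
  have s: "sqrt (1 + t) > 0" using assms by simp
  have "((\<lambda>t. 1 + t) has_real_derivative 1) (at t)" by (auto intro!: derivative_eq_intros)
  from DERIV_chain2[OF DERIV_real_sqrt this] assms
  have "((\<lambda>t. sqrt (1 + t)) has_real_derivative inverse (sqrt (1 + t)) / 2) (at t)" by simp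
  note d = DERIV_inverse'[OF this]
  have inv: "barrier = (\<lambda>t. inverse (sqrt (1 + t)))" by (simp add: barrier_def[abs_def] divide_inverse)
  have "- (inverse (sqrt (1 + t)) * (inverse (sqrt (1 + t)) / 2) * inverse (sqrt (1 + t))) = - (inverse (sqrt (1 + t)) ^ 3 / 2)"
    by (simp only: power3_eq_cube times_divide_eq_right times_divide_eq_left)
  with d s show 1: "(barrier has_real_derivative - (barrier t ^ 3 / 2)) (at t)"
    unfolding inv by (metis less_irrefl)
  show "((\<lambda>t. - (barrier t ^ 3 / 2)) has_real_derivative 3 / 4 * (barrier t) ^ 5) (at t)"
    using DERIV_minus[OF DERIV_cdivide[OF DERIV_power[OF 1, of 3], of 2]] by (simp add: eval_nat_numeral mult.assoc)
qed

lemma barrier_bounds: "t \<ge> 0 \<Longrightarrow> barrier t > 0" "t \<ge> 0 \<Longrightarrow> barrier t \<le> 1" "t \<ge> 0 \<Longrightarrow> (barrier t)\<^sup>2 = 1 / (1 + t)"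
  by (auto simp: barrier_def power_divide)

lemma barrier_less_iff: "s \<ge> 0 \<Longrightarrow> t \<ge> 0 \<Longrightarrow> barrier s < barrier t \<longleftrightarrow> t < s"
  unfolding barrier_def by (subst divide_less_cancel | simp add: frac_less2 divide_less_eq less_divide_eq)+

context soliton
begin

text \<open>The chain rule for jets, combined with the Bochner bound in \<open>soliton_jets\<close>; the square of the derivative of \<open>w\<close> is rewritten as a square of the
derivative of \<open>barrier \<circ> w\<close>.\<close>

lemma barrier_jets:
  assumes o: "osc q \<kappa>"
  obtains Fd Fh ud uh where "\<And>a. jet2 (\<lambda>\<epsilon>. barrier (w (\<kappa> a \<epsilon>))) (Fd a) (Fh a)" "\<And>a. jet2 (\<lambda>\<epsilon>. u (\<kappa> a \<epsilon>)) (ud a) (uh a)"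
    "barrier (w q) * ((\<Sum>a\<in>UNIV. Fh a) + (\<Sum>a\<in>UNIV. ud a * Fd a)) \<le> - ((w q - 1) / (w q + 1))\<^sup>2 / real CARD('n) + 3 * (\<Sum>a\<in>UNIV. (Fd a)\<^sup>2)"
proof -
  obtain ud uh wd wh where j: "\<And>a. jet2 (\<lambda>\<epsilon>. u (\<kappa> a \<epsilon>)) (ud a) (uh a)" "\<And>a. jet2 (\<lambda>\<epsilon>. w (\<kappa> a \<epsilon>)) (wd a) (wh a)"
    and b: "(\<Sum>a\<in>UNIV. wh a) + (\<Sum>a\<in>UNIV. ud a * wd a) \<ge> 2 * (1 - w q)\<^sup>2 / real CARD('n)"
    by (rule soliton_jets[OF o]) (rule that, assumption+)
  define s where "s = barrier (w q)"
  have w0: "w q \<ge> 0" by (rule w_nonneg)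
  have s: "s > 0" "s\<^sup>2 = 1 / (1 + w q)" using barrier_bounds[OF w0] by (auto simp: s_def)
  define Fd where "Fd a = - (s ^ 3 / 2) * wd a" for a
  define Fh where "Fh a = 3 / 4 * s ^ 5 * (wd a)\<^sup>2 + - (s ^ 3 / 2) * wh a" for a
  have w\<kappa>: "w (\<kappa> a 0) = w q" for a using osc_base(1)[OF o] by simp
  have "jet2 (\<lambda>\<epsilon>. barrier (w (\<kappa> a \<epsilon>))) (Fd a) (Fh a)" for a
  proof -
    have "jet2 (\<lambda>\<epsilon>. barrier (w (\<kappa> a \<epsilon>))) (- (barrier (w (\<kappa> a 0)) ^ 3 / 2) * wd a)
       (3 / 4 * (barrier (w (\<kappa> a 0))) ^ 5 * (wd a)\<^sup>2 + - (barrier (w (\<kappa> a 0)) ^ 3 / 2) * wh a)"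
      by (rule jet2_compose_real[OF j(2), of "{-1<..}"]) (use w0 w\<kappa> barrier_derivative[of "w q"] in \<open>auto intro: barrier_derivative(1)\<close>)
    then show ?thesis by (simp only: w\<kappa> Fd_def Fh_def s_def)
  qed
  note jF = this
  have F2: "3 / 4 * s ^ 6 * (wd a)\<^sup>2 = 3 * (Fd a)\<^sup>2" for a
    by (simp add: Fd_def power_mult_distrib power_divide)
  have "s * ((\<Sum>a\<in>UNIV. Fh a) + (\<Sum>a\<in>UNIV. ud a * Fd a))
     = (\<Sum>a\<in>UNIV. 3 / 4 * s ^ 6 * (wd a)\<^sup>2) - s ^ 4 / 2 * ((\<Sum>a\<in>UNIV. wh a) + (\<Sum>a\<in>UNIV. ud a * wd a))"
    unfolding sum_distrib_left distrib_left sum.distrib[symmetric] sum_subtractf[symmetric]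
    by (intro sum.cong refl) (simp add: Fh_def Fd_def eval_nat_numeral algebra_simps)
  also have "\<dots> \<le> (\<Sum>a\<in>UNIV. 3 * (Fd a)\<^sup>2) - s ^ 4 / 2 * (2 * (1 - w q)\<^sup>2 / real CARD('n))"
    unfolding F2 by (intro diff_left_mono mult_left_mono b) simp
  also have "\<dots> = - (s\<^sup>2 * (w q - 1))\<^sup>2 / real CARD('n) + 3 * (\<Sum>a\<in>UNIV. (Fd a)\<^sup>2)"
    by (simp add: sum_distrib_left power_mult_distrib power2_commute[of 1])
  also have "s\<^sup>2 * (w q - 1) = (w q - 1) / (w q + 1)" by (simp add: s(2) add.commute)
  finally show ?thesis using that[OF jF j(1)] by (simp add: s_def)
qed

lemma barrier_w_continuous: "continuous_on UNIV (\<lambda>p. barrier (w p))"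
proof -
  have "1 + w p \<noteq> 0" "sqrt (1 + w p) \<noteq> 0" for p using w_nonneg[of p] by auto
  then show ?thesis unfolding barrier_def by (intro continuous_intros w_continuous) auto
qed

end

locale complete_soliton = soliton \<A> g f for \<A> :: "('m::{t2_space,second_countable_topology}, 'n::finite) chart set" and g :: "'m metric" and f +
  assumes complete: "\<And>\<sigma>::nat \<Rightarrow> 'm. (\<forall>e>0. \<exists>N. \<forall>m\<ge>N. \<forall>k\<ge>N. riemannian_dist \<A> g (\<sigma> m) (\<sigma> k) < e) \<Longrightarrow>
        \<exists>p. (\<lambda>k. riemannian_dist \<A> g (\<sigma> k) p) \<longlonglongrightarrow> 0"
    and f_nonpos: "f p \<le> 0"
    and f_proper: "\<exists>K. compact K \<and> (\<forall>x\<in>- K. f x < a)"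
begin

lemma u_nonneg: "u p \<ge> 0"
  using f_nonpos[of p] by (simp add: u_def)

lemma u_proper: "compact {x. u x \<le> C}"
proof -
  obtain K where K: "compact K" "\<And>x. x \<notin> K \<Longrightarrow> f x < - C" using f_proper[of "- C"] by auto
  have "closed {x. u x \<le> C}" by (intro closed_Collect_le u_continuous continuous_on_const)
  moreover have "{x. u x \<le> C} \<subseteq> K" using K(2) by (force simp: u_def)
  ultimately show ?thesis using compact_Int_closed[OF K(1)] by (metis inf.absorb_iff2)
qed

sublocale proper_riemannian \<A> g u
  by unfold_locales (use complete u_continuous u_proper in auto)

text \<open>The proof by minimal chains. Suppose \<open>w p = 1 + 2 \<rho>\<close> with \<open>\<rho> > 0\<close>. The constants are chosen in this order: \<open>k\<close> bounds the Bochner term below where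
\<open>w \<ge> 1 + \<rho>\<close>; \<open>t\<close>, \<open>\<mu>\<close> and \<open>\<theta>\<close> are so small that the drift Laplacian and the gradient in \<open>chain_variation\<close> contradict this bound, and \<open>\<mu>\<close> also so
small that a minimal chain, compared with the constant chain at \<open>p\<close>, ends where \<open>w \<ge> 1 + \<rho>\<close>; then minimal chains have a length bounded in
terms of \<open>\<theta>\<close> and start in a compact set depending on \<open>\<mu>\<close>, so that they stay in a compact set \<open>B\<close>; finally \<open>N\<close> is so large that all steps are short.\<close>

theorem scalar_curvature_nonneg: "w p \<le> 1"
proof (rule ccontr)
  assume "\<not> ?thesis"
  then have wp: "w p > 1" by simp
  define n where "n = real CARD('n)"
  have n: "n \<ge> 1" by (simp add: n_def Suc_leI)
  define \<rho> where "\<rho> = (w p - 1) / 2"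
  have \<rho>: "\<rho> > 0" "1 + \<rho> < w p" using wp by (simp_all add: \<rho>_def field_simps)
  define k where "k = (\<rho> / (2 + \<rho>))\<^sup>2"
  have k: "k > 0" "k \<le> 1" using \<rho> by (auto simp: k_def power_le_one)
  define t where "t = k / (8 * n)"
  have t: "t > 0" using k n by (simp add: t_def)
  define \<Delta> where "\<Delta> = barrier (1 + \<rho>) - barrier (w p)"
  have \<Delta>: "\<Delta> > 0" using barrier_less_iff[of "w p" "1 + \<rho>"] \<rho> by (simp add: \<Delta>_def)
  define \<mu> where "\<mu> = min t (\<Delta> / (u p + 1))"
  have up: "u p + 1 > 0" using u_nonneg[of p] by simp
  have \<mu>: "\<mu> > 0" "\<mu> \<le> t" using t \<Delta> up by (auto simp: \<mu>_def)
  have "\<mu> * u p \<le> \<Delta> / (u p + 1) * u p" by (rule mult_right_mono) (use u_nonneg in \<open>auto simp: \<mu>_def\<close>)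
  also have "\<dots> \<le> \<Delta>" using up \<Delta> by (simp add: field_simps)
  finally have \<mu>u: "\<mu> * u p \<le> \<Delta>" .
  \<comment> \<open>This makes the gradient bound \<open>t + 3 sqrt \<theta>\<close> equal to \<open>2 t\<close>.\<close>
  define \<theta> where "\<theta> = (t / 3)\<^sup>2"
  have \<theta>: "\<theta> > 0" "3 * sqrt \<theta> = t" using t by (auto simp: \<theta>_def)
  obtain A s where A: "s > 0" "\<And>N x \<sigma>. u (x 0) \<le> 1 / \<mu> \<Longrightarrow> chain N x \<sigma> \<Longrightarrow> (\<forall>i<N. \<sigma> i \<le> s) \<Longrightarrow> (\<Sum>i<N. \<sigma> i) \<le> 2 * sqrt (1 / \<theta>) + 1 \<Longrightarrow> u (x N) \<le> A"
    using chains_bounded[of "1 / \<mu>" "2 * sqrt (1 / \<theta>) + 1"] by blast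
  \<comment> \<open>The extra \<open>1\<close> puts minimal chains into the interior of \<open>B\<close>, so that they can be varied freely.\<close>
  define A' where "A' = max A (u p) + 1"
  define B where "B = {x. u x \<le> A'}"
  have B: "compact B" unfolding B_def by (rule u_proper)
  have pB: "p \<in> B" by (simp add: B_def A'_def)
  have "\<forall>z. \<exists>P S. patch P \<and> open S \<and> z \<in> S \<and> S \<subseteq> patch_core P"
  proof
    fix z show "\<exists>P S. patch P \<and> open S \<and> z \<in> S \<and> S \<subseteq> patch_core P"
      by (rule patch_exists[of z]) blast
  qed
  then obtain pt nb where pn: "\<And>z. patch (pt z)" "\<And>z. open (nb z)" "\<And>z. z \<in> nb z" "\<And>z. nb z \<subseteq> patch_core (pt z)"
    by metis
  have "B \<subseteq> (\<Union>z\<in>UNIV. nb z)" using pn(3) by auto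
  from compactE_image[OF B pn(2) this] obtain Z where Z: "finite Z" "B \<subseteq> (\<Union>z\<in>Z. nb z)" by metis
  define \<P> where "\<P> = pt ` Z"
  have \<P>: "finite \<P>" "\<And>P. P \<in> \<P> \<Longrightarrow> patch P" using Z(1) pn(1) by (auto simp: \<P>_def)
  have cover: "B \<subseteq> (\<Union>P\<in>\<P>. patch_core P)"
  proof
    fix x assume "x \<in> B"
    then obtain z where "z \<in> Z" "x \<in> nb z" using subsetD[OF Z(2), of x] by auto
    then show "x \<in> (\<Union>P\<in>\<P>. patch_core P)" using subsetD[OF pn(4), of x z] by (auto simp: \<P>_def)
  qed
  obtain s0 where s0: "s0 > 0" "\<And>P p p'. P \<in> \<P> \<Longrightarrow> p \<in> B \<inter> patch_dom P \<Longrightarrow> p' \<in> B \<inter> patch_dom P \<Longrightarrow> cost P p p' < s0 \<Longrightarrow>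
     \<exists>Q\<in>\<P>. coupled_pair t Q p p' \<and> cost Q p p' \<le> cost P p p'"
    by (rule relabel_uniform[OF B \<P> cover t]) (assumption, rule that, assumption+)
  \<comment> \<open>The cost of a single step is at most \<open>1 / (\<theta> N)\<close>, by minimality.\<close>
  obtain N where N: "real N > max (1 / (\<theta> * s0)) (max (1 / (\<theta> * (s / 4)\<^sup>2)) (2 / s))" using reals_Archimedean2 by blast
  have "real N > 2 / s" using N by simp
  then have N0: "N > 0" using A(1) by (metis divide_pos_pos less_trans of_nat_0_less_iff zero_less_numeral)
  have \<theta>N: "\<theta> * real N > 0" using \<theta> N0 by simp
  have Ns0: "1 / (\<theta> * real N) < s0" using N s0(1) \<theta>(1) N0 by (simp add: field_simps)
  have "1 / (\<theta> * real N) \<le> (s / 4)\<^sup>2" using N A(1) \<theta>(1) N0 by (simp add: field_simps)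
  then have Ns: "sqrt (1 / (\<theta> * real N)) \<le> s / 4" by (rule real_le_lsqrt[rotated]) (use A(1) in simp)
  have N1: "1 / real N \<le> s / 2" using N A(1) N0 by (simp add: field_simps)
  obtain P0 where P0: "P0 \<in> \<P>" "p \<in> patch_core P0" using subsetD[OF cover pB] by blast
  have pd: "p \<in> patch_dom P0" using P0(2) patch_subsets(1)[OF \<P>(2)[OF P0(1)]] patch_subsets(2)[of P0] by blast
  have ad0: "admissible \<P> B N (\<lambda>i. P0) (\<lambda>i. p)" using pB pd P0 by (simp add: admissible_def)
  define \<Psi> where "\<Psi> l x = barrier (w (x N)) + \<mu> * u (x 0) + \<theta> * real N * (\<Sum>i<N. cost (l i) (x i) (x (Suc i)))" for l x
  have F0: "continuous_on UNIV (\<lambda>x. \<mu> * u x)" by (intro continuous_on_mult continuous_on_const u_continuous)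
  obtain l x where lx: "admissible \<P> B N l x" "\<And>l' x'. admissible \<P> B N l' x' \<Longrightarrow> \<Psi> l x \<le> \<Psi> l' x'"
    apply (rule minimal_chain[OF \<P> B F0 barrier_w_continuous ad0, of "\<theta> * real N"], assumption)
    subgoal premises prems for l x using prems(2,3) by (intro prems(1)[of l x]) (simp_all only: \<Psi>_def)
    done
  have xB: "x i \<in> B" for i using lx(1) by (simp add: admissible_def)
  have li: "l i \<in> \<P>" "x i \<in> patch_dom (l i)" "x (Suc i) \<in> patch_dom (l i)" if "i < N" for i
    using lx(1) that by (auto simp: admissible_def)
  define S where "S i = cost (l i) (x i) (x (Suc i))" for i
  have S0: "S i \<ge> 0" if "i < N" for i
    unfolding S_def using li[OF that] \<P>(2) patch_subsets(3)[of "l i"] by (intro cost_nonneg) auto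
  have "\<Psi> l x \<le> \<Psi> (\<lambda>i. P0) (\<lambda>i. p)" by (rule lx(2)[OF ad0])
  also have "\<dots> = barrier (w p) + \<mu> * u p" by (simp add: \<Psi>_def cost_self)
  also have "\<dots> \<le> barrier (1 + \<rho>)" using \<mu>u by (simp add: \<Delta>_def)
  finally have \<Psi>1: "\<Psi> l x \<le> barrier (1 + \<rho>)" .
  have b1: "barrier (1 + \<rho>) \<le> 1" by (rule barrier_bounds) (use \<rho> in simp)
  have nn: "barrier (w (x N)) > 0" "\<mu> * u (x 0) \<ge> 0" "\<theta> * real N * (\<Sum>i<N. S i) \<ge> 0"
    using barrier_bounds(1)[OF w_nonneg] \<mu> u_nonneg \<theta>(1) S0 by (auto intro!: mult_nonneg_nonneg sum_nonneg)
  have \<Psi>S: "\<Psi> l x = barrier (w (x N)) + \<mu> * u (x 0) + \<theta> * real N * (\<Sum>i<N. S i)" by (simp add: \<Psi>_def S_def)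
  have xN: "barrier (w (x N)) \<le> barrier (1 + \<rho>)" using \<Psi>1 nn unfolding \<Psi>S by linarith
  have "\<mu> * u (x 0) \<le> 1" using \<Psi>1 nn b1 unfolding \<Psi>S by linarith
  then have ux0: "u (x 0) \<le> 1 / \<mu>" using \<mu>(1) by (simp add: field_simps)
  have sumS: "\<theta> * real N * (\<Sum>i<N. S i) \<le> 1" using \<Psi>1 nn b1 unfolding \<Psi>S by linarith
  have Ssmall: "S i < s0" if "i < N" for i
  proof -
    have "S i \<le> (\<Sum>i<N. S i)" by (rule member_le_sum) (use that S0 in auto)
    also have "\<dots> \<le> 1 / (\<theta> * real N)" using sumS \<theta>N by (simp add: field_simps)
    finally show ?thesis using Ns0 by linarith
  qed
  have "\<exists>Q. i < N \<longrightarrow> Q \<in> \<P> \<and> coupled_pair t Q (x i) (x (Suc i)) \<and> cost Q (x i) (x (Suc i)) \<le> S i" for i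
    using s0(2)[of "l i" "x i" "x (Suc i)"] li[of i] xB Ssmall[of i] unfolding S_def by blast
  then obtain m where m: "\<And>i. i < N \<Longrightarrow> m i \<in> \<P>" "\<And>i. i < N \<Longrightarrow> coupled_pair t (m i) (x i) (x (Suc i))"
    "\<And>i. i < N \<Longrightarrow> cost (m i) (x i) (x (Suc i)) \<le> S i" by metis
  define S' where "S' i = cost (m i) (x i) (x (Suc i))" for i
  have mi: "x i \<in> patch_int (m i)" "x (Suc i) \<in> patch_int (m i)" "ds (x i) (x (Suc i)) \<le> ennreal (2 * sqrt (S' i))"
    "\<And>\<kappa>. osc (x i) \<kappa> \<Longrightarrow> \<exists>\<kappa>'. osc (x (Suc i)) \<kappa>' \<and> coupled_frames t (m i) (x i) (x (Suc i)) \<kappa> \<kappa>'" if "i < N" for i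
    using m(2)[OF that] unfolding coupled_pair_def S'_def by auto
  have S'0: "S' i \<ge> 0" if "i < N" for i
    unfolding S'_def using mi(1)[OF that] m(1)[OF that] \<P>(2) patch_subsets(2,3)[of "m i"] by (intro cost_nonneg) auto
  have S'S: "(\<Sum>i<N. S' i) \<le> (\<Sum>i<N. S i)" unfolding S'_def by (intro sum_mono m(3)) simp
  have sumS': "\<theta> * real N * (\<Sum>i<N. S' i) \<le> 1"
    using mult_left_mono[OF S'S, of "\<theta> * real N"] \<theta>N sumS by linarith
  \<comment> \<open>After relabelling the chain is still minimal.\<close>
  have minm: "\<Psi> m x \<le> \<Psi> l' x'" if "admissible \<P> B N l' x'" for l' x'
  proof -
    have "\<Psi> m x \<le> \<Psi> l x"
      using mult_left_mono[OF S'S, of "\<theta> * real N"] \<theta>N unfolding \<Psi>_def S'_def S_def by linarith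
    also have "\<dots> \<le> \<Psi> l' x'" by (rule lx(2)[OF that])
    finally show ?thesis .
  qed
  have uA: "u (x j) \<le> A" if j: "j \<le> N" for j
  proof -
    \<comment> \<open>The summand \<open>1 / N\<close> makes the bounds on the steps strict.\<close>
    define \<sigma> where "\<sigma> i = 2 * sqrt (S' i) + 1 / real N" for i
    have \<sigma>0: "\<sigma> i \<ge> 0" if "i < N" for i using S'0[OF that] by (simp add: \<sigma>_def)
    have "ds (x i) (x (Suc i)) < ennreal (\<sigma> i)" if "i < N" for i
    proof -
      have "ennreal (2 * sqrt (S' i)) < ennreal (\<sigma> i)" using S'0[OF that] N0 by (simp add: \<sigma>_def ennreal_less_iff)
      then show ?thesis using mi(3)[OF that] by (rule le_less_trans[rotated])
    qed
    then have ch: "chain j x \<sigma>" using \<sigma>0 j by (auto simp: chain_def)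
    have "\<sigma> i \<le> s" if "i < N" for i
    proof -
      have "S' i \<le> (\<Sum>i<N. S' i)" by (rule member_le_sum) (use that S'0 in auto)
      also have "\<dots> \<le> 1 / (\<theta> * real N)" using sumS' \<theta>N by (simp add: field_simps)
      finally have "sqrt (S' i) \<le> s / 4" using Ns by (meson order_trans real_sqrt_le_mono)
      then show ?thesis using N1 by (simp add: \<sigma>_def)
    qed
    then have st: "\<forall>i<j. \<sigma> i \<le> s" using j by simp
    have "(\<Sum>i<j. \<sigma> i) \<le> (\<Sum>i<N. \<sigma> i)" by (rule sum_mono2) (use j \<sigma>0 in auto)
    also have "\<dots> = 2 * (\<Sum>i<N. sqrt (S' i)) + 1" using N0 by (simp add: \<sigma>_def sum.distrib sum_distrib_left)
    also have "\<dots> \<le> 2 * sqrt (real N * (\<Sum>i<N. S' i)) + 1" using sum_sqrt_le[of N S'] S'0 by simp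
    also have "\<dots> \<le> 2 * sqrt (1 / \<theta>) + 1"
    proof -
      have "real N * (\<Sum>i<N. S' i) \<le> 1 / \<theta>" using sumS' \<theta>(1) by (simp add: field_simps)
      then show ?thesis using real_sqrt_le_mono by auto
    qed
    finally show ?thesis using A(2)[OF ux0 ch st] by simp
  qed
  have "\<exists>\<kappa>. \<forall>i. osc (x i) (\<kappa> i) \<and> (i < N \<longrightarrow> coupled_frames t (m i) (x i) (x (Suc i)) (\<kappa> i) (\<kappa> (Suc i)))"
  proof (rule dependent_nat_choice)
    show "\<exists>\<kappa>. osc (x 0) \<kappa>" by (rule osc_exists'[of "x 0"]) blast
    fix \<kappa> i assume o: "osc (x i) \<kappa>"
    show "\<exists>\<kappa>'. osc (x (Suc i)) \<kappa>' \<and> (i < N \<longrightarrow> coupled_frames t (m i) (x i) (x (Suc i)) \<kappa> \<kappa>')"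
    proof (cases "i < N")
      case True
      then show ?thesis using mi(4)[OF True o] by simp
    next
      case False
      show ?thesis by (rule osc_exists'[of "x (Suc i)"]) (use False in blast)
    qed
  qed
  then obtain \<kappa> where \<kappa>: "\<And>i. osc (x i) (\<kappa> i)" "\<And>i. i < N \<Longrightarrow> coupled_frames t (m i) (x i) (x (Suc i)) (\<kappa> i) (\<kappa> (Suc i))"
    by blast
  have local: "\<forall>\<^sub>F \<epsilon> in nhds 0. \<Psi> m x \<le> \<Psi> m (\<lambda>i. y i \<epsilon>)"
    if y: "\<And>i. y i 0 = x i" "\<And>i. isCont (y i) 0" for y :: "nat \<Rightarrow> real \<Rightarrow> 'm"
  proof -
    have oB: "open {z. u z < A'}" by (intro open_Collect_less u_continuous continuous_on_const)
    have "\<forall>\<^sub>F \<epsilon> in nhds 0. y i \<epsilon> \<in> {z. u z < A'}" if "i \<in> {..N}" for i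
      by (rule isCont_eventually_in[OF y(2) oB]) (use uA[of i] that y(1)[of i] in \<open>simp add: A'_def\<close>)
    then have 1: "\<forall>\<^sub>F \<epsilon> in nhds 0. \<forall>i\<in>{..N}. y i \<epsilon> \<in> {z. u z < A'}" by (intro eventually_ball_finite) auto
    have op: "open (patch_int (m i))" if "i < N" for i by (intro patch_int_open \<P>(2) m(1) that)
    have "\<forall>\<^sub>F \<epsilon> in nhds 0. y i \<epsilon> \<in> patch_int (m i)" if "i \<in> {..<N}" for i
      by (rule isCont_eventually_in[OF y(2) op]) (use mi[of i] that y(1)[of i] in auto)
    then have 2: "\<forall>\<^sub>F \<epsilon> in nhds 0. \<forall>i\<in>{..<N}. y i \<epsilon> \<in> patch_int (m i)" by (intro eventually_ball_finite) auto
    have "\<forall>\<^sub>F \<epsilon> in nhds 0. y (Suc i) \<epsilon> \<in> patch_int (m i)" if "i \<in> {..<N}" for i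
      by (rule isCont_eventually_in[OF y(2) op]) (use mi[of i] that y(1)[of "Suc i"] in auto)
    then have 3: "\<forall>\<^sub>F \<epsilon> in nhds 0. \<forall>i\<in>{..<N}. y (Suc i) \<epsilon> \<in> patch_int (m i)" by (intro eventually_ball_finite) auto
    from 1 2 3 show ?thesis
    proof eventually_elim
      case (elim \<epsilon>)
      define x' where "x' i = (if i \<le> N then y i \<epsilon> else x i)" for i
      have "admissible \<P> B N m x'"
        unfolding admissible_def
      proof (intro conjI allI impI)
        show "x' i \<in> B" for i using elim(1) xB[of i] by (force simp: x'_def B_def)
        fix i assume i: "i < N"
        show "m i \<in> \<P>" by (rule m(1)[OF i])
        show "x' i \<in> patch_dom (m i)" "x' (Suc i) \<in> patch_dom (m i)"
          using elim(2,3) i patch_subsets(2)[of "m i"] by (auto simp: x'_def)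
      qed
      from minm[OF this] show ?case by (simp add: \<Psi>_def x'_def)
    qed
  qed
  obtain Fd Fh ud uh where j: "\<And>a. jet2 (\<lambda>\<epsilon>. barrier (w (\<kappa> N a \<epsilon>))) (Fd a) (Fh a)" "\<And>a. jet2 (\<lambda>\<epsilon>. u (\<kappa> N a \<epsilon>)) (ud a) (uh a)"
    and est: "barrier (w (x N)) * ((\<Sum>a\<in>UNIV. Fh a) + (\<Sum>a\<in>UNIV. ud a * Fd a)) \<le> - ((w (x N) - 1) / (w (x N) + 1))\<^sup>2 / n + 3 * (\<Sum>a\<in>UNIV. (Fd a)\<^sup>2)"
    by (rule barrier_jets[OF \<kappa>(1)[of N]]) (rule that, assumption, assumption, simp only: n_def)
  note var = chain_variation[where F="\<lambda>z. barrier (w z)" and x=x and l=m and N=N and \<mu>=\<mu> and \<theta>=\<theta> and e=t and \<kappa>=\<kappa>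
      and Fd=Fd and Fh=Fh and ud=ud and uh=uh, OF less_imp_le[OF t] N0 \<theta>(1) \<kappa>(1)]
  have v1: "(\<Sum>a\<in>UNIV. Fh a) + (\<Sum>a\<in>UNIV. ud a * Fd a) + \<mu> + t \<ge> 0"
    by (rule var(1)) (erule \<kappa>(2), erule S'0[unfolded S'_def], rule sumS'[unfolded S'_def],
      rule local[unfolded \<Psi>_def], assumption, assumption, rule j(1), rule j(2))
  have v2': "\<bar>Fd a\<bar> \<le> t + 3 * sqrt \<theta>" for a
    by (rule var(2)) (erule \<kappa>(2), erule S'0[unfolded S'_def], rule sumS'[unfolded S'_def],
      rule local[unfolded \<Psi>_def], assumption, assumption, rule j(1), rule j(2))
  have v2: "\<bar>Fd a\<bar> \<le> 2 * t" for a using v2'[of a] \<theta>(2) by simp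
  have "(Fd a)\<^sup>2 \<le> (2 * t)\<^sup>2" for a using v2[of a] by (metis abs_ge_zero power2_abs power_mono)
  then have "(\<Sum>a\<in>UNIV. (Fd a)\<^sup>2) \<le> (\<Sum>a\<in>(UNIV::'n set). (2 * t)\<^sup>2)" by (intro sum_mono)
  then have F2: "3 * (\<Sum>a\<in>UNIV. (Fd a)\<^sup>2) \<le> 12 * n * t\<^sup>2" by (simp add: n_def power_mult_distrib)
  have "12 * n * t\<^sup>2 = (12 / 64) * k * k / n" using n by (simp add: t_def power2_eq_square field_simps)
  also have "\<dots> \<le> (12 / 64) * k * 1 / n" using k n by (intro divide_right_mono mult_left_mono) auto
  finally have F3: "3 * (\<Sum>a\<in>UNIV. (Fd a)\<^sup>2) \<le> (12 / 64) * k / n" using F2 by simp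
  have W: "w (x N) \<ge> 1 + \<rho>" using xN barrier_less_iff[of "1 + \<rho>" "w (x N)"] \<rho> w_nonneg[of "x N"] by linarith
  have "\<rho> / (2 + \<rho>) \<le> (w (x N) - 1) / (w (x N) + 1)"
    using W \<rho> by (simp add: divide_le_eq le_divide_eq field_simps)
  then have "k \<le> ((w (x N) - 1) / (w (x N) + 1))\<^sup>2" unfolding k_def by (rule power_mono) (use \<rho> in simp)
  then have "k / n \<le> ((w (x N) - 1) / (w (x N) + 1))\<^sup>2 / n" using n by (intro divide_right_mono) auto
  then have E1: "barrier (w (x N)) * ((\<Sum>a\<in>UNIV. Fh a) + (\<Sum>a\<in>UNIV. ud a * Fd a)) \<le> - (52 / 64) * (k / n)"
    using est F3 by simp
  have "- (2 * t) \<le> (\<Sum>a\<in>UNIV. Fh a) + (\<Sum>a\<in>UNIV. ud a * Fd a)" using v1 \<mu>(2) by linarith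
  then have "barrier (w (x N)) * (- (2 * t)) \<le> barrier (w (x N)) * ((\<Sum>a\<in>UNIV. Fh a) + (\<Sum>a\<in>UNIV. ud a * Fd a))"
    by (rule mult_left_mono) (use nn in simp)
  moreover have "barrier (w (x N)) * (2 * t) \<le> 1 * (2 * t)"
    by (rule mult_right_mono) (use barrier_bounds(2)[OF w_nonneg] t in auto)
  ultimately have "- (2 * t) \<le> - (52 / 64) * (k / n)" using E1 by simp
  moreover have "2 * t = (1 / 4) * (k / n)" by (simp add: t_def)
  moreover have "k / n > 0" using k n by simp
  ultimately show False by linarith
qed

end

section \<open>An inequality between constants\<close>

text \<open>The right-hand side exceeds the left one by very little at \<open>N = 6\<close>, and for real \<open>a\<close> between the admissible values the inequality can
fail; hence the small cases are treated one by one.\<close>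

lemma endpoint_inequality:
  fixes N :: nat assumes N: "N \<ge> 4" and a: "a > 0" "a\<^sup>2 = real N / 2"
  shows "5314 * a\<^sup>2 \<le> 2100 * a ^ 3 + 5041"
proof -
  have cube: "a ^ 3 = a\<^sup>2 * a" by (simp add: power2_eq_square power3_eq_cube)
  have below: "b < a" if "b\<^sup>2 < a\<^sup>2" for b using that a(1) by (simp add: power_less_imp_less_base)
  consider "N = 4" | "N = 5" | "N = 6" | "N \<ge> 7" using N by linarith
  then show ?thesis
  proof cases
    case 1
    then have 1: "a\<^sup>2 = 2" using a by simp
    have "134 / 100 < a" by (rule below) (simp add: 1 power_divide)
    then show ?thesis unfolding cube 1 by simp
  next
    case 2
    then have 2: "a\<^sup>2 = 5 / 2" using a by simp
    have "1571 / 1000 < a" by (rule below) (simp add: 2 power_divide)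
    then show ?thesis unfolding cube 2 by simp
  next
    case 3
    then have 3: "a\<^sup>2 = 3" using a by simp
    have "17304 / 10000 < a" by (rule below) (simp add: 3 power_divide)
    then show ?thesis unfolding cube 3 by simp
  next
    case 4
    \<comment> \<open>The polynomial and its derivatives are positive at \<open>187/100 < sqrt (7/2)\<close>.\<close>
    have "187 / 100 < a" by (rule below) (use 4 a in \<open>simp add: power_divide\<close>)
    then obtain d where d: "a = 187 / 100 + d" "d > 0" by (metis add.commute diff_add_cancel diff_gt_0_iff_gt)
    have "2100 * a ^ 3 + 5041 - 5314 * a\<^sup>2 = (2100 * (187 / 100) ^ 3 + 5041 - 5314 * (187 / 100)\<^sup>2)
       + (6300 * (187 / 100)\<^sup>2 - 10628 * (187 / 100)) * d + (6300 * (187 / 100) - 5314) * d\<^sup>2 + 2100 * d ^ 3"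
      unfolding d(1) by (simp add: power2_eq_square power3_eq_cube algebra_simps)
    moreover have "\<dots> \<ge> 0" using d(2) by (intro add_nonneg_nonneg mult_nonneg_nonneg) (simp_all add: power2_eq_square power3_eq_cube)
    ultimately show ?thesis by linarith
  qed
qed

text \<open>In low dimensions the discriminant is negative. Otherwise the quadratic function of \<open>X\<close> is increasing up to the end point
\<open>c (1 + t s)\<close>, because \<open>a\<^sup>2 \<ge> 2\<close>, and its value there is largest for \<open>s = 1\<close>, where the claim is \<open>endpoint_inequality\<close>. The value of \<open>t\<close> must satisfy
both: \<open>21/50\<close> is admissible in all dimensions.\<close>

lemma quadratic_negative:
  fixes N :: nat and a X s :: real
  defines "t \<equiv> 21 / 50 :: real" and "c \<equiv> 1 / (a + 2)"
  assumes N: "N \<ge> 1" and a: "a = sqrt (real N / 2)" and s: "0 < s" "s \<le> 1" and X: "0 \<le> X" "X < c * (1 + t * s)"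
  shows "- (X\<^sup>2 / a\<^sup>2) + (c + 4 * t * c * s) * X - 2 * t * c < 0"
proof -
  have a2: "a\<^sup>2 = real N / 2" using a by simp
  have a0: "a > 0" using a N by simp
  have c0: "c > 0" using a0 by (simp add: c_def)
  define y where "y = t * s"
  have y: "0 < y" "y \<le> t" using s by (auto simp: y_def t_def)
  define k where "k = c * (1 + 4 * y)"
  have k0: "k > 0" using c0 y by (simp add: k_def)
  have kX: "(c + 4 * t * c * s) * X = k * X" by (simp add: k_def y_def algebra_simps)
  have "- X\<^sup>2 + a\<^sup>2 * k * X - 2 * t * c * a\<^sup>2 < 0"
  proof (cases "N \<ge> 4")
    case False
    have "a\<^sup>2 \<le> 3 / 2" using False a2 by simp
    also have "\<dots> \<le> (1225 / 1000)\<^sup>2" by (simp add: power2_eq_square)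
    finally have a1: "a \<le> 1225 / 1000" by (rule power2_le_imp_le) simp
    have "a\<^sup>2 \<le> 1225 / 1000 * a" using a1 a0 by (simp add: power2_eq_square)
    then have "71824 * a\<^sup>2 < 33600 * (a + 2)" using a1 by simp
    then have d: "c * a\<^sup>2 * (1 + 4 * t)\<^sup>2 < 8 * t" using a0 by (simp add: c_def t_def power2_eq_square field_simps)
    have "(a\<^sup>2 * k)\<^sup>2 = (c * a\<^sup>2 * (1 + 4 * y)\<^sup>2) * (c * a\<^sup>2)" by (simp add: k_def power2_eq_square)
    also have "\<dots> \<le> (c * a\<^sup>2 * (1 + 4 * t)\<^sup>2) * (c * a\<^sup>2)"
      using y c0 a0 by (intro mult_right_mono mult_left_mono power_mono) auto
    also have "\<dots> < 8 * t * (c * a\<^sup>2)" using d c0 a0 by (intro mult_strict_right_mono) auto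
    finally have D: "(a\<^sup>2 * k)\<^sup>2 < 8 * t * (c * a\<^sup>2)" .
    have "- X\<^sup>2 + a\<^sup>2 * k * X - 2 * t * c * a\<^sup>2 = - (X - a\<^sup>2 * k / 2)\<^sup>2 + ((a\<^sup>2 * k)\<^sup>2 - 8 * t * (c * a\<^sup>2)) / 4"
      by (simp add: power2_eq_square field_simps)
    moreover have "- p + (q - r) / 4 < 0" if "p \<ge> 0" "q < r" for p q r :: real using that by simp
    ultimately show ?thesis using D zero_le_power2 by metis
  next
    case True
    define Y where "Y = c * (1 + y)"
    have XY: "X < Y" using X by (simp add: Y_def y_def)
    have a22: "a\<^sup>2 \<ge> 2" using True a2 by simp
    have "2 * Y \<le> 2 * k" using c0 y by (simp add: Y_def k_def)
    also have "\<dots> \<le> a\<^sup>2 * k" using a22 k0 by (intro mult_right_mono) auto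
    finally have "X + Y < a\<^sup>2 * k" using XY by linarith
    then have "(Y - X) * (a\<^sup>2 * k - (X + Y)) > 0" using XY by (intro mult_pos_pos) auto
    then have less: "- X\<^sup>2 + a\<^sup>2 * k * X < - Y\<^sup>2 + a\<^sup>2 * k * Y" by (simp add: power2_eq_square algebra_simps)
    have "(t - y) * (5 * a\<^sup>2 + 4 * a\<^sup>2 * (t + y) - 2 - (t + y)) \<ge> 0"
    proof (rule mult_nonneg_nonneg)
      have "4 * a\<^sup>2 * (t + y) \<ge> 1 * (t + y)" by (rule mult_right_mono) (use a22 y in linarith)+
      moreover have "5 * b + z - 2 - v \<ge> 0" if "1 * v \<le> z" "2 \<le> b" for b z v :: real using that by simp
      ultimately show "5 * a\<^sup>2 + 4 * a\<^sup>2 * (t + y) - 2 - (t + y) \<ge> 0" using a22 by blast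
    qed (use y in simp)
    then have "a\<^sup>2 * (1 + 5 * y + 4 * y\<^sup>2) - (1 + 2 * y + y\<^sup>2) \<le> a\<^sup>2 * (1 + 5 * t + 4 * t\<^sup>2) - (1 + 2 * t + t\<^sup>2)"
      by (simp add: power2_eq_square algebra_simps)
    also have "\<dots> \<le> 2 * t * (a + 2) * a\<^sup>2"
      using endpoint_inequality[OF True a0 a2] by (simp add: t_def power2_eq_square power3_eq_cube algebra_simps)
    finally have E: "a\<^sup>2 * (1 + 5 * y + 4 * y\<^sup>2) - (1 + 2 * y + y\<^sup>2) \<le> 2 * t * (a + 2) * a\<^sup>2" .
    have "- Y\<^sup>2 + a\<^sup>2 * k * Y = c\<^sup>2 * (a\<^sup>2 * (1 + 5 * y + 4 * y\<^sup>2) - (1 + 2 * y + y\<^sup>2))"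
      by (simp add: Y_def k_def power2_eq_square algebra_simps)
    also have "\<dots> \<le> c\<^sup>2 * (2 * t * (a + 2) * a\<^sup>2)" by (rule mult_left_mono[OF E]) simp
    also have "\<dots> = 2 * t * c * a\<^sup>2" using a0 by (simp add: c_def power2_eq_square)
    finally show ?thesis using less by linarith
  qed
  then have "(- X\<^sup>2 + a\<^sup>2 * k * X - 2 * t * c * a\<^sup>2) / a\<^sup>2 < 0" using a0 by (simp add: divide_less_0_iff)
  then show ?thesis unfolding kX using a0 by (simp add: diff_divide_distrib add_divide_distrib)
qed

context complete_soliton
begin

section \<open>The minimum principle\<close>

text \<open>At a negative minimum \<open>q\<close> of \<open>\<phi> = R - c e\<^sup>-\<^sup>u - t c e\<^sup>-\<^sup>2\<^sup>u\<close> the drift Laplacian of \<open>\<phi>\<close> is nonnegative. Computed from \<open>soliton_jets\<close>, it is at most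
\<open>E\<^sup>2\<close> times the expression in \<open>quadratic_negative\<close>, where \<open>E = e\<^sup>-\<^sup>u\<close> and \<open>X = R / E\<close>; and \<open>\<phi> < 0\<close> is the hypothesis \<open>X < c (1 + t E)\<close>.\<close>

theorem scalar_lower_bound: "1 - w p \<ge> 1 / (sqrt (real CARD('n) / 2) + 2) * exp (- u p)"
proof (rule ccontr)
  assume neg: "\<not> ?thesis"
  define a where "a = sqrt (real CARD('n) / 2)"
  define c where "c = 1 / (a + 2)"
  define t :: real where "t = 21 / 50"
  define \<phi> where "\<phi> p = 1 - w p - c * exp (- u p) - t * c * exp (- 2 * u p)" for p
  have a0: "a > 0" by (simp add: a_def)
  have a2: "a\<^sup>2 = real CARD('n) / 2" by (simp add: a_def)
  have c: "c > 0" "c \<le> 1 / 2" using a0 by (auto simp: c_def field_simps)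
  have t: "t > 0" "t < 1" by (auto simp: t_def)
  have "t * c * exp (- 2 * u p) > 0" using t c by simp
  moreover have "1 - w p < c * exp (- u p)" using neg by (simp add: c_def a_def)
  ultimately have \<phi>p: "\<phi> p < 0" by (simp add: \<phi>_def)
  \<comment> \<open>Outside of the sublevel set, \<open>\<phi> \<ge> - e\<^sup>-\<^sup>u > \<phi> p\<close>, using \<open>R \<ge> 0\<close>.\<close>
  define C where "C = max (u p) (- ln (- \<phi> p))"
  have "continuous_on UNIV \<phi>"
    unfolding \<phi>_def by (intro continuous_intros u_continuous w_continuous)
  then have "continuous_on {x. u x \<le> C} \<phi>" by (rule continuous_on_subset) simp
  moreover have "{x. u x \<le> C} \<noteq> {}" by (auto simp: C_def intro: exI[of _ p])
  ultimately obtain q where q: "u q \<le> C" "\<And>x. u x \<le> C \<Longrightarrow> \<phi> q \<le> \<phi> x"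
    using continuous_attains_inf[OF u_proper[of C]] by blast
  have qp: "\<phi> q \<le> \<phi> p" by (rule q(2)) (simp add: C_def)
  have min: "\<phi> q \<le> \<phi> x" for x
  proof (cases "u x \<le> C")
    case False
    have e: "exp (- 2 * u x) \<le> exp (- u x)" using u_nonneg[of x] by simp
    have "c * exp (- u x) + t * c * exp (- 2 * u x) \<le> 1 / 2 * exp (- u x) + 1 / 2 * exp (- u x)"
    proof (intro add_mono mult_right_mono mult_mono e)
      have "t * c \<le> 1 * c" by (rule mult_right_mono) (use t c in auto)
      then show "t * c \<le> 1 / 2" using c by linarith
    qed (use c in auto)
    also have "\<dots> \<le> exp (- C)" using False by simp
    also have "\<dots> \<le> exp (ln (- \<phi> p))" by (simp add: C_def)
    also have "\<dots> = - \<phi> p" using \<phi>p by simp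
    finally have "\<phi> x \<ge> \<phi> p" using scalar_curvature_nonneg[of x] by (simp add: \<phi>_def)
    then show ?thesis using qp by simp
  qed (rule q(2))
  obtain \<kappa> where o: "osc q \<kappa>" by (rule osc_exists')
  obtain ud uh wd wh where j: "\<And>a. jet2 (\<lambda>\<epsilon>. u (\<kappa> a \<epsilon>)) (ud a) (uh a)" "\<And>a. jet2 (\<lambda>\<epsilon>. w (\<kappa> a \<epsilon>)) (wd a) (wh a)"
    and tr: "(\<Sum>a\<in>UNIV. (ud a)\<^sup>2) = w q" "(\<Sum>a\<in>UNIV. uh a) = 1 - w q"
      "(\<Sum>a\<in>UNIV. wh a) + (\<Sum>a\<in>UNIV. ud a * wd a) \<ge> 2 * (1 - w q)\<^sup>2 / real CARD('n)"
    by (rule soliton_jets[OF o]) (rule that, assumption+)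
  define E where "E = exp (- u q)"
  have E: "0 < E" "E \<le> 1" using u_nonneg[of q] by (auto simp: E_def)
  have E2: "exp (- 2 * u q) = E\<^sup>2" by (simp add: E_def power2_eq_square flip: exp_add)
  have \<kappa>0: "\<kappa> a 0 = q" for a by (rule osc_base(1)[OF o])
  have jexp: "jet2 (\<lambda>\<epsilon>. exp (- m * u (\<kappa> a \<epsilon>))) (- m * exp (- m * u q) * ud a) (m * m * exp (- m * u q) * (ud a)\<^sup>2 + - m * exp (- m * u q) * uh a)" for m a
  proof -
    have d: "((\<lambda>t. exp (- m * t)) has_real_derivative - m * exp (- m * t)) (at t)" for t
      by (auto intro!: derivative_eq_intros)
    have "((\<lambda>t. - m * exp (- m * t)) has_real_derivative m * m * exp (- m * t)) (at t)" for t
      by (rule derivative_eq_intros d refl)+ simp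
    from jet2_compose_real[OF j(1)[of a] open_UNIV UNIV_I d this] show ?thesis by (simp only: \<kappa>0)
  qed
  define A where "A a = - wd a + (c * E + 2 * t * c * E\<^sup>2) * ud a" for a
  define H where "H a = - wh a - c * (E * (ud a)\<^sup>2 - E * uh a) - t * c * (4 * E\<^sup>2 * (ud a)\<^sup>2 - 2 * E\<^sup>2 * uh a)" for a
  have "jet2 (\<lambda>\<epsilon>. \<phi> (\<kappa> a \<epsilon>)) (A a) (H a)" for a
  proof -
    have "jet2 (\<lambda>\<epsilon>. 1 - w (\<kappa> a \<epsilon>) - c * exp (- 1 * u (\<kappa> a \<epsilon>)) - t * c * exp (- 2 * u (\<kappa> a \<epsilon>)))
      (0 - wd a - c * (- 1 * exp (- 1 * u q) * ud a) - t * c * (- 2 * exp (- 2 * u q) * ud a))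
      (0 - wh a - c * (1 * 1 * exp (- 1 * u q) * (ud a)\<^sup>2 + - 1 * exp (- 1 * u q) * uh a)
         - t * c * (2 * 2 * exp (- 2 * u q) * (ud a)\<^sup>2 + - 2 * exp (- 2 * u q) * uh a))"
      by (intro jet2_diff jet2_cmult jet2_const j jexp)
    then show ?thesis unfolding E2 by (simp add: \<phi>_def A_def H_def E_def algebra_simps)
  qed
  moreover have "\<forall>\<^sub>F \<epsilon> in nhds 0. \<phi> (\<kappa> a 0) \<le> \<phi> (\<kappa> a \<epsilon>)" for a by (simp add: \<kappa>0 min)
  ultimately have "A a = 0" "H a \<ge> 0" for a by (rule jet2_local_min)+
  then have "0 \<le> (\<Sum>a\<in>UNIV. H a + ud a * A a)" by (intro sum_nonneg) simp
  also have "\<dots> = (\<Sum>a\<in>UNIV. - (wh a) - ud a * wd a + (- 2 * t * c * E\<^sup>2) * (ud a)\<^sup>2 + (c * E + 2 * t * c * E\<^sup>2) * uh a)"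
    by (intro sum.cong refl) (simp add: A_def H_def power2_eq_square algebra_simps)
  also have "\<dots> = - ((\<Sum>a\<in>UNIV. wh a) + (\<Sum>a\<in>UNIV. ud a * wd a)) + (- 2 * t * c * E\<^sup>2) * (\<Sum>a\<in>UNIV. (ud a)\<^sup>2)
     + (c * E + 2 * t * c * E\<^sup>2) * (\<Sum>a\<in>UNIV. uh a)"
    by (simp add: sum.distrib sum_subtractf sum_negf sum_distrib_left)
  also have "\<dots> \<le> - (2 * (1 - w q)\<^sup>2 / real CARD('n)) + (- 2 * t * c * E\<^sup>2) * w q + (c * E + 2 * t * c * E\<^sup>2) * (1 - w q)"
    using tr by simp
  finally have ineq: "0 \<le> - (2 * (1 - w q)\<^sup>2 / real CARD('n)) + (- 2 * t * c * E\<^sup>2) * w q + (c * E + 2 * t * c * E\<^sup>2) * (1 - w q)" .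
  define X where "X = (1 - w q) / E"
  have XE: "1 - w q = X * E" using E by (simp add: X_def)
  have wq: "w q = 1 - X * E" using XE by simp
  have X0: "0 \<le> X" using scalar_curvature_nonneg[of q] E by (simp add: X_def)
  have "\<phi> q < 0" using qp \<phi>p by simp
  then have "1 - w q < c * E + t * c * E\<^sup>2" by (simp only: \<phi>_def E2) (simp add: E_def)
  then have "X * E < (c * (1 + t * E)) * E" unfolding XE by (simp add: power2_eq_square algebra_simps)
  then have X1: "X < c * (1 + t * E)" using E by (simp only: mult_less_cancel_right_pos)
  have n2: "2 * y / real CARD('n) = y / a\<^sup>2" for y by (simp add: a2)
  have "- (X\<^sup>2 / a\<^sup>2) + (c + 4 * t * c * E) * X - 2 * t * c < 0"
    unfolding c_def t_def
    by (rule quadratic_negative[OF _ a_def E X0 X1[unfolded c_def t_def]]) (simp add: Suc_leI)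
  then have "E\<^sup>2 * (- (X\<^sup>2 / a\<^sup>2) + (c + 4 * t * c * E) * X - 2 * t * c) < 0"
    using E by (simp add: mult_less_0_iff)
  also have "E\<^sup>2 * (- (X\<^sup>2 / a\<^sup>2) + (c + 4 * t * c * E) * X - 2 * t * c)
     = - (2 * (1 - w q)\<^sup>2 / real CARD('n)) + (- 2 * t * c * E\<^sup>2) * w q + (c * E + 2 * t * c * E\<^sup>2) * (1 - w q)"
    unfolding n2 XE unfolding wq by (simp add: power2_eq_square algebra_simps)
  finally show False using ineq by linarith
qed

end

theorem theorem1:
  fixes \<A> :: "('m::{t2_space,second_countable_topology}, 'n::finite) chart set"
    and g :: "'m metric" and f :: "'m \<Rightarrow> real"
  assumes "complete_steady_gradient_soliton \<A> g f"
    and "\<forall>p. scalar_curvature \<A> g p + (tangent_norm g p (gradient \<A> g f p))\<^sup>2 = 1"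
    and "tends_to_minus_infinity_at_infinity f"
    and "\<forall>p. f p \<le> 0"
  shows "\<forall>p. scalar_curvature \<A> g p \<ge> 1 / (sqrt (real CARD('n) / 2) + 2) * exp (f p)"
proof -
  interpret complete_soliton \<A> g f
  proof unfold_locales
    show "\<exists>p. (\<lambda>k. riemannian_dist \<A> g (\<sigma> k) p) \<longlonglongrightarrow> 0"
      if "\<forall>e>0. \<exists>N. \<forall>m\<ge>N. \<forall>k\<ge>N. riemannian_dist \<A> g (\<sigma> m) (\<sigma> k) < e" for \<sigma> :: "nat \<Rightarrow> 'm"
      using assms(1) that unfolding complete_steady_gradient_soliton_def complete_riemannian_manifold_def by blast
    show "\<exists>K. compact K \<and> (\<forall>x\<in>- K. f x < a)" for a
      using assms(3) unfolding tends_to_minus_infinity_at_infinity_def by blast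
  qed (use assms(1,2,4) in \<open>simp_all add: complete_steady_gradient_soliton_def complete_riemannian_manifold_def\<close>)
  show ?thesis using scalar_lower_bound by (simp add: w_def u_def)
qed

end
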